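(* Every rigid indecomposable module in $\mathrm{CM}_G(\widehat R)$ has a filtration with factors which are rank 1 modules whose types are the $k$-subsets in its profile.
   Context: Let $n\ge 2$, $1\le k\le n-1$, $\overline R=\mathbb{C}[x,y]/(x^k-y^{n-k})$ and $\widehat R=\mathbb{C}[[x,y]]/(x^k-y^{n-k})$. $G=\{\zeta\in\mathbb{C}^*:\zeta^n=1\}$ acts on both by $(x,y)\mapsto(\zeta x,\zeta^{-1}y)$, and sits (as $\zeta\mapsto(\zeta,\zeta^{-1})$) in $\Gamma=\{(s,t)\in(\mathbb{C}^* )^2:s^k=t^{n-k}\}$, which acts on $\overline R$ by scaling $x,y$. The character group $\Gamma^\vee$ is the abelian group generated by $\mathbf{x}=\deg x$, $\mathbf{y}=\deg y$ with the relation $k\mathbf{x}=(n-k)\mathbf{y}$; restriction to $G$ is the map $\rho\colon\Gamma^\vee\to G^\vee=\mathbb{Z}_n$, $\mathbf{x}\mapsto1$, $\mathbf{y}\mapsto-1$, with kernel $\mathbb{Z}(\mathbf{x}+\mathbf{y})\cong\mathbb{Z}$. Equivariant modules are regarded as graded modules over the character group. $\mathrm{CM}_G(\widehat R)$ is the category of finitely generated $G$-equivariant ($\mathbb{Z}_n$-graded) $\widehat R$-modules that are free over $\mathbb{C}[[t]]$, $t=xy$; $\mathrm{CM}_\Gamma(\overline R)$ is the category of finitely generated $\Gamma^\vee$-graded $\overline R$-modules that are free over $\mathbb{C}[t]$. The rank of a module is the rank over $\mathbb{C}[[t]]$ (resp. $\mathbb{C}[t]$) of any of its $\mathbb{Z}_n$-graded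 pieces. A module $M$ in $\mathrm{CM}_G(\widehat R)$ is rigid if $\mathrm{Ext}^1(M,M)=0$ in the category of $G$-equivariant $\widehat R$-modules. The completion functor $\mathbb{F}\colon\mathrm{CM}_\Gamma(\overline R)\to\mathrm{CM}_G(\widehat R)$ sends $\bigoplus_{i\in\Gamma^\vee}M_i$ to $\prod_{i\in\Gamma^\vee}M_i$, graded by $\mathbb{Z}_n$ via $\rho$. Rank one modules: for a $k$-subset $I\subseteq\{1,\dots,n\}$, $L_I\in\mathrm{CM}_G(\widehat R)$ has each graded piece $(L_I)_j=\mathbb{C}[[t]]$, $j\in\mathbb{Z}_n$, with $x\colon(L_I)_{a-1}\to(L_I)_a$ acting as $1$ if $a\in I$ and as $t$ otherwise, and $y\colon(L_I)_a\to(L_I)_{a-1}$ acting as $t$ if $a\in I$ and as $1$ otherwise. Every rank one module is isomorphic to $L_I$ for a unique $I$, called its type. Profile: for $\widetilde M\in\mathrm{CM}_\Gamma(\overline R)$ of rank $r$, let $\alpha_i=\dim\widetilde M_i$ for $i\in\Gamma^\vee$, and for $d=1,\dots,r$ let $S_d=\{i\in\Gamma^\vee:\alpha_i\ge d\}$. The $d$-th contour separates $S_d$ from its complement and its shape is the $k$-subset $I_d\subseteq\{1,\dots,n\}$ of those $a$ for which there is $i\in\Gamma^\vee$ with $\rho(i)=a$ in $\mathbb{Z}_n$, $i\notin S_d$ and $i+\mathbf{y}\in S_d$. The profile of $\widetilde M$ is the ordered collection (with repetitions) of shapes $I_1,\dots,I_r$. Every rigid indecomposable $M$ in $\mathrm{CM}_G(\widehat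 R)$ is isomorphic to $\mathbb{F}(\widetilde M)$ for some $\widetilde M\in\mathrm{CM}_\Gamma(\overline R)$, unique up to grade shift, and the profile of $M$ is defined to be the profile of $\widetilde M$. *)

theory Defs
  imports
    "HOL-Algebra.Algebra"
    "HOL-Algebra.Algebraic_Closure_Type"
    "HOL-Computational_Algebra.Computational_Algebra"
begin

section \<open>Modules: bases, rank, finite generation\<close>

definition is_basis :: "('a, 'm) ring_scheme \<Rightarrow> ('a, 'b, 'c) module_scheme \<Rightarrow> 'b set \<Rightarrow> bool" where
  "is_basis A N B \<longleftrightarrow> B \<subseteq> carrier N \<and>
     (\<forall>v\<in>carrier N. \<exists>!c. c \<in> B \<rightarrow>\<^sub>E carrier A \<and> finite {b \<in> B. c b \<noteq> \<zero>\<^bsub>A\<^esub>} \<and>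
        v = (\<Oplus>\<^bsub>N\<^esub>b\<in>{b \<in> B. c b \<noteq> \<zero>\<^bsub>A\<^esub>}. c b \<odot>\<^bsub>N\<^esub> b))"

definition free_module :: "('a, 'm) ring_scheme \<Rightarrow> ('a, 'b, 'c) module_scheme \<Rightarrow> bool" where
  "free_module A N \<longleftrightarrow> module A N \<and> (\<exists>B. is_basis A N B)"

definition free_rank :: "('a, 'm) ring_scheme \<Rightarrow> ('a, 'b, 'c) module_scheme \<Rightarrow> nat" where
  "free_rank A N = card (SOME B. is_basis A N B)"

definition fin_gen :: "('a, 'm) ring_scheme \<Rightarrow> ('a, 'b, 'c) module_scheme \<Rightarrow> bool" where
  "fin_gen R M \<longleftrightarrow> (\<exists>S. finite S \<and> S \<subseteq> carrier M \<and>
     (\<forall>N. submodule N R M \<and> S \<subseteq> N \<longrightarrow> N = carrier M))"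

definition restrict_scalars :: "('s \<Rightarrow> 'a) \<Rightarrow> ('a, 'b, 'c) module_scheme \<Rightarrow> ('s, 'b) module" where
  "restrict_scalars \<phi> M = \<lparr>carrier = carrier M, monoid.mult = monoid.mult M, monoid.one = monoid.one M,
     ring.zero = ring.zero M, ring.add = ring.add M, module.smult = (\<lambda>a m. \<phi> a \<odot>\<^bsub>M\<^esub> m)\<rparr>"


section \<open>Graded modules\<close>

text \<open>
  A grading is by an abelian group \<open>\<Lambda>\<close> (written multiplicatively, as in the library); only
  the pieces \<open>grade M i\<close> with \<open>i \<in> carrier \<Lambda>\<close> are meaningful.  The ring \<open>R\<close> is graded by the
  family \<open>Rg\<close>.
\<close>

record ('a, 'b, 'g) gmodule = "('a, 'b) module" +
  grade :: "'g \<Rightarrow> 'b set"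

definition graded_module ::
  "'g monoid \<Rightarrow> 'a ring \<Rightarrow> ('g \<Rightarrow> 'a set) \<Rightarrow> ('a, 'b, 'g) gmodule \<Rightarrow> bool" where
  "graded_module \<Lambda> R Rg M \<longleftrightarrow> module R M \<and>
     (\<forall>i\<in>carrier \<Lambda>. subgroup (grade M i) (add_monoid M)) \<and>
     (\<forall>m\<in>carrier M. \<exists>!f. f \<in> (\<Pi>\<^sub>E i\<in>carrier \<Lambda>. grade M i) \<and>
        finite {i \<in> carrier \<Lambda>. f i \<noteq> \<zero>\<^bsub>M\<^esub>} \<and>
        m = (\<Oplus>\<^bsub>M\<^esub>i\<in>{i \<in> carrier \<Lambda>. f i \<noteq> \<zero>\<^bsub>M\<^esub>}. f i)) \<and>
     (\<forall>i\<in>carrier \<Lambda>. \<forall>j\<in>carrier \<Lambda>. \<forall>r\<in>Rg i. \<forall>m\<in>grade M j. r \<odot>\<^bsub>M\<^esub> m \<in> grade M (i \<otimes>\<^bsub>\<Lambda>\<^esub> j))"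

definition hom_sums :: "('a, 'b, 'c) module_scheme \<Rightarrow> 'g set \<Rightarrow> ('g \<Rightarrow> 'b set) \<Rightarrow> 'b set" where
  "hom_sums M J H = {(\<Oplus>\<^bsub>M\<^esub>i\<in>F. f i) | F f. finite F \<and> F \<subseteq> J \<and> (\<forall>i\<in>F. f i \<in> H i)}"

text \<open>Graded submodules are those generated by their homogeneous elements.\<close>

definition graded_submodule :: "'g monoid \<Rightarrow> 'a ring \<Rightarrow> ('a, 'b, 'g) gmodule \<Rightarrow> 'b set \<Rightarrow> bool" where
  "graded_submodule \<Lambda> R M N \<longleftrightarrow>
     submodule N R M \<and> N \<subseteq> hom_sums M (carrier \<Lambda>) (\<lambda>i. N \<inter> grade M i)"

definition gsub :: "('a, 'b, 'g) gmodule \<Rightarrow> 'b set \<Rightarrow> ('a, 'b, 'g) gmodule" where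
  "gsub M N = M\<lparr>carrier := N, grade := (\<lambda>i. N \<inter> grade M i)\<rparr>"

definition gquot :: "('a, 'b, 'g) gmodule \<Rightarrow> 'b set \<Rightarrow> ('a, 'b set, 'g) gmodule" where
  "gquot M N = \<lparr>carrier = a_rcosets\<^bsub>M\<^esub> N, monoid.mult = undefined, monoid.one = undefined,
     ring.zero = N, ring.add = set_add M,
     module.smult = (\<lambda>r C. \<Union>m\<in>C. N +>\<^bsub>M\<^esub> (r \<odot>\<^bsub>M\<^esub> m)),
     grade = (\<lambda>i. (\<lambda>m. N +>\<^bsub>M\<^esub> m) ` grade M i)\<rparr>"

definition ghom ::
  "'g monoid \<Rightarrow> 'a ring \<Rightarrow> ('a, 'b, 'g) gmodule \<Rightarrow> ('a, 'c, 'g) gmodule \<Rightarrow> ('b \<Rightarrow> 'c) set" where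
  "ghom \<Lambda> R M N = {f. f \<in> carrier M \<rightarrow> carrier N \<and>
     (\<forall>u\<in>carrier M. \<forall>v\<in>carrier M. f (u \<oplus>\<^bsub>M\<^esub> v) = f u \<oplus>\<^bsub>N\<^esub> f v) \<and>
     (\<forall>r\<in>carrier R. \<forall>u\<in>carrier M. f (r \<odot>\<^bsub>M\<^esub> u) = r \<odot>\<^bsub>N\<^esub> f u) \<and>
     (\<forall>i\<in>carrier \<Lambda>. f ` grade M i \<subseteq> grade N i)}"

definition giso ::
  "'g monoid \<Rightarrow> 'a ring \<Rightarrow> ('a, 'b, 'g) gmodule \<Rightarrow> ('a, 'c, 'g) gmodule \<Rightarrow> bool" where
  "giso \<Lambda> R M N \<longleftrightarrow> (\<exists>f\<in>ghom \<Lambda> R M N. bij_betw f (carrier M) (carrier N))"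

definition gindecomposable :: "'g monoid \<Rightarrow> 'a ring \<Rightarrow> ('a, 'b, 'g) gmodule \<Rightarrow> bool" where
  "gindecomposable \<Lambda> R M \<longleftrightarrow> carrier M \<noteq> {\<zero>\<^bsub>M\<^esub>} \<and>
     (\<forall>A B. graded_submodule \<Lambda> R M A \<and> graded_submodule \<Lambda> R M B \<and>
        A \<inter> B = {\<zero>\<^bsub>M\<^esub>} \<and> A <+>\<^bsub>M\<^esub> B = carrier M \<longrightarrow> A = {\<zero>\<^bsub>M\<^esub>} \<or> B = {\<zero>\<^bsub>M\<^esub>})"

text \<open>
  \<open>Ext1_zero \<Lambda> R Rg L N\<close>: the Yoneda group Ext^1(L,N) of graded modules vanishes, that is, every
  short exact sequence 0 \<rightarrow> N \<rightarrow> E \<rightarrow> L \<rightarrow> 0 represents the zero class, the class of the split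
  extension.  The carrier of such an \<open>E\<close> is in bijection with that of \<open>N\<close> times that of \<open>L\<close>, so
  every extension is equivalent to one whose elements have type \<open>'c \<times> 'b\<close>.
\<close>

definition Ext1_zero ::
  "'g monoid \<Rightarrow> 'a ring \<Rightarrow> ('g \<Rightarrow> 'a set) \<Rightarrow> ('a, 'b, 'g) gmodule \<Rightarrow> ('a, 'c, 'g) gmodule \<Rightarrow> bool"
  where
  "Ext1_zero \<Lambda> R Rg L N \<longleftrightarrow>
     (\<forall>(E :: ('a, 'c \<times> 'b, 'g) gmodule) f g.
        graded_module \<Lambda> R Rg E \<and> f \<in> ghom \<Lambda> R N E \<and> g \<in> ghom \<Lambda> R E L \<and>
        inj_on f (carrier N) \<and> g ` carrier E = carrier L \<and>
        f ` carrier N = {e \<in> carrier E. g e = \<zero>\<^bsub>L\<^esub>}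
        \<longrightarrow> (\<exists>s\<in>ghom \<Lambda> R L E. \<forall>u\<in>carrier L. g (s u) = u))"

text \<open>A filtration with \<open>r\<close> factors; the factors are \<open>gfactor M F d\<close> for \<open>d < r\<close>.\<close>

definition gfiltration ::
  "'g monoid \<Rightarrow> 'a ring \<Rightarrow> ('a, 'b, 'g) gmodule \<Rightarrow> nat \<Rightarrow> (nat \<Rightarrow> 'b set) \<Rightarrow> bool" where
  "gfiltration \<Lambda> R M r F \<longleftrightarrow> F 0 = {\<zero>\<^bsub>M\<^esub>} \<and> F r = carrier M \<and>
     (\<forall>d\<le>r. graded_submodule \<Lambda> R M (F d)) \<and> (\<forall>d<r. F d \<subseteq> F (Suc d))"

definition gfactor :: "('a, 'b, 'g) gmodule \<Rightarrow> (nat \<Rightarrow> 'b set) \<Rightarrow> nat \<Rightarrow> ('a, 'b set, 'g) gmodule" where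
  "gfactor M F d = gquot (gsub M (F (Suc d))) (F d)"


section \<open>The rings and their gradings\<close>

text \<open>
  C[[x,y]] is \<^typ>\<open>complex fps fps\<close> and C[x,y] is \<^typ>\<open>complex poly poly\<close>, with \<open>y\<close> the outer
  variable: the coefficient of x^p y^q is \<open>fps_nth (fps_nth f q) p\<close>, resp.
  \<open>coeff (coeff f q) p\<close>.
\<close>

definition x_ser :: "complex fps fps" where "x_ser = fps_const fps_X"
definition y_ser :: "complex fps fps" where "y_ser = fps_X"
definition x_pol :: "complex poly poly" where "x_pol = [:monom 1 1:]"
definition y_pol :: "complex poly poly" where "y_pol = monom 1 1"

definition Ihat :: "nat \<Rightarrow> nat \<Rightarrow> complex fps fps set" where
  "Ihat n k = PIdl\<^bsub>ring_of_type_algebra\<^esub> (x_ser ^ k - y_ser ^ (n - k))"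

definition Rhat :: "nat \<Rightarrow> nat \<Rightarrow> complex fps fps set ring" where
  "Rhat n k = ring_of_type_algebra Quot Ihat n k"

definition clhat :: "nat \<Rightarrow> nat \<Rightarrow> complex fps fps \<Rightarrow> complex fps fps set" where
  "clhat n k f = Ihat n k +>\<^bsub>ring_of_type_algebra\<^esub> f"

definition Ibar :: "nat \<Rightarrow> nat \<Rightarrow> complex poly poly set" where
  "Ibar n k = PIdl\<^bsub>ring_of_type_algebra\<^esub> (x_pol ^ k - y_pol ^ (n - k))"

definition Rbar :: "nat \<Rightarrow> nat \<Rightarrow> complex poly poly set ring" where
  "Rbar n k = ring_of_type_algebra Quot Ibar n k"

definition clbar :: "nat \<Rightarrow> nat \<Rightarrow> complex poly poly \<Rightarrow> complex poly poly set" where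
  "clbar n k f = Ibar n k +>\<^bsub>ring_of_type_algebra\<^esub> f"

text \<open>
  The character group of \<open>\<Gamma>\<close>: Z^2 modulo the relation k deg(x) = (n-k) deg(y); \<open>char_class n k p q\<close> is the class
  of p deg(x) + q deg(y).
\<close>

definition rel_Gamma :: "nat \<Rightarrow> nat \<Rightarrow> (int \<times> int) set" where
  "rel_Gamma n k = generate (integer_group \<times>\<times> integer_group) {(int k, - (int n - int k))}"

definition Gamma_dual :: "nat \<Rightarrow> nat \<Rightarrow> (int \<times> int) set monoid" where
  "Gamma_dual n k = (integer_group \<times>\<times> integer_group) Mod rel_Gamma n k"

definition char_class :: "nat \<Rightarrow> nat \<Rightarrow> int \<Rightarrow> int \<Rightarrow> (int \<times> int) set" where
  "char_class n k p q = rel_Gamma n k #>\<^bsub>integer_group \<times>\<times> integer_group\<^esub> (p, q)"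

abbreviation G_dual :: "nat \<Rightarrow> int monoid" where
  "G_dual n \<equiv> integer_mod_group n"

definition res_deg :: "nat \<Rightarrow> (int \<times> int) set \<Rightarrow> int" where
  "res_deg n i = (THE j. \<exists>(p, q)\<in>i. j = (p - q) mod int n)"

definition Rhat_grade :: "nat \<Rightarrow> nat \<Rightarrow> int \<Rightarrow> complex fps fps set set" where
  "Rhat_grade n k j = clhat n k `
     {f. \<forall>p q. fps_nth (fps_nth f q) p \<noteq> 0 \<longrightarrow> (int p - int q) mod int n = j}"

definition Rbar_grade :: "nat \<Rightarrow> nat \<Rightarrow> (int \<times> int) set \<Rightarrow> complex poly poly set set" where
  "Rbar_grade n k i = clbar n k `
     {f. \<forall>p q. coeff (coeff f q) p \<noteq> 0 \<longrightarrow> char_class n k (int p) (int q) = i}"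

text \<open>The maps \<open>f(t) \<mapsto> f(xy)\<close> from C[[t]] and from C[t], and the inclusion of C.\<close>

definition t_hat :: "nat \<Rightarrow> nat \<Rightarrow> complex fps \<Rightarrow> complex fps fps set" where
  "t_hat n k f = clhat n k (Abs_fps (\<lambda>q. Abs_fps (\<lambda>p. if p = q then fps_nth f q else 0)))"

definition t_bar :: "nat \<Rightarrow> nat \<Rightarrow> complex poly \<Rightarrow> complex poly poly set" where
  "t_bar n k f = clbar n k (poly (map_poly (\<lambda>c. [:[:c:]:]) f) (x_pol * y_pol))"

definition c_bar :: "nat \<Rightarrow> nat \<Rightarrow> complex \<Rightarrow> complex poly poly set" where
  "c_bar n k c = clbar n k [:[:c:]:]"


section \<open>The categories of Cohen-Macaulay modules\<close>

type_synonym 'b G_module = "(complex fps fps set, 'b, int) gmodule"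
type_synonym 'b Gamma_module = "(complex poly poly set, 'b, (int \<times> int) set) gmodule"

definition CM_G :: "nat \<Rightarrow> nat \<Rightarrow> 'b G_module \<Rightarrow> bool" where
  "CM_G n k M \<longleftrightarrow> graded_module (G_dual n) (Rhat n k) (Rhat_grade n k) M \<and>
     fin_gen (Rhat n k) M \<and> free_module ring_of_type_algebra (restrict_scalars (t_hat n k) M)"

definition CM_Gamma :: "nat \<Rightarrow> nat \<Rightarrow> 'b Gamma_module \<Rightarrow> bool" where
  "CM_Gamma n k M \<longleftrightarrow> graded_module (Gamma_dual n k) (Rbar n k) (Rbar_grade n k) M \<and>
     fin_gen (Rbar n k) M \<and> free_module ring_of_type_algebra (restrict_scalars (t_bar n k) M)"

definition rigid :: "nat \<Rightarrow> nat \<Rightarrow> 'b G_module \<Rightarrow> bool" where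
  "rigid n k M \<longleftrightarrow> Ext1_zero (G_dual n) (Rhat n k) (Rhat_grade n k) M M"

definition iso_G :: "nat \<Rightarrow> nat \<Rightarrow> 'b G_module \<Rightarrow> 'c G_module \<Rightarrow> bool" where
  "iso_G n k = giso (G_dual n) (Rhat n k)"

text \<open>
  Completion.  A power series acts on a family by letting each monomial c x^p y^q send the
  component in degree i - p deg(x) - q deg(y) to degree i; for modules in \<open>CM_Gamma\<close> the sums are finite and
  independent of the chosen representative of the class \<open>C\<close>.
\<close>

definition completion :: "nat \<Rightarrow> nat \<Rightarrow> 'b Gamma_module \<Rightarrow> ((int \<times> int) set \<Rightarrow> 'b) G_module" where
  "completion n k M =
     (let \<Gamma> = Gamma_dual n k; D = carrier \<Gamma>;
          lower = (\<lambda>i (p, q). i \<otimes>\<^bsub>\<Gamma>\<^esub> inv\<^bsub>\<Gamma>\<^esub> (char_class n k (int p) (int q)));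
          mono_cl = (\<lambda>f (p, q). clbar n k (monom (monom (fps_nth (fps_nth f q) p) p) q)) in
      \<lparr>carrier = (\<Pi>\<^sub>E i\<in>D. grade M i), monoid.mult = undefined, monoid.one = undefined,
       ring.zero = (\<lambda>i\<in>D. \<zero>\<^bsub>M\<^esub>), ring.add = (\<lambda>u v. \<lambda>i\<in>D. u i \<oplus>\<^bsub>M\<^esub> v i),
       module.smult = (\<lambda>C u. let f = (SOME f. f \<in> C) in (\<lambda>i\<in>D.
         \<Oplus>\<^bsub>M\<^esub>pq\<in>{pq. u (lower i pq) \<noteq> \<zero>\<^bsub>M\<^esub>}. mono_cl f pq \<odot>\<^bsub>M\<^esub> u (lower i pq))),
       grade = (\<lambda>j. {u \<in> \<Pi>\<^sub>E i\<in>D. grade M i. \<forall>i\<in>D. res_deg n i \<noteq> j \<longrightarrow> u i = \<zero>\<^bsub>M\<^esub>})\<rparr>)"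


section \<open>Rank one modules\<close>

definition k_subset :: "nat \<Rightarrow> nat \<Rightarrow> nat set \<Rightarrow> bool" where
  "k_subset n k I \<longleftrightarrow> I \<subseteq> {1..n} \<and> card I = k"

text \<open>
  Degrees in Z_n are represented by \<open>{0..<n}\<close>, elements of \<open>I\<close> by \<open>{1..n}\<close>.  On families in
  C[[t]]^n, \<open>L_x\<close> and \<open>L_y\<close> are the actions of \<open>x\<close> and \<open>y\<close>.
\<close>

definition in_type :: "nat \<Rightarrow> nat set \<Rightarrow> int \<Rightarrow> bool" where
  "in_type n I a \<longleftrightarrow> (\<exists>b\<in>I. int b mod int n = a mod int n)"

definition L_x :: "nat \<Rightarrow> nat set \<Rightarrow> (int \<Rightarrow> complex fps) \<Rightarrow> int \<Rightarrow> complex fps" where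
  "L_x n I v = (\<lambda>a\<in>{0..<int n}. (if in_type n I a then 1 else fps_X) * v ((a - 1) mod int n))"

definition L_y :: "nat \<Rightarrow> nat set \<Rightarrow> (int \<Rightarrow> complex fps) \<Rightarrow> int \<Rightarrow> complex fps" where
  "L_y n I v = (\<lambda>b\<in>{0..<int n}. (if in_type n I (b + 1) then fps_X else 1) * v ((b + 1) mod int n))"

text \<open>
  The series f = \<open>\<Sum>\<close> c_pq x^p y^q acts coefficientwise in \<open>t\<close>: as x^n acts by t^(n-k) and y^n by
  t^k, only finitely many monomials contribute to each coefficient.
\<close>

definition L_module :: "nat \<Rightarrow> nat set \<Rightarrow> (int \<Rightarrow> complex fps) G_module" where
  "L_module n I =
     (let D = {0..<int n} in
      \<lparr>carrier = (\<Pi>\<^sub>E j\<in>D. UNIV), monoid.mult = undefined, monoid.one = undefined,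
       ring.zero = (\<lambda>j\<in>D. 0), ring.add = (\<lambda>u v. \<lambda>j\<in>D. u j + v j),
       module.smult = (\<lambda>C v. let f = (SOME f. f \<in> C) in (\<lambda>j\<in>D. Abs_fps (\<lambda>e.
         \<Sum>(p, q)\<in>{(p, q). fps_nth ((L_x n I ^^ p) ((L_y n I ^^ q) v) j) e \<noteq> 0}.
           fps_nth (fps_nth f q) p * fps_nth ((L_x n I ^^ p) ((L_y n I ^^ q) v) j) e))),
       grade = (\<lambda>j. {v \<in> \<Pi>\<^sub>E i\<in>D. UNIV. \<forall>i\<in>D. i \<noteq> j \<longrightarrow> v i = 0})\<rparr>)"

definition rank_one_of_type :: "nat \<Rightarrow> nat \<Rightarrow> 'b G_module \<Rightarrow> nat set \<Rightarrow> bool" where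
  "rank_one_of_type n k N I \<longleftrightarrow> k_subset n k I \<and> iso_G n k N (L_module n I)"


section \<open>Profiles\<close>

text \<open>The piece of degree \<open>j\<close> of the coarsened Z_n-grading along \<open>res_deg\<close>.\<close>

definition Zn_piece :: "nat \<Rightarrow> nat \<Rightarrow> 'b Gamma_module \<Rightarrow> int \<Rightarrow> 'b set" where
  "Zn_piece n k M j = hom_sums M {i \<in> carrier (Gamma_dual n k). res_deg n i = j} (grade M)"

text \<open>All Z_n-graded pieces have the same rank; we take the one of degree 0.\<close>

definition rank_Gamma :: "nat \<Rightarrow> nat \<Rightarrow> 'b Gamma_module \<Rightarrow> nat" where
  "rank_Gamma n k M =
     free_rank ring_of_type_algebra (restrict_scalars (t_bar n k) (M\<lparr>carrier := Zn_piece n k M 0\<rparr>))"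

definition dim_at :: "nat \<Rightarrow> nat \<Rightarrow> 'b Gamma_module \<Rightarrow> (int \<times> int) set \<Rightarrow> nat" where
  "dim_at n k M i =
     free_rank ring_of_type_algebra (restrict_scalars (c_bar n k) (M\<lparr>carrier := grade M i\<rparr>))"

definition supp_level :: "nat \<Rightarrow> nat \<Rightarrow> 'b Gamma_module \<Rightarrow> nat \<Rightarrow> (int \<times> int) set set" where
  "supp_level n k M d = {i \<in> carrier (Gamma_dual n k). dim_at n k M i \<ge> d}"

definition contour_shape :: "nat \<Rightarrow> nat \<Rightarrow> (int \<times> int) set set \<Rightarrow> nat set" where
  "contour_shape n k S = {a \<in> {1..n}. \<exists>i\<in>carrier (Gamma_dual n k).
     res_deg n i = int a mod int n \<and> i \<notin> S \<and> i \<otimes>\<^bsub>Gamma_dual n k\<^esub> char_class n k 0 1 \<in> S}"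

definition profile_Gamma :: "nat \<Rightarrow> nat \<Rightarrow> 'b Gamma_module \<Rightarrow> nat set list" where
  "profile_Gamma n k M =
     map (\<lambda>d. contour_shape n k (supp_level n k M d)) [1..<Suc (rank_Gamma n k M)]"

text \<open>
  The profile of a rigid indecomposable module: the lift along completion exists and is unique up
  to grade shift, which does not affect the profile.  The lift may be sought among
  modules with elements of the same type, as the sum of its pieces embeds in its completion.
\<close>

definition graded_lift :: "nat \<Rightarrow> nat \<Rightarrow> 'b G_module \<Rightarrow> 'b Gamma_module" where
  "graded_lift n k M = (SOME N. CM_Gamma n k N \<and> iso_G n k (completion n k N) M)"

definition profile :: "nat \<Rightarrow> nat \<Rightarrow> 'b G_module \<Rightarrow> nat set list" where
  "profile n k M = profile_Gamma n k (graded_lift n k M)"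

end

theory Submission
  imports Defs "HOL-Library.Function_Algebras"
begin

text \<open>
  The graded lift.  The Euler derivation of \<open>Rhat n k\<close>, which multiplies x^p y^q by (n-k)p + kq,
  defines an extension of \<open>M\<close> by itself.  If \<open>M\<close> is rigid it splits, which gives a connection on \<open>M\<close>
  that is regular singular in \<open>t\<close>.  Its eigenvalues on the layers t^N M / t^(N+1) M are those on M / tM
  shifted by nN, so \<open>M\<close> has a C[[t]]-basis of homogeneous generalized eigenvectors.  If \<open>M\<close> is
  indecomposable, their degrees and eigenvalues lie in one coset of the character group of \<open>\<Gamma>\<close>, and the
  elements of \<open>M\<close> with finitely many coefficients form a graded module whose completion is \<open>M\<close>.

  The filtration.  Setting t = 1 embeds all graded pieces of a lift \<open>N\<close> into one vector space.  A complete
  flag in general position meets each piece in the least possible dimension, that is, codimension \<open>d\<close>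
  lowers the dimension of a piece by \<open>d\<close> until it vanishes.  Hence the factors of the induced filtration
  have one-dimensional pieces exactly in the degrees above a contour, and are rank one modules of its
  shape.
\<close>

section \<open>The rings\<close>

text \<open>The profile is defined through a lift picked by \<open>SOME\<close>, so the existence of
  a lift has to be proved before anything can be said about the profile; the filtration argument
  then applies to every lift, hence to the chosen one. A degree p deg(x) + q deg(y) is determined by
  p - q modulo n together with its weight (n-k)p + kq. This is why eigenvalues of a connection,
  added to the Z_n-grading of M, amount to a grading by characters of \<Gamma>. A priori they are
  arbitrary complex numbers; indecomposability makes them comparable. General position has to hold
  for infinitely many pieces at once. It can be reached because the pieces form n increasing chains,
  one for each residue degree, so it suffices to look at the smallest nonzero member of each chain.
  No topology on modules is used: x^n and y^n are multiples of t, so each coefficient in t of the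
  action of a power series involves finitely many monomials.\<close>

abbreviation TA :: "'a::comm_ring_1 ring" where "TA \<equiv> ring_of_type_algebra"

lemma TA_simps [simp]:
  "carrier (TA :: 'a::comm_ring_1 ring) = UNIV"
  "monoid.mult (TA :: 'a ring) = (*)"
  "monoid.one (TA :: 'a ring) = 1"
  "ring.zero (TA :: 'a ring) = 0"
  "ring.add (TA :: 'a ring) = (+)"
  by (simp_all add: ring_of_type_algebra_def fun_eq_iff)

lemma TA_cring: "cring (TA :: 'a::comm_ring_1 ring)"
  by (rule cring_from_type_algebra)

lemma PIdl_TA: "PIdl\<^bsub>TA\<^esub> (g::'a::comm_ring_1) = {h. g dvd h}"
  by (auto simp: cgenideal_def dvd_def mult.commute)

lemma coset_TA: "PIdl\<^bsub>TA\<^esub> (g::'a::comm_ring_1) +>\<^bsub>TA\<^esub> f = {h. g dvd h - f}"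
  by (auto simp: a_r_coset_def r_coset_def PIdl_TA)

lemma coset_TA_eq_iff:
  "PIdl\<^bsub>TA\<^esub> (g::'a::comm_ring_1) +>\<^bsub>TA\<^esub> f = PIdl\<^bsub>TA\<^esub> g +>\<^bsub>TA\<^esub> f' \<longleftrightarrow> g dvd f - f'"
proof
  assume "PIdl\<^bsub>TA\<^esub> g +>\<^bsub>TA\<^esub> f = PIdl\<^bsub>TA\<^esub> g +>\<^bsub>TA\<^esub> f'"
  moreover have "f \<in> PIdl\<^bsub>TA\<^esub> g +>\<^bsub>TA\<^esub> f" by (simp add: coset_TA)
  ultimately show "g dvd f - f'" by (simp add: coset_TA)
next
  assume *: "g dvd f - f'"
  have "g dvd h - f \<longleftrightarrow> g dvd h - f'" for h
  proof -
    have "h - f' = (h - f) + (f - f')" by simp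
    thus ?thesis using * by (metis dvd_add_left_iff)
  qed
  thus "PIdl\<^bsub>TA\<^esub> g +>\<^bsub>TA\<^esub> f = PIdl\<^bsub>TA\<^esub> g +>\<^bsub>TA\<^esub> f'" by (simp add: coset_TA)
qed

lemma TA_PIdl_ideal: "ideal (PIdl\<^bsub>TA\<^esub> (g::'a::comm_ring_1)) TA"
  by (rule cring.cgenideal_ideal[OF TA_cring]) simp

lemma TA_Quot_hom: "((+>\<^bsub>TA\<^esub>) (PIdl\<^bsub>TA\<^esub> (g::'a::comm_ring_1))) \<in> ring_hom TA (TA Quot (PIdl\<^bsub>TA\<^esub> g))"
  by (rule ideal.rcos_ring_hom[OF TA_PIdl_ideal])

lemma TA_Quot_cring: "cring (TA Quot (PIdl\<^bsub>TA\<^esub> (g::'a::comm_ring_1)))"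
  by (rule ideal.quotient_is_cring[OF TA_PIdl_ideal TA_cring])

lemma TA_Quot_carrier: "carrier (TA Quot (PIdl\<^bsub>TA\<^esub> (g::'a::comm_ring_1))) = range ((+>\<^bsub>TA\<^esub>) (PIdl\<^bsub>TA\<^esub> g))"
  by (auto simp: FactRing_def A_RCOSETS_def')

definition Fhat :: "nat \<Rightarrow> nat \<Rightarrow> complex fps fps" where "Fhat n k = x_ser ^ k - y_ser ^ (n - k)"
definition Fbar :: "nat \<Rightarrow> nat \<Rightarrow> complex poly poly" where "Fbar n k = x_pol ^ k - y_pol ^ (n - k)"

lemmas Rhat_unfold = Rhat_def Ihat_def clhat_def Fhat_def[symmetric]
lemmas Rbar_unfold = Rbar_def Ibar_def clbar_def Fbar_def[symmetric]

lemma clhat_in [simp]: "clhat n k f \<in> carrier (Rhat n k)"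
  and clhat_eq_iff: "clhat n k f = clhat n k f' \<longleftrightarrow> Fhat n k dvd f - f'"
  and clhat_add: "clhat n k (f + f') = clhat n k f \<oplus>\<^bsub>Rhat n k\<^esub> clhat n k f'"
  and clhat_mult: "clhat n k (f * f') = clhat n k f \<otimes>\<^bsub>Rhat n k\<^esub> clhat n k f'"
  and clhat_one: "clhat n k 1 = \<one>\<^bsub>Rhat n k\<^esub>"
  and Rhat_cring: "cring (Rhat n k)"
  using ring_hom_closed[OF TA_Quot_hom[of "Fhat n k"], of f]
    ring_hom_add[OF TA_Quot_hom[of "Fhat n k"], of f f']
    ring_hom_mult[OF TA_Quot_hom[of "Fhat n k"], of f f']
    ring_hom_one[OF TA_Quot_hom[of "Fhat n k"]]
  by (simp_all add: Rhat_unfold coset_TA_eq_iff TA_Quot_cring)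

lemma clhat_mem_iff: "f' \<in> clhat n k f \<longleftrightarrow> Fhat n k dvd f' - f"
  by (simp add: Rhat_unfold coset_TA)

lemma Rhat_cases: assumes "C \<in> carrier (Rhat n k)" obtains f where "C = clhat n k f"
  using assms by (auto simp: Rhat_unfold TA_Quot_carrier)

lemma clhat_zero: "clhat n k 0 = \<zero>\<^bsub>Rhat n k\<^esub>"
proof -
  interpret cring "Rhat n k" by (rule Rhat_cring)
  have "clhat n k 0 \<oplus>\<^bsub>Rhat n k\<^esub> clhat n k 0 = clhat n k 0" using clhat_add[of n k 0 0] by simp
  thus ?thesis by (metis add.l_cancel_one' clhat_in)
qed

lemma clbar_in [simp]: "clbar n k f \<in> carrier (Rbar n k)"
  and clbar_eq_iff: "clbar n k f = clbar n k f' \<longleftrightarrow> Fbar n k dvd f - f'"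
  and clbar_add: "clbar n k (f + f') = clbar n k f \<oplus>\<^bsub>Rbar n k\<^esub> clbar n k f'"
  and clbar_mult: "clbar n k (f * f') = clbar n k f \<otimes>\<^bsub>Rbar n k\<^esub> clbar n k f'"
  and clbar_one: "clbar n k 1 = \<one>\<^bsub>Rbar n k\<^esub>"
  and Rbar_cring: "cring (Rbar n k)"
  using ring_hom_closed[OF TA_Quot_hom[of "Fbar n k"], of f]
    ring_hom_add[OF TA_Quot_hom[of "Fbar n k"], of f f']
    ring_hom_mult[OF TA_Quot_hom[of "Fbar n k"], of f f']
    ring_hom_one[OF TA_Quot_hom[of "Fbar n k"]]
  by (simp_all add: Rbar_unfold coset_TA_eq_iff TA_Quot_cring)

lemma clbar_mem_iff: "f' \<in> clbar n k f \<longleftrightarrow> Fbar n k dvd f' - f"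
  by (simp add: Rbar_unfold coset_TA)

lemma Rbar_cases: assumes "C \<in> carrier (Rbar n k)" obtains f where "C = clbar n k f"
  using assms by (auto simp: Rbar_unfold TA_Quot_carrier)

lemma clbar_zero: "clbar n k 0 = \<zero>\<^bsub>Rbar n k\<^esub>"
proof -
  interpret cring "Rbar n k" by (rule Rbar_cring)
  have "clbar n k 0 \<oplus>\<^bsub>Rbar n k\<^esub> clbar n k 0 = clbar n k 0" using clbar_add[of n k 0 0] by simp
  thus ?thesis by (metis add.l_cancel_one' clbar_in)
qed

text \<open>\<open>dC\<close> and the action on completions pick representatives with
  \<open>SOME\<close>; this leads back to the class.\<close>

lemma some_clhat: "C \<in> carrier (Rhat n k) \<Longrightarrow> clhat n k (SOME f. f \<in> C) = C"
proof (erule Rhat_cases, goal_cases)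
  case (1 f)
  hence "f \<in> C" by (simp add: clhat_mem_iff)
  hence "(SOME f. f \<in> C) \<in> C" by (rule someI)
  thus ?case using 1 by (simp add: clhat_mem_iff clhat_eq_iff)
qed

lemma some_clbar: "C \<in> carrier (Rbar n k) \<Longrightarrow> clbar n k (SOME f. f \<in> C) = C"
proof (erule Rbar_cases, goal_cases)
  case (1 f)
  hence "f \<in> C" by (simp add: clbar_mem_iff)
  hence "(SOME f. f \<in> C) \<in> C" by (rule someI)
  thus ?case using 1 by (simp add: clbar_mem_iff clbar_eq_iff)
qed

subsection \<open>Monomials\<close>

definition mon_ser :: "complex \<Rightarrow> nat \<Rightarrow> nat \<Rightarrow> complex fps fps" where
  "mon_ser c p q = Abs_fps (\<lambda>q'. Abs_fps (\<lambda>p'. if p' = p \<and> q' = q then c else 0))"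

definition mon_pol :: "complex \<Rightarrow> nat \<Rightarrow> nat \<Rightarrow> complex poly poly" where
  "mon_pol c p q = monom (monom c p) q"

definition tser :: "complex fps \<Rightarrow> complex fps fps" where
  "tser f = Abs_fps (\<lambda>q. Abs_fps (\<lambda>p. if p = q then fps_nth f q else 0))"

definition tpol :: "complex poly \<Rightarrow> complex poly poly" where
  "tpol f = poly (map_poly (\<lambda>c. [:[:c:]:]) f) (x_pol * y_pol)"

lemma t_hat_tser: "t_hat n k f = clhat n k (tser f)" by (simp add: t_hat_def tser_def)
lemma t_bar_tpol: "t_bar n k f = clbar n k (tpol f)" by (simp add: t_bar_def tpol_def)

lemma x_ser_pow: "x_ser ^ p = fps_const (fps_X ^ p)"
  by (simp add: x_ser_def fps_const_power)

lemma mon_ser_eq: "mon_ser c p q = fps_const (fps_const c) * x_ser ^ p * y_ser ^ q"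
  by (rule fps_ext, rule fps_ext)
    (simp add: mon_ser_def x_ser_pow y_ser_def fps_X_power_mult_right_nth fps_X_power_nth)

lemma mon_ser_mult: "mon_ser c p q * mon_ser c' p' q' = mon_ser (c * c') (p + p') (q + q')"
  by (simp add: mon_ser_eq power_add algebra_simps flip: fps_const_mult)

lemma tser_mult: "tser (f * g) = tser f * tser g"
proof (rule fps_ext, rule fps_ext)
  fix q p
  have "fps_nth (fps_nth (tser f * tser g) q) p
     = (\<Sum>i=0..q. \<Sum>j=0..p. fps_nth (fps_nth (tser f) i) j * fps_nth (fps_nth (tser g) (q-i)) (p-j))"
    by (simp add: fps_mult_nth fps_sum_nth)
  also have "\<dots> = (\<Sum>i=0..q. \<Sum>j=0..p. if j = i then (if p = q then fps_nth f i * fps_nth g (q - i) else 0) else 0)"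
    by (intro sum.cong refl) (auto simp: tser_def)
  also have "\<dots> = (\<Sum>i=0..q. if p = q then fps_nth f i * fps_nth g (q - i) else 0)"
    by (intro sum.cong refl) auto
  also have "\<dots> = fps_nth (fps_nth (tser (f * g)) q) p" by (simp add: tser_def fps_mult_nth)
  finally show "fps_nth (fps_nth (tser (f * g)) q) p = fps_nth (fps_nth (tser f * tser g) q) p" ..
qed

lemma tser_add: "tser (f + g) = tser f + tser g"
  by (rule fps_ext, rule fps_ext) (simp add: tser_def)

lemma tser_monom: "tser (fps_const c * fps_X ^ w) = mon_ser c w w"
  by (rule fps_ext, rule fps_ext) (auto simp: tser_def mon_ser_def fps_X_power_nth)

lemma mon_pol_mult: "mon_pol c p q * mon_pol c' p' q' = mon_pol (c * c') (p + p') (q + q')"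
  by (simp add: mon_pol_def mult_monom)

lemma tpol_add: "tpol (f + g) = tpol f + tpol g"
  proof -
  have "map_poly (\<lambda>c. [:[:c:]:]) (f + g) = map_poly (\<lambda>c. [:[:c:]:]) f + map_poly (\<lambda>c. [:[:c:]:]) (g::complex poly)"
    by (rule poly_eqI) (simp add: coeff_map_poly)
  thus ?thesis by (simp add: tpol_def)
qed

lemma coeff_pol_expand: "f = (\<Sum>(p,q)\<in>{(p,q). coeff (coeff f q) p \<noteq> 0}. mon_pol (coeff (coeff f q) p) p q)"
  and finite_coeff_pol: "finite {(p,q). coeff (coeff f q) p \<noteq> (0::complex)}"
proof -
  let ?A = "{(p,q). coeff (coeff f q) p \<noteq> 0}"
  have "?A \<subseteq> (\<Union>q\<in>{..degree f}. (\<lambda>p. (p,q)) ` {..degree (coeff f q)})"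
    by (auto simp: image_iff intro!: bexI le_degree)
  thus fin: "finite ?A" by (rule finite_subset) auto
  show "f = (\<Sum>(p,q)\<in>?A. mon_pol (coeff (coeff f q) p) p q)"
  proof (rule poly_eqI, rule poly_eqI)
    fix q p
    have "coeff (coeff (\<Sum>(p,q)\<in>?A. mon_pol (coeff (coeff f q) p) p q) q) p
      = (\<Sum>z\<in>?A. if z = (p,q) then coeff (coeff f q) p else 0)"
      by (simp add: coeff_sum split_def mon_pol_def) (intro sum.cong, auto)
    also have "\<dots> = coeff (coeff f q) p" using fin by (simp add: sum.delta)
    finally show "coeff (coeff f q) p = coeff (coeff (\<Sum>(p,q)\<in>?A. mon_pol (coeff (coeff f q) p) p q) q) p" ..
  qed
qed

lemma const_const_sum: "[:[:sum h A:]:] = (\<Sum>i\<in>A. [:[:h i:]:])" for h :: "'i \<Rightarrow> complex"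
proof (induction A rule: infinite_finite_induct)
  case (insert x F)
  have "[:[:sum h (insert x F):]:] = [:[:h x:]:] + [:[:sum h F:]:]" using insert(1,2) by simp
  thus ?case using insert by simp
qed simp_all

lemma tpol_mult: "tpol (f * g) = tpol f * tpol g"
proof -
  have "map_poly (\<lambda>c. [:[:c:]:]) (f * g) = map_poly (\<lambda>c. [:[:c:]:]) f * map_poly (\<lambda>c. [:[:c:]:]) (g::complex poly)"
    by (rule poly_eqI) (simp add: coeff_map_poly coeff_mult const_const_sum)
  thus ?thesis by (simp add: tpol_def)
qed

lemma x_pol_pow: "x_pol ^ p = [:monom 1 p:]"
  by (induction p) (simp_all add: x_pol_def mult_monom flip: one_pCons)

lemma y_pol_pow: "y_pol ^ p = monom 1 p"
  by (simp add: y_pol_def monom_power)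

lemma mon_pol_eq: "mon_pol c p q = [:[:c:]:] * x_pol ^ p * y_pol ^ q"
  by (simp add: mon_pol_def x_pol_pow y_pol_pow smult_monom)

lemma tpol_monom: "tpol (monom c w) = mon_pol c w w"
  by (simp add: tpol_def map_poly_monom poly_monom mon_pol_eq power_mult_distrib mult.assoc)

lemma tpol_const: "tpol [:c:] = mon_pol c 0 0"
  using tpol_monom[of c 0] by (simp add: monom_0)

lemma c_bar_mon: "c_bar n k c = clbar n k (mon_pol c 0 0)"
  by (simp add: c_bar_def mon_pol_eq)

lemma mon_pol_one: "mon_pol 1 0 0 = 1" by (simp add: mon_pol_eq flip: one_pCons)
lemma mon_ser_one: "mon_ser 1 0 0 = 1" by (simp add: mon_ser_eq)
lemma tpol_one: "tpol 1 = 1" using tpol_const[of 1] by (simp add: mon_pol_one one_pCons)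
lemma tser_X: "tser fps_X = mon_ser 1 1 1" using tser_monom[of 1 1] by simp
lemma tpol_X: "tpol (monom 1 1) = mon_pol 1 1 1" by (rule tpol_monom)

text \<open>The difference is the relation times the monomial c x^p y^q.\<close>

lemma clhat_rel: assumes "k \<le> n"
  shows "clhat n k (mon_ser c (k + p) q) = clhat n k (mon_ser c p (n - k + q))"
proof -
  have "mon_ser c (k + p) q - mon_ser c p (n - k + q) = Fhat n k * mon_ser c p q"
    by (simp add: mon_ser_eq Fhat_def power_add algebra_simps)
  thus ?thesis by (simp add: clhat_eq_iff)
qed

lemma clbar_rel: assumes "k \<le> n"
  shows "clbar n k (mon_pol c (k + p) q) = clbar n k (mon_pol c p (n - k + q))"
proof -
  have "mon_pol c (k + p) q - mon_pol c p (n - k + q) = Fbar n k * mon_pol c p q"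
    unfolding mon_pol_eq Fbar_def power_add by (simp only: algebra_simps)
  thus ?thesis by (simp add: clbar_eq_iff)
qed

text \<open>In the quotient x^n = x^(n-k) x^k = x^(n-k) y^(n-k) = t^(n-k); this is the N-th power of
  that identity times a monomial. Writing n as \<open>k + m\<close> keeps natural subtraction out of
  the exponents.\<close>

lemma clhat_x_pow_aux:
  "clhat (k + m) k (mon_ser c ((k + m) * N + p) q) = clhat (k + m) k (mon_ser c (m * N + p) (m * N + q))"
proof (induction N arbitrary: q)
  case (Suc N)
  let ?cl = "clhat (k + m) k"
  have "?cl (mon_ser c ((k + m) * Suc N + p) q) = ?cl (mon_ser c (k + ((k + m) * N + p + m)) q)"
    by (simp add: algebra_simps)
  also have "\<dots> = ?cl (mon_ser c ((k + m) * N + p) (m + q) * mon_ser 1 m 0)"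
    by (subst clhat_rel) (simp_all add: mon_ser_mult)
  also have "\<dots> = ?cl (mon_ser c (m * N + p) (m * N + (m + q)) * mon_ser 1 m 0)"
    by (simp add: clhat_mult Suc.IH)
  finally show ?case by (simp add: mon_ser_mult algebra_simps)
qed simp

text \<open>Likewise y^n = y^k y^(n-k) = x^k y^k = t^k.\<close>

lemma clhat_y_pow_aux:
  "clhat (k + m) k (mon_ser c p ((k + m) * N + q)) = clhat (k + m) k (mon_ser c (k * N + p) (k * N + q))"
proof (induction N arbitrary: p)
  case (Suc N)
  let ?cl = "clhat (k + m) k"
  have "?cl (mon_ser c p ((k + m) * Suc N + q)) = ?cl (mon_ser c p (k + m - k + ((k + m) * N + q + k)))"
    by (simp add: algebra_simps)
  also have "\<dots> = ?cl (mon_ser c (k + p) ((k + m) * N + q) * mon_ser 1 0 k)"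
    by (subst clhat_rel[symmetric]) (simp_all add: mon_ser_mult algebra_simps)
  also have "\<dots> = ?cl (mon_ser c (k * N + (k + p)) (k * N + q) * mon_ser 1 0 k)"
    by (simp add: clhat_mult Suc.IH)
  finally show ?case by (simp add: mon_ser_mult algebra_simps)
qed simp

lemma clhat_x_pow: assumes "k \<le> n"
  shows "clhat n k (mon_ser c (n * N + p) q) = clhat n k (mon_ser c ((n - k) * N + p) ((n - k) * N + q))"
  using clhat_x_pow_aux[of k "n - k"] assms by simp

lemma clhat_y_pow: assumes "k \<le> n"
  shows "clhat n k (mon_ser c p (n * N + q)) = clhat n k (mon_ser c (k * N + p) (k * N + q))"
  using clhat_y_pow_aux[of k "n - k"] assms by simp

lemma clbar_x_pow: assumes "k \<le> n"
  shows "clbar n k (mon_pol c (n + p) q) = clbar n k (mon_pol c ((n - k) + p) ((n - k) + q))"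
  using clbar_rel[OF assms, of c "n - k + p" q] assms by simp

lemma clbar_y_pow: assumes "k \<le> n"
  shows "clbar n k (mon_pol c p (n + q)) = clbar n k (mon_pol c (k + p) (k + q))"
  using clbar_rel[OF assms, of c p "k + q"] assms by simp

text \<open>Outside the box p, q < B a monomial is divisible by y^B if q is at least B, and
  otherwise by x^B; these two cases make up \<open>v\<close> and \<open>u\<close>.\<close>

lemma ser_split: 
  obtains u v where "f = (\<Sum>p<B. \<Sum>q<B. mon_ser (fps_nth (fps_nth f q) p) p q) + mon_ser 1 B 0 * u + mon_ser 1 0 B * v"
proof
  define u where "u = Abs_fps (\<lambda>q. if q < B then Abs_fps (\<lambda>p. fps_nth (fps_nth f q) (p + B)) else 0)"
  define v where "v = Abs_fps (\<lambda>q. fps_nth f (q + B))"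
  show "f = (\<Sum>p<B. \<Sum>q<B. mon_ser (fps_nth (fps_nth f q) p) p q) + mon_ser 1 B 0 * u + mon_ser 1 0 B * v"
  proof (rule fps_ext, rule fps_ext)
    fix q p
    have "fps_nth (fps_nth (\<Sum>p<B. \<Sum>q<B. mon_ser (fps_nth (fps_nth f q) p) p q) q) p
      = (\<Sum>p'<B. \<Sum>q'<B. if p' = p then if q' = q then fps_nth (fps_nth f q) p else 0 else 0)"
      by (simp add: fps_sum_nth mon_ser_def) (intro sum.cong refl, auto)
    also have "\<dots> = (\<Sum>p'<B. if p' = p then if q < B then fps_nth (fps_nth f q) p else 0 else 0)"
      by (intro sum.cong refl) auto
    also have "\<dots> = (if p < B \<and> q < B then fps_nth (fps_nth f q) p else 0)" by simp
    finally have 1: "fps_nth (fps_nth (\<Sum>p<B. \<Sum>q<B. mon_ser (fps_nth (fps_nth f q) p) p q) q) p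
       = (if p < B \<and> q < B then fps_nth (fps_nth f q) p else 0)" .
    have 2: "fps_nth (fps_nth (mon_ser 1 B 0 * u) q) p = (if q < B \<and> p \<ge> B then fps_nth (fps_nth f q) p else 0)"
      by (simp add: mon_ser_eq x_ser_pow fps_X_power_mult_nth u_def)
    have 3: "fps_nth (fps_nth (mon_ser 1 0 B * v) q) p = (if q \<ge> B then fps_nth (fps_nth f q) p else 0)"
      by (simp add: mon_ser_eq y_ser_def fps_X_power_mult_nth v_def)
    show "fps_nth (fps_nth f q) p = fps_nth (fps_nth ((\<Sum>p<B. \<Sum>q<B. mon_ser (fps_nth (fps_nth f q) p) p q) + mon_ser 1 B 0 * u + mon_ser 1 0 B * v) q) p"
      by (simp only: fps_add_nth 1 2 3) auto
  qed
qed

text \<open>Both x^(nN) and y^(nN) are multiples of t^N, because n-k and k are at least 1. Hence the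
  class of a power series is a polynomial plus a multiple of t^N. This takes the place of
  convergence: modulo t^N every action is a finite sum of monomial actions.\<close>

lemma clhat_trunc: assumes "1 \<le> k" "k < n"
  obtains g where "clhat n k f = clhat n k ((\<Sum>p<n*N. \<Sum>q<n*N. mon_ser (fps_nth (fps_nth f q) p) p q) + tser (fps_X ^ N) * g)"
proof -
  obtain u v where f: "f = (\<Sum>p<n*N. \<Sum>q<n*N. mon_ser (fps_nth (fps_nth f q) p) p q) + mon_ser 1 (n*N) 0 * u + mon_ser 1 0 (n*N) * v"
    using ser_split by blast
  have k: "k \<le> n" using assms by simp
  have a: "clhat n k (mon_ser 1 (n*N) 0) = clhat n k (tser (fps_X ^ N) * mon_ser 1 ((n-k-1)*N) ((n-k-1)*N))"
  proof -
    have "(n - k) = Suc (n - k - 1)" using assms by simp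
    hence "(n - k) * N = N + (n-k-1)*N" by (metis mult_Suc)
    thus ?thesis using clhat_x_pow[OF k, of 1 N 0 0] tser_monom[of 1 N] by (simp add: mon_ser_mult)
  qed
  have b: "clhat n k (mon_ser 1 0 (n*N)) = clhat n k (tser (fps_X ^ N) * mon_ser 1 ((k-1)*N) ((k-1)*N))"
  proof -
    have "k = Suc (k - 1)" using assms by simp
    hence "k * N = N + (k-1)*N" by (metis mult_Suc)
    thus ?thesis using clhat_y_pow[OF k, of 1 0 N 0] tser_monom[of 1 N] by (simp add: mon_ser_mult)
  qed
  interpret R: cring "Rhat n k" by (rule Rhat_cring)
  show thesis
    by (rule that[of "mon_ser 1 ((n-k-1)*N) ((n-k-1)*N) * u + mon_ser 1 ((k-1)*N) ((k-1)*N) * v"], subst f)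
      (simp add: clhat_add clhat_mult a b distrib_left R.a_assoc flip: mult.assoc)
qed

subsection \<open>The Euler derivation\<close>

text \<open>This is (n-k) x d/dx + k y d/dy. The weights are chosen to give x^k and y^(n-k) the same
  weight k(n-k), so that the derivation descends to the quotient ring; t = xy gets weight n.\<close>

definition dser :: "nat \<Rightarrow> nat \<Rightarrow> complex fps fps \<Rightarrow> complex fps fps" where
  "dser n k f = Abs_fps (\<lambda>q. Abs_fps (\<lambda>p. of_nat ((n-k)*p + k*q) * fps_nth (fps_nth f q) p))"

lemma dser_add: "dser n k (f + g) = dser n k f + dser n k g"
  by (rule fps_ext, rule fps_ext) (simp add: dser_def algebra_simps)

lemma dser_minus: "dser n k (f - g) = dser n k f - dser n k g"
  by (rule fps_ext, rule fps_ext) (simp add: dser_def algebra_simps)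

text \<open>The weight (n-k)p + kq is additive in (p, q), so the product rule holds on each term of
  the Cauchy product.\<close>

lemma dser_mult: "dser n k (f * g) = dser n k f * g + f * dser n k g"
proof (rule fps_ext, rule fps_ext)
  fix q p
  have "fps_nth (fps_nth (dser n k (f * g)) q) p
     = (\<Sum>i=0..q. \<Sum>j=0..p. of_nat ((n-k)*p + k*q) * (fps_nth (fps_nth f i) j * fps_nth (fps_nth g (q-i)) (p-j)))"
    by (simp add: fps_mult_nth fps_sum_nth dser_def sum_distrib_left)
  also have "\<dots> = (\<Sum>i=0..q. \<Sum>j=0..p. (of_nat ((n-k)*j + k*i) * fps_nth (fps_nth f i) j) * fps_nth (fps_nth g (q-i)) (p-j)
     + fps_nth (fps_nth f i) j * (of_nat ((n-k)*(p-j) + k*(q-i)) * fps_nth (fps_nth g (q-i)) (p-j)))"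
  proof (intro sum.cong refl)
    fix i j assume "i \<in> {0..q}" "j \<in> {0..p}"
    then obtain a b where "p = j + a" "q = i + b" by (auto simp: le_iff_add)
    hence "(n-k)*p + k*q = ((n-k)*j + k*i) + ((n-k)*(p-j) + k*(q-i))"
      by (simp add: add_mult_distrib2)
    thus "of_nat ((n-k)*p + k*q) * (fps_nth (fps_nth f i) j * fps_nth (fps_nth g (q-i)) (p-j)) =
      (of_nat ((n-k)*j + k*i) * fps_nth (fps_nth f i) j) * fps_nth (fps_nth g (q-i)) (p-j)
     + fps_nth (fps_nth f i) j * (of_nat ((n-k)*(p-j) + k*(q-i)) * fps_nth (fps_nth g (q-i)) (p-j))"
      by (simp only: of_nat_add) (simp add: algebra_simps)
  qed
  also have "\<dots> = fps_nth (fps_nth (dser n k f * g + f * dser n k g) q) p"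
    by (simp add: fps_mult_nth fps_sum_nth dser_def sum.distrib)
  finally show "fps_nth (fps_nth (dser n k (f * g)) q) p = fps_nth (fps_nth (dser n k f * g + f * dser n k g) q) p" .
qed

lemma dser_mon: "dser n k (mon_ser c p q) = mon_ser (of_nat ((n-k)*p + k*q) * c) p q"
  by (rule fps_ext, rule fps_ext) (simp add: dser_def mon_ser_def)

text \<open>t^q has weight (n-k)q + kq = nq, so on C[[t]] the derivation is n t d/dt.\<close>

lemma dser_tser: assumes "k \<le> n"
  shows "dser n k (tser f) = tser (of_nat n * fps_X * fps_deriv f)"
proof (rule fps_ext, rule fps_ext)
  fix q p
  have *: "(n - k) * q + k * q = n * q" using assms by (metis add_mult_distrib le_add_diff_inverse2)
  have "fps_nth (of_nat n * fps_X * fps_deriv f) q = of_nat (n * q) * fps_nth f q"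
    by (cases q) (simp_all add: mult.assoc fps_mult_of_nat_nth algebra_simps flip: fps_of_nat)
  thus "fps_nth (fps_nth (dser n k (tser f)) q) p = fps_nth (fps_nth (tser (of_nat n * fps_X * fps_deriv f)) q) p"
    using * by (auto simp: dser_def tser_def simp flip: of_nat_mult of_nat_add)
qed

lemma Fhat_mon: "Fhat n k = mon_ser 1 k 0 - mon_ser 1 0 (n - k)"
  by (simp add: Fhat_def mon_ser_eq)

lemma mon_ser_add: "mon_ser (a + b) p q = mon_ser a p q + mon_ser b p q"
  by (rule fps_ext, rule fps_ext) (simp add: mon_ser_def)

lemma mon_ser_0: "mon_ser 0 p q = 0"
  by (rule fps_ext, rule fps_ext) (simp add: mon_ser_def)

lemma of_nat_mon_ser: "of_nat m * mon_ser c p q = mon_ser (of_nat m * c) p q"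
  by (induction m) (simp_all add: mon_ser_0 mon_ser_add ring_distribs)

text \<open>Both monomials of the relation have weight k(n-k), so the relation is an eigenvector;
  with the product rule the ideal is stable.\<close>

lemma dser_Fhat: "dser n k (Fhat n k) = of_nat ((n-k)*k) * Fhat n k"
  by (simp only: Fhat_mon dser_minus dser_mon right_diff_distrib of_nat_mon_ser)
    (simp add: mult.commute)

lemma dser_dvd: "Fhat n k dvd f \<Longrightarrow> Fhat n k dvd dser n k f"
  by (auto elim!: dvdE simp: dser_mult dser_Fhat)

subsection \<open>Polynomials as power series\<close>

definition p2s :: "complex poly poly \<Rightarrow> complex fps fps" where
  "p2s f = Abs_fps (\<lambda>q. Abs_fps (\<lambda>p. coeff (coeff f q) p))"

lemma p2s_nth [simp]: "fps_nth (fps_nth (p2s f) q) p = coeff (coeff f q) p"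
  by (simp add: p2s_def)

lemma p2s_add: "p2s (f + g) = p2s f + p2s g"
  by (rule fps_ext, rule fps_ext) simp
lemma p2s_diff: "p2s (f - g) = p2s f - p2s g"
  by (rule fps_ext, rule fps_ext) simp
lemma p2s_mult: "p2s (f * g) = p2s f * p2s g"
  by (rule fps_ext, rule fps_ext) (simp add: coeff_mult coeff_sum fps_mult_nth fps_sum_nth atMost_atLeast0)
lemma p2s_mon: "p2s (mon_pol c p q) = mon_ser c p q"
  by (rule fps_ext, rule fps_ext) (auto simp: mon_pol_def mon_ser_def)
lemma p2s_one: "p2s 1 = 1" using p2s_mon[of 1 0 0] by (simp add: mon_pol_one mon_ser_one)
lemma p2s_Fbar: "p2s (Fbar n k) = Fhat n k"
proof -
  have "Fbar n k = mon_pol 1 k 0 - mon_pol 1 0 (n - k)" by (simp add: Fbar_def mon_pol_eq flip: one_pCons)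
  thus ?thesis by (simp add: p2s_diff p2s_mon Fhat_mon)
qed
lemma p2s_dvd: "Fbar n k dvd f \<Longrightarrow> Fhat n k dvd p2s f"
  by (auto elim!: dvdE simp: p2s_mult p2s_Fbar)
lemma p2s_tpol: "p2s (tpol f) = tser (fps_of_poly f)"
proof (induction f)
  case 0 show ?case by (rule fps_ext, rule fps_ext) (simp add: tpol_def tser_def)
next
  case (pCons a f)
  have "pCons a f = [:a:] + monom 1 1 * f" by (simp add: monom_altdef)
  hence "tpol (pCons a f) = mon_pol a 0 0 + mon_pol 1 1 1 * tpol f"
    by (metis tpol_add tpol_mult tpol_const tpol_X)
  hence "p2s (tpol (pCons a f)) = mon_ser a 0 0 + mon_ser 1 1 1 * tser (fps_of_poly f)"
    by (simp add: p2s_add p2s_mult p2s_mon pCons)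
  also have "\<dots> = tser (fps_const a + fps_X * fps_of_poly f)"
    using tser_monom[of a 0] by (simp add: tser_add tser_mult tser_X)
  finally show ?case by (simp add: fps_of_poly_pCons algebra_simps)
qed

subsection \<open>Graded pieces of the rings\<close>

lemma mon_Rhat_grade: "clhat n k (mon_ser c p q) \<in> Rhat_grade n k ((int p - int q) mod int n)"
  by (auto simp: Rhat_grade_def mon_ser_def split: if_splits)

lemma t_hat_grade: "t_hat n k f \<in> Rhat_grade n k 0"
  by (auto simp: Rhat_grade_def t_hat_tser tser_def intro!: imageI split: if_splits)

text \<open>The derivation only scales coefficients, so a homogeneous representative stays
  homogeneous; by \<open>dser_dvd\<close> the resulting class does not depend on the
  representative.\<close>

lemma dser_grade: "clhat n k f \<in> Rhat_grade n k j \<Longrightarrow> clhat n k (dser n k f) \<in> Rhat_grade n k j"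
proof -
  assume "clhat n k f \<in> Rhat_grade n k j"
  then obtain f' where f': "clhat n k f = clhat n k f'" "\<forall>p q. fps_nth (fps_nth f' q) p \<noteq> 0 \<longrightarrow> (int p - int q) mod int n = j"
    by (auto simp: Rhat_grade_def)
  hence "clhat n k (dser n k f) = clhat n k (dser n k f')"
    using dser_dvd[of n k "f - f'"] by (simp add: clhat_eq_iff dser_minus)
  moreover have "clhat n k (dser n k f') \<in> Rhat_grade n k j"
    unfolding Rhat_grade_def by (intro imageI) (use f'(2) in \<open>auto simp: dser_def\<close>)
  ultimately show ?thesis by simp
qed

lemma mon_Rbar_grade: "clbar n k (mon_pol c p q) \<in> Rbar_grade n k (char_class n k (int p) (int q))"
  by (auto simp: Rbar_grade_def mon_pol_def intro!: imageI split: if_splits)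

lemma t_hat_in [simp]: "t_hat n k f \<in> carrier (Rhat n k)" by (simp add: t_hat_tser)
lemma t_bar_in [simp]: "t_bar n k f \<in> carrier (Rbar n k)" by (simp add: t_bar_tpol)
lemma c_bar_in [simp]: "c_bar n k c \<in> carrier (Rbar n k)" by (simp add: c_bar_mon)
lemma t_bar_hom: 
  "t_bar n k (f + g) = t_bar n k f \<oplus>\<^bsub>Rbar n k\<^esub> t_bar n k g"
  "t_bar n k (f * g) = t_bar n k f \<otimes>\<^bsub>Rbar n k\<^esub> t_bar n k g"
  "t_bar n k 1 = \<one>\<^bsub>Rbar n k\<^esub>"
  by (simp_all add: t_bar_tpol tpol_add tpol_mult tpol_one clbar_add clbar_mult clbar_one)
lemma c_bar_t_bar: "c_bar n k c = t_bar n k [:c:]"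
  by (simp add: c_bar_mon t_bar_tpol tpol_const)

section \<open>Bases and coordinates\<close>

lemma sum_fun_apply: "(\<Sum>i\<in>A. f i) x = (\<Sum>i\<in>A. f i x)" for f :: "'i \<Rightarrow> 'x \<Rightarrow> 'v::comm_monoid_add"
  by (induction A rule: infinite_finite_induct) auto

lemma additive_map_zero:
  fixes \<kappa> :: "'b \<Rightarrow> 'v::ab_group_add"
  assumes "abelian_group M" "\<And>u v. u \<in> carrier M \<Longrightarrow> v \<in> carrier M \<Longrightarrow> \<kappa> (u \<oplus>\<^bsub>M\<^esub> v) = \<kappa> u + \<kappa> v"
  shows "\<kappa> \<zero>\<^bsub>M\<^esub> = 0"
proof -
  interpret abelian_group M by fact
  have "\<kappa> (\<zero>\<^bsub>M\<^esub> \<oplus>\<^bsub>M\<^esub> \<zero>\<^bsub>M\<^esub>) = \<kappa> \<zero>\<^bsub>M\<^esub> + \<kappa> \<zero>\<^bsub>M\<^esub>" by (rule assms) auto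
  thus ?thesis by simp
qed

lemma additive_map_neg:
  fixes \<kappa> :: "'b \<Rightarrow> 'v::ab_group_add"
  assumes "abelian_group M" "\<And>u v. u \<in> carrier M \<Longrightarrow> v \<in> carrier M \<Longrightarrow> \<kappa> (u \<oplus>\<^bsub>M\<^esub> v) = \<kappa> u + \<kappa> v"
    "u \<in> carrier M"
  shows "\<kappa> (\<ominus>\<^bsub>M\<^esub> u) = - \<kappa> u"
proof -
  interpret abelian_group M by fact
  have "\<kappa> (\<ominus>\<^bsub>M\<^esub> u \<oplus>\<^bsub>M\<^esub> u) = \<kappa> (\<ominus>\<^bsub>M\<^esub> u) + \<kappa> u" using assms by simp
  hence "\<kappa> (\<ominus>\<^bsub>M\<^esub> u) + \<kappa> u = 0" using additive_map_zero[OF assms(1,2)] assms(3) by (simp add: l_neg)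
  thus ?thesis by (simp add: eq_neg_iff_add_eq_0)
qed

lemma additive_map_finsum:
  fixes \<kappa> :: "'b \<Rightarrow> 'v::ab_group_add"
  assumes "abelian_group M" "\<And>u v. u \<in> carrier M \<Longrightarrow> v \<in> carrier M \<Longrightarrow> \<kappa> (u \<oplus>\<^bsub>M\<^esub> v) = \<kappa> u + \<kappa> v"
    "\<And>i. i \<in> A \<Longrightarrow> f i \<in> carrier M"
  shows "\<kappa> (\<Oplus>\<^bsub>M\<^esub>i\<in>A. f i) = (\<Sum>i\<in>A. \<kappa> (f i))"
proof -
  interpret abelian_group M by fact
  note z = additive_map_zero[OF assms(1,2)]
  show ?thesis using assms(3)
  proof (induction A rule: infinite_finite_induct)
    case (infinite A) thus ?case by (simp add: z)
  next
    case empty thus ?case by (simp add: z)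
  next
    case (insert x F)
    have "(\<Oplus>\<^bsub>M\<^esub>i\<in>insert x F. f i) = f x \<oplus>\<^bsub>M\<^esub> (\<Oplus>\<^bsub>M\<^esub>i\<in>F. f i)"
      by (rule finsum_insert) (use insert in auto)
    thus ?case using insert by (simp add: assms(2))
  qed
qed

lemma additive_map_finsum_in:
  assumes "abelian_group M" "abelian_group N" "\<And>u. u \<in> carrier M \<Longrightarrow> \<kappa> u \<in> carrier N"
    "\<And>u v. u \<in> carrier M \<Longrightarrow> v \<in> carrier M \<Longrightarrow> \<kappa> (u \<oplus>\<^bsub>M\<^esub> v) = \<kappa> u \<oplus>\<^bsub>N\<^esub> \<kappa> v"
    "\<And>i. i \<in> A \<Longrightarrow> f i \<in> carrier M"
  shows "\<kappa> (\<Oplus>\<^bsub>M\<^esub>i\<in>A. f i) = (\<Oplus>\<^bsub>N\<^esub>i\<in>A. \<kappa> (f i))"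
proof -
  interpret M: abelian_group M by fact
  interpret N: abelian_group N by fact
  have "\<kappa> \<zero>\<^bsub>M\<^esub> = \<kappa> \<zero>\<^bsub>M\<^esub> \<oplus>\<^bsub>N\<^esub> \<kappa> \<zero>\<^bsub>M\<^esub>"
    using assms(4)[of "\<zero>\<^bsub>M\<^esub>" "\<zero>\<^bsub>M\<^esub>"] by simp
  hence z: "\<kappa> \<zero>\<^bsub>M\<^esub> = \<zero>\<^bsub>N\<^esub>" by (metis M.zero_closed N.add.l_cancel_one' assms(3))
  show ?thesis using assms(5)
  proof (induction A rule: infinite_finite_induct)
    case (insert x F)
    have "(\<Oplus>\<^bsub>M\<^esub>i\<in>insert x F. f i) = f x \<oplus>\<^bsub>M\<^esub> (\<Oplus>\<^bsub>M\<^esub>i\<in>F. f i)"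
      by (rule M.finsum_insert) (use insert in auto)
    moreover have "(\<Oplus>\<^bsub>N\<^esub>i\<in>insert x F. \<kappa> (f i)) = \<kappa> (f x) \<oplus>\<^bsub>N\<^esub> (\<Oplus>\<^bsub>N\<^esub>i\<in>F. \<kappa> (f i))"
      by (rule N.finsum_insert) (use insert assms(3) in auto)
    moreover have "(\<Oplus>\<^bsub>M\<^esub>i\<in>F. f i) \<in> carrier M" using insert by auto
    ultimately show ?case using insert by (simp add: assms(4))
  qed (simp_all add: z)
qed

text \<open>Gaussian elimination without division.\<close>

lemma dependent_idom:
  fixes v :: "'s \<Rightarrow> 'b \<Rightarrow> 'k::idom"
  assumes "finite B" "finite S" "card S > card B"
  shows "\<exists>a. (\<exists>s\<in>S. a s \<noteq> 0) \<and> (\<forall>b\<in>B. (\<Sum>s\<in>S. a s * v s b) = 0)"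
  using assms
proof (induction B arbitrary: S v rule: finite_induct)
  case empty
  then obtain s where "s \<in> S" by fastforce
  thus ?case by (intro exI[of _ "\<lambda>_. 1"]) auto
next
  case (insert b0 B)
  show ?case
  proof (cases "\<forall>s\<in>S. v s b0 = 0")
    case True
    have "card S > card B" using insert by simp
    from insert.IH[OF insert.prems(1) this, of v] obtain a where
      "\<exists>s\<in>S. a s \<noteq> 0" "\<forall>b\<in>B. (\<Sum>s\<in>S. a s * v s b) = 0" by blast
    thus ?thesis using True by (intro exI[of _ a]) auto
  next
    case False
    then obtain s0 where s0: "s0 \<in> S" "v s0 b0 \<noteq> 0" by blast
    let ?S = "S - {s0}"
    have c: "finite ?S" "card ?S > card B" using insert s0 by auto
    \<comment> \<open>Cross-multiplication with the pivot \<open>v s0 b0\<close> clears the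
      coordinate \<open>b0\<close> without leaving the domain.\<close>
    define w where "w s b = v s0 b0 * v s b - v s b0 * v s0 b" for s b
    from insert.IH[OF c, of w] obtain a where
      a: "\<exists>s\<in>?S. a s \<noteq> 0" "\<And>b. b \<in> B \<Longrightarrow> (\<Sum>s\<in>?S. a s * w s b) = 0" by blast
    \<comment> \<open>The coefficient of \<open>s0\<close> is forced: with it the combination of the
      \<open>v s\<close> equals that of the reduced vectors \<open>w s\<close>.\<close>
    define a' where "a' s = (if s = s0 then - (\<Sum>s\<in>?S. a s * v s b0) else a s * v s0 b0)" for s
    have S: "(\<Sum>s\<in>S. a' s * v s b) = (\<Sum>s\<in>?S. a s * w s b)" for b
    proof -
      have "(\<Sum>s\<in>S. a' s * v s b) = a' s0 * v s0 b + (\<Sum>s\<in>?S. a' s * v s b)"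
        using insert.prems s0 by (simp add: sum.remove)
      also have "(\<Sum>s\<in>?S. a' s * v s b) = (\<Sum>s\<in>?S. a s * v s0 b0 * v s b)"
        by (intro sum.cong) (auto simp: a'_def)
      also have "a' s0 * v s0 b = - (\<Sum>s\<in>?S. a s * v s b0 * v s0 b)"
        by (simp add: a'_def sum_distrib_right)
      finally show ?thesis by (simp add: w_def algebra_simps sum_subtractf)
    qed
    have "w s b0 = 0" for s by (simp add: w_def)
    hence "\<forall>b\<in>insert b0 B. (\<Sum>s\<in>S. a' s * v s b) = 0" by (auto simp: S a(2))
    moreover have "\<exists>s\<in>S. a' s \<noteq> 0" using a(1) s0 by (auto simp: a'_def)
    ultimately show ?thesis by blast
  qed
qed

text \<open>Coordinates are extended by 0 outside B. \<open>is_basis\<close> speaks of extensional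
  functions, whose default value does not survive pointwise addition; with the default 0 the
  coordinate map is additive into the space of all functions.\<close>

definition bcoord :: "('k::comm_ring_1, 'b, 'c) module_scheme \<Rightarrow> 'b set \<Rightarrow> 'b \<Rightarrow> 'b \<Rightarrow> 'k" where
  "bcoord N B v = (\<lambda>b. if b \<in> B then (THE c. c \<in> B \<rightarrow>\<^sub>E UNIV \<and> finite {b \<in> B. c b \<noteq> 0} \<and>
        v = (\<Oplus>\<^bsub>N\<^esub>b\<in>{b \<in> B. c b \<noteq> 0}. c b \<odot>\<^bsub>N\<^esub> b)) b else 0)"

lemma TA_module:
  fixes N :: "('k::comm_ring_1, 'b, 'c) module_scheme" (structure)
  assumes "module TA N" "v \<in> carrier N"
  shows "0 \<odot> v = \<zero>" "1 \<odot> v = v" "r \<odot> v \<in> carrier N" "(r + r') \<odot> v = r \<odot> v \<oplus> r' \<odot> v"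
    "(r * r') \<odot> v = r \<odot> (r' \<odot> v)"
proof -
  interpret module TA N by fact
  show "0 \<odot> v = \<zero>" "1 \<odot> v = v" "r \<odot> v \<in> carrier N" "(r + r') \<odot> v = r \<odot> v \<oplus> r' \<odot> v"
    "(r * r') \<odot> v = r \<odot> (r' \<odot> v)"
    using assms(2) smult_l_null[of v] smult_one[of v] smult_l_distr[of r r' v] smult_assoc1[of r r' v] by simp_all
qed

locale module_with_basis = module TA N
  for N :: "('k::comm_ring_1, 'b, 'c) module_scheme" (structure) +
  fixes B :: "'b set"
  assumes basis: "is_basis (TA :: 'k ring) N B"
begin

abbreviation "\<kappa> \<equiv> bcoord N B"

lemmas TA_mod = TA_module[OF module_axioms]

lemma B_carrier: "b \<in> B \<Longrightarrow> b \<in> carrier N"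
  using basis by (auto simp: is_basis_def)

lemma coord_ex1: assumes "v \<in> carrier N"
  shows "\<exists>!c. c \<in> B \<rightarrow>\<^sub>E UNIV \<and> finite {b \<in> B. c b \<noteq> (0::'k)} \<and>
        v = (\<Oplus>\<^bsub>N\<^esub>b\<in>{b \<in> B. c b \<noteq> 0}. c b \<odot>\<^bsub>N\<^esub> b)"
  using basis assms by (simp add: is_basis_def)

lemma coord_outside: "b \<notin> B \<Longrightarrow> \<kappa> v b = 0"
  by (simp add: bcoord_def)

lemma coord_finite: "v \<in> carrier N \<Longrightarrow> finite {b. \<kappa> v b \<noteq> 0}"
  and coord_expand: "v \<in> carrier N \<Longrightarrow> v = (\<Oplus>\<^bsub>N\<^esub>b\<in>{b. \<kappa> v b \<noteq> 0}. \<kappa> v b \<odot>\<^bsub>N\<^esub> b)"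
proof -
  assume v: "v \<in> carrier N"
  define c where "c = (THE c. c \<in> B \<rightarrow>\<^sub>E UNIV \<and> finite {b \<in> B. c b \<noteq> (0::'k)} \<and>
        v = (\<Oplus>\<^bsub>N\<^esub>b\<in>{b \<in> B. c b \<noteq> 0}. c b \<odot>\<^bsub>N\<^esub> b))"
  have c: "finite {b \<in> B. c b \<noteq> (0::'k)}" "v = (\<Oplus>\<^bsub>N\<^esub>b\<in>{b \<in> B. c b \<noteq> 0}. c b \<odot>\<^bsub>N\<^esub> b)"
    using theI'[OF coord_ex1[OF v]] unfolding c_def by blast+
  have k: "\<kappa> v = (\<lambda>b. if b \<in> B then c b else 0)" unfolding bcoord_def c_def ..
  have s: "{b. \<kappa> v b \<noteq> 0} = {b \<in> B. c b \<noteq> 0}" by (auto simp: k)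
  show "finite {b. \<kappa> v b \<noteq> 0}" using c(1) s by simp
  have "(\<Oplus>\<^bsub>N\<^esub>b\<in>{b. \<kappa> v b \<noteq> 0}. \<kappa> v b \<odot>\<^bsub>N\<^esub> b) = (\<Oplus>\<^bsub>N\<^esub>b\<in>{b \<in> B. c b \<noteq> 0}. c b \<odot>\<^bsub>N\<^esub> b)"
    unfolding s by (rule finsum_cong') (auto simp: k B_carrier)
  thus "v = (\<Oplus>\<^bsub>N\<^esub>b\<in>{b. \<kappa> v b \<noteq> 0}. \<kappa> v b \<odot>\<^bsub>N\<^esub> b)" using c(2) by simp
qed

lemma coord_eqI:
  assumes S: "finite S" "S \<subseteq> B" and c: "\<And>b. b \<notin> S \<Longrightarrow> c b = 0"
  shows "\<kappa> (\<Oplus>\<^bsub>N\<^esub>b\<in>S. c b \<odot>\<^bsub>N\<^esub> b) = c"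
proof -
  let ?v = "\<Oplus>\<^bsub>N\<^esub>b\<in>S. c b \<odot>\<^bsub>N\<^esub> b"
  have v: "?v \<in> carrier N" using S by (intro finsum_closed) (auto simp: B_carrier subset_iff)
  have e: "?v = (\<Oplus>\<^bsub>N\<^esub>b\<in>{b \<in> B. c b \<noteq> 0}. c b \<odot>\<^bsub>N\<^esub> b)"
    by (rule add.finprod_mono_neutral_cong_right) (use S c in \<open>auto simp: B_carrier subset_iff TA_mod(1)\<close>)
  have f: "finite {b \<in> B. c b \<noteq> 0}" by (rule finite_subset[OF _ S(1)]) (use c in auto)
  have s: "{b \<in> B. (\<lambda>b\<in>B. c b) b \<noteq> 0} = {b \<in> B. c b \<noteq> 0}" by auto
  have "(THE c. c \<in> B \<rightarrow>\<^sub>E UNIV \<and> finite {b \<in> B. c b \<noteq> (0::'k)} \<and>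
        ?v = (\<Oplus>\<^bsub>N\<^esub>b\<in>{b \<in> B. c b \<noteq> 0}. c b \<odot>\<^bsub>N\<^esub> b)) = (\<lambda>b\<in>B. c b)"
  proof (rule the1_equality[OF coord_ex1[OF v]], intro conjI)
    show "finite {b \<in> B. (\<lambda>b\<in>B. c b) b \<noteq> 0}" unfolding s by fact
    show "?v = (\<Oplus>\<^bsub>N\<^esub>b\<in>{b \<in> B. (\<lambda>b\<in>B. c b) b \<noteq> 0}. (\<lambda>b\<in>B. c b) b \<odot>\<^bsub>N\<^esub> b)"
      unfolding s by (subst e, rule finsum_cong') (auto simp: B_carrier)
  qed auto
  thus ?thesis using S c by (auto simp: bcoord_def fun_eq_iff)
qed

lemma coord_expand':
  assumes "v \<in> carrier N" "finite S" "S \<subseteq> B" "\<And>b. b \<notin> S \<Longrightarrow> \<kappa> v b = 0"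
  shows "v = (\<Oplus>\<^bsub>N\<^esub>b\<in>S. \<kappa> v b \<odot>\<^bsub>N\<^esub> b)"
proof -
  have "(\<Oplus>\<^bsub>N\<^esub>b\<in>{b. \<kappa> v b \<noteq> 0}. \<kappa> v b \<odot>\<^bsub>N\<^esub> b) = (\<Oplus>\<^bsub>N\<^esub>b\<in>S. \<kappa> v b \<odot>\<^bsub>N\<^esub> b)"
    by (rule add.finprod_mono_neutral_cong_left) (use assms in \<open>auto simp: B_carrier subset_iff TA_mod(1)\<close>)
  thus ?thesis using coord_expand[OF assms(1)] by simp
qed

lemma coord_inj: "u \<in> carrier N \<Longrightarrow> v \<in> carrier N \<Longrightarrow> \<kappa> u = \<kappa> v \<Longrightarrow> u = v"
  using coord_expand[of u] coord_expand[of v] by simp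

lemma coord_surj:
  assumes "finite {b. c b \<noteq> 0}" "\<And>b. b \<notin> B \<Longrightarrow> c b = 0"
  obtains v where "v \<in> carrier N" "\<kappa> v = c"
proof
  show "\<kappa> (\<Oplus>\<^bsub>N\<^esub>b\<in>{b. c b \<noteq> 0}. c b \<odot>\<^bsub>N\<^esub> b) = c" by (rule coord_eqI) (use assms in auto)
  show "(\<Oplus>\<^bsub>N\<^esub>b\<in>{b. c b \<noteq> 0}. c b \<odot>\<^bsub>N\<^esub> b) \<in> carrier N"
  proof (intro finsum_closed Pi_I)
    fix b assume "b \<in> {b. c b \<noteq> 0}"
    hence "b \<in> B" using assms(2) by blast
    thus "c b \<odot> b \<in> carrier N" by (intro TA_mod B_carrier)
  qed
qed

lemma coord_add: assumes "u \<in> carrier N" "v \<in> carrier N"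
  shows "\<kappa> (u \<oplus>\<^bsub>N\<^esub> v) = \<kappa> u + \<kappa> v"
proof -
  let ?S = "{b. \<kappa> u b \<noteq> 0} \<union> {b. \<kappa> v b \<noteq> 0}"
  have S: "finite ?S" "?S \<subseteq> B" using coord_finite assms coord_outside by auto
  have "u \<oplus>\<^bsub>N\<^esub> v = (\<Oplus>\<^bsub>N\<^esub>b\<in>?S. \<kappa> u b \<odot>\<^bsub>N\<^esub> b) \<oplus>\<^bsub>N\<^esub> (\<Oplus>\<^bsub>N\<^esub>b\<in>?S. \<kappa> v b \<odot>\<^bsub>N\<^esub> b)"
    using coord_expand'[OF assms(1) S] coord_expand'[OF assms(2) S] by simp
  also have "\<dots> = (\<Oplus>\<^bsub>N\<^esub>b\<in>?S. \<kappa> u b \<odot>\<^bsub>N\<^esub> b \<oplus>\<^bsub>N\<^esub> \<kappa> v b \<odot>\<^bsub>N\<^esub> b)"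
    by (rule finsum_addf[symmetric]) (use S in \<open>auto simp: B_carrier subset_iff\<close>)
  also have "\<dots> = (\<Oplus>\<^bsub>N\<^esub>b\<in>?S. (\<kappa> u + \<kappa> v) b \<odot>\<^bsub>N\<^esub> b)"
  proof (rule finsum_cong', goal_cases)
    case 2 show ?case using S by (auto simp: B_carrier subset_iff)
  next
    case (3 b) hence "b \<in> carrier N" using S B_carrier by blast
    thus ?case using smult_l_distr[of "\<kappa> u b" "\<kappa> v b" b] by simp
  qed simp
  finally show ?thesis using coord_eqI[OF S, of "\<kappa> u + \<kappa> v"] by simp
qed

lemma coord_smult: assumes "v \<in> carrier N"
  shows "\<kappa> (r \<odot>\<^bsub>N\<^esub> v) = (\<lambda>b. r * \<kappa> v b)"
proof -
  let ?S = "{b. \<kappa> v b \<noteq> 0}"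
  have S: "finite ?S" "?S \<subseteq> B" using coord_finite assms coord_outside by auto
  have "r \<odot>\<^bsub>N\<^esub> v = r \<odot>\<^bsub>N\<^esub> (\<Oplus>\<^bsub>N\<^esub>b\<in>?S. \<kappa> v b \<odot>\<^bsub>N\<^esub> b)"
    using coord_expand'[OF assms S] by simp
  also have "\<dots> = (\<Oplus>\<^bsub>N\<^esub>b\<in>?S. r \<odot>\<^bsub>N\<^esub> (\<kappa> v b \<odot>\<^bsub>N\<^esub> b))"
    by (rule finsum_smult_ldistr) (use S in \<open>auto simp: B_carrier subset_iff\<close>)
  also have "\<dots> = (\<Oplus>\<^bsub>N\<^esub>b\<in>?S. (\<lambda>b. r * \<kappa> v b) b \<odot>\<^bsub>N\<^esub> b)"
  proof (rule finsum_cong', goal_cases)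
    case 2 show ?case using S by (auto simp: B_carrier subset_iff)
  next
    case (3 b) hence "b \<in> carrier N" using S B_carrier by blast
    thus ?case using smult_assoc1[of r "\<kappa> v b" b] by simp
  qed simp
  finally show ?thesis using coord_eqI[OF S, of "\<lambda>b. r * \<kappa> v b"] by simp
qed

lemma coord_finsum: "(\<And>i. i \<in> A \<Longrightarrow> f i \<in> carrier N) \<Longrightarrow> \<kappa> (\<Oplus>\<^bsub>N\<^esub>i\<in>A. f i) = (\<Sum>i\<in>A. \<kappa> (f i))"
  by (rule additive_map_finsum) (auto intro: coord_add abelian_group_axioms)

lemma coord_zero: "\<kappa> \<zero>\<^bsub>N\<^esub> = 0"
  by (rule additive_map_zero) (auto intro: coord_add abelian_group_axioms)

lemma coord_basis: assumes "b \<in> B" shows "\<kappa> b = (\<lambda>b'. if b' = b then 1 else 0)"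
proof -
  have "b \<in> carrier N" using assms by (rule B_carrier)
  hence "(\<Oplus>\<^bsub>N\<^esub>b'\<in>{b}. (\<lambda>b'. if b' = b then 1 else 0) b' \<odot>\<^bsub>N\<^esub> b') = b"
    using finsum_singleton[of b "{b}" "\<lambda>b'. (if b' = b then 1 else 0) \<odot>\<^bsub>N\<^esub> b'"] by (simp add: TA_mod(2))
  thus ?thesis using coord_eqI[of "{b}" "\<lambda>b'. if b' = b then 1 else 0"] assms by simp
qed

end

lemma is_basis_finiteI:
  fixes N :: "('k::comm_ring_1, 'b, 'c) module_scheme" (structure)
  assumes "module TA N" "finite B" "B \<subseteq> carrier N"
    and ex: "\<And>v. v \<in> carrier N \<Longrightarrow> \<exists>c. v = (\<Oplus>b\<in>B. c b \<odot> b)"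
    and ind: "\<And>c. (\<Oplus>b\<in>B. c b \<odot> b) = \<zero> \<Longrightarrow> \<forall>b\<in>B. c b = (0::'k)"
  shows "is_basis TA N B"
proof -
  interpret module TA N by fact
  have red: "(\<Oplus>b\<in>{b \<in> B. c b \<noteq> 0}. c b \<odot> b) = (\<Oplus>b\<in>B. c b \<odot> b)" for c :: "'b \<Rightarrow> 'k"
    by (rule add.finprod_mono_neutral_cong_left) (use assms(2,3) in \<open>auto simp: subset_iff TA_module(1)[OF assms(1)]\<close>)
  have uniq: "\<forall>b\<in>B. c b = c' b" if e: "(\<Oplus>b\<in>B. c b \<odot> b) = (\<Oplus>b\<in>B. c' b \<odot> b)" for c c' :: "'b \<Rightarrow> 'k"
  proof -
    have cl: "(\<Oplus>b\<in>B. c b \<odot> b) \<in> carrier N" for c :: "'b \<Rightarrow> 'k"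
      using assms(2,3) by (intro finsum_closed) auto
    have "(\<Oplus>b\<in>B. c b \<odot> b) = (\<Oplus>b\<in>B. (c b - c' b) \<odot> b \<oplus> c' b \<odot> b)"
    proof (rule finsum_cong', goal_cases)
      case (3 b) hence "b \<in> carrier N" using assms(3) by auto
      thus ?case using smult_l_distr[of "c b - c' b" "c' b" b] by simp
    qed (use assms(2,3) in auto)
    also have "\<dots> = (\<Oplus>b\<in>B. (c b - c' b) \<odot> b) \<oplus> (\<Oplus>b\<in>B. c' b \<odot> b)"
      by (rule finsum_addf) (use assms(2,3) in auto)
    finally have "(\<Oplus>b\<in>B. (c b - c' b) \<odot> b) \<oplus> (\<Oplus>b\<in>B. c' b \<odot> b) = (\<Oplus>b\<in>B. c' b \<odot> b)"
      using e by simp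
    hence "(\<Oplus>b\<in>B. (c b - c' b) \<odot> b) = \<zero>"
      using add.r_cancel_one[OF cl[of c'] cl[of "\<lambda>b. c b - c' b"]] by simp
    from ind[OF this] show ?thesis by simp
  qed
  show ?thesis unfolding is_basis_def
  proof (intro conjI ballI, goal_cases)
    case (2 v)
    then obtain c where c: "v = (\<Oplus>b\<in>B. c b \<odot> b)" using ex by blast
    show ?case
    proof (rule ex1I[of _ "\<lambda>b\<in>B. c b"], goal_cases)
      case 1
      have "(\<Oplus>b\<in>B. (\<lambda>b\<in>B. c b) b \<odot> b) = v" unfolding c
        by (rule finsum_cong') (use assms(2,3) in auto)
      thus ?case using red[of "\<lambda>b\<in>B. c b"] assms(2) by simp
    next
      case (2 c')
      hence "v = (\<Oplus>b\<in>B. c' b \<odot> b)" using red[of c'] by simp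
      with c uniq[of c c'] have "\<forall>b\<in>B. c b = c' b" by simp
      thus ?case using 2 by (auto simp: PiE_def extensional_def fun_eq_iff)
    qed
  qed (use assms(2,3) in auto)
qed

text \<open>A finite part of B' with more than \<open>card B\<close> elements is dependent, by
  elimination in the coordinates of B, against uniqueness of coordinates in B'. An infinite B' has
  such a part as well.\<close>

lemma basis_card_le:
  fixes N :: "('k::idom, 'b, 'c) module_scheme" (structure)
  assumes "module TA N" "is_basis TA N B" "finite B" "is_basis TA N B'"
  shows "finite B' \<and> card B' \<le> card B"
proof (rule ccontr)
  assume neg: "\<not> ?thesis"
  interpret B: module_with_basis N B
    by (intro module_with_basis.intro assms module_with_basis_axioms.intro)
  interpret B': module_with_basis N B'
    by (intro module_with_basis.intro assms module_with_basis_axioms.intro)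
  obtain S where S: "finite S" "S \<subseteq> B'" "card S > card B"
  proof (cases "finite B'")
    case True thus ?thesis using neg that[of B'] by auto
  next
    case False
    from infinite_arbitrarily_large[OF False, of "Suc (card B)"] show ?thesis using that by auto
  qed
  obtain a where a: "\<exists>s\<in>S. a s \<noteq> 0" "\<And>b. b \<in> B \<Longrightarrow> (\<Sum>s\<in>S. a s * bcoord N B s b) = 0"
    using dependent_idom[OF assms(3) S(1,3), of "\<lambda>s. bcoord N B s"] by blast
  let ?c = "\<lambda>s. if s \<in> S then a s else 0"
  let ?v = "\<Oplus>s\<in>S. ?c s \<odot> s"
  have SN: "s \<in> S \<Longrightarrow> s \<in> carrier N" for s using S B'.B_carrier by auto
  have "bcoord N B ?v = (\<Sum>s\<in>S. bcoord N B (?c s \<odot> s))"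
    by (rule B.coord_finsum) (auto simp: SN)
  also have "\<dots> = (\<Sum>s\<in>S. (\<lambda>b. a s * bcoord N B s b))"
    by (intro sum.cong refl) (simp add: B.coord_smult SN)
  also have "\<dots> = 0"
  proof
    fix b
    show "(\<Sum>s\<in>S. (\<lambda>b. a s * bcoord N B s b)) b = 0 b"
      by (cases "b \<in> B") (simp_all add: sum_fun_apply a(2) B.coord_outside)
  qed
  finally have "?v = \<zero>" using SN by (intro B.coord_inj) (auto simp: B.coord_zero intro!: B.finsum_closed)
  hence "bcoord N B' ?v = 0" by (simp add: B'.coord_zero)
  moreover have "bcoord N B' ?v = ?c" by (rule B'.coord_eqI) (use S in auto)
  ultimately have c0: "?c = 0" by simp
  obtain s where "s \<in> S" "a s \<noteq> 0" using a(1) by blast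
  thus False using fun_cong[OF c0, of s] by simp
qed

text \<open>\<open>free_rank\<close> reads the size of an unspecified basis; over a domain all bases
  have the same size as soon as one of them is finite.\<close>

lemma free_rank_eq_card:
  fixes N :: "('k::idom, 'b, 'c) module_scheme"
  assumes "module TA N" "is_basis TA N B" "finite B"
  shows "free_rank (TA :: 'k ring) N = card B"
proof -
  define B' where "B' = (SOME B. is_basis (TA :: 'k ring) N B)"
  have B': "is_basis TA N B'" unfolding B'_def using assms(2) by (rule someI)
  have "finite B'" "card B' \<le> card B" using basis_card_le[OF assms B'] by auto
  moreover have "card B \<le> card B'" using basis_card_le[OF assms(1) B' \<open>finite B'\<close> assms(2)] by simp
  ultimately show ?thesis by (simp add: free_rank_def B'_def)
qed

text \<open>For an infinite basis, the finitely many generators would span an infinite-dimensional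
  space modulo the maximal ideal.\<close>

lemma fin_gen_basis_finite:
  fixes \<epsilon> :: "'b \<Rightarrow> 'i \<Rightarrow> complex" and g :: "'q \<Rightarrow> 'a"
  assumes "module (R :: ('a, 'r) ring_scheme) M" "fin_gen R M"
    and add: "\<And>u v. u \<in> carrier M \<Longrightarrow> v \<in> carrier M \<Longrightarrow> \<epsilon> (u \<oplus>\<^bsub>M\<^esub> v) = \<epsilon> u + \<epsilon> v"
    and Q: "finite Q"
    and span: "\<And>r. r \<in> carrier R \<Longrightarrow> \<exists>c. \<forall>m\<in>carrier M. \<epsilon> (r \<odot>\<^bsub>M\<^esub> m) = (\<Sum>q\<in>Q. (\<lambda>b. c q * \<epsilon> (g q \<odot>\<^bsub>M\<^esub> m) b))"
    and unit: "\<And>b. b \<in> B \<Longrightarrow> \<exists>m\<in>carrier M. \<epsilon> m = (\<lambda>b'. if b' = b then 1 else 0)"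
  shows "finite B"
proof (rule ccontr)
  assume inf: "infinite B"
  interpret module R M by fact
  obtain S where S: "finite S" "S \<subseteq> carrier M" "\<And>N. submodule N R M \<Longrightarrow> S \<subseteq> N \<Longrightarrow> N = carrier M"
    using assms(2) by (auto simp: fin_gen_def)
  let ?G = "Q \<times> S"
  let ?g = "\<lambda>z. \<epsilon> (g (fst z) \<odot>\<^bsub>M\<^esub> snd z)"
  \<comment> \<open>\<open>W\<close> is spanned by the values on the products of the scalars
    \<open>g q\<close> with the generators, finitely many in all.\<close>
  define W where "W = {w. \<exists>c. w = (\<Sum>z\<in>?G. (\<lambda>b. c z * ?g z b))}"
  have W0: "0 \<in> W" by (auto simp: W_def fun_eq_iff sum_fun_apply intro!: exI[of _ "\<lambda>_. 0"])
  have Wadd: "u + v \<in> W" if "u \<in> W" "v \<in> W" for u v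
  proof -
    obtain c c' where "u = (\<Sum>z\<in>?G. (\<lambda>b. c z * ?g z b))" "v = (\<Sum>z\<in>?G. (\<lambda>b. c' z * ?g z b))"
      using \<open>u \<in> W\<close> \<open>v \<in> W\<close> unfolding W_def by blast
    thus ?thesis unfolding W_def
      by (intro CollectI exI[of _ "\<lambda>z. c z + c' z"]) (simp add: fun_eq_iff sum_fun_apply sum.distrib ring_distribs)
  qed
  have Wneg: "- u \<in> W" if u: "u \<in> W" for u
  proof -
    obtain c where "u = (\<Sum>z\<in>?G. (\<lambda>b. c z * ?g z b))" using u unfolding W_def by blast
    thus ?thesis unfolding W_def
      by (intro CollectI exI[of _ "\<lambda>z. - c z"]) (simp add: fun_eq_iff sum_fun_apply sum_negf)
  qed
  \<comment> \<open>All multiples are required to land in \<open>W\<close>, so that \<open>N\<close>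
    is a submodule by construction; it contains the generators because of
    \<open>span\<close>.\<close>
  define N where "N = {m \<in> carrier M. \<forall>r\<in>carrier R. \<epsilon> (r \<odot>\<^bsub>M\<^esub> m) \<in> W}"
  have "submodule N R M"
  proof (rule submoduleI)
    show "\<zero>\<^bsub>M\<^esub> \<in> N"
      using W0 additive_map_zero[OF abelian_group_axioms add] by (simp add: N_def)
    show "\<ominus>\<^bsub>M\<^esub> a \<in> N" if "a \<in> N" for a
    proof -
      have "\<epsilon> (r \<odot>\<^bsub>M\<^esub> (\<ominus>\<^bsub>M\<^esub> a)) \<in> W" if r: "r \<in> carrier R" for r
      proof -
        have a: "a \<in> carrier M" "\<epsilon> (r \<odot>\<^bsub>M\<^esub> a) \<in> W" using \<open>a \<in> N\<close> r by (auto simp: N_def)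
        have "r \<odot>\<^bsub>M\<^esub> (\<ominus>\<^bsub>M\<^esub> a) = \<ominus>\<^bsub>M\<^esub> (r \<odot>\<^bsub>M\<^esub> a)" using smult_r_minus r a by simp
        thus ?thesis using Wneg[OF a(2)] additive_map_neg[OF abelian_group_axioms add] a r by simp
      qed
      thus ?thesis using that by (simp add: N_def)
    qed
    show "a \<oplus>\<^bsub>M\<^esub> b \<in> N" if "a \<in> N" "b \<in> N" for a b
      using that Wadd by (auto simp: N_def smult_r_distr add)
    show "r \<odot>\<^bsub>M\<^esub> x \<in> N" if "r \<in> carrier R" "x \<in> N" for r x
      using that by (auto simp: N_def simp flip: smult_assoc1)
  qed (auto simp: N_def)
  moreover have "S \<subseteq> N"
  proof
    fix s assume s: "s \<in> S"
    have "\<epsilon> (r \<odot>\<^bsub>M\<^esub> s) \<in> W" if r: "r \<in> carrier R" for r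
    proof -
      obtain c where c: "\<epsilon> (r \<odot>\<^bsub>M\<^esub> s) = (\<Sum>q\<in>Q. (\<lambda>b. c q * \<epsilon> (g q \<odot>\<^bsub>M\<^esub> s) b))"
        using span[OF r] s S(2) by blast
      have "(\<Sum>z\<in>?G. (\<lambda>b. (if snd z = s then c (fst z) else 0) * ?g z b)) =
        (\<Sum>q\<in>Q. \<Sum>s'\<in>S. (\<lambda>b. (if s' = s then c q else 0) * \<epsilon> (g q \<odot>\<^bsub>M\<^esub> s') b))"
        by (simp add: sum.cartesian_product split_def)
      also have "\<dots> = (\<Sum>q\<in>Q. \<Sum>s'\<in>S. if s' = s then (\<lambda>b. c q * \<epsilon> (g q \<odot>\<^bsub>M\<^esub> s) b) else 0)"
        by (intro sum.cong refl) (auto simp: fun_eq_iff)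
      also have "\<dots> = \<epsilon> (r \<odot>\<^bsub>M\<^esub> s)" using s S(1) by (simp add: c)
      finally show ?thesis unfolding W_def by (intro CollectI exI[of _ "\<lambda>z. if snd z = s then c (fst z) else 0"]) simp
    qed
    thus "s \<in> N" using s S(2) by (auto simp: N_def)
  qed
  ultimately have N: "N = carrier M" by (rule S(3))
  have W: "\<epsilon> m \<in> W" if "m \<in> carrier M" for m
  proof -
    have "\<epsilon> (\<one>\<^bsub>R\<^esub> \<odot>\<^bsub>M\<^esub> m) \<in> W" using that N R.one_closed unfolding N_def by blast
    thus ?thesis using that by simp
  qed
  \<comment> \<open>More unit vectors than spanning vectors of \<open>W\<close> would have to be
    dependent.\<close>
  obtain T where T: "finite T" "T \<subseteq> B" "card T > card ?G"
    using infinite_arbitrarily_large[OF inf, of "Suc (card ?G)"] by auto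
  have "\<exists>c. \<forall>b\<in>T. (\<lambda>b'. if b' = b then 1 else 0) = (\<Sum>z\<in>?G. (\<lambda>b'. c b z * ?g z b'))"
  proof (rule bchoice, rule ballI)
    fix b assume "b \<in> T"
    then obtain m where "m \<in> carrier M" "\<epsilon> m = (\<lambda>b'. if b' = b then 1 else 0)" using unit T by blast
    thus "\<exists>c. (\<lambda>b'. if b' = b then 1 else 0) = (\<Sum>z\<in>?G. (\<lambda>b'. c z * ?g z b'))"
      using W[of m] by (auto simp: W_def)
  qed
  then obtain c where c: "\<And>b. b \<in> T \<Longrightarrow> (\<lambda>b'. if b' = b then 1 else 0) = (\<Sum>z\<in>?G. (\<lambda>b'. c b z * ?g z b'))" by blast
  obtain a where a: "\<exists>s\<in>T. a s \<noteq> 0" "\<And>z. z \<in> ?G \<Longrightarrow> (\<Sum>s\<in>T. a s * c s z) = 0"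
    using dependent_idom[of ?G T c] T Q(1) S(1) by auto
  have "a b' = 0" if b': "b' \<in> T" for b'
  proof -
    have "a b' = (\<Sum>b\<in>T. a b * (if b' = b then 1 else 0))"
      using b' T(1) by (simp add: if_distrib[of "\<lambda>x. _ * x"] cong: if_cong)
    also have "\<dots> = (\<Sum>b\<in>T. a b * (\<Sum>z\<in>?G. c b z * ?g z b'))"
    proof (intro sum.cong refl)
      fix b assume "b \<in> T"
      from fun_cong[OF c[OF this], of b'] show "a b * (if b' = b then 1 else 0) = a b * (\<Sum>z\<in>?G. c b z * ?g z b')"
        by (simp add: sum_fun_apply)
    qed
    also have "\<dots> = (\<Sum>z\<in>?G. (\<Sum>b\<in>T. a b * c b z) * ?g z b')"
      unfolding sum_distrib_left sum_distrib_right by (subst sum.swap) (simp add: mult.assoc)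
    also have "\<dots> = 0" by (simp add: a(2))
    finally show ?thesis .
  qed
  thus False using a(1) by blast
qed

section \<open>The character group\<close>

text \<open>The class \<open>pt n k j m\<close> is j deg(x) + m (deg(x) + deg(y)); thus \<open>j\<close> modulo \<open>n\<close> is the residue
  degree, multiplication by \<open>t\<close> increases \<open>m\<close>, and n deg(x) = (n-k) (deg(x) + deg(y)).\<close>

definition pt :: "nat \<Rightarrow> nat \<Rightarrow> int \<Rightarrow> int \<Rightarrow> (int \<times> int) set" where
  "pt n k j m = char_class n k (j + m) m"

abbreviation "ZZ \<equiv> integer_group \<times>\<times> integer_group"

lemma ZZ_comm_group: "comm_group ZZ"
proof (rule group.group_comm_groupI[OF DirProd_group])
  show "group integer_group" "group integer_group" by simp_all
qed (auto simp: DirProd_def)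

lemma ZZ_group: "group ZZ"
  using ZZ_comm_group by (simp add: comm_group_def)

lemma ZZ_inv: "inv\<^bsub>ZZ\<^esub> (a, b) = (- a, - b)"
  by (simp add: inv_DirProd)

lemma ZZ_pow: "(a, b) [^]\<^bsub>ZZ\<^esub> (s::int) = (a * s, b * s)"
proof -
  interpret group ZZ by (rule ZZ_group)
  have nat: "(a, b) [^]\<^bsub>ZZ\<^esub> (m::nat) = (a * int m, b * int m)" for m
    by (induction m) (simp_all add: algebra_simps DirProd_def)
  show ?thesis
  proof (cases "s \<ge> 0")
    case True
    then obtain m where "s = int m" by (metis nonneg_int_cases)
    thus ?thesis using nat[of m] by (simp add: int_pow_int)
  next
    case False
    then obtain m where "s = - int m" by (metis int_cases2 linorder_le_less_linear of_nat_0_le_iff)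
    thus ?thesis using nat[of m] by (simp add: int_pow_neg_int ZZ_inv)
  qed
qed

lemma rel_Gamma_eq: "rel_Gamma n k = {(int k * s, - ((int n - int k) * s)) | s. True}"
proof -
  have "rel_Gamma n k = range (\<lambda>s::int. (int k, - (int n - int k)) [^]\<^bsub>ZZ\<^esub> s)"
    unfolding rel_Gamma_def using group.generate_pow[OF ZZ_group, of "(int k, - (int n - int k))"] 
    by auto
  also have "\<dots> = {(int k * s, - ((int n - int k) * s)) | s. True}"
    by (auto simp: ZZ_pow algebra_simps)
  finally show ?thesis .
qed

lemma rel_Gamma_normal: "rel_Gamma n k \<lhd> ZZ"
  unfolding rel_Gamma_def
  by (rule comm_group.subgroup_imp_normal[OF ZZ_comm_group])
    (rule group.generate_is_subgroup[OF ZZ_group], auto)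

lemma char_class_eq: "char_class n k p q = {(p + int k * s, q - (int n - int k) * s) | s. True}"
proof -
  have "char_class n k p q = (\<lambda>s. (int k * s + p, - ((int n - int k) * s) + q)) ` UNIV"
    by (auto simp: char_class_def r_coset_def rel_Gamma_eq)
  thus ?thesis by (auto simp: add.commute)
qed

lemma char_class_eq_iff:
  "char_class n k p q = char_class n k p' q' \<longleftrightarrow> (\<exists>s. p' = p + int k * s \<and> q' = q - (int n - int k) * s)"
proof
  assume "char_class n k p q = char_class n k p' q'"
  moreover have "(p', q') \<in> char_class n k p' q'" unfolding char_class_eq by (auto intro!: exI[of _ 0])
  ultimately have "(p', q') \<in> char_class n k p q" by simp
  thus "\<exists>s. p' = p + int k * s \<and> q' = q - (int n - int k) * s" by (auto simp: char_class_eq)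
next
  assume "\<exists>s. p' = p + int k * s \<and> q' = q - (int n - int k) * s"
  then obtain s where s: "p' = p + int k * s" "q' = q - (int n - int k) * s" by blast
  show "char_class n k p q = char_class n k p' q'"
  proof (intro equalityI subsetI)
    fix z assume "z \<in> char_class n k p q"
    then obtain r where "z = (p + int k * r, q - (int n - int k) * r)" by (auto simp: char_class_eq)
    thus "z \<in> char_class n k p' q'" unfolding char_class_eq
      by (intro CollectI exI[of _ "r - s"]) (simp add: s algebra_simps)
  next
    fix z assume "z \<in> char_class n k p' q'"
    then obtain r where "z = (p' + int k * r, q' - (int n - int k) * r)" by (auto simp: char_class_eq)
    thus "z \<in> char_class n k p q" unfolding char_class_eq
      by (intro CollectI exI[of _ "r + s"]) (simp add: s algebra_simps)
  qed
qed

lemma Gamma_carrier: "carrier (Gamma_dual n k) = range (\<lambda>(p, q). char_class n k p q)"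
  by (auto simp: Gamma_dual_def FactGroup_def RCOSETS_def char_class_def image_iff)

lemma Gamma_comm_group: "comm_group (Gamma_dual n k)"
  unfolding Gamma_dual_def
  by (rule comm_group.abelian_FactGroup[OF ZZ_comm_group]) 
    (use rel_Gamma_normal in \<open>auto simp: normal_def\<close>)

lemma Gamma_mult: "char_class n k p q \<otimes>\<^bsub>Gamma_dual n k\<^esub> char_class n k p' q' = char_class n k (p + p') (q + q')"
  unfolding Gamma_dual_def char_class_def
  using normal.rcos_sum[OF rel_Gamma_normal, of "(p,q)" "(p',q')" n k] by (simp add: FactGroup_def)

lemma Gamma_one: "\<one>\<^bsub>Gamma_dual n k\<^esub> = char_class n k 0 0"
  by (auto simp: Gamma_dual_def FactGroup_def char_class_eq rel_Gamma_eq)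

lemma char_class_in [simp]: "char_class n k p q \<in> carrier (Gamma_dual n k)"
  by (auto simp: Gamma_carrier)

lemma Gamma_inv: "inv\<^bsub>Gamma_dual n k\<^esub> char_class n k p q = char_class n k (- p) (- q)"
proof -
  interpret comm_group "Gamma_dual n k" by (rule Gamma_comm_group)
  show ?thesis by (rule inv_equality) (simp_all add: Gamma_mult Gamma_one)
qed

lemma pt_in [simp]: "pt n k j m \<in> carrier (Gamma_dual n k)"
  by (simp add: pt_def)

lemma pt_eq_iff: "pt n k j m = pt n k j' m' \<longleftrightarrow> (\<exists>s. j' = j + int n * s \<and> m' = m - (int n - int k) * s)"
proof -
  have "(j' + m' = j + m + int k * s \<and> m' = m - (int n - int k) * s) \<longleftrightarrow>
    (j' = j + int n * s \<and> m' = m - (int n - int k) * s)" for s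
    by (auto simp: algebra_simps)
  thus ?thesis by (simp add: pt_def char_class_eq_iff)
qed

lemma pt_mult_char: "pt n k j m \<otimes>\<^bsub>Gamma_dual n k\<^esub> char_class n k p q = pt n k (j + p - q) (m + q)"
  and char_mult_pt: "char_class n k p q \<otimes>\<^bsub>Gamma_dual n k\<^esub> pt n k j m = pt n k (j + p - q) (m + q)"
  and pt_lower: "pt n k j m \<otimes>\<^bsub>Gamma_dual n k\<^esub> inv\<^bsub>Gamma_dual n k\<^esub> char_class n k p q = pt n k (j - p + q) (m - q)"
  by (simp_all add: pt_def Gamma_mult Gamma_inv algebra_simps)

lemma pt_shift: "pt n k (j + int n * s) m = pt n k j (m + (int n - int k) * s)"
  by (simp add: pt_eq_iff) (rule exI[of _ "-s"], simp)

lemma Gamma_cases: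
  assumes "i \<in> carrier (Gamma_dual n k)" "n > 0"
  obtains j m where "i = pt n k j m" "0 \<le> j" "j < int n"
proof -
  obtain p q where "i = char_class n k p q" using assms by (auto simp: Gamma_carrier)
  hence "i = pt n k (p - q) q" by (simp add: pt_def)
  also have "\<dots> = pt n k ((p - q) mod int n + int n * ((p - q) div int n)) q" by simp
  also have "\<dots> = pt n k ((p - q) mod int n) (q + (int n - int k) * ((p - q) div int n))" by (rule pt_shift)
  finally show thesis using that assms(2) by simp
qed

lemma Gamma_ex:
  assumes "i \<in> carrier (Gamma_dual n k)" "n > 0"
  shows "\<exists>j m. i = pt n k j m \<and> 0 \<le> j \<and> j < int n"
  by (rule Gamma_cases[OF assms]) blast

text \<open>The relation vector (k, -(n-k)) changes p - q by n, so p - q modulo n is the same for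
  all members of a class and \<open>THE\<close> is well defined.\<close>

lemma res_deg_char: "res_deg n (char_class n k p q) = (p - q) mod int n"
  unfolding res_deg_def
proof (rule the_equality)
  show "\<exists>(p', q')\<in>char_class n k p q. (p - q) mod int n = (p' - q') mod int n"
    unfolding char_class_eq by (intro bexI[of _ "(p, q)"]) (auto intro!: exI[of _ 0])
  fix j assume "\<exists>(p', q')\<in>char_class n k p q. j = (p' - q') mod int n"
  then obtain s where "j = (p + int k * s - (q - (int n - int k) * s)) mod int n"
    by (auto simp: char_class_eq)
  also have "p + int k * s - (q - (int n - int k) * s) = p - q + int n * s" by (simp add: algebra_simps)
  finally show "j = (p - q) mod int n" by simp
qed

lemma res_deg_pt: "res_deg n (pt n k j m) = j mod int n"
  by (simp add: pt_def res_deg_char)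

section \<open>Homogeneous components\<close>

definition gcomp :: "'g monoid \<Rightarrow> ('a, 'b, 'g) gmodule \<Rightarrow> 'b \<Rightarrow> 'g \<Rightarrow> 'b" where
  "gcomp \<Lambda> M m i = (if i \<in> carrier \<Lambda> then (THE f. f \<in> (\<Pi>\<^sub>E i\<in>carrier \<Lambda>. grade M i) \<and>
        finite {i \<in> carrier \<Lambda>. f i \<noteq> \<zero>\<^bsub>M\<^esub>} \<and>
        m = (\<Oplus>\<^bsub>M\<^esub>i\<in>{i \<in> carrier \<Lambda>. f i \<noteq> \<zero>\<^bsub>M\<^esub>}. f i)) i else \<zero>\<^bsub>M\<^esub>)"

locale graded_mod =
  fixes \<Lambda> :: "'g monoid" and R :: "'a ring" and Rg and M :: "('a, 'b, 'g) gmodule" (structure)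
  assumes gm: "graded_module \<Lambda> R Rg M"
begin

sublocale module R M using gm by (simp add: graded_module_def)

lemma grade_subgroup: "i \<in> carrier \<Lambda> \<Longrightarrow> subgroup (grade M i) (add_monoid M)"
  using gm by (simp add: graded_module_def)

lemma grade_carrier: "i \<in> carrier \<Lambda> \<Longrightarrow> u \<in> grade M i \<Longrightarrow> u \<in> carrier M"
  using subgroup.subset[OF grade_subgroup] by auto

lemma grade_zero: "i \<in> carrier \<Lambda> \<Longrightarrow> \<zero> \<in> grade M i"
  using subgroup.one_closed[OF grade_subgroup] by simp

lemma grade_add: "i \<in> carrier \<Lambda> \<Longrightarrow> u \<in> grade M i \<Longrightarrow> v \<in> grade M i \<Longrightarrow> u \<oplus> v \<in> grade M i"
  using subgroup.m_closed[OF grade_subgroup] by simp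

lemma grade_neg: "i \<in> carrier \<Lambda> \<Longrightarrow> u \<in> grade M i \<Longrightarrow> \<ominus> u \<in> grade M i"
  using subgroup.m_inv_closed[OF grade_subgroup] by (simp add: a_inv_def)

lemma grade_smult: "i \<in> carrier \<Lambda> \<Longrightarrow> j \<in> carrier \<Lambda> \<Longrightarrow> r \<in> Rg i \<Longrightarrow> u \<in> grade M j \<Longrightarrow> r \<odot> u \<in> grade M (i \<otimes>\<^bsub>\<Lambda>\<^esub> j)"
  using gm by (simp add: graded_module_def)

lemma comp_ex1: "m \<in> carrier M \<Longrightarrow> \<exists>!f. f \<in> (\<Pi>\<^sub>E i\<in>carrier \<Lambda>. grade M i) \<and>
        finite {i \<in> carrier \<Lambda>. f i \<noteq> \<zero>} \<and> m = (\<Oplus>i\<in>{i \<in> carrier \<Lambda>. f i \<noteq> \<zero>}. f i)"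
  using gm unfolding graded_module_def by blast

abbreviation "cmp \<equiv> gcomp \<Lambda> M"

lemma comp_props: assumes m: "m \<in> carrier M"
  shows "i \<in> carrier \<Lambda> \<Longrightarrow> cmp m i \<in> grade M i" "finite {i \<in> carrier \<Lambda>. cmp m i \<noteq> \<zero>}"
    "m = (\<Oplus>i\<in>{i \<in> carrier \<Lambda>. cmp m i \<noteq> \<zero>}. cmp m i)"
proof -
  define f where "f = (THE f. f \<in> (\<Pi>\<^sub>E i\<in>carrier \<Lambda>. grade M i) \<and>
        finite {i \<in> carrier \<Lambda>. f i \<noteq> \<zero>} \<and> m = (\<Oplus>i\<in>{i \<in> carrier \<Lambda>. f i \<noteq> \<zero>}. f i))"
  have f: "f \<in> (\<Pi>\<^sub>E i\<in>carrier \<Lambda>. grade M i)" "finite {i \<in> carrier \<Lambda>. f i \<noteq> \<zero>}"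
     "m = (\<Oplus>i\<in>{i \<in> carrier \<Lambda>. f i \<noteq> \<zero>}. f i)"
    using theI'[OF comp_ex1[OF m]] unfolding f_def by blast+
  have c: "cmp m i = f i" if "i \<in> carrier \<Lambda>" for i using that by (simp add: gcomp_def f_def)
  have s: "{i \<in> carrier \<Lambda>. cmp m i \<noteq> \<zero>} = {i \<in> carrier \<Lambda>. f i \<noteq> \<zero>}" using c by auto
  show "i \<in> carrier \<Lambda> \<Longrightarrow> cmp m i \<in> grade M i" using f(1) by (auto simp: c)
  show "finite {i \<in> carrier \<Lambda>. cmp m i \<noteq> \<zero>}" using f(2) s by simp
  have "(\<Oplus>i\<in>{i \<in> carrier \<Lambda>. cmp m i \<noteq> \<zero>}. cmp m i) = (\<Oplus>i\<in>{i \<in> carrier \<Lambda>. f i \<noteq> \<zero>}. f i)"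
    unfolding s by (rule finsum_cong') (use f(1) grade_carrier c in \<open>auto simp: PiE_def\<close>)
  thus "m = (\<Oplus>i\<in>{i \<in> carrier \<Lambda>. cmp m i \<noteq> \<zero>}. cmp m i)" using f(3) by simp
qed

lemma comp_closed: "m \<in> carrier M \<Longrightarrow> cmp m i \<in> carrier M"
  using comp_props(1) grade_carrier by (cases "i \<in> carrier \<Lambda>") (auto simp: gcomp_def)

text \<open>A finite sum of homogeneous elements of distinct degrees is already a decomposition, and
  decompositions are unique.\<close>

lemma comp_finsum_homog:
  assumes S: "finite S" "S \<subseteq> carrier \<Lambda>" and f: "\<And>i. i \<in> S \<Longrightarrow> f i \<in> grade M i"
  shows "cmp (\<Oplus>i\<in>S. f i) i = (if i \<in> S then f i else \<zero>)"
proof (cases "i \<in> carrier \<Lambda>")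
  case True
  let ?m = "\<Oplus>i\<in>S. f i" let ?f = "\<lambda>i\<in>carrier \<Lambda>. if i \<in> S then f i else \<zero>"
  have fc: "i \<in> S \<Longrightarrow> f i \<in> carrier M" for i using f S(2) grade_carrier by blast
  have m: "?m \<in> carrier M" using fc by (intro finsum_closed) auto
  have s: "{i \<in> carrier \<Lambda>. ?f i \<noteq> \<zero>} = {i \<in> S. f i \<noteq> \<zero>}" using S(2) by auto
  have "(THE f. f \<in> (\<Pi>\<^sub>E i\<in>carrier \<Lambda>. grade M i) \<and>
        finite {i \<in> carrier \<Lambda>. f i \<noteq> \<zero>} \<and> ?m = (\<Oplus>i\<in>{i \<in> carrier \<Lambda>. f i \<noteq> \<zero>}. f i)) = ?f"
  proof (rule the1_equality[OF comp_ex1[OF m]], intro conjI)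
    show "?f \<in> (\<Pi>\<^sub>E i\<in>carrier \<Lambda>. grade M i)" using f grade_zero by auto
    show "finite {i \<in> carrier \<Lambda>. ?f i \<noteq> \<zero>}" unfolding s using S(1) by simp
    have "(\<Oplus>i\<in>S. f i) = (\<Oplus>i\<in>{i \<in> S. f i \<noteq> \<zero>}. f i)"
      by (rule add.finprod_mono_neutral_cong_right) (use S fc in auto)
    also have "\<dots> = (\<Oplus>i\<in>{i \<in> S. f i \<noteq> \<zero>}. ?f i)"
      by (rule finsum_cong') (use S fc in auto)
    finally show "?m = (\<Oplus>i\<in>{i \<in> carrier \<Lambda>. ?f i \<noteq> \<zero>}. ?f i)" unfolding s .
  qed
  thus ?thesis using True by (simp add: gcomp_def)
qed (use S in \<open>auto simp: gcomp_def\<close>)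

lemma comp_homog: assumes "i \<in> carrier \<Lambda>" "u \<in> grade M i"
  shows "cmp u j = (if j = i then u else \<zero>)"
proof -
  have "(\<Oplus>j\<in>{i}. u) = u" using assms grade_carrier by simp
  thus ?thesis using comp_finsum_homog[of "{i}" "\<lambda>_. u" j] assms by auto
qed

lemma comp_expand: assumes "m \<in> carrier M" "finite S" "S \<subseteq> carrier \<Lambda>" "\<And>i. i \<notin> S \<Longrightarrow> cmp m i = \<zero>"
  shows "m = (\<Oplus>i\<in>S. cmp m i)"
proof -
  have "(\<Oplus>i\<in>{i \<in> carrier \<Lambda>. cmp m i \<noteq> \<zero>}. cmp m i) = (\<Oplus>i\<in>S. cmp m i)"
    by (rule add.finprod_mono_neutral_cong_left) (use assms comp_closed in \<open>auto simp: subset_iff\<close>)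
  thus ?thesis using comp_props(3)[OF assms(1)] by simp
qed

lemma comp_add: assumes "u \<in> carrier M" "v \<in> carrier M"
  shows "cmp (u \<oplus> v) i = cmp u i \<oplus> cmp v i"
proof -
  let ?S = "{i \<in> carrier \<Lambda>. cmp u i \<noteq> \<zero>} \<union> {i \<in> carrier \<Lambda>. cmp v i \<noteq> \<zero>}"
  have o: "i \<notin> carrier \<Lambda> \<Longrightarrow> cmp w i = \<zero>" for w i by (simp add: gcomp_def)
  have S: "finite ?S" "?S \<subseteq> carrier \<Lambda>" using comp_props(2) assms by auto
  have u: "u = (\<Oplus>i\<in>?S. cmp u i)" by (rule comp_expand[OF assms(1) S]) (use o in blast)
  have v: "v = (\<Oplus>i\<in>?S. cmp v i)" by (rule comp_expand[OF assms(2) S]) (use o in blast)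
  have "u \<oplus> v = (\<Oplus>i\<in>?S. cmp u i) \<oplus> (\<Oplus>i\<in>?S. cmp v i)" using u v by simp
  also have "\<dots> = (\<Oplus>i\<in>?S. cmp u i \<oplus> cmp v i)"
    by (rule finsum_addf[symmetric]) (use assms comp_closed in auto)
  finally have e: "u \<oplus> v = (\<Oplus>i\<in>?S. cmp u i \<oplus> cmp v i)" .
  have "cmp (u \<oplus> v) i = (if i \<in> ?S then cmp u i \<oplus> cmp v i else \<zero>)"
    unfolding e by (rule comp_finsum_homog[OF S]) (use assms S(2) in \<open>auto intro!: grade_add comp_props(1)\<close>)
  thus ?thesis using o assms comp_closed by (cases "i \<in> carrier \<Lambda>") auto
qed

lemma comp_zero: "cmp \<zero> i = \<zero>"
  using comp_finsum_homog[of "{}" "\<lambda>_. \<zero>" i] by simp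

lemma comp_neg: assumes "u \<in> carrier M" shows "cmp (\<ominus> u) i = \<ominus> cmp u i"
proof -
  have "cmp (\<ominus> u) i \<oplus> cmp u i = \<zero>" using comp_add[of "\<ominus> u" u i] assms by (simp add: l_neg comp_zero)
  thus ?thesis using assms by (intro minus_equality[symmetric] comp_closed) auto
qed

text \<open>Translation by \<open>a\<close> is injective, so multiplying the decomposition of u
  termwise by r gives a decomposition of the product, indexed by the translated degrees.\<close>

lemma comp_smult:
  assumes L: "comm_group \<Lambda>" and a: "a \<in> carrier \<Lambda>" and r: "r \<in> Rg a" "r \<in> carrier R"
    and u: "u \<in> carrier M" and i: "i \<in> carrier \<Lambda>"
  shows "cmp (r \<odot> u) (a \<otimes>\<^bsub>\<Lambda>\<^esub> i) = r \<odot> cmp u i"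
proof -
  interpret L: comm_group \<Lambda> by fact
  let ?S = "{i \<in> carrier \<Lambda>. cmp u i \<noteq> \<zero>}"
  let ?h = "\<lambda>i. a \<otimes>\<^bsub>\<Lambda>\<^esub> i" let ?g = "\<lambda>j. r \<odot> cmp u (inv\<^bsub>\<Lambda>\<^esub> a \<otimes>\<^bsub>\<Lambda>\<^esub> j)"
  have injL: "inj_on ?h (carrier \<Lambda>)" using L.inj_on_cmult[OF a] .
  hence inj: "inj_on ?h ?S" by (rule inj_on_subset) auto
  have hg: "inv\<^bsub>\<Lambda>\<^esub> a \<otimes>\<^bsub>\<Lambda>\<^esub> (a \<otimes>\<^bsub>\<Lambda>\<^esub> i) = i" if "i \<in> carrier \<Lambda>" for i
    using that a by (simp flip: L.m_assoc)
  have "r \<odot> u = r \<odot> (\<Oplus>i\<in>?S. cmp u i)" by (rule arg_cong[OF comp_props(3)[OF u]])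
  also have "\<dots> = (\<Oplus>i\<in>?S. r \<odot> cmp u i)"
    by (rule finsum_smult_ldistr) (use comp_props(2)[OF u] u r in \<open>auto intro!: comp_closed\<close>)
  also have "\<dots> = (\<Oplus>i\<in>?S. ?g (?h i))"
    by (rule finsum_cong') (use u r hg in \<open>auto intro!: smult_closed comp_closed\<close>)
  also have "\<dots> = (\<Oplus>j\<in>?h ` ?S. ?g j)"
  proof -
    have "?g \<in> ?h ` ?S \<rightarrow> carrier M" by (intro Pi_I smult_closed comp_closed r u)
    from add.finprod_reindex[of ?g ?h ?S, OF this inj] show ?thesis ..
  qed
  finally have e: "r \<odot> u = (\<Oplus>j\<in>?h ` ?S. ?g j)" .
  have g: "?g j \<in> grade M j" if "j \<in> ?h ` ?S" for j
    using that
  proof (rule imageE)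
    fix i assume i: "j = ?h i" "i \<in> ?S"
    hence ic: "i \<in> carrier \<Lambda>" by simp
    have "?g j = r \<odot> cmp u i" by (simp only: i(1) hg[OF ic])
    thus ?thesis using grade_smult[OF a ic r(1) comp_props(1)[OF u ic]] i(1) by simp
  qed
  have sub: "?h ` ?S \<subseteq> carrier \<Lambda>" by (intro image_subsetI L.m_closed a) simp
  have fin: "finite (?h ` ?S)" using comp_props(2)[OF u] by (rule finite_imageI)
  have "cmp (r \<odot> u) (?h i) = (if ?h i \<in> ?h ` ?S then ?g (?h i) else \<zero>)"
    unfolding e by (rule comp_finsum_homog[OF fin sub g])
  moreover have "?h i \<in> ?h ` ?S \<longleftrightarrow> i \<in> ?S" by (rule inj_on_image_mem_iff[OF injL i]) auto
  moreover have "r \<odot> cmp u i = \<zero>" if "i \<notin> ?S" using that i r(2) by simp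
  ultimately show ?thesis using hg[OF i] by presburger
qed

lemma comp_finsum: assumes "\<And>z. z \<in> A \<Longrightarrow> f z \<in> carrier M"
  shows "cmp (\<Oplus>z\<in>A. f z) i = (\<Oplus>z\<in>A. cmp (f z) i)"
  by (rule additive_map_finsum_in[where M = M]) (use assms in \<open>auto simp: comp_add comp_closed abelian_group_axioms\<close>)

end

section \<open>Graded Cohen-Macaulay modules\<close>

lemma restrict_scalars_simps [simp]:
  "carrier (restrict_scalars \<phi> M) = carrier M"
  "ring.zero (restrict_scalars \<phi> M) = \<zero>\<^bsub>M\<^esub>"
  "ring.add (restrict_scalars \<phi> M) = ring.add M"
  "module.smult (restrict_scalars \<phi> M) = (\<lambda>a m. \<phi> a \<odot>\<^bsub>M\<^esub> m)"
  by (simp_all add: restrict_scalars_def)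

lemma restrict_scalars_finsum: "finsum (restrict_scalars \<phi> M) f A = finsum M f A"
  by (simp add: finsum_def finprod_def)

locale gamma_mod =
  fixes n k :: nat and N :: "'b Gamma_module" (structure)
  assumes k1: "1 \<le> k" and kn: "k < n" and cm: "CM_Gamma n k N"
begin

abbreviation "\<Lambda> \<equiv> Gamma_dual n k"
abbreviation "T \<equiv> restrict_scalars (t_bar n k) N"

sublocale graded_mod \<Lambda> "Rbar n k" "Rbar_grade n k" N
  using cm by unfold_locales (simp add: CM_Gamma_def)

definition act :: "nat \<Rightarrow> nat \<Rightarrow> 'b \<Rightarrow> 'b" where
  "act p q u = clbar n k (mon_pol 1 p q) \<odot> u"

definition scal :: "complex \<Rightarrow> 'b \<Rightarrow> 'b" where
  "scal c u = c_bar n k c \<odot> u"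

lemma act_closed: "u \<in> carrier N \<Longrightarrow> act p q u \<in> carrier N"
  by (simp add: act_def)

lemma scal_closed: "u \<in> carrier N \<Longrightarrow> scal c u \<in> carrier N"
  by (simp add: scal_def)

lemma act_add: "u \<in> carrier N \<Longrightarrow> v \<in> carrier N \<Longrightarrow> act p q (u \<oplus> v) = act p q u \<oplus> act p q v"
  by (simp add: act_def smult_r_distr)

lemma act_zero: "act p q \<zero> = \<zero>"
  by (simp add: act_def)

lemma scal_zero: "scal c \<zero> = \<zero>"
  by (simp add: scal_def)

lemma act_act: "u \<in> carrier N \<Longrightarrow> act p q (act p' q' u) = act (p + p') (q + q') u"
  using smult_assoc1[of "clbar n k (mon_pol 1 p q)" "clbar n k (mon_pol 1 p' q')" u]
  by (simp add: act_def mon_pol_mult flip: clbar_mult)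

lemma mon_act: "u \<in> carrier N \<Longrightarrow> clbar n k (mon_pol c p q) \<odot> u = scal c (act p q u)"
  using smult_assoc1[of "clbar n k (mon_pol c 0 0)" "clbar n k (mon_pol 1 p q)" u]
  by (simp add: act_def scal_def c_bar_mon mon_pol_mult flip: clbar_mult)

lemma act_scal: assumes "u \<in> carrier N" shows "act p q (scal c u) = scal c (act p q u)"
proof -
  have "act p q (scal c u) = clbar n k (mon_pol c p q) \<odot> u"
    using smult_assoc1[of "clbar n k (mon_pol 1 p q)" "clbar n k (mon_pol c 0 0)" u] assms
    by (simp add: act_def scal_def c_bar_mon mon_pol_mult flip: clbar_mult)
  thus ?thesis using mon_act[OF assms] by simp
qed

lemma mon_pol_add: "mon_pol (c + d) p q = mon_pol c p q + mon_pol d p q"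
  by (simp add: mon_pol_def add_monom)

lemma act_0: "u \<in> carrier N \<Longrightarrow> act 0 0 u = u"
  by (simp add: act_def mon_pol_one clbar_one)

lemma scal_0: "u \<in> carrier N \<Longrightarrow> scal 0 u = \<zero>"
  by (simp add: scal_def c_bar_mon mon_pol_def clbar_zero)

lemma act_x_pow: "act (n + p) q u = act ((n - k) + p) ((n - k) + q) u"
  using clbar_x_pow[of k n 1 p q] kn by (simp add: act_def)

lemma act_y_pow: "act p (n + q) u = act (k + p) (k + q) u"
  using clbar_y_pow[of k n 1 p q] kn by (simp add: act_def)

lemma clbar_sum_smult: assumes "u \<in> carrier N" "finite A"
  shows "clbar n k (\<Sum>z\<in>A. f z) \<odot> u = (\<Oplus>z\<in>A. clbar n k (f z) \<odot> u)"
  using assms(2)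
proof (induction A rule: finite_induct)
  case empty show ?case using assms by (simp add: clbar_zero)
next
  case (insert z A)
  have "(\<Oplus>z\<in>insert z A. clbar n k (f z) \<odot> u) = clbar n k (f z) \<odot> u \<oplus> (\<Oplus>z\<in>A. clbar n k (f z) \<odot> u)"
    by (rule finsum_insert) (use insert assms in auto)
  moreover have "clbar n k (\<Sum>z\<in>insert z A. f z) \<odot> u = clbar n k (f z) \<odot> u \<oplus> clbar n k (\<Sum>z\<in>A. f z) \<odot> u"
    using insert(1,2) assms(1) by (simp add: clbar_add smult_l_distr)
  ultimately show ?case using insert(3) by simp
qed

lemma clbar_smult: assumes "u \<in> carrier N"
  shows "clbar n k f \<odot> u = (\<Oplus>z\<in>{(p,q). Polynomial.coeff (Polynomial.coeff f q) p \<noteq> 0}. case z of (p,q) \<Rightarrow> scal (Polynomial.coeff (Polynomial.coeff f q) p) (act p q u))"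
proof -
  let ?A = "{(p,q). Polynomial.coeff (Polynomial.coeff f q) p \<noteq> 0}"
  have "clbar n k f \<odot> u = clbar n k (\<Sum>z\<in>?A. case z of (p,q) \<Rightarrow> mon_pol (Polynomial.coeff (Polynomial.coeff f q) p) p q) \<odot> u"
    by (rule arg_cong[of _ _ "\<lambda>f. clbar n k f \<odot> u"]) (rule coeff_pol_expand)
  also have "\<dots> = (\<Oplus>z\<in>?A. clbar n k (case z of (p,q) \<Rightarrow> mon_pol (Polynomial.coeff (Polynomial.coeff f q) p) p q) \<odot> u)"
    by (rule clbar_sum_smult[OF assms finite_coeff_pol])
  also have "\<dots> = (\<Oplus>z\<in>?A. case z of (p,q) \<Rightarrow> scal (Polynomial.coeff (Polynomial.coeff f q) p) (act p q u))"
    by (rule finsum_cong') (use assms in \<open>auto simp: mon_act act_closed scal_closed\<close>)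
  finally show ?thesis .
qed

lemma grade_act: "u \<in> grade N (pt n k j m) \<Longrightarrow> act p q u \<in> grade N (pt n k (j + int p - int q) (m + int q))"
  using grade_smult[of "char_class n k (int p) (int q)" "pt n k j m" "clbar n k (mon_pol 1 p q)" u]
  by (simp add: act_def mon_Rbar_grade char_mult_pt)

lemma grade_scal: assumes "i \<in> carrier \<Lambda>" "u \<in> grade N i" shows "scal c u \<in> grade N i"
proof -
  obtain j m where "i = pt n k j m" using Gamma_ex[OF assms(1)] kn by auto
  thus ?thesis using assms
    grade_smult[of "char_class n k 0 0" "pt n k j m" "clbar n k (mon_pol c 0 0)" u]
    mon_Rbar_grade[of n k c 0 0]
    by (simp add: scal_def c_bar_mon char_mult_pt)
qed

lemma comp_act: "u \<in> carrier N \<Longrightarrow> cmp (act p q u) (pt n k (j + int p - int q) (m + int q)) = act p q (cmp u (pt n k j m))"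
  using comp_smult[OF Gamma_comm_group, of "char_class n k (int p) (int q)" "clbar n k (mon_pol 1 p q)" u "pt n k j m"]
  by (simp add: act_def mon_Rbar_grade char_mult_pt)

lemma comp_scal: assumes "u \<in> carrier N" shows "cmp (scal c u) i = scal c (cmp u i)"
proof (cases "i \<in> carrier \<Lambda>")
  case True
  then obtain j m where "i = pt n k j m" using Gamma_ex[OF True] kn by auto
  thus ?thesis using assms 
    comp_smult[OF Gamma_comm_group, of "char_class n k 0 0" "clbar n k (mon_pol c 0 0)" u "pt n k j m"]
    mon_Rbar_grade[of n k c 0 0]
    by (simp add: scal_def c_bar_mon char_mult_pt)
qed (simp add: gcomp_def scal_zero)

definition B :: "'b set" where "B = (SOME B. is_basis TA T B)"

lemma T_module: "module TA T"
  using cm by (simp add: CM_Gamma_def free_module_def)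

lemma T_basis: "is_basis TA T B"
  unfolding B_def by (rule someI_ex) (use cm in \<open>simp add: CM_Gamma_def free_module_def\<close>)

sublocale T: module_with_basis T B
  by (intro module_with_basis.intro T_module module_with_basis_axioms.intro T_basis)

abbreviation "\<kappa> \<equiv> bcoord T B"

lemma \<kappa>_add: "u \<in> carrier N \<Longrightarrow> v \<in> carrier N \<Longrightarrow> \<kappa> (u \<oplus> v) = \<kappa> u + \<kappa> v"
  using T.coord_add[of u v] by simp

lemma \<kappa>_t: "u \<in> carrier N \<Longrightarrow> \<kappa> (t_bar n k f \<odot> u) = (\<lambda>b. f * \<kappa> u b)"
  using T.coord_smult[of u f] by simp

lemma \<kappa>_act: "u \<in> carrier N \<Longrightarrow> \<kappa> (act 1 1 u) = (\<lambda>b. Polynomial.monom 1 1 * \<kappa> u b)"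
  using \<kappa>_t[of u "Polynomial.monom 1 1"] by (simp add: act_def t_bar_tpol tpol_monom)

lemma \<kappa>_scal: "u \<in> carrier N \<Longrightarrow> \<kappa> (scal c u) = (\<lambda>b. smult c (\<kappa> u b))"
  using \<kappa>_t[of u "[:c:]"] by (simp add: scal_def c_bar_t_bar)

lemma \<kappa>_zero: "\<kappa> \<zero> = 0" using T.coord_zero by simp

lemma \<kappa>_inj: "u \<in> carrier N \<Longrightarrow> v \<in> carrier N \<Longrightarrow> \<kappa> u = \<kappa> v \<Longrightarrow> u = v"
  using T.coord_inj[of u v] by simp

text \<open>\<open>\<epsilon>\<close> reads coordinates modulo t. Since x^n and y^n are multiples of
  t, only the monomials with p, q < n act nontrivially there, so the ring acts modulo t through
  finitely many operators and finite generation bounds the rank.\<close>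

lemma finite_B: "finite B"
proof -
  define \<epsilon> :: "'b \<Rightarrow> 'b \<Rightarrow> complex" where "\<epsilon> u = (\<lambda>b. Polynomial.coeff (\<kappa> u b) 0)" for u
  have e_add: "\<epsilon> (u \<oplus> v) = \<epsilon> u + \<epsilon> v" if "u \<in> carrier N" "v \<in> carrier N" for u v
    using that by (simp add: \<epsilon>_def \<kappa>_add fun_eq_iff)
  have e_scal: "\<epsilon> (scal c u) = (\<lambda>b. c * \<epsilon> u b)" if "u \<in> carrier N" for c u
    using that by (simp add: \<epsilon>_def \<kappa>_scal)
  have e_t: "\<epsilon> (act 1 1 u) = 0" if "u \<in> carrier N" for u
    using that by (simp add: \<epsilon>_def \<kappa>_act fun_eq_iff coeff_monom_mult del: One_nat_def)
  have e_act: "\<epsilon> (act p q u) = 0" if u: "u \<in> carrier N" and pq: "p \<ge> n \<or> q \<ge> n" for p q u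
  proof -
    have "\<exists>p' q'. act p q u = act (1 + p') (1 + q') u"
      using pq
    proof
      assume "p \<ge> n"
      hence "act p q u = act ((n - k) + (p - n)) ((n - k) + q) u" using act_x_pow[of "p - n" q u] by simp
      moreover have "n - k = 1 + (n - k - 1)" using kn by simp
      ultimately have "act p q u = act (1 + ((n - k - 1) + (p - n))) (1 + ((n - k - 1) + q)) u"
        by (metis add.assoc)
      thus ?thesis by blast
    next
      assume "q \<ge> n"
      hence "act p q u = act (k + p) (k + (q - n)) u" using act_y_pow[of p "q - n" u] by simp
      thus ?thesis using k1 by - (rule exI[of _ "k - 1 + p"], rule exI[of _ "k - 1 + (q - n)"], simp)
    qed
    then obtain p' q' where "act p q u = act 1 1 (act p' q' u)" using act_act[OF u] by metis
    thus ?thesis using e_t[OF act_closed[OF u]] by simp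
  qed
  show ?thesis
  proof (rule fin_gen_basis_finite[where \<epsilon> = \<epsilon> and Q = "{..<n} \<times> {..<n}" and M = N and R = "Rbar n k"
      and g = "\<lambda>(p,q). clbar n k (mon_pol 1 p q)"])
    show "module (Rbar n k) N" by (rule module_axioms)
    show "fin_gen (Rbar n k) N" using cm by (simp add: CM_Gamma_def)
    show "finite ({..<n} \<times> {..<n})" by simp
    fix r assume "r \<in> carrier (Rbar n k)"
    then obtain f where f: "r = clbar n k f" by (rule Rbar_cases)
    let ?A = "{(p,q). Polynomial.coeff (Polynomial.coeff f q) p \<noteq> 0}"
    show "\<exists>c. \<forall>m\<in>carrier N. \<epsilon> (r \<odot> m) = (\<Sum>q\<in>{..<n} \<times> {..<n}. (\<lambda>b. c q * \<epsilon> ((case q of (p, q) \<Rightarrow> clbar n k (mon_pol 1 p q)) \<odot> m) b))"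
    proof (intro exI[of _ "\<lambda>(p,q). Polynomial.coeff (Polynomial.coeff f q) p"] ballI)
      fix m assume m: "m \<in> carrier N"
      have e_act2: "p < n \<and> q < n" if "\<epsilon> (act p q m) x \<noteq> 0" for p q x
        by (rule ccontr) (use e_act[OF m, of p q] that in auto)
      have "\<epsilon> (r \<odot> m) = (\<Sum>z\<in>?A. \<epsilon> (case z of (p,q) \<Rightarrow> scal (Polynomial.coeff (Polynomial.coeff f q) p) (act p q m)))"
        unfolding f clbar_smult[OF m]
        by (rule additive_map_finsum[OF abelian_group_axioms e_add]) (use m in \<open>auto simp: scal_closed act_closed\<close>)
      also have "\<dots> = (\<Sum>z\<in>?A. (\<lambda>b. (case z of (p,q) \<Rightarrow> Polynomial.coeff (Polynomial.coeff f q) p) * \<epsilon> (act (fst z) (snd z) m) b))"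
        using m by (intro sum.cong refl) (auto simp: e_scal act_closed)
      also have "\<dots> = (\<Sum>z\<in>?A \<inter> ({..<n} \<times> {..<n}). (\<lambda>b. (case z of (p,q) \<Rightarrow> Polynomial.coeff (Polynomial.coeff f q) p) * \<epsilon> (act (fst z) (snd z) m) b))"
        by (intro sum.mono_neutral_right finite_coeff_pol) (auto simp: fun_eq_iff dest: e_act2)
      also have "\<dots> = (\<Sum>z\<in>{..<n} \<times> {..<n}. (\<lambda>b. (case z of (p,q) \<Rightarrow> Polynomial.coeff (Polynomial.coeff f q) p) * \<epsilon> (act (fst z) (snd z) m) b))"
        by (intro sum.mono_neutral_left) (auto simp: fun_eq_iff)
      also have "\<dots> = (\<Sum>z\<in>{..<n} \<times> {..<n}. (\<lambda>b. (case z of (p,q) \<Rightarrow> Polynomial.coeff (Polynomial.coeff f q) p) * \<epsilon> ((case z of (p, q) \<Rightarrow> clbar n k (mon_pol 1 p q)) \<odot> m) b))"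
        by (intro sum.cong refl) (auto simp: act_def)
      finally show "\<epsilon> (r \<odot> m) = (\<Sum>z\<in>{..<n} \<times> {..<n}. (\<lambda>b. (case z of (p,q) \<Rightarrow> Polynomial.coeff (Polynomial.coeff f q) p) * \<epsilon> ((case z of (p, q) \<Rightarrow> clbar n k (mon_pol 1 p q)) \<odot> m) b))" .
    qed
  next
    fix b assume b: "b \<in> B"
    show "\<exists>m\<in>carrier N. \<epsilon> m = (\<lambda>b'. if b' = b then 1 else 0)"
      using T.coord_basis[OF b] T.B_carrier[OF b] by (intro bexI[of _ b]) (auto simp: \<epsilon>_def fun_eq_iff)
  qed (rule e_add)
qed

lemma act11_inj: assumes "u \<in> carrier N" "act 1 1 u = \<zero>" shows "u = \<zero>"
proof (rule \<kappa>_inj[OF assms(1) zero_closed])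
  have "(\<lambda>b. Polynomial.monom 1 1 * \<kappa> u b) = 0" using \<kappa>_act[OF assms(1)] assms(2) \<kappa>_zero by simp
  hence "Polynomial.monom 1 1 * \<kappa> u b = 0" for b by (simp add: fun_eq_iff)
  hence "\<kappa> u b = 0" for b by (metis monom_eq_0_iff mult_eq_0_iff one_neq_zero)
  thus "\<kappa> u = \<kappa> \<zero>" by (simp add: \<kappa>_zero fun_eq_iff)
qed

text \<open>x^q y^p completes x^p y^q to a power of t, and t is injective on a free module.\<close>

lemma act_eq_0D: assumes "u \<in> carrier N" "act p q u = \<zero>" shows "u = \<zero>"
proof -
  have d: "u = \<zero>" if "act s s u = \<zero>" for s
    using that
  proof (induction s)
    case 0 thus ?case using act_0[OF assms(1)] by simp
  next
    case (Suc s)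
    have "act 1 1 (act s s u) = \<zero>" using Suc.prems by (simp add: act_act[OF assms(1)])
    from act11_inj[OF act_closed[OF assms(1)] this] show ?case by (rule Suc.IH)
  qed
  have "act q p (act p q u) = \<zero>" using assms(2) by (simp add: act_zero)
  hence "act (p + q) (p + q) u = \<zero>" by (simp add: act_act[OF assms(1)] add.commute)
  thus ?thesis by (rule d)
qed

definition \<kappa>1 :: "'b \<Rightarrow> 'b \<Rightarrow> complex" where "\<kappa>1 u = (\<lambda>b. poly (\<kappa> u b) 1)"

lemma \<kappa>1_add: "u \<in> carrier N \<Longrightarrow> v \<in> carrier N \<Longrightarrow> \<kappa>1 (u \<oplus> v) = \<kappa>1 u + \<kappa>1 v"
  by (simp add: \<kappa>1_def \<kappa>_add fun_eq_iff)

lemma \<kappa>1_scal: "u \<in> carrier N \<Longrightarrow> \<kappa>1 (scal c u) = (\<lambda>b. c * \<kappa>1 u b)"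
  by (simp add: \<kappa>1_def \<kappa>_scal)

lemma \<kappa>1_t: "u \<in> carrier N \<Longrightarrow> \<kappa>1 (act 1 1 u) = \<kappa>1 u"
  by (simp add: \<kappa>1_def \<kappa>_act poly_monom del: One_nat_def)

lemma \<kappa>1_outside: "b \<notin> B \<Longrightarrow> \<kappa>1 u b = 0"
  by (simp add: \<kappa>1_def T.coord_outside)

lemma \<kappa>1_act_shift: assumes u: "u \<in> carrier N" shows "\<kappa>1 (act (p + s) (q + s) u) = \<kappa>1 (act p q u)"
proof (induction s)
  case (Suc s)
  have "\<kappa>1 (act (p + Suc s) (q + Suc s) u) = \<kappa>1 (act 1 1 (act (p + s) (q + s) u))"
    by (simp add: act_act[OF u])
  thus ?case using Suc.IH \<kappa>1_t[OF act_closed[OF u]] by simp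
qed simp

lemma \<kappa>1_act_n: assumes u: "u \<in> carrier N" shows "\<kappa>1 (act (p + n * s) q u) = \<kappa>1 (act p q u)"
proof (induction s)
  case (Suc s)
  have "\<kappa>1 (act (p + n * Suc s) q u) = \<kappa>1 (act (n + (p + n * s)) q u)" by (simp add: algebra_simps)
  also have "\<dots> = \<kappa>1 (act ((p + n * s) + (n - k)) (q + (n - k)) u)"
    by (simp only: act_x_pow add.commute)
  finally show ?case using Suc.IH \<kappa>1_act_shift[OF u] by simp
qed simp

text \<open>At t = 1 the variable y becomes the inverse of x and x^n becomes 1, so only p - q modulo
  n matters.\<close>

lemma \<kappa>1_act_mod: assumes u: "u \<in> carrier N" 
  shows "\<kappa>1 (act p q u) = \<kappa>1 (act (nat ((int p - int q) mod int n)) 0 u)"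
proof -
  \<comment> \<open>y is replaced by x^(n-1): adding n q to the exponent of x changes nothing at t =
    1, and then q factors xy are removed.\<close>
  let ?r = "p + (n - 1) * q"
  have "n * q = (n - 1) * q + q" using kn by (cases n) auto
  hence "\<kappa>1 (act p q u) = \<kappa>1 (act (?r + q) (0 + q) u)"
    using \<kappa>1_act_n[OF u, of p q q] by (simp add: add.assoc)
  also have "\<dots> = \<kappa>1 (act ?r 0 u)" by (rule \<kappa>1_act_shift[OF u])
  also have "\<dots> = \<kappa>1 (act (?r mod n + n * (?r div n)) 0 u)" by simp
  also have "\<dots> = \<kappa>1 (act (?r mod n) 0 u)" by (rule \<kappa>1_act_n[OF u])
  also have "?r mod n = nat ((int p - int q) mod int n)"
  proof -
    have "int ?r = (int p - int q) + int n * int q" proof -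
      obtain n' where "n = Suc n'" using kn by (cases n) auto
      thus ?thesis by (simp add: algebra_simps)
    qed
    hence "int ?r mod int n = (int p - int q) mod int n" by (simp only: mod_mult_self2)
    hence "int (?r mod n) = (int p - int q) mod int n" by (simp only: zmod_int)
    thus ?thesis by (metis nat_int)
  qed
  finally show ?thesis .
qed

text \<open>All graded pieces embed compatibly into one space: set t = 1, after moving to residue degree 0
  with a power of x.\<close>

definition iota :: "int \<Rightarrow> 'b \<Rightarrow> 'b \<Rightarrow> complex" where
  "iota j u = \<kappa>1 (act (nat ((- j) mod int n)) 0 u)"

lemma iota_add: "u \<in> carrier N \<Longrightarrow> v \<in> carrier N \<Longrightarrow> iota j (u \<oplus> v) = iota j u + iota j v"
  by (simp add: iota_def act_add \<kappa>1_add act_closed)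

lemma iota_scal: "u \<in> carrier N \<Longrightarrow> iota j (scal c u) = (\<lambda>b. c * iota j u b)"
  by (simp add: iota_def act_scal \<kappa>1_scal act_closed)

lemma iota_outside: "b \<notin> B \<Longrightarrow> iota j u b = 0"
  by (simp add: iota_def \<kappa>1_outside)

lemma iota_shift: "iota (j + int n * s) u = iota j u"
proof -
  have "- (j + int n * s) = (- j) + int n * (- s)" by simp
  hence "(- (j + int n * s)) mod int n = (- j) mod int n" by (simp only: mod_mult_self2)
  thus ?thesis by (simp only: iota_def)
qed

text \<open>Moving to residue degree 0 before or after the multiplication uses total powers of x
  with the same exponent modulo n, and these agree at t = 1.\<close>

lemma iota_act: assumes u: "u \<in> carrier N" shows "iota (j + int p - int q) (act p q u) = iota j u"
proof -
  let ?a = "nat ((- (j + int p - int q)) mod int n)"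
  have "iota (j + int p - int q) (act p q u) = \<kappa>1 (act (?a + p) q u)"
    by (simp add: iota_def act_act[OF u])
  also have "\<dots> = \<kappa>1 (act (nat ((int (?a + p) - int q) mod int n)) 0 u)" by (rule \<kappa>1_act_mod[OF u])
  also have "(int (?a + p) - int q) mod int n = (- j) mod int n"
  proof -
    have "int ?a = (- (j + int p - int q)) mod int n" using kn by simp
    hence "(int (?a + p) - int q) mod int n = ((- (j + int p - int q)) mod int n + (int p - int q)) mod int n"
      by (simp add: algebra_simps)
    also have "\<dots> = (- (j + int p - int q) + (int p - int q)) mod int n" by (rule mod_add_left_eq)
    finally show ?thesis by simp
  qed
  finally show ?thesis by (simp add: iota_def)
qed

lemma cmp_finite_pt: assumes "w \<in> carrier N" shows "finite {m. cmp w (pt n k j m) \<noteq> \<zero>}"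
proof (rule finite_imageD)
  show "finite (pt n k j ` {m. cmp w (pt n k j m) \<noteq> \<zero>})"
    by (rule finite_subset[OF _ comp_props(2)[OF assms]]) auto
  show "inj_on (pt n k j) {m. cmp w (pt n k j m) \<noteq> \<zero>}"
    using kn by (auto intro!: inj_onI simp: pt_eq_iff)
qed

text \<open>If u vanishes at t = 1 then u = (t - 1) w. Let a_i be the component of w that lies i
  steps above u. Below u all a_i vanish, since only finitely many components are nonzero; hence a_0
  = -u, and a_(i+1) = t a_i from there on. As t is injective, finiteness forces u = 0.\<close>

lemma \<kappa>1_eq_0D: assumes u: "u \<in> grade N (pt n k j m)" and z: "\<kappa>1 u = 0" shows "u = \<zero>"
proof -
  have uN: "u \<in> carrier N" by (rule grade_carrier[OF _ u]) simp
  have "\<exists>c. \<kappa> u b = [:-1, 1:] * c" for b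
    using fun_cong[OF z, of b] by (simp add: \<kappa>1_def poly_eq_0_iff_dvd dvd_def)
  then obtain c where c: "\<And>b. \<kappa> u b = [:-1, 1:] * c b" by metis
  have cB: "c b = 0" if "b \<notin> B" for b
  proof -
    have "[:-1, 1:] * c b = 0" using c[of b] T.coord_outside[OF that] by simp
    thus ?thesis by (metis mult_eq_0_iff pCons_eq_0_iff one_neq_zero)
  qed
  hence "finite {b. c b \<noteq> 0}" using finite_subset[OF _ finite_B, of "{b. c b \<noteq> 0}"] by auto
  then obtain w where w: "w \<in> carrier N" "\<kappa> w = c" using T.coord_surj[of c] cB by auto
  \<comment> \<open>This is u = (t - 1) w, written without subtraction.\<close>
  have "\<kappa> (u \<oplus> w) = \<kappa> (act 1 1 w)"
    using c by (simp add: \<kappa>_add uN w \<kappa>_act fun_eq_iff monom_altdef algebra_simps del: One_nat_def)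
  hence uw: "u \<oplus> w = act 1 1 w" by (rule \<kappa>_inj[rotated 2]) (simp_all add: uN w act_closed)
  define a where "a i = cmp w (pt n k j (m + i))" for i
  have aN: "a i \<in> carrier N" for i unfolding a_def by (rule comp_closed[OF w(1)])
  have step: "cmp u (pt n k j (m + i)) \<oplus> a i = act 1 1 (a (i - 1))" for i
    using comp_act[OF w(1), of 1 1 j "m + i - 1"] comp_add[OF uN w(1), of "pt n k j (m + i)"] uw
    by (simp add: a_def algebra_simps)
  have uc: "cmp u (pt n k j (m + i)) = (if i = 0 then u else \<zero>)" for i
    using comp_homog[OF _ u, of "pt n k j (m + i)"] kn by (auto simp: pt_eq_iff)
  have fin: "finite {i. a i \<noteq> \<zero>}"
  proof (rule finite_imageD[where f = "\<lambda>i. m + i"])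
    show "finite ((\<lambda>i. m + i) ` {i. a i \<noteq> \<zero>})"
      by (rule finite_subset[OF _ cmp_finite_pt[OF w(1), of j]]) (auto simp: a_def)
  qed simp
  obtain M where M: "\<And>i. a i \<noteq> \<zero> \<Longrightarrow> \<bar>i\<bar> < M"
  proof -
    have "bdd_above (abs ` {i. a i \<noteq> \<zero>})" using fin by (intro bdd_above_finite) auto
    then obtain M where "\<forall>x\<in>abs ` {i. a i \<noteq> \<zero>}. x \<le> M" by (auto simp: bdd_above_def)
    thus thesis by (intro that[of "M + 1"]) force
  qed
  have neg: "a i = \<zero>" if "i < 0" for i
  proof (cases "i < - M")
    case True thus ?thesis using M[of i] by fastforce
  next
    case False
    have "- M \<le> i" using False by simp
    thus ?thesis using that
    proof (induction i rule: int_ge_induct)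
      case base show ?case using M[of "- M"] by fastforce
    next
      case (step i)
      have "a i = \<zero>" using step by simp
      thus ?case using \<open>i + 1 < 0\<close> \<open>\<And>i. cmp u (pt n k j (m + i)) \<oplus> a i = act 1 1 (a (i - 1))\<close>[of "i + 1"] uc[of "i + 1"] aN act_zero by simp
    qed
  qed
  have pos: "a (int s) = act s s (a 0)" for s
  proof (induction s)
    case 0 show ?case using act_0[OF aN] by simp
  next
    case (Suc s)
    have "a (int (Suc s)) = act 1 1 (a (int s))"
      using step[of "int (Suc s)"] uc[of "int (Suc s)"] aN by simp
    thus ?case using Suc.IH act_act[OF aN] by simp
  qed
  have "a (int (nat M)) = \<zero>" using M[of "int (nat M)"] by fastforce
  hence "a 0 = \<zero>" using pos[of "nat M"] act_eq_0D[OF aN] by metis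
  hence "u \<oplus> \<zero> = \<zero>" using step[of 0] uc[of 0] neg[of "-1"] act_zero by simp
  thus ?thesis using uN by simp
qed

lemma iota_eq_0D: assumes "u \<in> grade N (pt n k j m)" "iota j u = 0" shows "u = \<zero>"
proof -
  have uN: "u \<in> carrier N" by (rule grade_carrier[OF _ assms(1)]) simp
  let ?a = "nat ((- j) mod int n)"
  have "act ?a 0 u = \<zero>"
    using \<kappa>1_eq_0D[OF grade_act[OF assms(1), of ?a 0]] assms(2) by (simp add: iota_def)
  thus ?thesis by (rule act_eq_0D[OF uN])
qed

lemma iota_zero: "iota j \<zero> = 0"
  using additive_map_zero[OF abelian_group_axioms, of "iota j"] iota_add by blast

lemma iota_inj: "inj_on (iota j) (grade N (pt n k j m))"
proof (rule inj_onI)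
  fix u v assume uv: "u \<in> grade N (pt n k j m)" "v \<in> grade N (pt n k j m)" "iota j u = iota j v"
  have c: "u \<in> carrier N" "v \<in> carrier N" using uv grade_carrier[OF pt_in] by auto
  have d: "u \<oplus> \<ominus> v \<in> grade N (pt n k j m)" using uv by (intro grade_add grade_neg) auto
  have "iota j (u \<oplus> \<ominus> v) = 0"
    using c uv(3) by (simp add: iota_add additive_map_neg[OF abelian_group_axioms, of "iota j"])
  hence "u \<oplus> \<ominus> v = \<zero>" by (rule iota_eq_0D[OF d])
  thus "u = v" using c minus_equality[of u "\<ominus> v"] by simp
qed

text \<open>Horner's rule: closure under t, scalars and sums gives closure under C[t].\<close>

lemma t_bar_induct_closed:
  assumes "u \<in> carrier N" "P u" "P \<zero>" 
    "\<And>u v. u \<in> carrier N \<Longrightarrow> v \<in> carrier N \<Longrightarrow> P u \<Longrightarrow> P v \<Longrightarrow> P (u \<oplus> v)"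
    "\<And>u. u \<in> carrier N \<Longrightarrow> P u \<Longrightarrow> P (act 1 1 u)" "\<And>c u. u \<in> carrier N \<Longrightarrow> P u \<Longrightarrow> P (scal c u)"
  shows "P (t_bar n k f \<odot> u)"
proof (induction f)
  case 0
  have "t_bar n k 0 \<odot> u = \<zero>" using T.TA_mod(1)[of u] assms(1) by simp
  thus ?case using assms(3) by simp
next
  case (pCons a f)
  have "pCons a f = [:a:] + Polynomial.monom 1 1 * f" by (simp add: monom_altdef)
  hence "t_bar n k (pCons a f) \<odot> u = t_bar n k [:a:] \<odot> u \<oplus> t_bar n k (Polynomial.monom 1 1) \<odot> (t_bar n k f \<odot> u)"
    using T.TA_mod(4)[of u "[:a:]" "Polynomial.monom 1 1 * f"] T.TA_mod(5)[of u "Polynomial.monom 1 1" f] assms(1) by simp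
  also have "\<dots> = scal a u \<oplus> act 1 1 (t_bar n k f \<odot> u)"
    by (simp add: scal_def c_bar_t_bar act_def t_bar_tpol tpol_monom)
  finally show ?case using pCons assms by (simp add: act_closed scal_closed)
qed

text \<open>The finite basis has finitely many nonzero components on the n chains, hence a lowest
  height, and multiplication by t only raises heights.\<close>

lemma bounded_below:
  obtains m0 where "\<And>j m. 0 \<le> j \<Longrightarrow> j < int n \<Longrightarrow> m < m0 \<Longrightarrow> grade N (pt n k j m) = {\<zero>}"
proof -
  let ?M = "\<Union>b\<in>B. \<Union>j\<in>{0..<int n}. {m. cmp b (pt n k j m) \<noteq> \<zero>}"
  have bN: "b \<in> B \<Longrightarrow> b \<in> carrier N" for b using T.B_carrier by simp
  have "finite ?M" using finite_B cmp_finite_pt[OF bN] by simp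
  hence bdd: "bdd_below ?M" by (rule bdd_below_finite)
  obtain m0 where "\<forall>m\<in>?M. m0 \<le> m" using bdd unfolding bdd_below_def ..
  hence m0: "\<And>m. m \<in> ?M \<Longrightarrow> m0 \<le> m" by (rule bspec)
  define P where "P u \<longleftrightarrow> (\<forall>j m. 0 \<le> j \<longrightarrow> j < int n \<longrightarrow> m < m0 \<longrightarrow> cmp u (pt n k j m) = \<zero>)" for u
  have P0: "P \<zero>" by (simp add: P_def comp_zero)
  have Padd: "P (u \<oplus> v)" if "u \<in> carrier N" "v \<in> carrier N" "P u" "P v" for u v
    using that by (simp add: P_def comp_add)
  have Pscal: "P (scal c u)" if "u \<in> carrier N" "P u" for c u
    using that by (simp add: P_def comp_scal scal_zero)
  have Pt: "P (act 1 1 u)" if "u \<in> carrier N" "P u" for u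
  proof -
    have "cmp (act 1 1 u) (pt n k j m) = act 1 1 (cmp u (pt n k j (m - 1)))" for j m
      using comp_act[OF that(1), of 1 1 j "m - 1"] by simp
    thus ?thesis using that(2) by (simp add: P_def act_zero)
  qed
  have Pb: "P b" if "b \<in> B" for b
  proof -
    have "cmp b (pt n k j m) = \<zero>" if "0 \<le> j" "j < int n" "m < m0" for j m
    proof (rule ccontr)
      assume "cmp b (pt n k j m) \<noteq> \<zero>"
      hence "m \<in> ?M" using that by (intro UN_I[of b, OF \<open>b \<in> B\<close>] UN_I[of j]) simp_all
      from m0[OF this] show False using that by simp
    qed
    thus ?thesis by (simp add: P_def)
  qed
  have Pall: "P v" if v: "v \<in> carrier N" for v
  proof -
    have fs: "P (\<Oplus>b\<in>S. t_bar n k (c b) \<odot> b)" if "finite S" "S \<subseteq> B" for S c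
      using that
    proof (induction S rule: finite_induct)
      case empty show ?case using P0 by simp
    next
      case (insert b S)
      have i: "(\<Oplus>b\<in>insert b S. t_bar n k (c b) \<odot> b) = t_bar n k (c b) \<odot> b \<oplus> (\<Oplus>b\<in>S. t_bar n k (c b) \<odot> b)"
        by (rule finsum_insert) (use insert bN in auto)
      have "P (t_bar n k (c b) \<odot> b)"
        by (rule t_bar_induct_closed) (use insert bN Pb P0 Padd Pt Pscal in auto)
      moreover have "(\<Oplus>b\<in>S. t_bar n k (c b) \<odot> b) \<in> carrier N" using insert bN by (intro finsum_closed) auto
      ultimately show ?case unfolding i using insert bN by (intro Padd) auto
    qed
    have "{b. \<kappa> v b \<noteq> 0} \<subseteq> B" using T.coord_outside by blast
    from fs[OF finite_subset[OF this finite_B] this, of "\<kappa> v"]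
    show ?thesis using T.coord_expand[of v] v by (simp add: restrict_scalars_finsum)
  qed
  show thesis
  proof (rule that)
    fix j m assume jm: "0 \<le> j" "j < int n" "m < m0"
    have "u = \<zero>" if u: "u \<in> grade N (pt n k j m)" for u
    proof -
      have "cmp u (pt n k j m) = u" using comp_homog[OF pt_in u] by simp
      thus ?thesis using Pall[OF grade_carrier[OF pt_in u]] jm by (simp add: P_def)
    qed
    thus "grade N (pt n k j m) = {\<zero>}" using grade_zero[OF pt_in] by auto
  qed
qed

end

section \<open>Functionals in general position\<close>

global_interpretation CV: vector_space "\<lambda>(c::complex) (v::'b \<Rightarrow> complex) b. c * v b"
  defines cspan = CV.span and cdim = CV.dim and csubspace = CV.subspace
  by unfold_locales (auto simp: fun_eq_iff algebra_simps)

text \<open>The ambient space is that of all functions; finite dimension comes from staying inside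
  \<open>supported B\<close> with B finite.\<close>

definition supported :: "'b set \<Rightarrow> ('b \<Rightarrow> complex) set" where
  "supported B = {v. \<forall>b. b \<notin> B \<longrightarrow> v b = 0}"

definition functional :: "(('b \<Rightarrow> complex) \<Rightarrow> complex) \<Rightarrow> bool" where
  "functional \<phi> \<longleftrightarrow> (\<forall>u v. \<phi> (u + v) = \<phi> u + \<phi> v) \<and> (\<forall>c v. \<phi> (\<lambda>b. c * v b) = c * \<phi> v)"

lemma functional_zero: "functional \<phi> \<Longrightarrow> \<phi> 0 = 0"
proof -
  assume "functional \<phi>"
  hence "\<phi> (\<lambda>b. 0 * 0 b) = 0 * \<phi> 0" unfolding functional_def by blast
  thus ?thesis by (simp add: zero_fun_def)
qed

lemma csubspaceI: 
  "0 \<in> U \<Longrightarrow> (\<And>u v. u \<in> U \<Longrightarrow> v \<in> U \<Longrightarrow> u + v \<in> U) \<Longrightarrow> (\<And>c u. u \<in> U \<Longrightarrow> (\<lambda>b. c * u b) \<in> U) \<Longrightarrow> csubspace U"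
  by (simp add: CV.subspace_def)

lemma functional_kernel_subspace: 
  assumes "\<And>l. l < d \<Longrightarrow> functional (\<Phi> l)" shows "csubspace {v. \<forall>l<d. \<Phi> l v = 0}"
proof (rule csubspaceI)
  show "0 \<in> {v. \<forall>l<d. \<Phi> l v = 0}" using assms functional_zero by blast
qed (use assms in \<open>simp_all add: functional_def\<close>)

lemma supported_bound:
  assumes "finite B" "S \<subseteq> supported B" "CV.independent S"
  shows "finite S \<and> card S \<le> card B"
proof -
  let ?e = "\<lambda>b b'. if b' = b then (1::complex) else 0"
  have "v \<in> cspan (?e ` B)" if v: "v \<in> supported B" for v
  proof -
    have "v = (\<Sum>b\<in>B. (\<lambda>b'. v b * ?e b b'))"
    proof
      fix x
      have "(\<Sum>b\<in>B. (\<lambda>b'. v b * ?e b b')) x = (\<Sum>b\<in>B. if x = b then v b else 0)"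
        by (simp add: sum_fun_apply if_distrib cong: if_cong)
      thus "v x = (\<Sum>b\<in>B. (\<lambda>b'. v b * ?e b b')) x"
        using v assms(1) by (simp add: supported_def)
    qed
    moreover have "(\<Sum>b\<in>B. (\<lambda>b'. v b * ?e b b')) \<in> cspan (?e ` B)"
      by (intro CV.span_sum CV.span_scale CV.span_base) auto
    ultimately show ?thesis by simp
  qed
  hence "S \<subseteq> cspan (?e ` B)" using assms(2) by auto
  from CV.independent_span_bound[OF _ assms(3) this] show ?thesis
    using card_image_le[OF assms(1), of ?e] assms(1) by auto
qed

lemma supported_basis:
  assumes "finite B" "U \<subseteq> supported B" "csubspace U"
  obtains S where "S \<subseteq> U" "CV.independent S" "cspan S = U" "finite S" "card S = cdim U"
proof -
  obtain S where S: "S \<subseteq> U" "CV.independent S" "U \<subseteq> cspan S" "card S = cdim U"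
    by (rule CV.basis_exists[of U]) auto
  have "cspan S = U" using S CV.span_minimal[OF S(1) assms(3)] by auto
  moreover have "finite S" using supported_bound[OF assms(1) _ S(2)] S(1) assms(2) by auto
  ultimately show thesis using that S by blast
qed

lemma cdim_le:
  assumes "finite B" "U' \<subseteq> supported B" "csubspace U" "csubspace U'" "U \<subseteq> U'"
  shows "cdim U \<le> cdim U'" "cdim U = cdim U' \<Longrightarrow> U = U'"
proof -
  have UB: "U \<subseteq> supported B" using assms by auto
  obtain S where S: "S \<subseteq> U" "CV.independent S" "cspan S = U" "finite S" "card S = cdim U"
    using supported_basis[OF assms(1) UB assms(3)] .
  obtain S' where S': "S' \<subseteq> U'" "CV.independent S'" "cspan S' = U'" "finite S'" "card S' = cdim U'"
    using supported_basis[OF assms(1,2,4)] .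
  have sub: "S \<subseteq> cspan S'" using S S' assms by auto
  show "cdim U \<le> cdim U'" using CV.independent_span_bound[OF S'(4) S(2) sub] S(5) S'(5) by simp
  assume eq: "cdim U = cdim U'"
  show "U = U'"
  proof (rule ccontr)
    assume "U \<noteq> U'"
    then obtain w where w: "w \<in> U'" "w \<notin> cspan S" using assms(5) S(3) by auto
    have "CV.independent (insert w S)" by (rule CV.independent_insertI[OF w(2) S(2)])
    moreover have "insert w S \<subseteq> cspan S'" using sub w S' by auto
    ultimately have "card (insert w S) \<le> card S'" using CV.independent_span_bound[OF S'(4)] by blast
    moreover have "w \<notin> S" using w CV.span_base by blast
    ultimately show False using S(4,5) S'(5) eq by simp
  qed
qed

lemma cdim_zero: "cdim {0} = 0"
  using CV.dim_eq_card[of "{}" "{0}"] by (simp add: CV.span_insert_0 CV.independent_empty)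

text \<open>The vector v spans a complement of the kernel of \<phi> in U.\<close>

lemma cdim_kernel:
  assumes "finite B" "U \<subseteq> supported B" "csubspace U" "functional \<phi>" "v \<in> U" "\<phi> v \<noteq> 0"
  shows "cdim U = Suc (cdim {u \<in> U. \<phi> u = 0})"
proof -
  let ?K = "{u \<in> U. \<phi> u = 0}"
  have K: "csubspace ?K" using assms(3,4) functional_zero[OF assms(4)]
    by (intro csubspaceI) (auto simp: functional_def intro: CV.subspace_0 CV.subspace_add CV.subspace_scale)
  have KB: "?K \<subseteq> supported B" using assms by auto
  obtain S where S: "S \<subseteq> ?K" "CV.independent S" "cspan S = ?K" "finite S" "card S = cdim ?K"
    using supported_basis[OF assms(1) KB K] .
  have v: "v \<notin> cspan S" using S(3) assms(6) by auto
  have ind: "CV.independent (insert v S)" by (rule CV.independent_insertI[OF v S(2)])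
  have "u \<in> cspan (insert v S)" if u: "u \<in> U" for u
  proof -
    let ?c = "\<phi> u / \<phi> v"
    have e: "u = (u + (\<lambda>b. (- ?c) * v b)) + (\<lambda>b. ?c * v b)" by (simp add: fun_eq_iff)
    have "\<phi> (u + (\<lambda>b. (- ?c) * v b)) = \<phi> u + (- ?c) * \<phi> v" using assms(4) unfolding functional_def by metis
    hence "\<phi> (u + (\<lambda>b. (- ?c) * v b)) = 0" using assms(6) by simp
    moreover have "u + (\<lambda>b. (- ?c) * v b) \<in> U"
      by (intro CV.subspace_add[OF assms(3)] CV.subspace_scale[OF assms(3)] u assms(5))
    ultimately have "u + (\<lambda>b. (- ?c) * v b) \<in> cspan S" using S(3) by auto
    hence "u + (\<lambda>b. (- ?c) * v b) \<in> cspan (insert v S)" using CV.span_mono[of S "insert v S"] by auto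
    moreover have "(\<lambda>b. ?c * v b) \<in> cspan (insert v S)" by (intro CV.span_scale CV.span_base) simp
    ultimately have "(u + (\<lambda>b. (- ?c) * v b)) + (\<lambda>b. ?c * v b) \<in> cspan (insert v S)" by (rule CV.span_add)
    thus ?thesis using e by metis
  qed
  moreover have "cspan (insert v S) \<subseteq> U" by (rule CV.span_minimal[OF _ assms(3)]) (use S(1) assms(5) in auto)
  ultimately have "cspan (insert v S) = U" by auto
  hence "cspan (insert v S) = cspan U" by (metis CV.span_span)
  from CV.dim_eq_card[OF this ind] have "cdim U = card (insert v S)" by simp
  moreover have "v \<notin> S" using v CV.span_base by blast
  ultimately show ?thesis using S(4,5) by simp
qed

text \<open>The functionals are points of a moment curve.\<close>

lemma generic_functional:
  fixes B :: "'b set"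
  assumes "finite B" "finite A" "A \<subseteq> supported B - {0}"
  shows "\<exists>\<phi>. functional \<phi> \<and> (\<forall>v\<in>A. \<phi> v \<noteq> 0)"
proof -
  obtain idx :: "'b \<Rightarrow> nat" where idx: "inj_on idx B" using finite_imp_inj_to_nat_seg[OF assms(1)] by blast
  \<comment> \<open>\<open>poly (P v) s\<close> pairs v with the point of the curve whose coordinate
    at b is s to the power \<open>idx b\<close>. For nonzero v the polynomial is nonzero, so all but
    finitely many s serve the whole finite set \<open>A\<close>.\<close>
  define P where "P v = (\<Sum>b\<in>B. monom (v b) (idx b))" for v :: "'b \<Rightarrow> complex"
  have P0: "P v \<noteq> 0" if "v \<in> A" for v
  proof
    assume P: "P v = 0"
    have "v \<noteq> 0" using assms(3) that by auto
    then obtain b where b: "v b \<noteq> 0" by (auto simp: fun_eq_iff)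
    hence bB: "b \<in> B" using assms(3) that by (auto simp: supported_def)
    have "coeff (P v) (idx b) = (\<Sum>b'\<in>B. if b' = b then v b else 0)"
      unfolding P_def coeff_sum by (intro sum.cong refl) (use idx bB in \<open>auto simp: inj_on_def\<close>)
    also have "\<dots> = v b" using bB assms(1) by simp
    finally show False using P b by simp
  qed
  have "finite (\<Union>v\<in>A. {s. poly (P v) s = 0})" using assms(2) P0 by (auto intro: poly_roots_finite)
  then obtain s where s: "s \<notin> (\<Union>v\<in>A. {s. poly (P v) s = 0})"
    using ex_new_if_finite[OF infinite_UNIV_char_0] by blast
  have "functional (\<lambda>v. poly (P v) s)"
    by (auto simp: functional_def P_def poly_sum poly_monom sum.distrib algebra_simps sum_distrib_left)
  thus ?thesis using s by blast
qed

lemma int_least: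
  assumes "P (m::int)" "\<And>m. P m \<Longrightarrow> m0 \<le> m"
  shows "\<exists>m. P m \<and> (\<forall>m'<m. \<not> P m')"
proof -
  let ?Q = "\<lambda>i. P (m0 + int i)"
  have "?Q (nat (m - m0))" using assms by simp
  hence Q: "?Q (LEAST i. ?Q i)" by (rule LeastI)
  have "\<not> P m'" if "m' < m0 + int (LEAST i. ?Q i)" for m'
  proof
    assume P: "P m'"
    have "m0 \<le> m'" using assms(2)[OF P] .
    hence "?Q (nat (m' - m0))" using P by simp
    hence "(LEAST i. ?Q i) \<le> nat (m' - m0)" by (rule Least_le)
    thus False using that \<open>m0 \<le> m'\<close> by linarith
  qed
  thus ?thesis using Q by blast
qed

lemma int_mono_chain:
  assumes "\<And>m::int. U m \<subseteq> U (m + 1)" "m \<le> m'" shows "U m \<subseteq> U m'"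
  using assms(2)
proof (induction m' rule: int_ge_induct)
  case (step i) thus ?case using assms(1)[of i] by blast
qed simp

text \<open>By induction on D. For each of the n chains the spaces \<open>W j m\<close> cut out so
  far increase with m and vanish for low m, so a nonzero vector \<open>w j\<close> of the first
  nonzero one lies in all later ones. A functional that is nonzero at these at most n vectors lowers
  each nonzero \<open>W j m\<close> by exactly one; truncated subtraction covers those that are
  already zero.\<close>

lemma generic_flag:
  fixes V :: "int \<Rightarrow> int \<Rightarrow> ('b \<Rightarrow> complex) set" and n :: nat
  assumes B: "finite B" "\<And>j m. V j m \<subseteq> supported B" "\<And>j m. csubspace (V j m)"
    and mono: "\<And>j m. V j m \<subseteq> V j (m + 1)"
    and bd: "\<And>j m. 0 \<le> j \<Longrightarrow> j < int n \<Longrightarrow> m < m0 \<Longrightarrow> V j m = {0}"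
  shows "\<exists>\<Phi>::nat \<Rightarrow> ('b \<Rightarrow> complex) \<Rightarrow> complex. (\<forall>l<D. functional (\<Phi> l)) \<and>
    (\<forall>d\<le>D. \<forall>j m. 0 \<le> j \<longrightarrow> j < int n \<longrightarrow> cdim (V j m \<inter> {v. \<forall>l<d. \<Phi> l v = 0}) = cdim (V j m) - d)"
proof (induction D)
  case 0 show ?case by simp
next
  case (Suc D)
  then obtain \<Phi> where \<Phi>': "\<forall>l<D. functional (\<Phi> l)"
    "\<forall>d\<le>D. \<forall>j m. 0 \<le> j \<longrightarrow> j < int n \<longrightarrow> cdim (V j m \<inter> {v. \<forall>l<d. \<Phi> l v = 0}) = cdim (V j m) - d"
    by (elim exE conjE)
  have \<Phi>: "\<And>l. l < D \<Longrightarrow> functional (\<Phi> l)"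
    "\<And>d j m. d \<le> D \<Longrightarrow> 0 \<le> j \<Longrightarrow> j < int n \<Longrightarrow> cdim (V j m \<inter> {v. \<forall>l<d. \<Phi> l v = 0}) = cdim (V j m) - d"
    using \<Phi>' by simp_all
  define W where "W j m = V j m \<inter> {v. \<forall>l<D. \<Phi> l v = 0}" for j m
  have Wsub: "csubspace (W j m)" for j m unfolding W_def
    by (intro CV.subspace_inter B functional_kernel_subspace \<Phi>)
  have W0: "0 \<in> W j m" for j m using CV.subspace_0[OF Wsub] .
  have "\<exists>w. \<forall>j\<in>{j\<in>{0..<int n}. \<exists>m. W j m \<noteq> {0}}. w j \<noteq> 0 \<and> w j \<in> supported B \<and> (\<forall>m. W j m \<noteq> {0} \<longrightarrow> w j \<in> W j m)"
  proof (rule bchoice, rule ballI)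
    fix j assume j: "j \<in> {j\<in>{0..<int n}. \<exists>m. W j m \<noteq> {0}}"
    then obtain m where m: "W j m \<noteq> {0}" by blast
    have "m0 \<le> m" if "W j m \<noteq> {0}" for m
    proof (rule ccontr)
      assume "\<not> m0 \<le> m"
      hence "V j m = {0}" using bd j by simp
      thus False using that W0[of j m] unfolding W_def by auto
    qed
    from int_least[of "\<lambda>m. W j m \<noteq> {0}", OF m this] obtain m1 where
      m1: "W j m1 \<noteq> {0}" "\<And>m'. m' < m1 \<Longrightarrow> W j m' = {0}" by blast
    then obtain w where w: "w \<in> W j m1" "w \<noteq> 0" using W0[of j m1] by blast
    have "w \<in> W j m" if "W j m \<noteq> {0}" for m
    proof -
      have "m1 \<le> m" using m1(2)[of m] that by force
      hence "V j m1 \<subseteq> V j m" using int_mono_chain[of "V j"] mono by blast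
      thus ?thesis using w unfolding W_def by auto
    qed
    moreover have "w \<in> supported B" using w B(2) unfolding W_def by auto
    ultimately show "\<exists>w. w \<noteq> 0 \<and> w \<in> supported B \<and> (\<forall>m. W j m \<noteq> {0} \<longrightarrow> w \<in> W j m)" using w by blast
  qed
  then obtain w where w: "\<And>j. j \<in> {j\<in>{0..<int n}. \<exists>m. W j m \<noteq> {0}} \<Longrightarrow> w j \<noteq> 0 \<and> w j \<in> supported B \<and> (\<forall>m. W j m \<noteq> {0} \<longrightarrow> w j \<in> W j m)"
    by blast
  let ?J = "{j\<in>{0..<int n}. \<exists>m. W j m \<noteq> {0}}"
  have "w ` ?J \<subseteq> supported B - {0}"
  proof (rule image_subsetI)
    fix j assume "j \<in> ?J"
    from w[OF this] show "w j \<in> supported B - {0}" by simp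
  qed
  moreover have "finite ?J" by (rule finite_subset[of _ "{0..<int n}"]) auto
  hence "finite (w ` ?J)" by (rule finite_imageI)
  ultimately have "\<exists>\<phi>. functional \<phi> \<and> (\<forall>v\<in>w ` ?J. \<phi> v \<noteq> 0)" by (intro generic_functional[OF B(1)])
  then obtain \<phi> where \<phi>: "functional \<phi>" "\<forall>v\<in>w ` ?J. \<phi> v \<noteq> 0" by (elim exE conjE)
  define \<Phi>' where "\<Phi>' = \<Phi>(D := \<phi>)"
  have eq: "{v. \<forall>l<d. \<Phi>' l v = 0} = {v. \<forall>l<d. \<Phi> l v = 0}" if "d \<le> D" for d
    using that by (auto simp: \<Phi>'_def)
  have eqS: "V j m \<inter> {v. \<forall>l<Suc D. \<Phi>' l v = 0} = {v \<in> W j m. \<phi> v = 0}" for j m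
    by (auto simp: \<Phi>'_def W_def less_Suc_eq)
  show ?case
  proof (intro exI[of _ \<Phi>'] conjI allI impI)
    fix l assume "l < Suc D" thus "functional (\<Phi>' l)" using \<Phi>(1) \<phi>(1) by (auto simp: \<Phi>'_def less_Suc_eq)
  next
    fix d and j m :: int assume d: "d \<le> Suc D" and j: "0 \<le> j" "j < int n"
    show "cdim (V j m \<inter> {v. \<forall>l<d. \<Phi>' l v = 0}) = cdim (V j m) - d"
    proof (cases "d \<le> D")
      case True thus ?thesis using eq[OF True] \<Phi>(2)[OF True j] by simp
    next
      case False
      hence d: "d = Suc D" using d by simp
      have dW: "cdim (W j m) = cdim (V j m) - D" using \<Phi>(2)[of D, OF _ j] by (simp add: W_def)
      show ?thesis
      proof (cases "W j m = {0}")
        case True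
        hence "{v \<in> W j m. \<phi> v = 0} = {0}" using functional_zero[OF \<phi>(1)] by auto
        moreover have "cdim (V j m) - D = 0" using dW[unfolded True cdim_zero] by simp
        ultimately show ?thesis using cdim_zero by (simp only: d eqS) simp
      next
        case False
        hence "j \<in> ?J" using j by auto
        hence "w j \<in> W j m" "\<phi> (w j) \<noteq> 0" using w[of j] False bspec[OF \<phi>(2), of "w j"] by simp_all
        moreover have "W j m \<subseteq> supported B" using B(2)[of j m] by (auto simp: W_def)
        ultimately have "cdim (W j m) = Suc (cdim {v \<in> W j m. \<phi> v = 0})"
          using cdim_kernel[OF B(1) _ Wsub \<phi>(1)] by blast
        thus ?thesis using dW by (simp add: d eqS)
      qed
    qed
  qed
qed

text \<open>Extending a basis step by step records at which stage a vector enters; in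
  \<open>rank_facts\<close> this stage is the height at which a homogeneous generator is
  placed.\<close>

lemma adapted_basis:
  assumes B: "finite B" "\<And>i. U i \<subseteq> supported B" "\<And>i. csubspace (U i)" and mono: "\<And>i. U i \<subseteq> U (Suc i)"
    and U0: "U 0 = {0}"
  obtains S :: "nat \<Rightarrow> ('b \<Rightarrow> complex) set" where "S 0 = {}" "\<And>i. S i \<subseteq> S (Suc i)" "\<And>i. S i \<subseteq> U i"
    "\<And>i. CV.independent (S i)" "\<And>i. cspan (S i) = U i"
proof -
  have "\<exists>S. \<forall>i. (S i \<subseteq> U i \<and> CV.independent (S i) \<and> cspan (S i) = U i \<and> (i = 0 \<longrightarrow> S i = {})) \<and> S i \<subseteq> S (Suc i)"
  proof (rule dependent_nat_choice)
    show "\<exists>S. S \<subseteq> U 0 \<and> CV.independent S \<and> cspan S = U 0 \<and> (0 = (0::nat) \<longrightarrow> S = {})"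
      by (intro exI[of _ "{}"]) (simp add: U0 CV.independent_empty)
  next
    fix S i assume S: "S \<subseteq> U i \<and> CV.independent S \<and> cspan S = U i \<and> (i = 0 \<longrightarrow> S = {})"
    have "S \<subseteq> U (Suc i)" using S mono[of i] by auto
    then obtain S' where S': "S \<subseteq> S'" "S' \<subseteq> U (Suc i)" "CV.independent S'" "U (Suc i) \<subseteq> cspan S'"
      using CV.maximal_independent_subset_extend[of S "U (Suc i)"] S by auto
    thus "\<exists>S'. (S' \<subseteq> U (Suc i) \<and> CV.independent S' \<and> cspan S' = U (Suc i) \<and> (Suc i = 0 \<longrightarrow> S' = {})) \<and> S \<subseteq> S'"
      using CV.span_minimal[OF S'(2) B(3)] by (intro exI[of _ S']) auto
  qed
  then obtain S where "\<forall>i. (S i \<subseteq> U i \<and> CV.independent (S i) \<and> cspan (S i) = U i \<and> (i = 0 \<longrightarrow> S i = {})) \<and> S i \<subseteq> S (Suc i)" ..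
  thus thesis by (intro that[of S]) auto
qed

section \<open>Dimensions and ranks\<close>

lemma restrict_scalars_module:
  fixes N :: "('a, 'b, 'c) module_scheme" (structure) and \<phi> :: "'k::comm_ring_1 \<Rightarrow> 'a"
  assumes "module R N" "P \<subseteq> carrier N" "\<zero> \<in> P" "\<And>u v. u \<in> P \<Longrightarrow> v \<in> P \<Longrightarrow> u \<oplus> v \<in> P"
    "\<And>u. u \<in> P \<Longrightarrow> \<ominus> u \<in> P" "\<And>a u. u \<in> P \<Longrightarrow> \<phi> a \<odot> u \<in> P"
    "\<And>a. \<phi> a \<in> carrier R" "\<And>a b. \<phi> (a + b) = \<phi> a \<oplus>\<^bsub>R\<^esub> \<phi> b" "\<And>a b. \<phi> (a * b) = \<phi> a \<otimes>\<^bsub>R\<^esub> \<phi> b" "\<phi> 1 = \<one>\<^bsub>R\<^esub>"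
  shows "module TA (restrict_scalars \<phi> (N\<lparr>carrier := P\<rparr>))"
proof -
  interpret module R N by fact
  have c: "u \<in> P \<Longrightarrow> u \<in> carrier N" for u using assms(2) by blast
  show ?thesis
  proof (rule moduleI[OF TA_cring])
    show "abelian_group (restrict_scalars \<phi> (N\<lparr>carrier := P\<rparr>))"
    proof (rule abelian_groupI)
      fix u assume "u \<in> carrier (restrict_scalars \<phi> (N\<lparr>carrier := P\<rparr>))"
      thus "\<exists>y\<in>carrier (restrict_scalars \<phi> (N\<lparr>carrier := P\<rparr>)). y \<oplus>\<^bsub>restrict_scalars \<phi> (N\<lparr>carrier := P\<rparr>)\<^esub> u = \<zero>\<^bsub>restrict_scalars \<phi> (N\<lparr>carrier := P\<rparr>)\<^esub>"
        using assms(5) c by (intro bexI[of _ "\<ominus> u"]) (simp_all add: l_neg)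
    qed (simp_all add: assms(3,4) c a_ac)
  qed (simp_all add: assms(6-) c smult_l_distr smult_r_distr smult_assoc1)
qed

lemma restrict_scalars_finsum_sub:
  fixes N :: "('a, 'b, 'c) module_scheme" (structure)
  assumes "module TA (restrict_scalars \<phi> (N\<lparr>carrier := P\<rparr>))" "abelian_group N" "P \<subseteq> carrier N"
    "\<And>i. i \<in> A \<Longrightarrow> f i \<in> P"
  shows "finsum (restrict_scalars \<phi> (N\<lparr>carrier := P\<rparr>)) f A = finsum N f A"
proof -
  interpret module TA "restrict_scalars \<phi> (N\<lparr>carrier := P\<rparr>)" by fact
  have "id (finsum (restrict_scalars \<phi> (N\<lparr>carrier := P\<rparr>)) f A) = finsum N (\<lambda>i. id (f i)) A"
    by (rule additive_map_finsum_in[OF abelian_group_axioms assms(2)]) (use assms(3,4) in auto)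
  thus ?thesis by simp
qed

context gamma_mod
begin

definition V :: "int \<Rightarrow> int \<Rightarrow> ('b \<Rightarrow> complex) set" where
  "V j m = iota j ` grade N (pt n k j m)"

lemma V_subspace: "csubspace (V j m)"
proof (rule csubspaceI)
  show "0 \<in> V j m" unfolding V_def by (rule image_eqI[of _ _ "\<zero>"]) (simp_all add: iota_zero grade_zero[OF pt_in])
next
  fix u v assume "u \<in> V j m" "v \<in> V j m"
  then obtain a b where ab: "u = iota j a" "v = iota j b" "a \<in> grade N (pt n k j m)" "b \<in> grade N (pt n k j m)"
    unfolding V_def by (elim imageE) simp
  show "u + v \<in> V j m" unfolding V_def
    by (rule image_eqI[of _ _ "a \<oplus> b"]) (use ab in \<open>simp_all add: iota_add grade_carrier[OF pt_in] grade_add[OF pt_in]\<close>)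
next
  fix c u assume "u \<in> V j m"
  then obtain a where a: "u = iota j a" "a \<in> grade N (pt n k j m)" unfolding V_def by (elim imageE) simp
  show "(\<lambda>b. c * u b) \<in> V j m" unfolding V_def
    by (rule image_eqI[of _ _ "scal c a"]) (use a in \<open>simp_all add: iota_scal grade_carrier[OF pt_in] grade_scal[OF pt_in]\<close>)
qed

lemma V_supported: "V j m \<subseteq> supported B"
  by (auto simp: V_def supported_def iota_outside)

text \<open>At t = 1 multiplication by x^p y^q becomes the inclusion of one embedded piece into
  another.\<close>

lemma V_act: "V j m \<subseteq> V (j + int p - int q) (m + int q)"
proof
  fix v assume "v \<in> V j m"
  then obtain a where a: "v = iota j a" "a \<in> grade N (pt n k j m)" unfolding V_def by (elim imageE) simp
  show "v \<in> V (j + int p - int q) (m + int q)" unfolding V_def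
    by (rule image_eqI[of _ _ "act p q a"])
      (use a iota_act[OF grade_carrier[OF pt_in a(2)], of j p q] grade_act[OF a(2)] in simp_all)
qed

lemma V_mono: "V j m \<subseteq> V j (m + 1)"
  using V_act[of j m 1 1] by simp

lemma V_shift: "V (j + int n * s) m = V j (m + (int n - int k) * s)"
  by (simp add: V_def iota_shift pt_shift)

lemma grade_finsum:
  assumes "\<And>z. z \<in> A \<Longrightarrow> f z \<in> grade N (pt n k j m)" shows "finsum N f A \<in> grade N (pt n k j m)"
  using assms
proof (induction A rule: infinite_finite_induct)
  case (insert z A)
  have "finsum N f (insert z A) = f z \<oplus> finsum N f A"
    by (rule finsum_insert) (use insert grade_carrier[OF pt_in] in auto)
  thus ?case using insert by (simp add: grade_add[OF pt_in])
qed (simp_all add: grade_zero[OF pt_in])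

lemma smult_c: "c_bar n k c \<odot> u = scal c u" by (simp add: scal_def)

text \<open>A basis of the embedded piece pulls back along the injective \<open>iota\<close> to a
  basis of the piece over C.\<close>

lemma dim_at_pt: "dim_at n k N (pt n k j m) = cdim (V j m)"
proof -
  let ?P = "grade N (pt n k j m)" let ?M = "restrict_scalars (c_bar n k) (N\<lparr>carrier := ?P\<rparr>)"
  have PN: "u \<in> ?P \<Longrightarrow> u \<in> carrier N" for u using grade_carrier[OF pt_in] .
  have mod: "module TA ?M"
  proof (rule restrict_scalars_module[OF module_axioms])
    show "c_bar n k 1 = \<one>\<^bsub>Rbar n k\<^esub>" by (simp add: c_bar_mon mon_pol_one clbar_one)
    show "c_bar n k (a + b) = c_bar n k a \<oplus>\<^bsub>Rbar n k\<^esub> c_bar n k b" for a b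
      by (simp add: c_bar_mon mon_pol_add clbar_add)
    show "c_bar n k (a * b) = c_bar n k a \<otimes>\<^bsub>Rbar n k\<^esub> c_bar n k b" for a b
      by (simp add: c_bar_mon mon_pol_mult flip: clbar_mult)
  qed (auto simp: PN smult_c intro: grade_zero[OF pt_in] grade_add[OF pt_in] grade_neg[OF pt_in] grade_scal[OF pt_in])
  obtain S where S: "S \<subseteq> V j m" "CV.independent S" "cspan S = V j m" "finite S" "card S = cdim (V j m)"
    using supported_basis[OF finite_B V_supported V_subspace] .
  define e where "e s = inv_into ?P (iota j) s" for s
  have e: "e s \<in> ?P" "iota j (e s) = s" if "s \<in> S" for s
    using S(1) that unfolding e_def V_def by (auto intro: inv_into_into f_inv_into_f)
  have inj: "inj_on e S" by (rule inj_on_inverseI[of _ "iota j"]) (rule e(2))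
  have eN: "s \<in> S \<Longrightarrow> e s \<in> carrier N" for s using e(1) PN by blast
  have fs: "finsum ?M (\<lambda>b. c b \<odot>\<^bsub>?M\<^esub> b) (e ` S) = (\<Oplus>s\<in>S. scal (c (e s)) (e s))" for c
  proof -
    have "finsum ?M (\<lambda>b. c b \<odot>\<^bsub>?M\<^esub> b) (e ` S) = finsum N (\<lambda>b. c b \<odot>\<^bsub>?M\<^esub> b) (e ` S)"
      by (rule restrict_scalars_finsum_sub[OF mod abelian_group_axioms])
        (use PN e(1) in \<open>auto simp: smult_c intro: grade_scal[OF pt_in]\<close>)
    also have "\<dots> = (\<Oplus>s\<in>S. c (e s) \<odot>\<^bsub>?M\<^esub> e s)"
      by (rule add.finprod_reindex[of "\<lambda>b. c b \<odot>\<^bsub>?M\<^esub> b" e S, OF _ inj])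
        (use eN in \<open>auto simp: smult_c scal_closed\<close>)
    finally show ?thesis by (simp add: smult_c)
  qed
  have io: "iota j (\<Oplus>s\<in>S. scal (c s) (e s)) = (\<Sum>s\<in>S. (\<lambda>b. c s * s b))" for c
  proof -
    have "iota j (\<Oplus>s\<in>S. scal (c s) (e s)) = (\<Sum>s\<in>S. iota j (scal (c s) (e s)))"
      by (rule additive_map_finsum[OF abelian_group_axioms iota_add]) (use eN scal_closed in auto)
    also have "\<dots> = (\<Sum>s\<in>S. (\<lambda>b. c s * s b))" by (intro sum.cong refl) (simp add: iota_scal eN e(2))
    finally show ?thesis .
  qed
  have inP: "(\<Oplus>s\<in>S. scal (c s) (e s)) \<in> ?P" for c
    by (rule grade_finsum) (use e(1) grade_scal[OF pt_in] in auto)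
  have "is_basis TA ?M (e ` S)"
  proof (rule is_basis_finiteI[OF mod])
    fix v assume "v \<in> carrier ?M"
    hence v: "v \<in> ?P" by simp
    hence "iota j v \<in> cspan S" using S(3) by (simp add: V_def)
    then obtain c where c: "iota j v = (\<Sum>s\<in>S. (\<lambda>b. c s * s b))"
      unfolding CV.span_finite[OF S(4)] by auto
    have "v = (\<Oplus>s\<in>S. scal (c s) (e s))"
      by (rule inj_onD[OF iota_inj _ v inP]) (simp add: io c)
    also have "\<dots> = (\<Oplus>s\<in>S. scal ((c \<circ> iota j) (e s)) (e s))"
      by (rule finsum_cong') (use eN scal_closed e(2) in auto)
    finally show "\<exists>c. v = finsum ?M (\<lambda>b. c b \<odot>\<^bsub>?M\<^esub> b) (e ` S)" unfolding fs by blast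
  next
    fix c assume "finsum ?M (\<lambda>b. c b \<odot>\<^bsub>?M\<^esub> b) (e ` S) = \<zero>\<^bsub>?M\<^esub>"
    hence "(\<Oplus>s\<in>S. scal (c (e s)) (e s)) = \<zero>" unfolding fs by simp
    hence "(\<Sum>s\<in>S. (\<lambda>b. c (e s) * s b)) = 0" using io[of "c \<circ> e"] iota_zero by simp
    from CV.independentD[OF S(2,4) subset_refl this] show "\<forall>b\<in>e ` S. c b = 0" by auto
  qed (use S(4) e(1) in auto)
  from free_rank_eq_card[OF mod this] S(4) have "dim_at n k N (pt n k j m) = card (e ` S)" by (simp add: dim_at_def)
  thus ?thesis using S(5) card_image[OF inj] by simp
qed

text \<open>The coefficient of t^d in f raises u by d steps, and the steps of a chain are distinct
  degrees.\<close>

lemma t_bar_comp: assumes u: "u \<in> grade N (pt n k j m)"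
  shows "cmp (t_bar n k f \<odot> u) (pt n k j m') = (if m' \<ge> m then scal (Polynomial.coeff f (nat (m' - m))) (act (nat (m' - m)) (nat (m' - m)) u) else \<zero>)"
proof (induction f arbitrary: m')
  case 0
  have uN: "u \<in> carrier N" using grade_carrier[OF pt_in u] .
  have "t_bar n k 0 \<odot> u = \<zero>" using T.TA_mod(1)[of u] uN by simp
  thus ?case using uN by (simp add: comp_zero scal_0 act_closed)
next
  case (pCons a f)
  have uN: "u \<in> carrier N" using grade_carrier[OF pt_in u] .
  have fN: "t_bar n k f \<odot> u \<in> carrier N" using uN by simp
  have "pCons a f = [:a:] + Polynomial.monom 1 1 * f" by (simp add: monom_altdef)
  hence "t_bar n k (pCons a f) \<odot> u = t_bar n k [:a:] \<odot> u \<oplus> t_bar n k (Polynomial.monom 1 1) \<odot> (t_bar n k f \<odot> u)"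
    using T.TA_mod(4)[of u "[:a:]" "Polynomial.monom 1 1 * f"] T.TA_mod(5)[of u "Polynomial.monom 1 1" f] uN by simp
  also have "\<dots> = scal a u \<oplus> act 1 1 (t_bar n k f \<odot> u)"
    by (simp add: scal_def c_bar_t_bar act_def t_bar_tpol tpol_monom)
  finally have "cmp (t_bar n k (pCons a f) \<odot> u) (pt n k j m') = cmp (scal a u) (pt n k j m') \<oplus> cmp (act 1 1 (t_bar n k f \<odot> u)) (pt n k j m')"
    using uN fN by (simp add: comp_add scal_closed act_closed)
  also have "cmp (act 1 1 (t_bar n k f \<odot> u)) (pt n k j m') = act 1 1 (cmp (t_bar n k f \<odot> u) (pt n k j (m' - 1)))"
    using comp_act[OF fN, of 1 1 j "m' - 1"] by simp
  also have "cmp (scal a u) (pt n k j m') = (if m' = m then scal a u else \<zero>)"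
    using comp_homog[OF pt_in u, of "pt n k j m'"] kn by (auto simp: comp_scal[OF uN] scal_zero pt_eq_iff)
  finally have e: "cmp (t_bar n k (pCons a f) \<odot> u) (pt n k j m') = 
     (if m' = m then scal a u else \<zero>) \<oplus> act 1 1 (cmp (t_bar n k f \<odot> u) (pt n k j (m' - 1)))" .
  consider "m' < m" | "m' = m" | "m' > m" by linarith
  thus ?case
  proof cases
    case 1 thus ?thesis unfolding e pCons by (simp add: act_zero)
  next
    case 2 thus ?thesis unfolding e pCons using uN by (simp add: act_zero act_0 scal_closed)
  next
    case 3
    have s: "nat (m' - m) = Suc (nat (m' - 1 - m))" using 3 by simp
    show ?thesis unfolding e pCons s using 3 uN by (simp add: act_scal act_act act_closed scal_closed del: One_nat_def) simp
  qed
qed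

lemma Zn_piece_eq: "Zn_piece n k N 0 = {v \<in> carrier N. \<forall>i\<in>carrier \<Lambda>. res_deg n i \<noteq> 0 \<longrightarrow> cmp v i = \<zero>}"
proof (intro equalityI subsetI)
  fix v assume "v \<in> Zn_piece n k N 0"
  then obtain F f where F: "v = (\<Oplus>i\<in>F. f i)" "finite F" "F \<subseteq> {i \<in> carrier \<Lambda>. res_deg n i = 0}" "\<And>i. i \<in> F \<Longrightarrow> f i \<in> grade N i"
    unfolding Zn_piece_def hom_sums_def by (elim CollectE exE conjE) simp
  have FL: "F \<subseteq> carrier \<Lambda>" using F(3) by (rule subset_trans) simp
  have fN: "f i \<in> carrier N" if "i \<in> F" for i using grade_carrier F(4)[OF that] FL that by (metis subsetD)
  have "v \<in> carrier N" unfolding F(1) by (rule finsum_closed) (rule Pi_I, rule fN)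
  moreover have "cmp v i = \<zero>" if "res_deg n i \<noteq> 0" for i
  proof -
    have "i \<notin> F" using that F(3) by fastforce
    moreover have "cmp (finsum N f F) i = (if i \<in> F then f i else \<zero>)"
      by (rule comp_finsum_homog[OF F(2) FL F(4)])
    ultimately show ?thesis unfolding F(1) by presburger
  qed
  ultimately show "v \<in> {v \<in> carrier N. \<forall>i\<in>carrier \<Lambda>. res_deg n i \<noteq> 0 \<longrightarrow> cmp v i = \<zero>}" by simp
next
  fix v assume "v \<in> {v \<in> carrier N. \<forall>i\<in>carrier \<Lambda>. res_deg n i \<noteq> 0 \<longrightarrow> cmp v i = \<zero>}"
  hence v: "v \<in> carrier N" "\<And>i. i \<in> carrier \<Lambda> \<Longrightarrow> res_deg n i \<noteq> 0 \<Longrightarrow> cmp v i = \<zero>" by simp_all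
  let ?F = "{i \<in> carrier \<Lambda>. cmp v i \<noteq> \<zero>}"
  have a: "v = finsum N (cmp v) ?F" by (rule comp_props(3)[OF v(1)])
  have b: "finite ?F" by (rule comp_props(2)[OF v(1)])
  have c: "?F \<subseteq> {i \<in> carrier \<Lambda>. res_deg n i = 0}" using v(2) by fastforce
  have d: "\<forall>i\<in>?F. cmp v i \<in> grade N i" using comp_props(1)[OF v(1)] by simp
  show "v \<in> Zn_piece n k N 0" unfolding Zn_piece_def hom_sums_def
    using a b c d by (intro CollectI exI[of _ ?F] exI[of _ "cmp v"] conjI)
qed

lemma t_bar_monom: "u \<in> carrier N \<Longrightarrow> t_bar n k (Polynomial.monom c d) \<odot> u = scal c (act d d u)"
  by (simp add: t_bar_tpol tpol_monom mon_act)

text \<open>Take a basis \<open>SS\<close> of the union of the embedded pieces in residue degree 0,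
  adapted to their heights, and lift each s to the lowest height \<open>h s\<close> at which it
  occurs. The lifts \<open>e s\<close> are a homogeneous basis of \<open>Zn_piece n k N 0\<close>
  over C[t], so the rank is \<open>card SS\<close>, the largest dimension on this chain. Powers of x
  enclose any other chain between two shifts of this one, which gives the same bound and the same
  maximum there.\<close>

lemma rank_facts:
  shows rank_upper: "0 \<le> j \<Longrightarrow> j < int n \<Longrightarrow> cdim (V j m) \<le> rank_Gamma n k N"
    and rank_attained: "0 \<le> j \<Longrightarrow> j < int n \<Longrightarrow> \<exists>m. cdim (V j m) = rank_Gamma n k N"
proof -
  obtain m0 where m0: "\<And>j m. 0 \<le> j \<Longrightarrow> j < int n \<Longrightarrow> m < m0 \<Longrightarrow> grade N (pt n k j m) = {\<zero>}"
    using bounded_below by blast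
  \<comment> \<open>Starting one step below the bound \<open>m0\<close> makes the first space zero,
    as \<open>adapted_basis\<close> wants.\<close>
  define U where "U i = V 0 (m0 - 1 + int i)" for i
  have Vlow: "V 0 m = {0}" if "m < m0" for m using m0[of 0 m] that kn by (simp add: V_def iota_zero)
  have Umono: "U i \<subseteq> U (Suc i)" for i using V_mono[of 0 "m0 - 1 + int i"] by (simp add: U_def algebra_simps)
  have U0: "U 0 = {0}" using Vlow by (simp add: U_def)
  have Usub: "csubspace (U i)" "U i \<subseteq> supported B" for i by (simp_all add: U_def V_subspace V_supported)
  obtain S where S: "S 0 = {}" "\<And>i. S i \<subseteq> S (Suc i)" "\<And>i. S i \<subseteq> U i"
    "\<And>i. CV.independent (S i)" "\<And>i. cspan (S i) = U i"
    by (rule adapted_basis[OF finite_B Usub(2) Usub(1) Umono U0]) (rule that)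
  have Smono: "S i \<subseteq> S i'" if "i \<le> i'" for i i' using S(2) that by (rule lift_Suc_mono_le)
  have Sfin: "finite (S i)" "card (S i) \<le> card B" for i
    using supported_bound[OF finite_B subset_trans[OF S(3) Usub(2)] S(4)] by auto
  define SS where "SS = (\<Union>i. S i)"
  define h where "h s = (LEAST i. s \<in> S i)" for s
  have hS: "s \<in> S (h s)" if "s \<in> SS" for s
  proof -
    have "\<exists>i. s \<in> S i" using that by (simp add: SS_def)
    then obtain i where "s \<in> S i" ..
    thus ?thesis unfolding h_def by (rule LeastI)
  qed
  have hle: "h s \<le> i" if "s \<in> S i" for s i unfolding h_def using that by (rule Least_le)
  have cover: "\<exists>i. F \<subseteq> S i" if "finite F" "F \<subseteq> SS" for F
  proof (intro exI subsetI)
    fix s assume s: "s \<in> F"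
    have "h s \<le> Max (insert 0 (h ` F))" using s that(1) by (intro Max_ge) auto
    thus "s \<in> S (Max (insert 0 (h ` F)))" using Smono hS[of s] s that(2) by blast
  qed
  \<comment> \<open>A finite part of the union lies in a single \<open>S i\<close>, and independent
    sets there have at most \<open>card B\<close> elements.\<close>
  have SSfin: "finite SS"
  proof (rule ccontr)
    assume "infinite SS"
    then obtain F where F: "finite F" "card F = Suc (card B)" "F \<subseteq> SS" by (metis infinite_arbitrarily_large)
    then obtain i where "F \<subseteq> S i" using cover by blast
    from card_mono[OF Sfin(1) this] Sfin(2)[of i] F(2) show False by simp
  qed
  then obtain i0 where "SS \<subseteq> S i0" using cover[of SS] by blast
  hence i0: "SS = S i0" by (auto simp: SS_def)
  define e where "e s = inv_into (grade N (pt n k 0 (m0 - 1 + int (h s)))) (iota 0) s" for s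
  have e: "e s \<in> grade N (pt n k 0 (m0 - 1 + int (h s)))" "iota 0 (e s) = s" if "s \<in> SS" for s
  proof -
    have "s \<in> V 0 (m0 - 1 + int (h s))" using hS[OF that] S(3) by (auto simp: U_def)
    thus "e s \<in> grade N (pt n k 0 (m0 - 1 + int (h s)))" "iota 0 (e s) = s"
      unfolding e_def V_def by (auto intro: inv_into_into f_inv_into_f)
  qed
  have eN: "e s \<in> carrier N" if "s \<in> SS" for s using grade_carrier[OF pt_in e(1)[OF that]] .
  have inj: "inj_on e SS" by (rule inj_on_inverseI[of _ "iota 0"]) (rule e(2))
  let ?P = "Zn_piece n k N 0" let ?M = "restrict_scalars (t_bar n k) (N\<lparr>carrier := ?P\<rparr>)"
  have PN: "u \<in> ?P \<Longrightarrow> u \<in> carrier N" for u by (simp add: Zn_piece_eq)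
  have Pt: "t_bar n k f \<odot> v \<in> ?P" if "v \<in> ?P" for f v
  proof -
    have "v \<in> carrier N" using that PN by blast
    moreover have "\<forall>i\<in>carrier \<Lambda>. res_deg n i \<noteq> 0 \<longrightarrow> cmp (t_bar n k f \<odot> v) i = \<zero>"
    proof (rule t_bar_induct_closed[OF \<open>v \<in> carrier N\<close>])
      show "\<forall>i\<in>carrier \<Lambda>. res_deg n i \<noteq> 0 \<longrightarrow> cmp v i = \<zero>" using that by (simp add: Zn_piece_eq)
    next
      fix u assume u: "u \<in> carrier N" "\<forall>i\<in>carrier \<Lambda>. res_deg n i \<noteq> 0 \<longrightarrow> cmp u i = \<zero>"
      show "\<forall>i\<in>carrier \<Lambda>. res_deg n i \<noteq> 0 \<longrightarrow> cmp (act 1 1 u) i = \<zero>"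
      proof (intro ballI impI)
        fix i assume i: "i \<in> carrier \<Lambda>" "res_deg n i \<noteq> 0"
        then obtain j m where jm: "i = pt n k j m" using Gamma_ex[of i n k] kn by auto
        have "cmp (act 1 1 u) i = act 1 1 (cmp u (pt n k j (m - 1)))"
          using comp_act[OF u(1), of 1 1 j "m - 1"] by (simp add: jm)
        moreover have "res_deg n (pt n k j (m - 1)) \<noteq> 0" using i(2) by (simp add: jm res_deg_pt)
        ultimately show "cmp (act 1 1 u) i = \<zero>" using u(2) by (simp add: act_zero)
      qed
    qed (simp_all add: comp_zero comp_add comp_scal scal_zero)
    ultimately show ?thesis by (simp add: Zn_piece_eq)
  qed
  have mod: "module TA ?M"
  proof (rule restrict_scalars_module[OF module_axioms])
    show "?P \<subseteq> carrier N" using PN by (rule subsetI)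
    show "\<zero> \<in> ?P" by (simp add: Zn_piece_eq comp_zero)
    show "u \<oplus> v \<in> ?P" if "u \<in> ?P" "v \<in> ?P" for u v using that by (simp add: Zn_piece_eq comp_add)
    show "\<ominus> u \<in> ?P" if "u \<in> ?P" for u using that by (simp add: Zn_piece_eq comp_neg)
    show "t_bar n k a \<odot> u \<in> ?P" if "u \<in> ?P" for a u using that by (rule Pt)
  qed (simp_all add: t_bar_hom)
  have eP: "e s \<in> ?P" if s: "s \<in> SS" for s
  proof -
    have "cmp (e s) i = \<zero>" if "res_deg n i \<noteq> 0" for i
    proof -
      have "i \<noteq> pt n k 0 (m0 - 1 + int (h s))" using that by (auto simp: res_deg_pt)
      thus ?thesis using comp_homog[OF pt_in e(1)[OF s], of i] by simp
    qed
    thus ?thesis using eN[OF s] by (simp add: Zn_piece_eq)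
  qed
  have teN: "t_bar n k c \<odot> e s \<in> carrier N" if "s \<in> SS" for c s using eN[OF that] by simp
  have fs: "finsum ?M (\<lambda>b. c b \<odot>\<^bsub>?M\<^esub> b) (e ` SS) = (\<Oplus>s\<in>SS. t_bar n k (c (e s)) \<odot> e s)" for c
  proof -
    have "finsum ?M (\<lambda>b. c b \<odot>\<^bsub>?M\<^esub> b) (e ` SS) = finsum N (\<lambda>b. c b \<odot>\<^bsub>?M\<^esub> b) (e ` SS)"
      by (rule restrict_scalars_finsum_sub[OF mod abelian_group_axioms]) (use PN Pt eP in auto)
    also have "\<dots> = (\<Oplus>s\<in>SS. c (e s) \<odot>\<^bsub>?M\<^esub> e s)"
      by (rule add.finprod_reindex[of "\<lambda>b. c b \<odot>\<^bsub>?M\<^esub> b" e SS, OF _ inj]) (use eN in auto)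
    finally show ?thesis by simp
  qed
  define Q where "Q = {v. \<exists>c. v = (\<Oplus>s\<in>SS. t_bar n k (c s) \<odot> e s)}"
  have Q0: "\<zero> \<in> Q"
  proof -
    have "(\<Oplus>s\<in>SS. t_bar n k 0 \<odot> e s) = (\<Oplus>s\<in>SS. \<zero>)"
      by (rule finsum_cong') (use T.TA_mod(1) eN in auto)
    thus ?thesis unfolding Q_def by (intro CollectI exI[of _ "\<lambda>_. 0"]) simp
  qed
  have Qadd: "u \<oplus> v \<in> Q" if uv: "u \<in> Q" "v \<in> Q" for u v
  proof -
    obtain c d where cd: "u = (\<Oplus>s\<in>SS. t_bar n k (c s) \<odot> e s)" "v = (\<Oplus>s\<in>SS. t_bar n k (d s) \<odot> e s)"
      using uv unfolding Q_def by (elim CollectE exE) simp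
    have "u \<oplus> v = (\<Oplus>s\<in>SS. t_bar n k (c s) \<odot> e s \<oplus> t_bar n k (d s) \<odot> e s)"
      unfolding cd by (rule finsum_addf[symmetric]) (use teN in auto)
    also have "\<dots> = (\<Oplus>s\<in>SS. t_bar n k (c s + d s) \<odot> e s)"
      by (rule finsum_cong') (use teN eN in \<open>auto simp: t_bar_hom smult_l_distr\<close>)
    finally show ?thesis unfolding Q_def by (intro CollectI exI[of _ "\<lambda>s. c s + d s"])
  qed
  have Qhom: "u \<in> Q" if u: "u \<in> grade N (pt n k 0 m)" for u m
  proof (cases "m < m0")
    case True thus ?thesis using m0[of 0 m] u Q0 kn by simp
  next
    case False
    define l where "l = nat (m - m0 + 1)"
    have m: "m = m0 - 1 + int l" using False by (simp add: l_def)
    have "iota 0 u \<in> cspan (S l)" using u by (simp add: S(5) U_def V_def m)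
    then obtain c where c: "iota 0 u = (\<Sum>s\<in>S l. (\<lambda>b. c s * s b))"
      unfolding CV.span_finite[OF Sfin(1)] by auto
    \<comment> \<open>The vector s enters at height \<open>h s\<close>, so its lift needs the factor
      t^(l - h s) to reach the height l of u.\<close>
    define c' where "c' s = (if s \<in> S l then Polynomial.monom (c s) (l - h s) else 0)" for s
    have c'e: "t_bar n k (c' s) \<odot> e s = (if s \<in> S l then scal (c s) (act (l - h s) (l - h s) (e s)) else \<zero>)" if "s \<in> SS" for s
      using eN[OF that] T.TA_mod(1)[of "e s"] by (simp add: c'_def t_bar_monom)
    have g: "t_bar n k (c' s) \<odot> e s \<in> grade N (pt n k 0 m)" if s: "s \<in> SS" for s
    proof (cases "s \<in> S l")
      case True
      have "m0 - 1 + int (h s) + int (l - h s) = m" using hle[OF True] by (simp add: m of_nat_diff)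
      thus ?thesis using grade_act[OF e(1)[OF s], of "l - h s" "l - h s"] True
        by (simp add: c'e[OF s] grade_scal[OF pt_in])
    qed (simp add: c'e[OF s] grade_zero[OF pt_in])
    have "iota 0 (\<Oplus>s\<in>SS. t_bar n k (c' s) \<odot> e s) = (\<Sum>s\<in>SS. iota 0 (t_bar n k (c' s) \<odot> e s))"
      by (rule additive_map_finsum[OF abelian_group_axioms iota_add]) (use teN in auto)
    also have "\<dots> = (\<Sum>s\<in>SS. if s \<in> S l then (\<lambda>b. c s * s b) else 0)"
    proof (intro sum.cong refl)
      fix s assume s: "s \<in> SS"
      have "iota 0 (act (l - h s) (l - h s) (e s)) = s"
        using iota_act[OF eN[OF s], of 0 "l - h s" "l - h s"] e(2)[OF s] by simp
      thus "iota 0 (t_bar n k (c' s) \<odot> e s) = (if s \<in> S l then (\<lambda>b. c s * s b) else 0)"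
        by (simp add: c'e[OF s] iota_scal act_closed eN[OF s] iota_zero)
    qed
    also have "\<dots> = (\<Sum>s\<in>SS \<inter> S l. (\<lambda>b. c s * s b))" by (rule sum.inter_restrict[OF SSfin, symmetric])
    also have "SS \<inter> S l = S l" by (auto simp: SS_def)
    finally have "iota 0 u = iota 0 (\<Oplus>s\<in>SS. t_bar n k (c' s) \<odot> e s)" by (simp only: c)
    hence "u = (\<Oplus>s\<in>SS. t_bar n k (c' s) \<odot> e s)"
      by (rule inj_onD[OF iota_inj _ u grade_finsum[OF g]])
    thus ?thesis unfolding Q_def by (intro CollectI exI[of _ c'])
  qed
  have spanQ: "v \<in> Q" if v: "v \<in> ?P" for v
  proof -
    have vN: "v \<in> carrier N" and vz: "\<And>i. i \<in> carrier \<Lambda> \<Longrightarrow> res_deg n i \<noteq> 0 \<Longrightarrow> cmp v i = \<zero>"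
      using v by (simp_all add: Zn_piece_eq)
    have cQ: "cmp v i \<in> Q" if i: "i \<in> carrier \<Lambda>" for i
    proof (cases "res_deg n i = 0")
      case True
      obtain j m where jm: "i = pt n k j m" "0 \<le> j" "j < int n" using Gamma_ex[OF i] kn by auto
      hence "j = 0" using True by (simp add: res_deg_pt)
      thus ?thesis using Qhom[of "cmp v i" m] comp_props(1)[OF vN i] by (simp add: jm)
    qed (simp add: vz[OF i] Q0)
    have "finsum N (cmp v) F \<in> Q" if "finite F" "F \<subseteq> carrier \<Lambda>" for F
      using that
    proof (induction F rule: finite_induct)
      case (insert i F)
      have "finsum N (cmp v) (insert i F) = cmp v i \<oplus> finsum N (cmp v) F"
        by (rule finsum_insert) (use insert comp_closed[OF vN] in auto)
      thus ?case using insert cQ Qadd by simp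
    qed (simp add: Q0)
    from this[OF comp_props(2)[OF vN]] show ?thesis by (subst comp_props(3)[OF vN]) simp
  qed
  have "is_basis TA ?M (e ` SS)"
  proof (rule is_basis_finiteI[OF mod])
    fix v assume "v \<in> carrier ?M"
    hence "v \<in> ?P" by simp
    then obtain c where "v = (\<Oplus>s\<in>SS. t_bar n k (c s) \<odot> e s)" using spanQ unfolding Q_def by blast
    also have "\<dots> = (\<Oplus>s\<in>SS. t_bar n k ((c \<circ> iota 0) (e s)) \<odot> e s)"
      by (rule finsum_cong') (use teN e(2) in auto)
    finally show "\<exists>c. v = finsum ?M (\<lambda>b. c b \<odot>\<^bsub>?M\<^esub> b) (e ` SS)" unfolding fs by blast
  next
    fix c assume "finsum ?M (\<lambda>b. c b \<odot>\<^bsub>?M\<^esub> b) (e ` SS) = \<zero>\<^bsub>?M\<^esub>"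
    hence z: "(\<Oplus>s\<in>SS. t_bar n k (c (e s)) \<odot> e s) = \<zero>" unfolding fs by simp
    \<comment> \<open>The component of the relation at height l involves the coefficients of t^(l -
      h s) only, so independence of \<open>SS\<close> kills the coefficients one height at a
      time.\<close>
    have van: "(\<Sum>s\<in>SS. (\<lambda>b. (if h s \<le> l then Polynomial.coeff (c (e s)) (l - h s) else 0) * s b)) = 0" for l
    proof -
      let ?i = "pt n k 0 (m0 - 1 + int l)"
      have "\<zero> = cmp (\<Oplus>s\<in>SS. t_bar n k (c (e s)) \<odot> e s) ?i" by (simp add: z comp_zero)
      also have "\<dots> = (\<Oplus>s\<in>SS. cmp (t_bar n k (c (e s)) \<odot> e s) ?i)" by (rule comp_finsum) (rule teN)
      finally have zz: "\<zero> = (\<Oplus>s\<in>SS. cmp (t_bar n k (c (e s)) \<odot> e s) ?i)" .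
      have "0 = iota 0 (\<Oplus>s\<in>SS. cmp (t_bar n k (c (e s)) \<odot> e s) ?i)"
        by (subst zz[symmetric]) (simp add: iota_zero)
      also have "\<dots> = (\<Sum>s\<in>SS. iota 0 (cmp (t_bar n k (c (e s)) \<odot> e s) ?i))"
        by (rule additive_map_finsum[OF abelian_group_axioms iota_add]) (use comp_closed teN in auto)
      also have "\<dots> = (\<Sum>s\<in>SS. (\<lambda>b. (if h s \<le> l then Polynomial.coeff (c (e s)) (l - h s) else 0) * s b))"
      proof (intro sum.cong refl)
        fix s assume s: "s \<in> SS"
        have n: "nat (int l - int (h s)) = l - h s" by (simp add: nat_diff_distrib)
        show "iota 0 (cmp (t_bar n k (c (e s)) \<odot> e s) ?i) = (\<lambda>b. (if h s \<le> l then Polynomial.coeff (c (e s)) (l - h s) else 0) * s b)"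
        proof (cases "h s \<le> l")
          case True
          have "iota 0 (act (l - h s) (l - h s) (e s)) = s"
            using iota_act[OF eN[OF s], of 0 "l - h s" "l - h s"] e(2)[OF s] by simp
          thus ?thesis using True by (simp add: t_bar_comp[OF e(1)[OF s]] n iota_scal act_closed eN[OF s])
        qed (simp add: t_bar_comp[OF e(1)[OF s]] iota_zero zero_fun_def)
      qed
      finally show ?thesis by (rule sym)
    qed
    have ind: "CV.independent SS" using i0 S(4) by simp
    show "\<forall>b\<in>e ` SS. c b = 0"
    proof (intro ballI, elim imageE)
      fix b s assume b: "b = e s" "s \<in> SS"
      have "Polynomial.coeff (c (e s)) d = 0" for d
        using CV.independentD[OF ind SSfin subset_refl van[of "h s + d"] b(2)] by simp
      thus "c b = 0" using b by (simp add: poly_eq_iff)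
    qed
  qed (use SSfin eP in auto)
  from free_rank_eq_card[OF mod this] SSfin have r: "rank_Gamma n k N = card SS"
    using card_image[OF inj] by (simp add: rank_Gamma_def)
  have dS: "cdim (U i) = card (S i)" for i
    by (rule CV.dim_eq_card[OF _ S(4)]) (metis S(5) CV.span_span)
  have up0: "cdim (V 0 m) \<le> card SS" for m
  proof (cases "m < m0")
    case True thus ?thesis using Vlow by (simp add: cdim_zero)
  next
    case False
    hence "V 0 m = U (nat (m - m0 + 1))" by (simp add: U_def)
    moreover have "card (S (nat (m - m0 + 1))) \<le> card SS" by (rule card_mono[OF SSfin]) (auto simp: SS_def)
    ultimately show ?thesis by (simp add: dS)
  qed
  have dm: "cdim (V j m) \<le> cdim (V j' m')" if "V j m \<subseteq> V j' m'" for j m j' m'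
    by (rule cdim_le(1)[OF finite_B V_supported V_subspace V_subspace that])
  have upj: "cdim (V j m) \<le> card SS" if "0 \<le> j" "j < int n" for j m
  proof -
    \<comment> \<open>x^(n-j) takes the chain j into the chain n, which is the chain 0 raised by
      n-k.\<close>
    have "V j m \<subseteq> V (int n) m" using V_act[of j m "nat (int n - j)" 0] that by simp
    also have "V (int n) m = V 0 (m + (int n - int k))" using V_shift[of 0 1 m] by simp
    finally show ?thesis using dm up0 le_trans by blast
  qed
  show "0 \<le> j \<Longrightarrow> j < int n \<Longrightarrow> cdim (V j m) \<le> rank_Gamma n k N" using upj r by simp
  show "\<exists>m. cdim (V j m) = rank_Gamma n k N" if j: "0 \<le> j" "j < int n"
  proof -
    have "V 0 (m0 - 1 + int i0) \<subseteq> V j (m0 - 1 + int i0)" using V_act[of 0 "m0 - 1 + int i0" "nat j" 0] j by simp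
    moreover have "cdim (V 0 (m0 - 1 + int i0)) = card SS" using dS[of i0] i0 by (simp add: U_def)
    ultimately have "card SS \<le> cdim (V j (m0 - 1 + int i0))" using dm by metis
    hence "cdim (V j (m0 - 1 + int i0)) = rank_Gamma n k N" using upj[OF j, of "m0 - 1 + int i0"] r by simp
    thus ?thesis ..
  qed
qed

end

section \<open>Contours and rank one modules\<close>

text \<open>\<open>H j\<close> is the height at which the contour starts in the chain j deg(x) + Z (deg(x) + deg(y)); a
  family \<open>w\<close> supported above the contour is encoded as an element of \<open>L_module\<close>.\<close>

definition encode :: "nat \<Rightarrow> (int \<Rightarrow> int) \<Rightarrow> (int \<Rightarrow> int \<Rightarrow> complex) \<Rightarrow> int \<Rightarrow> complex fps" where
  "encode n H w = (\<lambda>j\<in>{0..<int n}. Abs_fps (\<lambda>e. w j (H j + int e)))"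

text \<open>\<open>H\<close> is the boundary of a set of degrees that is closed under x and y.
  Closure under x gives H j \<le> H (j - 1), closure under y gives H (j - 1) \<le> H j + 1, and n
  deg(x) = (n-k) (deg(x) + deg(y)) gives the period. The a at which the boundary stays level form
  the shape.\<close>

locale contour =
  fixes n k :: nat and H :: "int \<Rightarrow> int" and I :: "nat set"
  assumes k1: "1 \<le> k" and kn: "k < n"
    and H_period: "\<And>j s. H (j + int n * s) = H j - (int n - int k) * s"
    and H_step: "\<And>j. H j = H (j - 1) \<or> H j = H (j - 1) - 1"
    and I_def: "I = {a \<in> {1..n}. H (int a) = H (int a - 1)}"
begin

text \<open>Consecutive values of H shift by the same amount over a period, so whether H stays level
  at a depends only on a modulo n.\<close>

lemma in_type_iff: "in_type n I a \<longleftrightarrow> H a = H (a - 1)"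
proof -
  have per: "H (b + int n * s) = H (b + int n * s - 1) \<longleftrightarrow> H b = H (b - 1)" for b s
  proof -
    have "b - 1 + int n * s = b + int n * s - 1" by simp
    hence "H (b + int n * s - 1) = H (b - 1) - (int n - int k) * s" using H_period[of "b - 1" s] by metis
    thus ?thesis using H_period[of b s] by linarith
  qed
  show ?thesis
  proof
    assume "in_type n I a"
    then obtain b where b: "b \<in> I" "int b mod int n = a mod int n" by (auto simp: in_type_def)
    then obtain s where "a = int b + int n * s"
      by (metis mod_eqE add_diff_cancel_left' diff_add_cancel add.commute)
    thus "H a = H (a - 1)" using per[of "int b" s] b(1) by (simp add: I_def)
  next
    assume a: "H a = H (a - 1)"
    \<comment> \<open>The representative of a in {1..n}, since types are subsets of {1..n} while
      degrees are taken in {0..<n}.\<close>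
    define b where "b = nat ((a - 1) mod int n) + 1"
    have ib: "int b = (a - 1) mod int n + 1" using kn by (simp add: b_def)
    have "a = int b + int n * ((a - 1) div int n)" 
      using mult_div_mod_eq[of "int n" "a - 1"] ib by linarith
    hence Hb: "H (int b) = H (int b - 1)" using per[of "int b" "(a - 1) div int n"] a by metis
    have "int b \<le> int n" using pos_mod_bound[of "int n" "a - 1"] kn ib by linarith
    hence "b \<le> n" by (simp only: of_nat_le_iff)
    moreover have "1 \<le> b" by (simp add: b_def)
    ultimately have "b \<in> I" using Hb by (simp add: I_def)
    moreover have "int b mod int n = a mod int n" unfolding ib by (simp add: mod_add_left_eq)
    ultimately show "in_type n I a" by (auto simp: in_type_def)
  qed
qed

text \<open>Over one period H drops by n - k in steps of 0 or 1, so n - k of the n steps drop and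
  the other k make up I.\<close>

lemma k_subset: "k_subset n k I"
proof -
  have tel: "(\<Sum>a=1..m. H (int a - 1) - H (int a)) = H 0 - H (int m)" for m
    by (induction m) simp_all
  have IS: "I \<subseteq> {1..n}" by (auto simp: I_def)
  have "int n - int k = (\<Sum>a=1..n. H (int a - 1) - H (int a))"
    unfolding tel using H_period[of 0 1] by simp
  also have "\<dots> = (\<Sum>a=1..n. if a \<in> I then 0 else 1)"
  proof (intro sum.cong refl)
    fix a assume "a \<in> {1..n}"
    thus "H (int a - 1) - H (int a) = (if a \<in> I then 0 else 1)" using H_step[of "int a"] by (auto simp: I_def)
  qed
  also have "\<dots> = (\<Sum>a\<in>{1..n} - I. 1)"
    by (rule sum.mono_neutral_cong_right) auto
  also have "\<dots> = int (card ({1..n} - I))" by simp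
  also have "card ({1..n} - I) = n - card I"
    using card_Diff_subset[OF finite_subset[OF IS finite_atLeastAtMost] IS] by simp
  also have "card I \<le> n" using card_mono[OF finite_atLeastAtMost IS] by simp
  hence "int (n - card I) = int n - int (card I)" by (simp add: of_nat_diff)
  finally have "card I = k" by simp
  thus ?thesis by (auto simp: k_subset_def I_def)
qed

text \<open>An admissible w is a function on degrees, written in the redundant coordinates (j, m),
  that vanishes below the contour.\<close>

definition adm :: "(int \<Rightarrow> int \<Rightarrow> complex) \<Rightarrow> bool" where
  "adm w \<longleftrightarrow> (\<forall>j m s. w (j + int n * s) m = w j (m + (int n - int k) * s)) \<and> (\<forall>j m. m < H j \<longrightarrow> w j m = 0)"

lemma adm_shift_x: "adm w \<Longrightarrow> adm (\<lambda>j m. w (j - 1) m)"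
  unfolding adm_def
proof (intro conjI allI impI, elim conjE)
  fix j m s assume "\<forall>j m s. w (j + int n * s) m = w j (m + (int n - int k) * s)"
  hence "w ((j - 1) + int n * s) m = w (j - 1) (m + (int n - int k) * s)" by blast
  thus "w (j + int n * s - 1) m = w (j - 1) (m + (int n - int k) * s)" by (simp add: algebra_simps)
next
  fix j m assume *: "(\<forall>j m s. w (j + int n * s) m = w j (m + (int n - int k) * s)) \<and> (\<forall>j m. m < H j \<longrightarrow> w j m = 0)" "m < H j"
  have "m < H (j - 1)" using *(2) H_step[of j] by linarith
  thus "w (j - 1) m = 0" using * by blast
qed

lemma adm_shift_y: "adm w \<Longrightarrow> adm (\<lambda>j m. w (j + 1) (m - 1))"
  unfolding adm_def
proof (intro conjI allI impI, elim conjE)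
  fix j m s assume "\<forall>j m s. w (j + int n * s) m = w j (m + (int n - int k) * s)"
  hence "w ((j + 1) + int n * s) (m - 1) = w (j + 1) (m - 1 + (int n - int k) * s)" by blast
  moreover have "(j + 1) + int n * s = j + int n * s + 1" "m - 1 + (int n - int k) * s = m + (int n - int k) * s - 1" by simp_all
  ultimately show "w (j + int n * s + 1) (m - 1) = w (j + 1) (m + (int n - int k) * s - 1)" by metis
next
  fix j m assume *: "(\<forall>j m s. w (j + int n * s) m = w j (m + (int n - int k) * s)) \<and> (\<forall>j m. m < H j \<longrightarrow> w j m = 0)" "m < H j"
  have "m - 1 < H (j + 1)" using *(2) H_step[of "j + 1"] by simp linarith
  thus "w (j + 1) (m - 1) = 0" using * by blast
qed

text \<open>\<open>encode\<close> lives on 0 \<le> j < n, but the periods of w and of H cancel, so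
  the same formula is valid at every integer j.\<close>

lemma encode_mod: assumes "adm w"
  shows "encode n H w (j mod int n) = Abs_fps (\<lambda>e. w j (H j + int e))"
proof -
  have j: "j mod int n + int n * (j div int n) = j" by simp
  have "w j m = w (j mod int n) (m + (int n - int k) * (j div int n))" for m
    using assms unfolding adm_def by (metis j)
  moreover have "H j + int e + (int n - int k) * (j div int n) = H (j mod int n) + int e" for e
    using H_period[of "j mod int n" "j div int n"] unfolding j by linarith
  ultimately have "w j (H j + int e) = w (j mod int n) (H (j mod int n) + int e)" for e by metis
  moreover have "j mod int n \<in> {0..<int n}" using kn by simp
  ultimately show ?thesis unfolding encode_def by simp
qed

text \<open>The series at j starts at height \<open>H j\<close>. If a - 1 and a have equal starting
  heights, x leaves the series unchanged; if the start drops by one, the vanishing coefficient at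
  the new start amounts to a factor t. These are the two cases of \<open>L_x\<close>.\<close>

lemma L_x_encode: assumes "adm w" shows "L_x n I (encode n H w) = encode n H (\<lambda>j m. w (j - 1) m)"
proof
  fix a
  show "L_x n I (encode n H w) a = encode n H (\<lambda>j m. w (j - 1) m) a"
  proof (cases "a \<in> {0..<int n}")
    case False thus ?thesis unfolding L_x_def encode_def restrict_def by (simp only: if_False)
  next
    case a: True
    show ?thesis
    proof (cases "H a = H (a - 1)")
      case True
      thus ?thesis using a encode_mod[OF assms, of "a - 1"] in_type_iff[of a] by (simp add: L_x_def) (simp add: encode_def)
    next
      case False
      hence Ha: "H a = H (a - 1) - 1" using H_step[of a] by simp
      have "fps_X * Abs_fps (\<lambda>e. w (a - 1) (H (a - 1) + int e)) = Abs_fps (\<lambda>e. w (a - 1) (H a + int e))"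
      proof (rule fps_ext)
        fix e show "fps_nth (fps_X * Abs_fps (\<lambda>e. w (a - 1) (H (a - 1) + int e))) e = fps_nth (Abs_fps (\<lambda>e. w (a - 1) (H a + int e))) e"
        proof (cases e)
          case 0
          have "w (a - 1) (H a) = 0" using assms Ha by (simp add: adm_def)
          thus ?thesis using 0 by simp
        next
          case (Suc e') thus ?thesis by (simp add: Ha algebra_simps)
        qed
      qed
      thus ?thesis using a False encode_mod[OF assms, of "a - 1"] in_type_iff[of a] by (simp add: L_x_def) (simp add: encode_def)
    qed
  qed
qed

text \<open>Here y takes height m - 1 at b + 1 to height m at b. If both series start at the same
  height this is a factor t; if the series at b starts one higher, the two shifts cancel.\<close>

lemma L_y_encode: assumes "adm w" shows "L_y n I (encode n H w) = encode n H (\<lambda>j m. w (j + 1) (m - 1))"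
proof
  fix b
  show "L_y n I (encode n H w) b = encode n H (\<lambda>j m. w (j + 1) (m - 1)) b"
  proof (cases "b \<in> {0..<int n}")
    case False thus ?thesis unfolding L_y_def encode_def restrict_def by (simp only: if_False)
  next
    case b: True
    show ?thesis
    proof (cases "H (b + 1) = H b")
      case False
      hence Hb: "H (b + 1) = H b - 1" using H_step[of "b + 1"] by simp
      have "Abs_fps (\<lambda>e. w (b + 1) (H (b + 1) + int e)) = Abs_fps (\<lambda>e. w (b + 1) (H b + int e - 1))"
      proof -
        have eq: "H (b + 1) + int e = H b + int e - 1" for e using Hb by simp
        show ?thesis by (simp only: eq)
      qed
      thus ?thesis using b False encode_mod[OF assms, of "b + 1"] in_type_iff[of "b + 1"] by (simp add: L_y_def) (simp add: encode_def)
    next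
      case True
      have "fps_X * Abs_fps (\<lambda>e. w (b + 1) (H (b + 1) + int e)) = Abs_fps (\<lambda>e. w (b + 1) (H b + int e - 1))"
      proof (rule fps_ext)
        fix e show "fps_nth (fps_X * Abs_fps (\<lambda>e. w (b + 1) (H (b + 1) + int e))) e = fps_nth (Abs_fps (\<lambda>e. w (b + 1) (H b + int e - 1))) e"
        proof (cases e)
          case 0
          have "w (b + 1) (H b - 1) = 0" using assms True by (simp add: adm_def)
          thus ?thesis using 0 by simp
        next
          case (Suc e')
          have "H (b + 1) + int e' = H b + int (Suc e') - 1" using True by simp
          hence "w (b + 1) (H (b + 1) + int e') = w (b + 1) (H b + int (Suc e') - 1)" by (simp only:)
          thus ?thesis using Suc by simp
        qed
      qed
      thus ?thesis using b True encode_mod[OF assms, of "b + 1"] in_type_iff[of "b + 1"] by (simp add: L_y_def) (simp add: encode_def)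
    qed
  qed
qed

lemma L_y_pow: assumes "adm w"
  shows "(L_y n I ^^ q) (encode n H w) = encode n H (\<lambda>j m. w (j + int q) (m - int q)) \<and> adm (\<lambda>j m. w (j + int q) (m - int q))"
proof (induction q)
  case 0 thus ?case using assms by simp
next
  case (Suc q)
  have "(\<lambda>j m. w (j + 1 + int q) (m - 1 - int q)) = (\<lambda>j m. w (j + int (Suc q)) (m - int (Suc q)))"
    by (intro ext) (simp add: algebra_simps)
  thus ?case using Suc L_y_encode[of "\<lambda>j m. w (j + int q) (m - int q)"] adm_shift_y[of "\<lambda>j m. w (j + int q) (m - int q)"]
    by simp
qed

lemma L_x_pow: assumes "adm w"
  shows "(L_x n I ^^ p) (encode n H w) = encode n H (\<lambda>j m. w (j - int p) m) \<and> adm (\<lambda>j m. w (j - int p) m)"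
proof (induction p)
  case 0 thus ?case using assms by simp
next
  case (Suc p)
  have "(\<lambda>j m. w (j - 1 - int p) m) = (\<lambda>j m. w (j - int (Suc p)) m)"
    by (intro ext) (simp add: algebra_simps)
  thus ?case using Suc L_x_encode[of "\<lambda>j m. w (j - int p) m"] adm_shift_x[of "\<lambda>j m. w (j - int p) m"]
    by simp
qed

lemma L_pow_nth: assumes "adm w" "j \<in> {0..<int n}"
  shows "fps_nth ((L_x n I ^^ p) ((L_y n I ^^ q) (encode n H w)) j) e = w (j - int p + int q) (H j + int e - int q)"
  using L_y_pow[OF assms(1), of q] L_x_pow[of "\<lambda>j m. w (j + int q) (m - int q)" p] assms(2)
  by (simp add: encode_def algebra_simps)

lemma encode_surj: assumes "v \<in> carrier (L_module n I)"
  obtains w where "adm w" "encode n H w = v"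
proof
  define w where "w j m = (if m < H j then 0 else fps_nth (v (j mod int n)) (nat (m - H j)))" for j m
  show "adm w" unfolding adm_def
  proof (intro conjI allI impI)
    fix j m s
    have e: "(m < H (j + int n * s)) = (m + (int n - int k) * s < H j)"
       "m - H (j + int n * s) = m + (int n - int k) * s - H j"
      using H_period[of j s] by linarith+
    show "w (j + int n * s) m = w j (m + (int n - int k) * s)" unfolding w_def by (simp only: e mod_mult_self2)
  qed (simp add: w_def)
  show "encode n H w = v"
  proof
    fix j show "encode n H w j = v j"
      using assms by (cases "j \<in> {0..<int n}") (auto simp: encode_def w_def L_module_def Let_def PiE_def extensional_def fps_eq_iff)
  qed
qed

text \<open>\<open>w False\<close> is the family acted on and \<open>w True\<close> the result. The
  index sets \<open>A j m\<close> may be larger than the sets of nonzero terms over which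
  \<open>L_module\<close> sums; both sides use the same representative of C.\<close>

lemma L_smult_encode:
  assumes w: "\<And>z. adm (w z)" and fin: "\<And>j m. finite (A j m)"
    and A: "\<And>j m p q. w False (j - int p + int q) (m - int q) \<noteq> 0 \<Longrightarrow> (p, q) \<in> A j m"
    and eq: "\<And>j m. w True j m = (\<Sum>(p, q)\<in>A j m. fps_nth (fps_nth (SOME f. f \<in> C) q) p * w False (j - int p + int q) (m - int q))"
  shows "encode n H (w True) = C \<odot>\<^bsub>L_module n I\<^esub> encode n H (w False)"
proof
  fix j
  let ?f = "SOME f. f \<in> C"
  show "encode n H (w True) j = (C \<odot>\<^bsub>L_module n I\<^esub> encode n H (w False)) j"
  proof (cases "j \<in> {0..<int n}")
    case True
    have "w True j (H j + int e) = (\<Sum>(p, q)\<in>{(p, q). w False (j - int p + int q) (H j + int e - int q) \<noteq> 0}. 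
         fps_nth (fps_nth ?f q) p * w False (j - int p + int q) (H j + int e - int q))" for e
      unfolding eq by (rule sum.mono_neutral_right[OF fin]) (use A in auto)
    thus ?thesis using True by (simp add: L_module_def Let_def L_pow_nth[OF w] encode_def[of n H "w True"])
  qed (simp add: L_module_def Let_def encode_def restrict_def del: atLeastLessThan_iff)
qed

end

section \<open>Filtrations of completed modules\<close>

text \<open>The first isomorphism theorem for A / N. The kernel condition is split into
  \<open>absorb\<close> and \<open>fibre\<close>, which compare values of \<psi> instead of
  mentioning the zero of L, so that L may be a bare record of operations.\<close>

lemma giso_gquot:
  fixes M :: "('a, 'b, 'g) gmodule" (structure) and L :: "('a, 'c, 'g) gmodule"
  assumes "module R M" "A \<subseteq> carrier M" "N \<subseteq> A" "\<zero> \<in> N"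
    and Aadd: "\<And>u v. u \<in> A \<Longrightarrow> v \<in> A \<Longrightarrow> u \<oplus> v \<in> A"
    and Asm: "\<And>r u. r \<in> carrier R \<Longrightarrow> u \<in> A \<Longrightarrow> r \<odot> u \<in> A"
    and Nadd: "\<And>u v. u \<in> N \<Longrightarrow> v \<in> N \<Longrightarrow> u \<oplus> v \<in> N" and Nneg: "\<And>u. u \<in> N \<Longrightarrow> \<ominus> u \<in> N"
    and add: "\<And>u v. u \<in> A \<Longrightarrow> v \<in> A \<Longrightarrow> \<psi> (u \<oplus> v) = \<psi> u \<oplus>\<^bsub>L\<^esub> \<psi> v"
    and smult: "\<And>r u. r \<in> carrier R \<Longrightarrow> u \<in> A \<Longrightarrow> \<psi> (r \<odot> u) = r \<odot>\<^bsub>L\<^esub> \<psi> u"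
    and absorb: "\<And>h u. h \<in> N \<Longrightarrow> u \<in> A \<Longrightarrow> \<psi> (h \<oplus> u) = \<psi> u"
    and fibre: "\<And>u v. u \<in> A \<Longrightarrow> v \<in> A \<Longrightarrow> \<psi> u = \<psi> v \<Longrightarrow> \<exists>h\<in>N. u = h \<oplus> v"
    and surj: "\<psi> ` A = carrier L"
    and grade: "\<And>i u. i \<in> carrier \<Lambda> \<Longrightarrow> u \<in> A \<Longrightarrow> u \<in> grade M i \<Longrightarrow> \<psi> u \<in> grade L i"
  shows "giso \<Lambda> R (gquot (gsub M A) N) L"
proof -
  interpret module R M by fact
  let ?c = "\<lambda>a. (\<lambda>h. h \<oplus> a) ` N"
  have AM: "u \<in> A \<Longrightarrow> u \<in> carrier M" for u using assms(2) by blast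
  have NA: "u \<in> N \<Longrightarrow> u \<in> A" for u using assms(3) by blast
  have coset: "N +>\<^bsub>gsub M A\<^esub> a = ?c a" for a
    by (auto simp: a_r_coset_def r_coset_def gsub_def)
  \<comment> \<open>Any representative will do, since by \<open>absorb\<close> the map \<psi> is
    constant on cosets.\<close>
  define f where "f Z = \<psi> (SOME m. m \<in> Z)" for Z
  have fZ: "f Z = c" if "x \<in> Z" "\<And>x. x \<in> Z \<Longrightarrow> \<psi> x = c" for x Z c
    unfolding f_def by (rule that(2)) (rule someI[of "\<lambda>m. m \<in> Z", OF that(1)])
  have self: "a \<in> ?c a" if "a \<in> A" for a
    using assms(4) AM[OF that] by (intro image_eqI[of _ _ "\<zero>"]) simp_all
  have el: "\<psi> x = \<psi> a" if "a \<in> A" "x \<in> ?c a" for a x using that absorb by auto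
  have fc: "f (?c a) = \<psi> a" if "a \<in> A" for a by (rule fZ[OF self[OF that] el[OF that]])
  have car: "carrier (gquot (gsub M A) N) = ?c ` A"
    by (auto simp: gquot_def A_RCOSETS_def RCOSETS_def a_r_coset_def[symmetric] coset) (auto simp: gsub_def)
  have cA: "?c a \<subseteq> A" if "a \<in> A" for a using that NA Aadd by auto
  have ghom: "f \<in> ghom \<Lambda> R (gquot (gsub M A) N) L"
    unfolding ghom_def
  proof (intro CollectI conjI ballI)
    show "f \<in> carrier (gquot (gsub M A) N) \<rightarrow> carrier L" using fc surj unfolding car by auto
  next
    fix Z W assume "Z \<in> carrier (gquot (gsub M A) N)" "W \<in> carrier (gquot (gsub M A) N)"
    then obtain a b where ab: "Z = ?c a" "W = ?c b" "a \<in> A" "b \<in> A" unfolding car by blast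
    have e: "Z \<oplus>\<^bsub>gquot (gsub M A) N\<^esub> W = (\<Union>x\<in>Z. \<Union>y\<in>W. {x \<oplus> y})"
      by (simp add: gquot_def set_add_def set_mult_def gsub_def)
    have "f (Z \<oplus>\<^bsub>gquot (gsub M A) N\<^esub> W) = \<psi> a \<oplus>\<^bsub>L\<^esub> \<psi> b"
    proof (rule fZ)
      show "a \<oplus> b \<in> Z \<oplus>\<^bsub>gquot (gsub M A) N\<^esub> W" unfolding e unfolding ab
        by (rule UN_I[OF self[OF ab(3)]], rule UN_I[OF self[OF ab(4)]]) simp
      fix z assume "z \<in> Z \<oplus>\<^bsub>gquot (gsub M A) N\<^esub> W"
      then obtain x y where xy: "x \<in> ?c a" "y \<in> ?c b" "z = x \<oplus> y" unfolding e unfolding ab by blast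
      have "x \<in> A" "y \<in> A" using xy cA ab by blast+
      thus "\<psi> z = \<psi> a \<oplus>\<^bsub>L\<^esub> \<psi> b" using xy(3) add el[OF ab(3) xy(1)] el[OF ab(4) xy(2)] by simp
    qed
    thus "f (Z \<oplus>\<^bsub>gquot (gsub M A) N\<^esub> W) = f Z \<oplus>\<^bsub>L\<^esub> f W" using fc ab by simp
  next
    fix r Z assume r: "r \<in> carrier R" and "Z \<in> carrier (gquot (gsub M A) N)"
    then obtain a where a: "Z = ?c a" "a \<in> A" unfolding car by blast
    have e: "r \<odot>\<^bsub>gquot (gsub M A) N\<^esub> Z = (\<Union>m\<in>Z. ?c (r \<odot> m))"
      by (simp add: gquot_def coset) (simp add: gsub_def)
    have "f (r \<odot>\<^bsub>gquot (gsub M A) N\<^esub> Z) = r \<odot>\<^bsub>L\<^esub> \<psi> a"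
    proof (rule fZ)
      show "r \<odot> a \<in> r \<odot>\<^bsub>gquot (gsub M A) N\<^esub> Z" unfolding e unfolding a
        by (rule UN_I[OF self[OF a(2)]], rule self[OF Asm[OF r a(2)]])
      fix z assume "z \<in> r \<odot>\<^bsub>gquot (gsub M A) N\<^esub> Z"
      then obtain m where m: "m \<in> ?c a" "z \<in> ?c (r \<odot> m)" unfolding e unfolding a by blast
      have mA: "m \<in> A" using m cA a by blast
      have "\<psi> z = \<psi> (r \<odot> m)" by (rule el[OF Asm[OF r mA] m(2)])
      also have "\<dots> = r \<odot>\<^bsub>L\<^esub> \<psi> a" using smult[OF r mA] el[OF a(2) m(1)] by simp
      finally show "\<psi> z = r \<odot>\<^bsub>L\<^esub> \<psi> a" .
    qed
    thus "f (r \<odot>\<^bsub>gquot (gsub M A) N\<^esub> Z) = r \<odot>\<^bsub>L\<^esub> f Z" using fc a by simp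
  next
    fix i assume i: "i \<in> carrier \<Lambda>"
    have "grade (gquot (gsub M A) N) i = ?c ` (A \<inter> grade M i)"
      by (simp add: gquot_def coset) (simp add: gsub_def)
    thus "f ` grade (gquot (gsub M A) N) i \<subseteq> grade L i" using fc grade[OF i] by auto
  qed
  have "bij_betw f (carrier (gquot (gsub M A) N)) (carrier L)"
  proof (rule bij_betwI')
    fix Z W assume "Z \<in> carrier (gquot (gsub M A) N)" "W \<in> carrier (gquot (gsub M A) N)"
    then obtain a b where ab: "Z = ?c a" "W = ?c b" "a \<in> A" "b \<in> A" unfolding car by blast
    have sub: "?c a \<subseteq> ?c b" if ab: "a \<in> A" "b \<in> A" "\<psi> a = \<psi> b" for a b
    proof
      fix x assume "x \<in> ?c a"
      then obtain h where h: "h \<in> N" "x = h \<oplus> a" by blast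
      obtain h' where h': "h' \<in> N" "a = h' \<oplus> b" using fibre[OF ab] by blast
      have "x = (h \<oplus> h') \<oplus> b" using h h' AM NA ab by (simp add: a_assoc)
      thus "x \<in> ?c b" using Nadd h h' by blast
    qed
    show "(f Z = f W) = (Z = W)"
    proof
      assume "f Z = f W"
      hence "\<psi> a = \<psi> b" using fc ab by metis
      thus "Z = W" unfolding ab(1,2) using sub[of a b] sub[of b a] ab(3,4) by (intro equalityI) simp_all
    qed simp
  next
    fix Z assume "Z \<in> carrier (gquot (gsub M A) N)"
    thus "f Z \<in> carrier L" using ghom by (auto simp: ghom_def)
  next
    fix v assume "v \<in> carrier L"
    then obtain a where "a \<in> A" "v = \<psi> a" using surj by blast
    thus "\<exists>Z\<in>carrier (gquot (gsub M A) N). v = f Z" using fc unfolding car by force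
  qed
  thus ?thesis using ghom by (auto simp: giso_def)
qed

lemma functional_sum: assumes "functional \<phi>" shows "\<phi> (\<Sum>z\<in>A. f z) = (\<Sum>z\<in>A. \<phi> (f z))"
proof -
  have "\<phi> (u + v) = \<phi> u + \<phi> v" for u v using assms by (simp add: functional_def)
  thus ?thesis using functional_zero[OF assms] by (induction A rule: infinite_finite_induct) simp_all
qed

section \<open>The completion, its values in the common space, and the contours of a graded
  module\<close>

context gamma_mod
begin

abbreviation "CC \<equiv> completion n k N"

lemma CC_carrier: "carrier CC = (\<Pi>\<^sub>E i\<in>carrier \<Lambda>. grade N i)"
  and CC_zero: "\<zero>\<^bsub>CC\<^esub> = (\<lambda>i\<in>carrier \<Lambda>. \<zero>)"
  and CC_add: "u \<oplus>\<^bsub>CC\<^esub> v = (\<lambda>i\<in>carrier \<Lambda>. u i \<oplus> v i)"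
  and CC_grade: "grade CC j = {u \<in> carrier CC. \<forall>i\<in>carrier \<Lambda>. res_deg n i \<noteq> j \<longrightarrow> u i = \<zero>}"
  by (simp_all add: completion_def Let_def)

lemma CC_smult: "C \<odot>\<^bsub>CC\<^esub> u = (\<lambda>i\<in>carrier \<Lambda>. \<Oplus>pq\<in>{pq. u (i \<otimes>\<^bsub>\<Lambda>\<^esub> inv\<^bsub>\<Lambda>\<^esub> char_class n k (int (fst pq)) (int (snd pq))) \<noteq> \<zero>}.
   clbar n k (mon_pol (fps_nth (fps_nth (SOME f. f \<in> C) (snd pq)) (fst pq)) (fst pq) (snd pq)) \<odot> u (i \<otimes>\<^bsub>\<Lambda>\<^esub> inv\<^bsub>\<Lambda>\<^esub> char_class n k (int (fst pq)) (int (snd pq))))"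
  by (simp add: completion_def Let_def mon_pol_def split_def)

text \<open>The component of u that x^p y^q carries to the degree \<open>pt n k j m\<close>, where z
  = (p, q).\<close>

definition low :: "((int \<times> int) set \<Rightarrow> 'b) \<Rightarrow> int \<Rightarrow> int \<Rightarrow> nat \<times> nat \<Rightarrow> 'b" where
  "low u j m z = u (pt n k (j - int (fst z) + int (snd z)) (m - int (snd z)))"

lemma CC_pt: "u \<in> carrier CC \<Longrightarrow> u (pt n k j m) \<in> grade N (pt n k j m)"
  by (simp add: CC_carrier PiE_iff)

lemma CC_ext: assumes "u \<in> carrier CC" "v \<in> carrier CC" "\<And>j m. 0 \<le> j \<Longrightarrow> j < int n \<Longrightarrow> u (pt n k j m) = v (pt n k j m)"
  shows "u = v"
proof (rule PiE_ext[OF assms(1,2)[unfolded CC_carrier]])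
  fix i assume "i \<in> carrier \<Lambda>"
  thus "u i = v i" using Gamma_ex[of i n k] kn assms(3) by auto
qed

lemma low_grade: "u \<in> carrier CC \<Longrightarrow> low u j m z \<in> grade N (pt n k (j - int (fst z) + int (snd z)) (m - int (snd z)))"
  unfolding low_def by (rule CC_pt)

text \<open>The weight (n-k) j + n m of a degree is at least n m0 on the support of N, and going
  down by x^p y^q lowers it by (n-k) p + k q. Both coefficients are at least 1, so p and q are at
  most K.\<close>

lemma low_finite: assumes u: "u \<in> carrier CC" shows "finite {z. low u j m z \<noteq> \<zero>}"
proof -
  obtain m0 where m0: "\<And>j m. 0 \<le> j \<Longrightarrow> j < int n \<Longrightarrow> m < m0 \<Longrightarrow> grade N (pt n k j m) = {\<zero>}"
    using bounded_below by blast
  define K where "K = int n * m + (int n - int k) * j - int n * m0"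
  have "int (fst z) \<le> K \<and> int (snd z) \<le> K" if z: "low u j m z \<noteq> \<zero>" for z
  proof -
    obtain p q where pq: "z = (p, q)" by (cases z)
    let ?j = "j - int p + int q" let ?s = "?j div int n"
    have "pt n k ?j (m - int q) = pt n k (?j mod int n + int n * ?s) (m - int q)" by simp
    also have "\<dots> = pt n k (?j mod int n) (m - int q + (int n - int k) * ?s)" by (rule pt_shift)
    finally have e: "pt n k ?j (m - int q) = pt n k (?j mod int n) (m - int q + (int n - int k) * ?s)" .
    have "m0 \<le> m - int q + (int n - int k) * ?s"
    proof (rule ccontr)
      assume "\<not> ?thesis"
      hence "grade N (pt n k ?j (m - int q)) = {\<zero>}" unfolding e using m0 kn by simp
      thus False using low_grade[OF u, of j m z] z by (simp add: pq)
    qed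
    hence "int n * m0 \<le> int n * (m - int q + (int n - int k) * ?s)" by (intro mult_left_mono) simp_all
    also have "\<dots> = int n * (m - int q) + (int n - int k) * (int n * ?s)" by (simp add: algebra_simps)
    also have "(int n - int k) * (int n * ?s) \<le> (int n - int k) * ?j"
    proof (rule mult_left_mono)
      show "int n * ?s \<le> ?j" using pos_mod_sign[of "int n" ?j] mult_div_mod_eq[of "int n" ?j] kn by linarith
    qed (use kn in simp)
    finally have "int k * int q + (int n - int k) * int p \<le> K" by (simp add: K_def algebra_simps)
    moreover have "int q \<le> int k * int q" using k1 by (simp add: mult_le_cancel_right1)
    moreover have "1 * int p \<le> (int n - int k) * int p" by (rule mult_right_mono) (use kn in auto)
    ultimately show ?thesis unfolding pq fst_conv snd_conv by linarith
  qed
  hence "{z. low u j m z \<noteq> \<zero>} \<subseteq> {..nat K} \<times> {..nat K}" by (auto simp: le_nat_iff) fastforce+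
  thus ?thesis by (rule finite_subset) simp
qed

lemma CC_smult_pt: assumes u: "u \<in> carrier CC"
  shows "(C \<odot>\<^bsub>CC\<^esub> u) (pt n k j m) = (\<Oplus>z\<in>{z. low u j m z \<noteq> \<zero>}.
    scal (fps_nth (fps_nth (SOME f. f \<in> C) (snd z)) (fst z)) (act (fst z) (snd z) (low u j m z)))"
proof -
  have lN: "low u j m z \<in> carrier N" for z using grade_carrier[OF pt_in low_grade[OF u]] .
  show ?thesis unfolding CC_smult pt_lower low_def[symmetric] restrict_apply if_P[OF pt_in]
    by (rule finsum_cong') (use lN scal_closed act_closed in \<open>auto simp: mon_act\<close>)
qed

lemma CC_smult_closed: assumes u: "u \<in> carrier CC" shows "C \<odot>\<^bsub>CC\<^esub> u \<in> carrier CC"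
proof -
  have "(C \<odot>\<^bsub>CC\<^esub> u) i \<in> grade N i" if i: "i \<in> carrier \<Lambda>" for i
  proof -
    obtain j m where jm: "i = pt n k j m" using Gamma_ex[OF i] kn by auto
    have "scal c (act (fst z) (snd z) (low u j m z)) \<in> grade N (pt n k j m)" for c z
      using grade_act[OF low_grade[OF u, of j m z], of "fst z" "snd z"] by (intro grade_scal[OF pt_in]) simp
    thus ?thesis unfolding jm CC_smult_pt[OF u] by (intro grade_finsum)
  qed
  moreover have "C \<odot>\<^bsub>CC\<^esub> u \<in> extensional (carrier \<Lambda>)" by (simp add: CC_smult)
  ultimately show ?thesis unfolding CC_carrier by (auto simp: PiE_iff)
qed

lemma CC_add_closed: "u \<in> carrier CC \<Longrightarrow> v \<in> carrier CC \<Longrightarrow> u \<oplus>\<^bsub>CC\<^esub> v \<in> carrier CC"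
  by (auto simp: CC_carrier CC_add PiE_iff grade_add)

lemma CC_zero_closed: "\<zero>\<^bsub>CC\<^esub> \<in> carrier CC"
  by (auto simp: CC_carrier CC_zero grade_zero)

text \<open>The completion is handled as a record of operations, so its negatives are written
  out.\<close>

definition CCneg :: "((int \<times> int) set \<Rightarrow> 'b) \<Rightarrow> (int \<times> int) set \<Rightarrow> 'b" where
  "CCneg u = (\<lambda>i\<in>carrier \<Lambda>. \<ominus> u i)"

lemma CCneg_closed: "u \<in> carrier CC \<Longrightarrow> CCneg u \<in> carrier CC"
  by (auto simp: CC_carrier CCneg_def PiE_iff grade_neg)

lemma CCneg_add: assumes "u \<in> carrier CC" shows "CCneg u \<oplus>\<^bsub>CC\<^esub> u = \<zero>\<^bsub>CC\<^esub>"
proof -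
  have "\<ominus> u i \<oplus> u i = \<zero>" if "i \<in> carrier \<Lambda>" for i
    using assms grade_carrier[OF that] that by (simp add: CC_carrier PiE_iff l_neg)
  thus ?thesis by (auto simp: CC_add CCneg_def CC_zero)
qed

definition val :: "((int \<times> int) set \<Rightarrow> 'b) \<Rightarrow> int \<Rightarrow> int \<Rightarrow> 'b \<Rightarrow> complex" where
  "val u j m = iota j (u (pt n k j m))"

lemma CC_val_carrier: "u \<in> carrier CC \<Longrightarrow> u (pt n k j m) \<in> carrier N"
  using grade_carrier[OF pt_in CC_pt] .

lemma val_add: "u \<in> carrier CC \<Longrightarrow> v \<in> carrier CC \<Longrightarrow> val (u \<oplus>\<^bsub>CC\<^esub> v) j m = val u j m + val v j m"
  by (simp add: val_def CC_add iota_add CC_val_carrier)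

lemma val_zero: "val \<zero>\<^bsub>CC\<^esub> j m = 0"
  by (simp add: val_def CC_zero iota_zero)

lemma val_neg: assumes "u \<in> carrier CC" shows "val (CCneg u) j m = - val u j m"
proof -
  have "val (CCneg u) j m + val u j m = 0"
    using val_add[OF CCneg_closed[OF assms] assms, of j m] by (simp add: CCneg_add[OF assms] val_zero)
  thus ?thesis by (simp add: eq_neg_iff_add_eq_0)
qed

lemma val_shift: "val u (j + int n * s) m = val u j (m + (int n - int k) * s)"
  by (simp add: val_def iota_shift pt_shift)

lemma val_in_V: "u \<in> carrier CC \<Longrightarrow> val u j m \<in> V j m"
  by (simp add: val_def V_def CC_pt)

lemma val_eq_0D: "u \<in> carrier CC \<Longrightarrow> val u j m = 0 \<Longrightarrow> u (pt n k j m) = \<zero>"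
  unfolding val_def by (rule iota_eq_0D[OF CC_pt])

lemma val_smult: assumes u: "u \<in> carrier CC"
  shows "val (C \<odot>\<^bsub>CC\<^esub> u) j m = (\<Sum>z\<in>{z. low u j m z \<noteq> \<zero>}.
    (\<lambda>b. fps_nth (fps_nth (SOME f. f \<in> C) (snd z)) (fst z) * val u (j - int (fst z) + int (snd z)) (m - int (snd z)) b))"
proof -
  have lN: "low u j m z \<in> carrier N" for z using grade_carrier[OF pt_in low_grade[OF u]] .
  have "val (C \<odot>\<^bsub>CC\<^esub> u) j m = (\<Sum>z\<in>{z. low u j m z \<noteq> \<zero>}. 
     iota j (scal (fps_nth (fps_nth (SOME f. f \<in> C) (snd z)) (fst z)) (act (fst z) (snd z) (low u j m z))))"
    unfolding val_def CC_smult_pt[OF u]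
    by (rule additive_map_finsum[OF abelian_group_axioms iota_add]) (use lN scal_closed act_closed in auto)
  also have "\<dots> = (\<Sum>z\<in>{z. low u j m z \<noteq> \<zero>}.
    (\<lambda>b. fps_nth (fps_nth (SOME f. f \<in> C) (snd z)) (fst z) * val u (j - int (fst z) + int (snd z)) (m - int (snd z)) b))"
  proof (intro sum.cong refl)
    fix z
    show "iota j (scal (fps_nth (fps_nth (SOME f. f \<in> C) (snd z)) (fst z)) (act (fst z) (snd z) (low u j m z))) =
       (\<lambda>b. fps_nth (fps_nth (SOME f. f \<in> C) (snd z)) (fst z) * val u (j - int (fst z) + int (snd z)) (m - int (snd z)) b)"
      using iota_act[OF lN[of z], of "j - int (fst z) + int (snd z)" "fst z" "snd z"]
        lN[of z, unfolded low_def] by (simp add: iota_scal act_closed val_def low_def)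
  qed
  finally show ?thesis .
qed

text \<open>A functional turns the action on families of vectors into the same convolution on
  families of scalars, the form in which it is compared with \<open>L_module\<close>.\<close>

lemma val_functional_smult: assumes u: "u \<in> carrier CC" and \<phi>: "functional \<phi>"
  shows "\<phi> (val (C \<odot>\<^bsub>CC\<^esub> u) j m) = (\<Sum>(p, q)\<in>{z. low u j m z \<noteq> \<zero>}.
    fps_nth (fps_nth (SOME f. f \<in> C) q) p * \<phi> (val u (j - int p + int q) (m - int q)))"
  unfolding val_smult[OF u] functional_sum[OF \<phi>]
  by (intro sum.cong refl) (use \<phi> in \<open>simp add: functional_def split_def\<close>)

definition part :: "((int \<times> int) set \<Rightarrow> 'b) \<Rightarrow> int \<Rightarrow> (int \<times> int) set \<Rightarrow> 'b" where
  "part u j = (\<lambda>i\<in>carrier \<Lambda>. if res_deg n i = j then u i else \<zero>)"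

lemma part_grade: "u \<in> carrier CC \<Longrightarrow> part u j \<in> grade CC j" "u \<in> carrier CC \<Longrightarrow> part u j \<in> carrier CC"
  by (auto simp: CC_grade CC_carrier part_def PiE_iff grade_zero)

lemma res_deg_bounds: "i \<in> carrier \<Lambda> \<Longrightarrow> 0 \<le> res_deg n i \<and> res_deg n i < int n"
  using Gamma_ex[of i n k] kn by (auto simp: res_deg_pt)

lemma V_cdim_mono: "V j m \<subseteq> V j' m' \<Longrightarrow> cdim (V j m) \<le> cdim (V j' m')"
  by (rule cdim_le(1)[OF finite_B V_supported V_subspace V_subspace])

lemma V_pt: "pt n k j m = pt n k j' m' \<Longrightarrow> V j m = V j' m'"
  unfolding pt_eq_iff by (elim exE conjE) (simp add: V_shift)

text \<open>Along a chain the dimensions do not decrease, are 0 far down and reach the rank, so the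
  heights with dimension at least d form a half-line.\<close>

lemma height_exists:
  assumes d: "1 \<le> d" "d \<le> rank_Gamma n k N"
  shows "\<exists>H. \<forall>j m. d \<le> cdim (V j m) \<longleftrightarrow> H j \<le> m"
proof (rule choice, rule allI)
  fix j
  obtain m0 where m0: "\<And>j m. 0 \<le> j \<Longrightarrow> j < int n \<Longrightarrow> m < m0 \<Longrightarrow> grade N (pt n k j m) = {\<zero>}"
    using bounded_below by blast
  let ?j = "j mod int n" and ?s = "j div int n"
  have j: "0 \<le> ?j" "?j < int n" using kn by simp_all
  have "m0 \<le> m" if "d \<le> cdim (V ?j m)" for m
  proof (rule ccontr)
    assume "\<not> m0 \<le> m"
    hence "V ?j m = {0}" using m0[OF j] by (simp add: V_def iota_zero)
    thus False using that d by (simp add: cdim_zero)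
  qed
  moreover obtain m1 where "d \<le> cdim (V ?j m1)" using rank_attained[OF j] d by metis
  ultimately obtain h where h: "d \<le> cdim (V ?j h)" "\<forall>m'<h. \<not> d \<le> cdim (V ?j m')"
    using int_least[of "\<lambda>m. d \<le> cdim (V ?j m)"] by blast
  have "d \<le> cdim (V ?j m) \<longleftrightarrow> h \<le> m" for m
  proof
    assume "d \<le> cdim (V ?j m)" thus "h \<le> m" using h(2) linorder_not_le by blast
  next
    assume "h \<le> m"
    hence "V ?j h \<subseteq> V ?j m" using int_mono_chain[of "V ?j"] V_mono by blast
    thus "d \<le> cdim (V ?j m)" using V_cdim_mono h(1) le_trans by blast
  qed
  moreover have "V j m = V ?j (m + (int n - int k) * ?s)" for m using V_shift[of ?j ?s m] by simp
  ultimately have "d \<le> cdim (V j m) \<longleftrightarrow> h - (int n - int k) * ?s \<le> m" for m by (simp add: algebra_simps)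
  thus "\<exists>h. \<forall>m. d \<le> cdim (V j m) \<longleftrightarrow> h \<le> m" by blast
qed

text \<open>The inclusions along x and y give the step bounds. A degree (a, m) outside the set whose
  translate (a - 1, m + 1) by deg(y) lies inside means m + 1 \<le> H a \<le> H (a - 1) \<le> m + 1,
  so the shape collects the a at which H stays level.\<close>

lemma contour_of_height:
  assumes H: "\<And>j m. d \<le> cdim (V j m) \<longleftrightarrow> H j \<le> m"
  shows "contour n k H (contour_shape n k (supp_level n k N d))"
proof
  show "1 \<le> k" "k < n" using k1 kn .
  show per: "H (j + int n * s) = H j - (int n - int k) * s" for j s
  proof -
    have "H (j + int n * s) \<le> m \<longleftrightarrow> H j \<le> m + (int n - int k) * s" for m
      using H[of "j + int n * s" m] H[of j "m + (int n - int k) * s"] by (simp add: V_shift)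
    from this[of "H (j + int n * s)"] this[of "H j - (int n - int k) * s"] show ?thesis by linarith
  qed
  have step1: "H j \<le> H (j - 1)" for j
    using V_cdim_mono[OF V_act[of "j - 1" "H (j - 1)" 1 0]] H[of "j - 1" "H (j - 1)"] H[of j "H (j - 1)"] by simp
  have step2: "H (j - 1) \<le> H j + 1" for j
    using V_cdim_mono[OF V_act[of j "H j" 0 1]] H[of j "H j"] H[of "j - 1" "H j + 1"] by simp
  show "H j = H (j - 1) \<or> H j = H (j - 1) - 1" for j using step1[of j] step2[of j] by linarith
  have mem: "pt n k j m \<in> supp_level n k N d \<longleftrightarrow> H j \<le> m" for j m
    using H by (simp add: supp_level_def dim_at_pt)
  show "contour_shape n k (supp_level n k N d) = {a \<in> {1..n}. H (int a) = H (int a - 1)}"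
  proof (intro equalityI subsetI)
    fix a assume "a \<in> contour_shape n k (supp_level n k N d)"
    then obtain i where a: "a \<in> {1..n}" and i: "i \<in> carrier \<Lambda>" "res_deg n i = int a mod int n" "i \<notin> supp_level n k N d"
       "i \<otimes>\<^bsub>\<Lambda>\<^esub> char_class n k 0 1 \<in> supp_level n k N d" unfolding contour_shape_def by blast
    obtain j m where jm: "i = pt n k j m" using Gamma_ex[OF i(1)] kn by auto
    have "j mod int n = int a mod int n" using i(2) by (simp add: jm res_deg_pt)
    then obtain s where s: "j = int a + int n * s" by (metis mod_eqE add_diff_cancel_left' diff_add_cancel add.commute)
    let ?m = "m + (int n - int k) * s"
    have im: "i = pt n k (int a) ?m" unfolding jm s by (rule pt_shift)
    have "\<not> H (int a) \<le> ?m" "H (int a - 1) \<le> ?m + 1"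
      using i(3,4) unfolding im pt_mult_char mem by simp_all
    thus "a \<in> {a \<in> {1..n}. H (int a) = H (int a - 1)}" using a step1[of "int a"] by simp
  next
    fix a assume a: "a \<in> {a \<in> {1..n}. H (int a) = H (int a - 1)}"
    let ?i = "pt n k (int a) (H (int a) - 1)"
    have "?i \<notin> supp_level n k N d" by (simp add: mem)
    moreover have "?i \<otimes>\<^bsub>\<Lambda>\<^esub> char_class n k 0 1 \<in> supp_level n k N d" using a by (simp add: pt_mult_char mem)
    ultimately show "a \<in> contour_shape n k (supp_level n k N d)"
      using a unfolding contour_shape_def by (intro CollectI conjI bexI[of _ ?i]) (simp_all add: res_deg_pt)
  qed
qed

text \<open>The part of the completion with values in the member of the flag cut out by the first d
  functionals. It decreases as d grows.\<close>

definition Gset :: "(nat \<Rightarrow> ('b \<Rightarrow> complex) \<Rightarrow> complex) \<Rightarrow> nat \<Rightarrow> ((int \<times> int) set \<Rightarrow> 'b) set" where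
  "Gset \<Phi> d = {u \<in> carrier CC. \<forall>j m. \<forall>l<d. \<Phi> l (val u j m) = 0}"

definition graph_val where
  "graph_val \<phi> u = (\<lambda>j m. \<phi> (val u j m))"

end

locale flagged = gamma_mod n k N for n k and N :: "'b Gamma_module" (structure) +
  fixes \<Phi> :: "nat \<Rightarrow> ('b \<Rightarrow> complex) \<Rightarrow> complex" and r :: nat
  assumes r: "r = rank_Gamma n k N"
    and fun_\<Phi>: "\<And>l. l < r \<Longrightarrow> functional (\<Phi> l)"
    and dim_\<Phi>: "\<And>d j m. d \<le> r \<Longrightarrow> 0 \<le> j \<Longrightarrow> j < int n \<Longrightarrow>
        cdim (V j m \<inter> {v. \<forall>l<d. \<Phi> l v = 0}) = cdim (V j m) - d"
begin

abbreviation "G \<equiv> Gset \<Phi>"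

lemma G_carrier: "u \<in> G d \<Longrightarrow> u \<in> carrier CC"
  by (simp add: Gset_def)

lemma G_val: "u \<in> G d \<Longrightarrow> l < d \<Longrightarrow> \<Phi> l (val u j m) = 0"
  by (simp add: Gset_def)

lemma \<Phi>_add: "l < r \<Longrightarrow> \<Phi> l (u + v) = \<Phi> l u + \<Phi> l v"
  using fun_\<Phi> by (simp add: functional_def)

lemma \<Phi>_scale: "l < r \<Longrightarrow> \<Phi> l (\<lambda>b. c * v b) = c * \<Phi> l v"
  using fun_\<Phi> by (simp add: functional_def)

lemma \<Phi>_zero: "l < r \<Longrightarrow> \<Phi> l 0 = 0"
  using functional_zero[OF fun_\<Phi>] .

lemma \<Phi>_neg: "l < r \<Longrightarrow> \<Phi> l (- u) = - \<Phi> l u"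
  using \<Phi>_add[of l "- u" u] \<Phi>_zero[of l] by (simp add: eq_neg_iff_add_eq_0)

lemma \<Phi>_diff: "l < r \<Longrightarrow> \<Phi> l (u - v) = \<Phi> l u - \<Phi> l v"
  using \<Phi>_add[of l u "- v"] \<Phi>_neg[of l v] by simp

lemma G_add: "d \<le> r \<Longrightarrow> u \<in> G d \<Longrightarrow> v \<in> G d \<Longrightarrow> u \<oplus>\<^bsub>CC\<^esub> v \<in> G d"
  by (auto simp: Gset_def CC_add_closed val_add \<Phi>_add)

lemma G_neg: "d \<le> r \<Longrightarrow> u \<in> G d \<Longrightarrow> CCneg u \<in> G d"
  by (auto simp: Gset_def CCneg_closed val_neg \<Phi>_neg)

lemma G_zero: "d \<le> r \<Longrightarrow> \<zero>\<^bsub>CC\<^esub> \<in> G d"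
  by (auto simp: Gset_def CC_zero_closed val_zero \<Phi>_zero)

text \<open>At t = 1 monomials act as the identity, so the values of a multiple of u are
  combinations of values of u and stay in the same member of the flag.\<close>

lemma G_smult: assumes "d \<le> r" "u \<in> G d" shows "C \<odot>\<^bsub>CC\<^esub> u \<in> G d"
proof -
  have u: "u \<in> carrier CC" using assms(2) by (rule G_carrier)
  have "\<Phi> l (val (C \<odot>\<^bsub>CC\<^esub> u) j m) = 0" if "l < d" for l j m
    using val_functional_smult[OF u fun_\<Phi>, of l C j m] G_val[OF assms(2) that] that assms(1)
    by (simp add: split_def)
  thus ?thesis using CC_smult_closed[OF u] by (simp add: Gset_def)
qed

lemma val_part: assumes "u \<in> carrier CC" shows "val (part u i) j m = (if j mod int n = i then val u j m else 0)"
  by (simp add: val_def part_def res_deg_pt iota_zero)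

lemma G_part: "d \<le> r \<Longrightarrow> u \<in> G d \<Longrightarrow> part u i \<in> G d"
  by (auto simp: Gset_def part_grade val_part \<Phi>_zero)

lemma G_0: "G 0 = carrier CC" by (auto simp: Gset_def)

text \<open>By general position a piece of dimension at most d meets the codimension d member of the
  flag only in 0.\<close>

lemma G_vanish: assumes d: "d \<le> r" and u: "u \<in> G d" and c: "cdim (V j m) \<le> d" shows "u (pt n k j m) = \<zero>"
proof -
  obtain j' m' where jm: "pt n k j m = pt n k j' m'" "0 \<le> j'" "j' < int n"
    using Gamma_ex[OF pt_in, of n k j m] kn by auto
  have V: "V j m = V j' m'" by (rule V_pt[OF jm(1)])
  have "cdim (V j' m' \<inter> {v. \<forall>l<d. \<Phi> l v = 0}) = 0" using dim_\<Phi>[OF d jm(2,3)] c V by simp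
  moreover have "csubspace (V j' m' \<inter> {v. \<forall>l<d. \<Phi> l v = 0})"
    by (intro CV.subspace_inter V_subspace functional_kernel_subspace fun_\<Phi>) (use d in simp)
  moreover have "V j' m' \<inter> {v. \<forall>l<d. \<Phi> l v = 0} \<subseteq> supported B" using V_supported by blast
  ultimately have z: "{0} = V j' m' \<inter> {v. \<forall>l<d. \<Phi> l v = 0}"
    by (intro cdim_le(2)[OF finite_B _ CV.subspace_single_0]) (auto simp: cdim_zero dest: CV.subspace_0)
  have uC: "u \<in> carrier CC" using u by (rule G_carrier)
  have "val u j' m' \<in> V j' m' \<inter> {v. \<forall>l<d. \<Phi> l v = 0}" using val_in_V[OF uC] G_val[OF u] by simp
  hence "val u j' m' \<in> {0}" by (subst z)
  hence "val u j' m' = 0" by simp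
  thus ?thesis unfolding jm(1) by (rule val_eq_0D[OF uC])
qed

lemma G_r: "G r = {\<zero>\<^bsub>CC\<^esub>}"
proof (intro equalityI subsetI)
  fix u assume u: "u \<in> G r"
  have "u = \<zero>\<^bsub>CC\<^esub>"
  proof (rule CC_ext[OF G_carrier[OF u] CC_zero_closed])
    fix j m assume "0 \<le> j" "j < int n"
    hence "cdim (V j m) \<le> r" using rank_upper r by simp
    thus "u (pt n k j m) = \<zero>\<^bsub>CC\<^esub> (pt n k j m)" using G_vanish[OF le_refl u] by (simp add: CC_zero)
  qed
  thus "u \<in> {\<zero>\<^bsub>CC\<^esub>}" by simp
qed (simp add: G_zero)

text \<open>If the piece has dimension above d, the cuts by d and by d + 1 functionals have
  different dimensions, so \<open>\<Phi> d\<close> is not zero on the former; scaling then gives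
  every value c.\<close>

lemma choose_value:
  assumes d: "d < r" and j: "0 \<le> j" "j < int n" and c: "d < cdim (V j m) \<or> c = 0"
  shows "\<exists>x\<in>grade N (pt n k j m). (\<forall>l<d. \<Phi> l (iota j x) = 0) \<and> \<Phi> d (iota j x) = c"
proof (cases "d < cdim (V j m)")
  case False
  thus ?thesis using c grade_zero[OF pt_in] d by (intro bexI[of _ \<zero>]) (auto simp: iota_zero \<Phi>_zero)
next
  case True
  have "\<exists>v\<in>V j m. (\<forall>l<d. \<Phi> l v = 0) \<and> \<Phi> d v \<noteq> 0"
  proof (rule ccontr)
    assume "\<not> ?thesis"
    hence "V j m \<inter> {v. \<forall>l<Suc d. \<Phi> l v = 0} = V j m \<inter> {v. \<forall>l<d. \<Phi> l v = 0}" by (auto simp: less_Suc_eq)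
    thus False using dim_\<Phi>[OF _ j, of d m] dim_\<Phi>[OF _ j, of "Suc d" m] d True by simp
  qed
  then obtain v where v: "v \<in> V j m" "\<And>l. l < d \<Longrightarrow> \<Phi> l v = 0" "\<Phi> d v \<noteq> 0" by blast
  let ?v = "\<lambda>b. c / \<Phi> d v * v b"
  have "?v \<in> V j m" using CV.subspace_scale[OF V_subspace v(1)] .
  then obtain x where x: "x \<in> grade N (pt n k j m)" "iota j x = ?v" unfolding V_def by (elim imageE) simp
  have "\<Phi> l ?v = 0" if "l < d" for l using \<Phi>_scale[of l "c / \<Phi> d v" v] v(2)[OF that] that d by simp
  moreover have "\<Phi> d ?v = c" using \<Phi>_scale[OF d, of "c / \<Phi> d v" v] v(3) by simp
  ultimately show ?thesis using x by (intro bexI[of _ x]) simp_all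
qed

text \<open>\<open>\<Phi> d\<close> maps \<open>G d\<close> to families of scalars, one scalar for
  each degree, with kernel \<open>G (Suc d)\<close>. Where the piece has dimension at most d the
  scalar is 0, elsewhere it is arbitrary. So the factor consists of all families above the contour
  of level d + 1, and \<open>encode\<close> identifies these with the rank one module of its
  shape.\<close>

lemma level:
  assumes d: "d < r"
  obtains \<psi> I where "I = contour_shape n k (supp_level n k N (Suc d))" "k_subset n k I"
    "\<And>u v. u \<in> G d \<Longrightarrow> v \<in> G d \<Longrightarrow> \<psi> (u \<oplus>\<^bsub>CC\<^esub> v) = \<psi> u \<oplus>\<^bsub>L_module n I\<^esub> \<psi> v"
    "\<And>C u. u \<in> G d \<Longrightarrow> \<psi> (C \<odot>\<^bsub>CC\<^esub> u) = C \<odot>\<^bsub>L_module n I\<^esub> \<psi> u"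
    "\<And>h u. h \<in> G (Suc d) \<Longrightarrow> u \<in> G d \<Longrightarrow> \<psi> (h \<oplus>\<^bsub>CC\<^esub> u) = \<psi> u"
    "\<And>u v. u \<in> G d \<Longrightarrow> v \<in> G d \<Longrightarrow> \<psi> u = \<psi> v \<Longrightarrow> \<exists>h\<in>G (Suc d). u = h \<oplus>\<^bsub>CC\<^esub> v"
    "\<psi> ` G d = carrier (L_module n I)"
    "\<And>i u. u \<in> G d \<Longrightarrow> u \<in> grade CC i \<Longrightarrow> \<psi> u \<in> grade (L_module n I) i"
proof -
  obtain H where H: "\<And>j m. Suc d \<le> cdim (V j m) \<longleftrightarrow> H j \<le> m"
    using height_exists[of "Suc d"] d r by auto
  let ?I = "contour_shape n k (supp_level n k N (Suc d))"
  interpret C: contour n k H ?I by (rule contour_of_height[OF H])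
  define w where "w u = graph_val (\<Phi> d) u" for u
  have w: "w u j m = \<Phi> d (val u j m)" for u j m by (simp add: w_def graph_val_def)
  define \<psi> where "\<psi> u = encode n H (w u)" for u
  have adm: "C.adm (w u)" if u: "u \<in> G d" for u
    unfolding C.adm_def
  proof (intro conjI allI impI)
    fix j m s show "w u (j + int n * s) m = w u j (m + (int n - int k) * s)" by (simp add: w val_shift)
  next
    fix j m assume "m < H j"
    hence "cdim (V j m) \<le> d" using H[of j m] by linarith
    hence "u (pt n k j m) = \<zero>" using G_vanish[OF _ u] d by simp
    thus "w u j m = 0" by (simp add: w val_def iota_zero \<Phi>_zero d)
  qed
  have wadd: "w (u \<oplus>\<^bsub>CC\<^esub> v) = (\<lambda>j m. w u j m + w v j m)" if "u \<in> G d" "v \<in> G d" for u v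
    using that G_carrier by (intro ext) (simp add: w val_add \<Phi>_add d)
  have inj: "w u = w v" if uv: "u \<in> G d" "v \<in> G d" "\<psi> u = \<psi> v" for u v
  proof (intro ext)
    fix j m
    show "w u j m = w v j m"
    proof (cases "m < H j")
      case True thus ?thesis using adm uv by (simp add: C.adm_def)
    next
      case False
      have "Abs_fps (\<lambda>e. w u j (H j + int e)) = Abs_fps (\<lambda>e. w v j (H j + int e))"
        using C.encode_mod[OF adm[OF uv(1)], of j] C.encode_mod[OF adm[OF uv(2)], of j] uv(3) by (simp add: \<psi>_def)
      hence "w u j (H j + int (nat (m - H j))) = w v j (H j + int (nat (m - H j)))"
        by (metis fps_nth_Abs_fps)
      thus ?thesis using False by simp
    qed
  qed
  show thesis
  proof (rule that[of ?I \<psi>, OF refl C.k_subset])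
    fix u v assume "u \<in> G d" "v \<in> G d"
    thus "\<psi> (u \<oplus>\<^bsub>CC\<^esub> v) = \<psi> u \<oplus>\<^bsub>L_module n ?I\<^esub> \<psi> v"
      unfolding \<psi>_def by (subst wadd) (auto simp: encode_def L_module_def Let_def fps_eq_iff fun_eq_iff)
  next
    fix C u assume u: "u \<in> G d"
    have uC: "u \<in> carrier CC" using u by (rule G_carrier)
    \<comment> \<open>The two families as one function on booleans, the form in which
      \<open>L_smult_encode\<close> expects them.\<close>
    define ww where "ww z = (if z then w (C \<odot>\<^bsub>CC\<^esub> u) else w u)" for z
    have "encode n H (ww True) = C \<odot>\<^bsub>L_module n ?I\<^esub> encode n H (ww False)"
    proof (rule C.L_smult_encode[where A = "\<lambda>j m. {z. low u j m z \<noteq> \<zero>}"])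
      show "C.adm (ww z)" for z using adm u G_smult[OF _ u] d by (simp add: ww_def)
      show "finite {z. low u j m z \<noteq> \<zero>}" for j m by (rule low_finite[OF uC])
      show "(p, q) \<in> {z. low u j m z \<noteq> \<zero>}" if "ww False (j - int p + int q) (m - int q) \<noteq> 0" for j m p q
      proof (rule ccontr)
        assume "(p, q) \<notin> {z. low u j m z \<noteq> \<zero>}"
        hence "u (pt n k (j - int p + int q) (m - int q)) = \<zero>" by (simp add: low_def)
        thus False using that by (simp add: ww_def w val_def iota_zero \<Phi>_zero d)
      qed
      show "ww True j m = (\<Sum>(p, q)\<in>{z. low u j m z \<noteq> \<zero>}. fps_nth (fps_nth (SOME f. f \<in> C) q) p * ww False (j - int p + int q) (m - int q))" for j m
        using val_functional_smult[OF uC fun_\<Phi>[OF d], of C j m] by (simp add: ww_def w)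
    qed
    thus "\<psi> (C \<odot>\<^bsub>CC\<^esub> u) = C \<odot>\<^bsub>L_module n ?I\<^esub> \<psi> u" by (simp add: ww_def \<psi>_def)
  next
    fix h u assume h: "h \<in> G (Suc d)" and u: "u \<in> G d"
    have hd: "h \<in> G d" using h by (auto simp: Gset_def)
    have "w h j m = 0" for j m using G_val[OF h] by (simp add: w)
    hence "w (h \<oplus>\<^bsub>CC\<^esub> u) = w u" using wadd[OF hd u] by simp
    thus "\<psi> (h \<oplus>\<^bsub>CC\<^esub> u) = \<psi> u" by (simp add: \<psi>_def)
  next
    fix u v assume uv: "u \<in> G d" "v \<in> G d" "\<psi> u = \<psi> v"
    let ?h = "u \<oplus>\<^bsub>CC\<^esub> CCneg v"
    have uC: "u \<in> carrier CC" "v \<in> carrier CC" using uv G_carrier by auto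
    have nv: "CCneg v \<in> G d" by (rule G_neg[OF _ uv(2)]) (use d in simp)
    have hd: "?h \<in> G d" by (rule G_add[OF _ uv(1) nv]) (use d in simp)
    have "\<Phi> d (val ?h j m) = w u j m - w v j m" for j m
      using d by (simp add: w val_add uC CCneg_closed val_neg \<Phi>_diff)
    hence "\<Phi> d (val ?h j m) = 0" for j m using inj[OF uv] by simp
    hence "?h \<in> G (Suc d)" using hd by (auto simp: Gset_def less_Suc_eq)
    moreover have "u = ?h \<oplus>\<^bsub>CC\<^esub> v"
    proof (rule CC_ext[OF uC(1) G_carrier[OF G_add[OF _ hd uv(2)]]])
      fix j m
      have "u (pt n k j m) \<in> carrier N" "v (pt n k j m) \<in> carrier N" using CC_val_carrier uC by auto
      thus "u (pt n k j m) = (?h \<oplus>\<^bsub>CC\<^esub> v) (pt n k j m)" by (simp add: CC_add CCneg_def a_assoc l_neg)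
    qed (use d in simp)
    ultimately show "\<exists>h\<in>G (Suc d). u = h \<oplus>\<^bsub>CC\<^esub> v" by blast
  next
    have "\<psi> u \<in> carrier (L_module n ?I)" for u by (simp add: \<psi>_def encode_def L_module_def Let_def)
    moreover have "v \<in> \<psi> ` G d" if v: "v \<in> carrier (L_module n ?I)" for v
    proof -
      obtain w' where w': "C.adm w'" "encode n H w' = v" using C.encode_surj[OF v] .
      \<comment> \<open>Values can be prescribed independently in each degree. The clause over all
        (j, m) that name the degree i makes the choice independent of its coordinates.\<close>
      have "\<exists>u. \<forall>i\<in>carrier \<Lambda>. u i \<in> grade N i \<and> (\<forall>j m. i = pt n k j m \<longrightarrow> (\<forall>l<d. \<Phi> l (iota j (u i)) = 0) \<and> \<Phi> d (iota j (u i)) = w' j m)"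
      proof (rule bchoice, rule ballI)
        fix i assume "i \<in> carrier \<Lambda>"
        then obtain j m where jm: "i = pt n k j m" "0 \<le> j" "j < int n" using Gamma_ex[of i n k] kn by auto
        have "d < cdim (V j m) \<or> w' j m = 0" using H[of j m] w'(1) by (auto simp: C.adm_def)
        then obtain x where x: "x \<in> grade N i" "\<forall>l<d. \<Phi> l (iota j x) = 0" "\<Phi> d (iota j x) = w' j m"
          using choose_value[OF d jm(2,3)] unfolding jm(1) by blast
        have "(\<forall>l<d. \<Phi> l (iota j' x) = 0) \<and> \<Phi> d (iota j' x) = w' j' m'" if e: "i = pt n k j' m'" for j' m'
        proof -
          obtain s where s: "j' = j + int n * s" "m' = m - (int n - int k) * s" using e unfolding jm(1) pt_eq_iff by blast
          have "w' j' m' = w' j m" using w'(1) unfolding C.adm_def s by simp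
          thus ?thesis using x by (simp add: s iota_shift)
        qed
        thus "\<exists>x. x \<in> grade N i \<and> (\<forall>j m. i = pt n k j m \<longrightarrow> (\<forall>l<d. \<Phi> l (iota j x) = 0) \<and> \<Phi> d (iota j x) = w' j m)"
          using x(1) by blast
      qed
      then obtain u where u: "\<forall>i\<in>carrier \<Lambda>. u i \<in> grade N i \<and> (\<forall>j m. i = pt n k j m \<longrightarrow> (\<forall>l<d. \<Phi> l (iota j (u i)) = 0) \<and> \<Phi> d (iota j (u i)) = w' j m)" ..
      define u' where "u' = (\<lambda>i\<in>carrier \<Lambda>. u i)"
      have u2: "(\<forall>l<d. \<Phi> l (iota j (u (pt n k j m))) = 0) \<and> \<Phi> d (iota j (u (pt n k j m))) = w' j m" for j m
        using bspec[OF u pt_in[of n k j m]] by blast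
      have "u' \<in> carrier CC" using u by (simp add: u'_def CC_carrier)
      hence "u' \<in> G d" using u2 by (simp add: u'_def Gset_def val_def)
      moreover have "w u' = w'" using u2 by (intro ext) (simp add: w u'_def val_def)
      ultimately show ?thesis using w'(2) by (intro image_eqI[of _ _ u']) (simp_all add: \<psi>_def)
    qed
    ultimately show "\<psi> ` G d = carrier (L_module n ?I)" by blast
  next
    fix i u assume u: "u \<in> G d" "u \<in> grade CC i"
    have "encode n H (w u) j = 0" if "j \<in> {0..<int n}" "j \<noteq> i" for j
    proof -
      have "u (pt n k j m) = \<zero>" for m using u(2) that by (simp add: CC_grade res_deg_pt)
      hence "w u j m = 0" for m by (simp add: w val_def iota_zero \<Phi>_zero d)
      thus ?thesis using that by (simp add: encode_def fps_eq_iff)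
    qed
    thus "\<psi> u \<in> grade (L_module n ?I) i" by (auto simp: \<psi>_def L_module_def Let_def) (auto simp: encode_def)
  qed
qed

end

section \<open>Transport of the filtration to a module isomorphic to the completion\<close>

lemma giso_inverse_hom:
  fixes P :: "('a, 'c, 'g) gmodule" and M :: "('a, 'b, 'g) gmodule"
  assumes f: "f \<in> ghom \<Lambda> R P M" "bij_betw f (carrier P) (carrier M)"
  defines "g \<equiv> inv_into (carrier P) f"
  shows "\<And>m. m \<in> carrier M \<Longrightarrow> g m \<in> carrier P" "\<And>m. m \<in> carrier M \<Longrightarrow> f (g m) = m"
    "\<And>u. u \<in> carrier P \<Longrightarrow> g (f u) = u" "\<And>u. u \<in> carrier P \<Longrightarrow> f u \<in> carrier M"
  using f unfolding g_def
  by (auto simp: bij_betw_def inv_into_into f_inv_into_f inv_into_f_f) 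

context flagged
begin

text \<open>The images of the sets \<open>G d\<close> filter M. They decrease with d, so
  \<open>F e\<close> is the image of \<open>G (r - e)\<close> and the shapes come in the reverse of
  their order in the profile; this is why the conclusion compares multisets.\<close>

lemma filtration:
  fixes M :: "'c G_module"
  assumes gM: "graded_module (G_dual n) (Rhat n k) (Rhat_grade n k) M"
    and f: "f \<in> ghom (G_dual n) (Rhat n k) CC M" "bij_betw f (carrier CC) (carrier M)"
  shows "\<exists>F Is. mset Is = mset (profile_Gamma n k N) \<and>
           gfiltration (G_dual n) (Rhat n k) M (length Is) F \<and>
           (\<forall>d < length Is. rank_one_of_type n k (gfactor M F d) (Is ! d))"
proof -
  interpret M: graded_mod "G_dual n" "Rhat n k" "Rhat_grade n k" M
    by unfold_locales (rule gM)
  define g where "g = inv_into (carrier CC) f"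
  note g = giso_inverse_hom[OF f, folded g_def]
  have fadd: "f (u \<oplus>\<^bsub>CC\<^esub> v) = f u \<oplus>\<^bsub>M\<^esub> f v" if "u \<in> carrier CC" "v \<in> carrier CC" for u v
    using f(1) that unfolding ghom_def by blast
  have fsm: "f (C \<odot>\<^bsub>CC\<^esub> u) = C \<odot>\<^bsub>M\<^esub> f u" if "C \<in> carrier (Rhat n k)" "u \<in> carrier CC" for C u
    using f(1) that unfolding ghom_def by blast
  have Gc: "carrier (G_dual n) = {0..<int n}" using kn by (simp add: carrier_integer_mod_group)
  have fgr: "f u \<in> grade M i" if "u \<in> grade CC i" "i \<in> carrier (G_dual n)" for u i
    using f(1) that unfolding ghom_def by blast
  have fz: "f \<zero>\<^bsub>CC\<^esub> = \<zero>\<^bsub>M\<^esub>"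
  proof -
    have "\<zero>\<^bsub>CC\<^esub> \<oplus>\<^bsub>CC\<^esub> \<zero>\<^bsub>CC\<^esub> = \<zero>\<^bsub>CC\<^esub>" by (auto simp: CC_add CC_zero)
    hence "f \<zero>\<^bsub>CC\<^esub> \<oplus>\<^bsub>M\<^esub> f \<zero>\<^bsub>CC\<^esub> = f \<zero>\<^bsub>CC\<^esub>" using fadd[OF CC_zero_closed CC_zero_closed] by simp
    thus ?thesis using g(4)[OF CC_zero_closed] M.add.l_cancel_one' by metis
  qed
  have fneg: "f (CCneg u) = \<ominus>\<^bsub>M\<^esub> f u" if u: "u \<in> carrier CC" for u
  proof -
    have "f (CCneg u) \<oplus>\<^bsub>M\<^esub> f u = \<zero>\<^bsub>M\<^esub>"
      using fadd[OF CCneg_closed[OF u] u] CCneg_add[OF u] fz by simp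
    thus ?thesis using M.minus_equality g(4)[OF u] g(4)[OF CCneg_closed[OF u]] by metis
  qed
  have fparts: "f u = (\<Oplus>\<^bsub>M\<^esub>i\<in>{0..<int n}. f (part u i))" if u: "u \<in> carrier CC" for u
  proof -
    \<comment> \<open>Partial sums over the residue degrees below l turn the decomposition of u into
      an induction.\<close>
    define t where "t l = (\<lambda>i\<in>carrier \<Lambda>. if res_deg n i < int l then u i else \<zero>)" for l :: nat
    have tC: "t l \<in> carrier CC" for l using u by (auto simp: t_def CC_carrier PiE_iff grade_zero)
    have pM: "f (part u i) \<in> carrier M" for i using g(4)[OF part_grade(2)[OF u]] .
    have "f (t l) = (\<Oplus>\<^bsub>M\<^esub>i\<in>{0..<int l}. f (part u i))" for l
    proof (induction l)
      case 0
      have "t 0 = \<zero>\<^bsub>CC\<^esub>" using res_deg_bounds by (auto simp: t_def CC_zero fun_eq_iff restrict_def) fastforce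
      thus ?case by (simp add: fz)
    next
      case (Suc l)
      have s: "{0..<int (Suc l)} = insert (int l) {0..<int l}" by auto
      have uc: "u i \<in> carrier N" if "i \<in> carrier \<Lambda>" for i
        using u grade_carrier[OF that] that by (auto simp: CC_carrier PiE_iff)
      have "t (Suc l) = part u (int l) \<oplus>\<^bsub>CC\<^esub> t l"
        unfolding t_def part_def CC_add by (rule restrict_ext) (use uc in auto)
      hence "f (t (Suc l)) = f (part u (int l)) \<oplus>\<^bsub>M\<^esub> f (t l)" using fadd[OF part_grade(2)[OF u] tC] by simp
      also have "\<dots> = (\<Oplus>\<^bsub>M\<^esub>i\<in>insert (int l) {0..<int l}. f (part u i))"
        unfolding Suc by (rule M.finsum_insert[symmetric]) (use pM in auto)
      finally show ?case unfolding s .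
    qed
    moreover have "t n = u"
    proof
      fix i show "t n i = u i"
        using u res_deg_bounds[of i] by (cases "i \<in> carrier \<Lambda>") (auto simp: t_def CC_carrier PiE_iff extensional_def)
    qed
    ultimately show ?thesis by metis
  qed
  \<comment> \<open>A homomorphism is only known to map pieces into pieces. That the inverse of f
    does so too follows from the uniqueness of components in M.\<close>
  have ggr: "g a \<in> grade CC i" if a: "a \<in> grade M i" and i: "i \<in> carrier (G_dual n)" for a i
  proof -
    have aM: "a \<in> carrier M" using M.grade_carrier[OF i a] .
    let ?u = "g a"
    have u: "?u \<in> carrier CC" using g(1)[OF aM] .
    have "a = (\<Oplus>\<^bsub>M\<^esub>i\<in>{0..<int n}. f (part ?u i))" using fparts[OF u] g(2)[OF aM] by simp
    hence "gcomp (G_dual n) M a i = (if i \<in> {0..<int n} then f (part ?u i) else \<zero>\<^bsub>M\<^esub>)"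
      using M.comp_finsum_homog[of "{0..<int n}" "\<lambda>i. f (part ?u i)" i] fgr[OF part_grade(1)[OF u]] Gc by simp
    moreover have "gcomp (G_dual n) M a i = a" using M.comp_homog[OF i a, of i] by simp
    ultimately have "f (part ?u i) = f ?u" using i Gc g(2)[OF aM] by simp
    hence "part ?u i = ?u" using g(3)[OF part_grade(2)[OF u]] g(3)[OF u] by metis
    thus ?thesis using part_grade(1)[OF u] by metis
  qed
  define F where "F e = f ` G (r - e)" for e
  have GC: "u \<in> G d \<Longrightarrow> u \<in> carrier CC" for u d by (rule G_carrier)
  have FM: "F e \<subseteq> carrier M" for e using g(4) GC by (auto simp: F_def)
  have gF: "g a \<in> G (r - e)" if "a \<in> F e" for a e
    using that g(3) GC by (auto simp: F_def)
  have Fadd: "a \<oplus>\<^bsub>M\<^esub> b \<in> F e" if ab: "a \<in> F e" "b \<in> F e" for a b e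
  proof -
    obtain u v where uv: "u \<in> G (r - e)" "v \<in> G (r - e)" "a = f u" "b = f v" using ab unfolding F_def by (elim imageE) simp
    have "a \<oplus>\<^bsub>M\<^esub> b = f (u \<oplus>\<^bsub>CC\<^esub> v)" using fadd[OF GC[OF uv(1)] GC[OF uv(2)]] uv by simp
    moreover have "u \<oplus>\<^bsub>CC\<^esub> v \<in> G (r - e)" by (rule G_add[OF _ uv(1,2)]) simp
    ultimately show ?thesis unfolding F_def by (rule image_eqI)
  qed
  have Fneg: "\<ominus>\<^bsub>M\<^esub> a \<in> F e" if a: "a \<in> F e" for a e
  proof -
    obtain u where u: "u \<in> G (r - e)" "a = f u" using a unfolding F_def by (elim imageE) simp
    have "\<ominus>\<^bsub>M\<^esub> a = f (CCneg u)" using fneg[OF GC[OF u(1)]] u by simp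
    moreover have "CCneg u \<in> G (r - e)" by (rule G_neg[OF _ u(1)]) simp
    ultimately show ?thesis unfolding F_def by (rule image_eqI)
  qed
  have Fsm: "C \<odot>\<^bsub>M\<^esub> a \<in> F e" if C: "C \<in> carrier (Rhat n k)" and a: "a \<in> F e" for C a e
  proof -
    obtain u where u: "u \<in> G (r - e)" "a = f u" using a unfolding F_def by (elim imageE) simp
    have "C \<odot>\<^bsub>M\<^esub> a = f (C \<odot>\<^bsub>CC\<^esub> u)" using fsm[OF C GC[OF u(1)]] u by simp
    moreover have "C \<odot>\<^bsub>CC\<^esub> u \<in> G (r - e)" by (rule G_smult[OF _ u(1)]) simp
    ultimately show ?thesis unfolding F_def by (rule image_eqI)
  qed
  have Fz: "\<zero>\<^bsub>M\<^esub> \<in> F e" for e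
    unfolding F_def by (rule image_eqI[of _ f "\<zero>\<^bsub>CC\<^esub>"]) (simp_all add: fz G_zero)
  have Fgr: "graded_submodule (G_dual n) (Rhat n k) M (F e)" for e
    unfolding graded_submodule_def
  proof (intro conjI subsetI)
    show "submodule (F e) (Rhat n k) M"
      by (rule M.submoduleI) (use FM Fz Fneg Fadd Fsm in auto)
    fix a assume "a \<in> F e"
    then obtain u where u: "u \<in> G (r - e)" "a = f u" unfolding F_def by (elim imageE) simp
    have "f (part u i) \<in> F e \<inter> grade M i" if "i \<in> {0..<int n}" for i
    proof
      show "f (part u i) \<in> F e" unfolding F_def by (rule imageI, rule G_part[OF _ u(1)]) simp
      show "f (part u i) \<in> grade M i" by (rule fgr[OF part_grade(1)[OF GC[OF u(1)]]]) (use that Gc in simp)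
    qed
    thus "a \<in> hom_sums M (carrier (G_dual n)) (\<lambda>i. F e \<inter> grade M i)"
      unfolding hom_sums_def Gc u(2) fparts[OF GC[OF u(1)]]
      by (intro CollectI exI[of _ "{0..<int n}"] exI[of _ "\<lambda>i. f (part u i)"]) auto
  qed
  have Gmono: "G (Suc d) \<subseteq> G d" for d by (auto simp: Gset_def)
  have Fmono: "F e \<subseteq> F (Suc e)" if "e < r" for e
  proof -
    have "r - e = Suc (r - Suc e)" using that by simp
    thus ?thesis using Gmono[of "r - Suc e"] unfolding F_def by (metis image_mono)
  qed
  define Is where "Is = rev (profile_Gamma n k N)"
  have lenI: "length Is = r" by (simp add: Is_def profile_Gamma_def r)
  have nthI: "Is ! e = contour_shape n k (supp_level n k N (r - e))" if "e < r" for e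
    using that by (simp add: Is_def profile_Gamma_def rev_nth r[symmetric] Suc_diff_Suc del: upt_Suc)
  have F0: "F 0 = {\<zero>\<^bsub>M\<^esub>}" by (simp add: F_def G_r fz)
  have Fr: "F r = carrier M" using f(2) by (simp add: F_def G_0 bij_betw_def)
  have filt: "gfiltration (G_dual n) (Rhat n k) M (length Is) F"
    unfolding gfiltration_def lenI using F0 Fr Fgr Fmono by blast
  have fac: "rank_one_of_type n k (gfactor M F e) (Is ! e)" if e: "e < r" for e
  proof -
    define d where "d = r - Suc e"
    have d: "d < r" "r - e = Suc d" "r - Suc e = d" using e by (auto simp: d_def)
    obtain \<psi> I where L: "I = contour_shape n k (supp_level n k N (Suc d))" "k_subset n k I"
      and Ladd: "\<And>u v. u \<in> G d \<Longrightarrow> v \<in> G d \<Longrightarrow> \<psi> (u \<oplus>\<^bsub>CC\<^esub> v) = \<psi> u \<oplus>\<^bsub>L_module n I\<^esub> \<psi> v"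
      and Lsm: "\<And>C u. u \<in> G d \<Longrightarrow> \<psi> (C \<odot>\<^bsub>CC\<^esub> u) = C \<odot>\<^bsub>L_module n I\<^esub> \<psi> u"
      and Lab: "\<And>h u. h \<in> G (Suc d) \<Longrightarrow> u \<in> G d \<Longrightarrow> \<psi> (h \<oplus>\<^bsub>CC\<^esub> u) = \<psi> u"
      and Lfi: "\<And>u v. u \<in> G d \<Longrightarrow> v \<in> G d \<Longrightarrow> \<psi> u = \<psi> v \<Longrightarrow> \<exists>h\<in>G (Suc d). u = h \<oplus>\<^bsub>CC\<^esub> v"
      and Lsu: "\<psi> ` G d = carrier (L_module n I)"
      and Lgr: "\<And>i u. u \<in> G d \<Longrightarrow> u \<in> grade CC i \<Longrightarrow> \<psi> u \<in> grade (L_module n I) i"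
      by (rule level[OF d(1)]) (rule that; assumption)
    have gS: "g a \<in> G d" "a \<in> carrier M" if "a \<in> F (Suc e)" for a using gF[OF that] FM that d(3) by auto
    have gE: "g a \<in> G (Suc d)" if "a \<in> F e" for a using gF[OF that] d(2) by simp
    have gadd: "g (a \<oplus>\<^bsub>M\<^esub> b) = g a \<oplus>\<^bsub>CC\<^esub> g b" if "a \<in> carrier M" "b \<in> carrier M" for a b
    proof -
      have "f (g a \<oplus>\<^bsub>CC\<^esub> g b) = a \<oplus>\<^bsub>M\<^esub> b" using fadd g that by simp
      thus ?thesis using g(3)[OF CC_add_closed[OF g(1)[OF that(1)] g(1)[OF that(2)]]] by simp
    qed
    have gsm: "g (C \<odot>\<^bsub>M\<^esub> a) = C \<odot>\<^bsub>CC\<^esub> g a" if "C \<in> carrier (Rhat n k)" "a \<in> carrier M" for a C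
    proof -
      have "f (C \<odot>\<^bsub>CC\<^esub> g a) = C \<odot>\<^bsub>M\<^esub> a" using fsm g that by simp
      thus ?thesis using g(3)[OF CC_smult_closed[OF g(1)[OF that(2)]]] by metis
    qed
    have "giso (G_dual n) (Rhat n k) (gquot (gsub M (F (Suc e))) (F e)) (L_module n I)"
    proof (rule giso_gquot[where \<psi> = "\<lambda>a. \<psi> (g a)"])
      show "module (Rhat n k) M" by (rule M.module_axioms)
      show "F (Suc e) \<subseteq> carrier M" by (rule FM)
      show "F e \<subseteq> F (Suc e)" by (rule Fmono[OF e])
      show "\<zero>\<^bsub>M\<^esub> \<in> F e" by (rule Fz)
      show "a \<oplus>\<^bsub>M\<^esub> b \<in> F (Suc e)" if "a \<in> F (Suc e)" "b \<in> F (Suc e)" for a b using Fadd that .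
      show "C \<odot>\<^bsub>M\<^esub> a \<in> F (Suc e)" if "C \<in> carrier (Rhat n k)" "a \<in> F (Suc e)" for C a using Fsm that .
      show "a \<oplus>\<^bsub>M\<^esub> b \<in> F e" if "a \<in> F e" "b \<in> F e" for a b using Fadd that .
      show "\<ominus>\<^bsub>M\<^esub> a \<in> F e" if "a \<in> F e" for a using Fneg that .
      show "\<psi> (g (a \<oplus>\<^bsub>M\<^esub> b)) = \<psi> (g a) \<oplus>\<^bsub>L_module n I\<^esub> \<psi> (g b)" if "a \<in> F (Suc e)" "b \<in> F (Suc e)" for a b
        using gadd[OF gS(2)[OF that(1)] gS(2)[OF that(2)]] Ladd[OF gS(1)[OF that(1)] gS(1)[OF that(2)]] by simp
      show "\<psi> (g (C \<odot>\<^bsub>M\<^esub> a)) = C \<odot>\<^bsub>L_module n I\<^esub> \<psi> (g a)" if "C \<in> carrier (Rhat n k)" "a \<in> F (Suc e)" for C a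
        using gsm[OF that(1) gS(2)[OF that(2)]] Lsm[OF gS(1)[OF that(2)]] by simp
      show "\<psi> (g (h \<oplus>\<^bsub>M\<^esub> a)) = \<psi> (g a)" if "h \<in> F e" "a \<in> F (Suc e)" for h a
      proof -
        have "h \<in> carrier M" using FM that(1) by blast
        thus ?thesis using gadd[OF _ gS(2)[OF that(2)]] Lab[OF gE[OF that(1)] gS(1)[OF that(2)]] by simp
      qed
      show "\<exists>h\<in>F e. a = h \<oplus>\<^bsub>M\<^esub> b" if ab: "a \<in> F (Suc e)" "b \<in> F (Suc e)" "\<psi> (g a) = \<psi> (g b)" for a b
      proof -
        obtain h where h: "h \<in> G (Suc d)" "g a = h \<oplus>\<^bsub>CC\<^esub> g b"
          using Lfi[OF gS(1)[OF ab(1)] gS(1)[OF ab(2)] ab(3)] by blast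
        have "a = f (h \<oplus>\<^bsub>CC\<^esub> g b)" using g(2)[OF gS(2)[OF ab(1)]] h(2) by simp
        also have "\<dots> = f h \<oplus>\<^bsub>M\<^esub> b"
          using fadd[OF GC[OF h(1)] g(1)[OF gS(2)[OF ab(2)]]] g(2)[OF gS(2)[OF ab(2)]] by simp
        finally have "a = f h \<oplus>\<^bsub>M\<^esub> b" .
        moreover have "f h \<in> F e" using h(1) unfolding F_def d(2) by (rule imageI)
        ultimately show ?thesis by blast
      qed
      have "g ` F (Suc e) = G d"
      proof
        show "g ` F (Suc e) \<subseteq> G d" using gS by blast
        show "G d \<subseteq> g ` F (Suc e)"
        proof
          fix u assume u: "u \<in> G d"
          have "f u \<in> F (Suc e)" using u unfolding F_def d(3) by (rule imageI)
          thus "u \<in> g ` F (Suc e)" using g(3)[OF GC[OF u]] by (metis imageI)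
        qed
      qed
      thus "(\<lambda>a. \<psi> (g a)) ` F (Suc e) = carrier (L_module n I)" using Lsu by (metis image_image)
      show "\<psi> (g a) \<in> grade (L_module n I) i" if "i \<in> carrier (G_dual n)" "a \<in> F (Suc e)" "a \<in> grade M i" for i a
        by (rule Lgr[OF gS(1)[OF that(2)] ggr[OF that(3,1)]])
    qed
    moreover have "Is ! e = I" using nthI[OF e] L(1) d(2) by simp
    ultimately show ?thesis using L(2) by (simp add: rank_one_of_type_def iso_G_def gfactor_def)
  qed
  show ?thesis
    using filt fac lenI by (intro exI[of _ F] exI[of _ Is]) (auto simp: Is_def)
qed

end

lemma lifted_filtration:
  fixes M :: "'c G_module" and N :: "'b Gamma_module"
  assumes "1 \<le> k" "k < n" "graded_module (G_dual n) (Rhat n k) (Rhat_grade n k) M"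
    and "CM_Gamma n k N" "iso_G n k (completion n k N) M"
  shows "\<exists>F Is. mset Is = mset (profile_Gamma n k N) \<and>
           gfiltration (G_dual n) (Rhat n k) M (length Is) F \<and>
           (\<forall>d < length Is. rank_one_of_type n k (gfactor M F d) (Is ! d))"
proof -
  interpret gamma_mod n k N by unfold_locales fact+
  obtain m0 where m0: "\<And>j m. 0 \<le> j \<Longrightarrow> j < int n \<Longrightarrow> m < m0 \<Longrightarrow> grade N (pt n k j m) = {\<zero>\<^bsub>N\<^esub>}"
    using bounded_below by blast
  have Vb: "V j m = {0}" if "0 \<le> j" "j < int n" "m < m0" for j m using m0[OF that] by (simp add: V_def iota_zero)
  have "\<exists>\<Phi>::nat \<Rightarrow> ('b \<Rightarrow> complex) \<Rightarrow> complex. (\<forall>l<rank_Gamma n k N. functional (\<Phi> l)) \<and>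
    (\<forall>d\<le>rank_Gamma n k N. \<forall>j m. 0 \<le> j \<longrightarrow> j < int n \<longrightarrow> cdim (V j m \<inter> {v. \<forall>l<d. \<Phi> l v = 0}) = cdim (V j m) - d)"
    using finite_B V_supported V_subspace V_mono Vb by (rule generic_flag)
  then obtain \<Phi> :: "nat \<Rightarrow> ('b \<Rightarrow> complex) \<Rightarrow> complex" where \<Phi>: "\<forall>l<rank_Gamma n k N. functional (\<Phi> l)"
    "\<forall>d\<le>rank_Gamma n k N. \<forall>j m. 0 \<le> j \<longrightarrow> j < int n \<longrightarrow> cdim (V j m \<inter> {v. \<forall>l<d. \<Phi> l v = 0}) = cdim (V j m) - d"
    by (elim exE conjE)
  interpret flagged n k N \<Phi> "rank_Gamma n k N"
    by unfold_locales (use \<Phi> in auto)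
  obtain f where "f \<in> ghom (G_dual n) (Rhat n k) CC M" "bij_betw f (carrier CC) (carrier M)"
    using assms(5) unfolding iso_G_def giso_def by blast
  from filtration[OF assms(3) this] show ?thesis .
qed

section \<open>Generalized eigenvectors modulo a subspace\<close>

locale linop = vector_space scale
  for scale :: "complex \<Rightarrow> 'v::ab_group_add \<Rightarrow> 'v" (infixr \<open>*s\<close> 75) +
  fixes D :: "'v \<Rightarrow> 'v"
  assumes D_add: "D (u + v) = D u + D v" and D_scale: "D (c *s v) = c *s D v"
begin

definition op :: "complex \<Rightarrow> 'v \<Rightarrow> 'v" where "op \<mu> v = D v - \<mu> *s v"

definition stable :: "'v set \<Rightarrow> bool" where
  "stable T \<longleftrightarrow> subspace T \<and> (\<forall>v\<in>T. D v \<in> T)"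

fun prodop :: "complex list \<Rightarrow> 'v \<Rightarrow> 'v" where
  "prodop [] v = v"
| "prodop (\<mu> # \<mu>s) v = prodop \<mu>s (op \<mu> v)"

text \<open>For stable T inside S this is the preimage in S of the generalized \<mu>-eigenspace of D
  on S / T. Working with preimages avoids a quotient space for each layer.\<close>

definition gen :: "'v set \<Rightarrow> 'v set \<Rightarrow> complex \<Rightarrow> 'v set" where
  "gen S T \<mu> = {v \<in> S. \<exists>K. (op \<mu> ^^ K) v \<in> T}"

lemma op_add: "op \<mu> (u + v) = op \<mu> u + op \<mu> v"
  by (simp add: op_def D_add scale_right_distrib)

lemma op_scale: "op \<mu> (c *s v) = c *s op \<mu> v"
  by (simp add: op_def D_scale scale_right_diff_distrib mult.commute)

lemma op_zero: "op \<mu> 0 = 0"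
  using op_add[of \<mu> 0 0] by simp

lemma op_diff: "op \<mu> (u - v) = op \<mu> u - op \<mu> v"
  using op_add[of \<mu> "u - v" v] by (simp add: algebra_simps)

lemma D_diff: "D (u - v) = D u - D v"
  using D_add[of "u - v" v] by (simp add: algebra_simps)

lemma op_commute: "op \<mu> (op \<nu> v) = op \<nu> (op \<mu> v)"
  by (simp add: op_def D_diff D_scale scale_right_diff_distrib mult.commute)

lemma pow_add: "(op \<mu> ^^ K) (u + v) = (op \<mu> ^^ K) u + (op \<mu> ^^ K) v"
  by (induction K) (simp_all add: op_add)

lemma pow_scale: "(op \<mu> ^^ K) (c *s v) = c *s (op \<mu> ^^ K) v"
  by (induction K) (simp_all add: op_scale)

lemma pow_diff: "(op \<mu> ^^ K) (u - v) = (op \<mu> ^^ K) u - (op \<mu> ^^ K) v"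
  by (induction K) (simp_all add: op_diff)

lemma pow_zero: "(op \<mu> ^^ K) 0 = 0"
  by (induction K) (simp_all add: op_zero)

lemma pow_op: "(op \<mu> ^^ K) (op \<nu> v) = op \<nu> ((op \<mu> ^^ K) v)"
  by (induction K) (simp_all add: op_commute)

lemma prod_add: "prodop \<mu>s (u + v) = prodop \<mu>s u + prodop \<mu>s v"
  by (induction \<mu>s arbitrary: u v) (simp_all add: op_add)

lemma prod_scale: "prodop \<mu>s (c *s v) = c *s prodop \<mu>s v"
  by (induction \<mu>s arbitrary: v) (simp_all add: op_scale)

lemma prod_op: "prodop \<mu>s (op \<nu> v) = op \<nu> (prodop \<mu>s v)"
proof (induction \<mu>s arbitrary: v)
  case (Cons a \<mu>s)
  have "op a (op \<nu> v) = op \<nu> (op a v)" by (rule op_commute)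
  thus ?case using Cons by simp
qed simp

lemma prod_append: "prodop (\<mu>s @ \<nu>s) v = prodop \<nu>s (prodop \<mu>s v)"
  by (induction \<mu>s arbitrary: v) simp_all

lemma prod_swap: "prodop \<mu>s (prodop \<nu>s v) = prodop \<nu>s (prodop \<mu>s v)"
  by (induction \<nu>s arbitrary: v) (simp_all add: prod_op[symmetric])

lemma prod_replicate: "prodop (replicate K \<mu>) v = (op \<mu> ^^ K) v"
  by (induction K arbitrary: v) (simp_all add: pow_op)

context
  fixes T assumes T: "stable T"
begin

lemma T_sub: "subspace T" using T by (simp add: stable_def)

lemma T_op: "v \<in> T \<Longrightarrow> op \<mu> v \<in> T"
  using T by (auto simp: stable_def op_def intro: subspace_diff subspace_scale)

lemma T_pow: "v \<in> T \<Longrightarrow> (op \<mu> ^^ K) v \<in> T"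
  by (induction K) (simp_all add: T_op)

lemma T_prod: "v \<in> T \<Longrightarrow> prodop \<mu>s v \<in> T"
  by (induction \<mu>s arbitrary: v) (simp_all add: T_op)

lemma pow_mono: "(op \<mu> ^^ K) v \<in> T \<Longrightarrow> K \<le> K' \<Longrightarrow> (op \<mu> ^^ K') v \<in> T"
proof -
  assume *: "(op \<mu> ^^ K) v \<in> T" "K \<le> K'"
  then obtain d where "K' = d + K" by (metis le_iff_add add.commute)
  thus ?thesis using T_pow[OF *(1)] by (simp add: funpow_add)
qed

lemma gen_subspace: assumes S: "stable S" shows "subspace (gen S T \<mu>)"
proof -
  have SS: "subspace S" using S by (simp add: stable_def)
  show ?thesis
  proof (rule subspaceI)
    show "0 \<in> gen S T \<mu>" using subspace_0[OF SS] subspace_0[OF T_sub] by (auto simp: gen_def intro!: exI[of _ 0])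
  next
    fix u v assume uv: "u \<in> gen S T \<mu>" "v \<in> gen S T \<mu>"
    then obtain K K' where K: "(op \<mu> ^^ K) u \<in> T" "(op \<mu> ^^ K') v \<in> T" by (auto simp: gen_def)
    have "(op \<mu> ^^ (max K K')) (u + v) \<in> T"
      unfolding pow_add by (intro subspace_add[OF T_sub] pow_mono[OF K(1)] pow_mono[OF K(2)]) auto
    thus "u + v \<in> gen S T \<mu>" using uv subspace_add[OF SS] by (auto simp: gen_def)
  next
    fix c u assume "u \<in> gen S T \<mu>"
    then obtain K where "u \<in> S" "(op \<mu> ^^ K) u \<in> T" by (auto simp: gen_def)
    hence "c *s u \<in> S" "(op \<mu> ^^ K) (c *s u) \<in> T"
      by (simp_all add: pow_scale subspace_scale[OF SS] subspace_scale[OF T_sub])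
    thus "c *s u \<in> gen S T \<mu>" unfolding gen_def by blast
  qed
qed

text \<open>On a generalized \<nu>-eigenspace D - \<mu> is the nonzero scalar \<nu> - \<mu> plus the
  operator D - \<nu>, which is nilpotent modulo T; hence it is invertible there. The induction on K
  sums the geometric series.\<close>

lemma gen_invert_base:
  assumes S: "stable S" and ne: "\<nu> \<noteq> \<mu>" and u: "u \<in> S" "(op \<nu> ^^ K) u \<in> T"
  shows "\<exists>w\<in>gen S T \<nu>. u - op \<mu> w \<in> T"
  using u
proof (induction K arbitrary: u)
  case 0
  have "0 \<in> gen S T \<nu>" using subspace_0[OF gen_subspace[OF S]] .
  thus ?case using 0 by (intro bexI[of _ 0]) (simp_all add: op_zero)
next
  case (Suc K)
  have SS: "subspace S" using S by (simp add: stable_def)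
  let ?c = "1 / (\<nu> - \<mu>)"
  have Sop: "op \<nu> u \<in> S" using S Suc.prems(1) by (auto simp: stable_def op_def intro: subspace_diff subspace_scale)
  \<comment> \<open>The first approximation \<open>?c *s u\<close> to a preimage of u leaves the
    error u', whose nilpotency order is one less than that of u.\<close>
  define u' where "u' = (- ?c) *s op \<nu> u"
  have u'S: "u' \<in> S" unfolding u'_def by (rule subspace_scale[OF SS Sop])
  have "(op \<nu> ^^ K) (op \<nu> u) \<in> T" using Suc.prems(2) by (simp add: pow_op)
  hence "(op \<nu> ^^ K) u' \<in> T" unfolding u'_def pow_scale by (rule subspace_scale[OF T_sub])
  from Suc.IH[OF u'S this] obtain w where w: "w \<in> gen S T \<nu>" "u' - op \<mu> w \<in> T" by blast
  have ug: "u \<in> gen S T \<nu>" using Suc.prems unfolding gen_def by blast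
  have "op \<mu> u = op \<nu> u + (\<nu> - \<mu>) *s u" by (simp add: op_def scale_left_diff_distrib)
  hence "op \<mu> (?c *s u) = ?c *s op \<nu> u + u" using ne by (simp add: op_scale scale_right_distrib)
  hence e: "u - op \<mu> (?c *s u + w) = u' - op \<mu> w" by (simp add: op_add u'_def)
  have "?c *s u + w \<in> gen S T \<nu>"
    by (intro subspace_add[OF gen_subspace[OF S]] subspace_scale[OF gen_subspace[OF S]] ug w(1))
  thus ?case using w(2) e by (intro bexI[of _ "?c *s u + w"]) simp_all
qed

abbreviation "Gsp S \<equiv> span (\<Union>\<nu>. gen S T \<nu>)"

text \<open>D - \<mu> is invertible modulo T on all generalized eigenspaces other than the one for
  \<mu>, so on their sum it is onto up to the \<mu>-part.\<close>

lemma gen_invert: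
  assumes S: "stable S" and u: "u \<in> Gsp S"
  shows "\<exists>w\<in>Gsp S. u - op \<mu> w \<in> gen S T \<mu>"
  using u
proof (induction u rule: span_induct_alt)
  case base
  show ?case using subspace_0[OF gen_subspace[OF S]] by (intro bexI[of _ 0]) (simp_all add: op_zero span_zero)
next
  case (step c x y)
  then obtain w where w: "w \<in> Gsp S" "y - op \<mu> w \<in> gen S T \<mu>" by blast
  obtain \<nu> where x: "x \<in> gen S T \<nu>" using step by blast
  have "\<exists>w'\<in>Gsp S. x - op \<mu> w' \<in> gen S T \<mu>"
  proof (cases "\<nu> = \<mu>")
    case True thus ?thesis using x by (intro bexI[of _ 0]) (simp_all add: op_zero span_zero)
  next
    case False
    obtain K where K: "x \<in> S" "(op \<nu> ^^ K) x \<in> T" using x by (auto simp: gen_def)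
    obtain w' where w': "w' \<in> gen S T \<nu>" "x - op \<mu> w' \<in> T" using gen_invert_base[OF S False K] by blast
    have "w' \<in> S" using w'(1) by (simp add: gen_def)
    hence "x - op \<mu> w' \<in> S" using S K(1) by (auto simp: stable_def op_def intro!: subspace_diff subspace_scale)
    hence "x - op \<mu> w' \<in> gen S T \<mu>" using w'(2) unfolding gen_def by (auto intro!: exI[of _ 0])
    moreover have "w' \<in> Gsp S" using w'(1) by (intro span_base) blast
    ultimately show ?thesis by blast
  qed
  then obtain w' where w': "w' \<in> Gsp S" "x - op \<mu> w' \<in> gen S T \<mu>" by blast
  have "c *s x + y - op \<mu> (c *s w' + w) = c *s (x - op \<mu> w') + (y - op \<mu> w)"
    by (simp add: op_add op_scale scale_right_diff_distrib)
  moreover have "c *s (x - op \<mu> w') + (y - op \<mu> w) \<in> gen S T \<mu>"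
    by (intro subspace_add[OF gen_subspace[OF S]] subspace_scale[OF gen_subspace[OF S]] w' w)
  moreover have "c *s w' + w \<in> Gsp S" by (intro span_add span_scale w w')
  ultimately show ?case by metis
qed

lemma Gsp_sub: assumes S: "stable S" shows "Gsp S \<subseteq> S"
  by (rule span_minimal) (use S in \<open>auto simp: gen_def stable_def\<close>)

lemma gen_invert_pow:
  assumes S: "stable S" and u: "u \<in> Gsp S"
  shows "\<exists>w\<in>Gsp S. u - (op \<mu> ^^ K) w \<in> gen S T \<mu>"
  using u
proof (induction K arbitrary: u)
  case 0
  show ?case using 0 subspace_0[OF gen_subspace[OF S]] by (intro bexI[of _ u]) simp_all
next
  case (Suc K)
  obtain w where w: "w \<in> Gsp S" "u - op \<mu> w \<in> gen S T \<mu>" using gen_invert[OF S Suc.prems] by blast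
  obtain w' where w': "w' \<in> Gsp S" "w - (op \<mu> ^^ K) w' \<in> gen S T \<mu>" using Suc.IH[OF w(1)] by blast
  have gop: "op \<mu> x \<in> gen S T \<mu>" if x: "x \<in> gen S T \<mu>" for x
  proof -
    obtain K where K: "x \<in> S" "(op \<mu> ^^ K) x \<in> T" using x by (auto simp: gen_def)
    have "op \<mu> x \<in> S" using S K(1) by (auto simp: stable_def op_def intro!: subspace_diff subspace_scale)
    moreover have "(op \<mu> ^^ K) (op \<mu> x) \<in> T" using T_op[OF K(2)] by (simp add: pow_op)
    ultimately show ?thesis by (auto simp: gen_def)
  qed
  have e: "u - (op \<mu> ^^ Suc K) w' = (u - op \<mu> w) + op \<mu> (w - (op \<mu> ^^ K) w')"
    by (simp add: op_diff)
  have "u - (op \<mu> ^^ Suc K) w' \<in> gen S T \<mu>"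
    unfolding e by (intro subspace_add[OF gen_subspace[OF S]] w gop w')
  thus ?case using w'(1) by blast
qed

text \<open>Primary decomposition by induction on the factors: (D - \<mu>) v is a sum of generalized
  eigenvectors, so (D - \<mu>) w = (D - \<mu>) v can be solved up to the \<mu>-part by such a sum w,
  and then v - w is a generalized \<mu>-eigenvector.\<close>

lemma gen_decompose:
  assumes S: "stable S" and v: "v \<in> S" "prodop \<mu>s v \<in> T"
  shows "v \<in> Gsp S"
  using v
proof (induction \<mu>s arbitrary: v)
  case Nil
  hence "v \<in> gen S T 0" by (auto simp: gen_def intro!: exI[of _ 0])
  thus ?case by (intro span_base) blast
next
  case (Cons \<mu> \<mu>s)
  have SS: "subspace S" using S by (simp add: stable_def)
  have "op \<mu> v \<in> S" using S Cons.prems(1) by (auto simp: stable_def op_def intro!: subspace_diff subspace_scale)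
  hence "op \<mu> v \<in> Gsp S" using Cons by simp
  then obtain w where w: "w \<in> Gsp S" "op \<mu> v - op \<mu> w \<in> gen S T \<mu>" using gen_invert[OF S] by blast
  then obtain K where "(op \<mu> ^^ K) (op \<mu> (v - w)) \<in> T" by (auto simp: gen_def op_diff)
  hence "(op \<mu> ^^ Suc K) (v - w) \<in> T" by (simp add: pow_op)
  moreover have "v - w \<in> S" using subspace_diff[OF SS Cons.prems(1)] Gsp_sub[OF S] w(1) by blast
  ultimately have "v - w \<in> gen S T \<mu>" unfolding gen_def by blast
  hence "v - w \<in> Gsp S" by (intro span_base) blast
  hence "(v - w) + w \<in> Gsp S" by (rule span_add[OF _ w(1)])
  thus ?case by simp
qed

text \<open>As a polynomial, the product of the X - \<mu> is congruent modulo X - \<nu> to the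
  product c of the \<nu> - \<mu>, which is nonzero; w is the quotient of the division, evaluated at
  D and applied to u.\<close>

lemma prod_expand:
  assumes S: "stable S" and u: "u \<in> S" and ne: "\<nu> \<notin> set \<mu>s"
  shows "\<exists>w\<in>S. \<exists>c. c \<noteq> 0 \<and> prodop \<mu>s u = c *s u + op \<nu> w \<and> (op \<nu> u \<in> T \<longrightarrow> op \<nu> w \<in> T)"
  using ne
proof (induction \<mu>s)
  case Nil
  have SS: "subspace S" using S by (simp add: stable_def)
  show ?case using subspace_0[OF SS] subspace_0[OF T_sub] by (intro bexI[of _ 0] exI[of _ 1]) (simp_all add: op_zero)
next
  case (Cons \<mu> \<mu>s)
  have SS: "subspace S" using S by (simp add: stable_def)
  have Sop: "x \<in> S \<Longrightarrow> op \<rho> x \<in> S" for x \<rho> using S by (auto simp: stable_def op_def intro!: subspace_diff subspace_scale)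
  obtain w c where w: "w \<in> S" "c \<noteq> 0" "prodop \<mu>s u = c *s u + op \<nu> w" "op \<nu> u \<in> T \<longrightarrow> op \<nu> w \<in> T"
    using Cons by auto
  have ou: "op \<mu> u = op \<nu> u + (\<nu> - \<mu>) *s u" by (simp add: op_def scale_left_diff_distrib)
  have "prodop (\<mu> # \<mu>s) u = op \<mu> (c *s u + op \<nu> w)" by (simp add: prod_op w(3))
  also have "\<dots> = c *s (op \<nu> u + (\<nu> - \<mu>) *s u) + op \<nu> (op \<mu> w)"
    by (simp only: op_add op_scale ou op_commute[of \<mu> \<nu>])
  also have "\<dots> = (c * (\<nu> - \<mu>)) *s u + op \<nu> (c *s u + op \<mu> w)"
    by (simp add: scale_right_distrib op_add op_scale)
  finally have "prodop (\<mu> # \<mu>s) u = (c * (\<nu> - \<mu>)) *s u + op \<nu> (c *s u + op \<mu> w)" .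
  moreover have "c *s u + op \<mu> w \<in> S" by (intro subspace_add[OF SS] subspace_scale[OF SS] u Sop w(1))
  moreover have "c * (\<nu> - \<mu>) \<noteq> 0" using w(2) Cons.prems by auto
  moreover have "op \<nu> u \<in> T \<longrightarrow> op \<nu> (c *s u + op \<mu> w) \<in> T"
    using w(4) by (auto simp: op_add op_scale op_commute[of \<nu> \<mu>] intro!: subspace_add[OF T_sub] subspace_scale[OF T_sub] T_op)
  ultimately show ?case by blast
qed

lemma stable_UNIV: "stable UNIV" by (simp add: stable_def)

text \<open>A product without the factor X - \<nu> is coprime to the powers of X - \<nu>, so what
  both kill modulo T is zero modulo T.\<close>

lemma prod_coprime_pow:
  assumes "\<nu> \<notin> set \<mu>s" "prodop \<mu>s u \<in> T" "(op \<nu> ^^ K) u \<in> T"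
  shows "u \<in> T"
  using assms(2,3)
proof (induction K arbitrary: u)
  case (Suc K)
  have "op \<nu> u \<in> T"
  proof (rule Suc.IH)
    show "prodop \<mu>s (op \<nu> u) \<in> T" using T_op[OF Suc.prems(1)] by (simp add: prod_op)
    show "(op \<nu> ^^ K) (op \<nu> u) \<in> T" using Suc.prems(2) by (simp add: pow_op)
  qed
  then obtain w c where w: "c \<noteq> 0" "prodop \<mu>s u = c *s u + op \<nu> w" "op \<nu> w \<in> T"
    using prod_expand[OF stable_UNIV _ assms(1), of u] by auto
  have "c *s u = prodop \<mu>s u - op \<nu> w" using w(2) by simp
  hence "c *s u \<in> T" using subspace_diff[OF T_sub Suc.prems(1) w(3)] by simp
  hence "(1 / c) *s (c *s u) \<in> T" by (rule subspace_scale[OF T_sub])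
  thus ?case using w(1) by simp
qed simp

text \<open>v is a generalized \<nu>-eigenvector modulo S. The defect (D - \<nu>)^K v lies in S,
  where it equals (D - \<nu>)^K w up to a generalized \<nu>-eigenvector modulo T. Replacing v by v -
  w moves the congruence from S down to T.\<close>

lemma lift_step:
  assumes S: "stable S" and all: "S \<subseteq> Gsp S" and v: "(op \<nu> ^^ K) v \<in> S"
  shows "\<exists>v' K'. v - v' \<in> S \<and> (op \<nu> ^^ K') v' \<in> T"
proof -
  obtain w where w: "w \<in> Gsp S" "(op \<nu> ^^ K) v - (op \<nu> ^^ K) w \<in> gen S T \<nu>"
    using gen_invert_pow[OF S subsetD[OF all v]] by blast
  then obtain K' where "(op \<nu> ^^ K') ((op \<nu> ^^ K) (v - w)) \<in> T" by (auto simp: gen_def pow_diff)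
  hence "(op \<nu> ^^ (K' + K)) (v - w) \<in> T" by (simp add: funpow_add)
  moreover have "v - (v - w) \<in> S" using w(1) Gsp_sub[OF S] by auto
  ultimately show ?thesis by blast
qed

end

text \<open>The operator p(D), applied to u.\<close>

definition pap :: "complex poly \<Rightarrow> 'v \<Rightarrow> 'v" where
  "pap p u = (\<Sum>i\<le>degree p. coeff p i *s (D ^^ i) u)"

lemma pap_bound: "degree p \<le> m \<Longrightarrow> pap p u = (\<Sum>i\<le>m. coeff p i *s (D ^^ i) u)"
  unfolding pap_def by (rule sum.mono_neutral_left) (auto simp: coeff_eq_0)

lemma Dpow_op: "(D ^^ i) (op \<mu> u) = (D ^^ Suc i) u - \<mu> *s (D ^^ i) u"
proof (induction i)
  case 0 show ?case by (simp add: op_def)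
next
  case (Suc i) thus ?case by (simp add: D_diff D_scale)
qed

lemma pap_root: "pap ([:- \<mu>, 1:] * q) u = pap q (op \<mu> u)"
proof -
  let ?p = "[:- \<mu>, 1:] * q" let ?m = "degree q"
  have p: "?p = pCons 0 q - smult \<mu> q" by simp
  have "degree ?p \<le> Suc ?m" using degree_mult_le[of "[:- \<mu>, 1:]" q] by simp
  hence "pap ?p u = (\<Sum>i\<le>Suc ?m. coeff ?p i *s (D ^^ i) u)" by (rule pap_bound)
  also have "\<dots> = (\<Sum>i\<le>Suc ?m. coeff (pCons 0 q) i *s (D ^^ i) u) - (\<Sum>i\<le>Suc ?m. (\<mu> * coeff q i) *s (D ^^ i) u)"
    unfolding p by (simp only: coeff_diff coeff_smult scale_left_diff_distrib sum_subtractf)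
  also have "(\<Sum>i\<le>Suc ?m. coeff (pCons 0 q) i *s (D ^^ i) u) = (\<Sum>i\<le>?m. coeff q i *s (D ^^ Suc i) u)"
    unfolding sum.atMost_Suc_shift by simp
  also have "(\<Sum>i\<le>Suc ?m. (\<mu> * coeff q i) *s (D ^^ i) u) = (\<Sum>i\<le>?m. (\<mu> * coeff q i) *s (D ^^ i) u)"
    by (simp add: coeff_eq_0)
  also have "(\<Sum>i\<le>?m. coeff q i *s (D ^^ Suc i) u) - (\<Sum>i\<le>?m. (\<mu> * coeff q i) *s (D ^^ i) u)
     = (\<Sum>i\<le>?m. coeff q i *s (D ^^ i) (op \<mu> u))"
    unfolding sum_subtractf[symmetric] by (intro sum.cong refl) (simp only: Dpow_op scale_right_diff_distrib scale_scale mult.commute)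
  finally show ?thesis by (simp add: pap_def)
qed

text \<open>Over the complex numbers p splits into linear factors; they are split off one root at a
  time.\<close>

lemma pap_prodop:
  assumes T: "subspace T" and p: "p \<noteq> 0" "pap p u \<in> T"
  shows "\<exists>\<mu>s. prodop \<mu>s u \<in> T"
  using p
proof (induction "degree p" arbitrary: p u)
  case 0
  then obtain c where c: "p = [:c:]" by (metis degree_eq_zeroE)
  hence "c *s u \<in> T" "c \<noteq> 0" using 0 by (auto simp: pap_def)
  hence "(1 / c) *s (c *s u) \<in> T" using subspace_scale[OF T] by blast
  hence "u \<in> T" using \<open>c \<noteq> 0\<close> by simp
  thus ?case by (intro exI[of _ "[]"]) simp
next
  case (Suc m)
  have "\<not> constant (poly p)" using Suc.hyps(2) by (simp add: constant_degree)
  then obtain \<mu> where "poly p \<mu> = 0" using fundamental_theorem_of_algebra by blast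
  then obtain q where q: "p = [:- \<mu>, 1:] * q" by (auto simp: poly_eq_0_iff_dvd elim: dvdE)
  have q0: "q \<noteq> 0" using Suc.prems(1) q by auto
  have "degree p = Suc (degree q)" unfolding q using degree_mult_eq[of "[:- \<mu>, 1:]" q] q0 by simp
  moreover have "pap q (op \<mu> u) \<in> T" using Suc.prems(2) by (simp only: q pap_root)
  ultimately obtain \<mu>s where "prodop \<mu>s (op \<mu> u) \<in> T" using Suc.hyps(1)[of q "op \<mu> u"] Suc.hyps(2) q0 by auto
  thus ?case by (intro exI[of _ "\<mu> # \<mu>s"]) simp
qed

end

section \<open>Regular singular connections\<close>

definition smul :: "complex fps \<Rightarrow> ('i \<Rightarrow> complex fps) \<Rightarrow> 'i \<Rightarrow> complex fps" where
  "smul f v = (\<lambda>b. f * v b)"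

lemma smul_simps:
  "smul f (u + v) = smul f u + smul f v" "smul (f + g) v = smul f v + smul g v"
  "smul f (smul g v) = smul (f * g) v" "smul 1 v = v" "smul 0 v = 0" "smul f 0 = 0"
  "smul f (u - v) = smul f u - smul f v" "smul (f - g) v = smul f v - smul g v"
  by (simp_all add: smul_def fun_eq_iff algebra_simps)

lemma smul_sum: "smul f (\<Sum>z\<in>A. g z) = (\<Sum>z\<in>A. smul f (g z))"
  by (rule ext) (simp add: smul_def sum_fun_apply sum_distrib_left)

lemma FV_vector_space: "vector_space (\<lambda>c. smul (fps_const c) :: ('i \<Rightarrow> complex fps) \<Rightarrow> 'i \<Rightarrow> complex fps)"
  by unfold_locales (simp_all add: smul_simps flip: fps_const_add fps_const_mult)

text \<open>A module in coordinates with respect to a finite C[[t]]-basis B: \<open>D\<close> is a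
  connection over n t d/dt and the \<open>pi j\<close> are the projections to its graded pieces. The
  Leibniz rule is asked for v supported on B only, because values of \<open>D\<close> vanish outside
  B while the term with the derivative of f need not.\<close>

locale connection =
  fixes B :: "'i set" and n :: nat and D :: "('i \<Rightarrow> complex fps) \<Rightarrow> 'i \<Rightarrow> complex fps"
    and J :: "int set" and pi :: "int \<Rightarrow> ('i \<Rightarrow> complex fps) \<Rightarrow> 'i \<Rightarrow> complex fps"
  assumes finB: "finite B" and n1: "1 \<le> n" and finJ: "finite J"
    and D_add: "D (u + v) = D u + D v"
    and D_scale: "D (smul (fps_const c) v) = smul (fps_const c) (D v)"
    and D_out: "b \<notin> B \<Longrightarrow> D v b = 0"
    and D_smul: "\<forall>b. b \<notin> B \<longrightarrow> v b = 0 \<Longrightarrow> D (smul f v) = smul f (D v) + smul (of_nat n * fps_X * fps_deriv f) v"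
    and pi_add: "pi j (u + v) = pi j u + pi j v"
    and pi_smul: "pi j (smul f v) = smul f (pi j v)"
    and pi_out: "b \<notin> B \<Longrightarrow> pi j v b = 0"
    and pi_pi: "i \<in> J \<Longrightarrow> j \<in> J \<Longrightarrow> pi i (pi j v) = (if i = j then pi j v else 0)"
    and pi_sum: "\<forall>b. b \<notin> B \<longrightarrow> v b = 0 \<Longrightarrow> (\<Sum>j\<in>J. pi j v) = v"
    and pi_D: "j \<in> J \<Longrightarrow> pi j (D v) = D (pi j v)"
begin

sublocale linop "\<lambda>c. smul (fps_const c)" D
  by (intro linop.intro FV_vector_space linop_axioms.intro D_add D_scale)

definition VB :: "('i \<Rightarrow> complex fps) set" where "VB = {v. \<forall>b. b \<notin> B \<longrightarrow> v b = 0}"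

text \<open>This is t^N M, as \<open>T_factor\<close> and \<open>T_power\<close> confirm.\<close>

definition T :: "nat \<Rightarrow> ('i \<Rightarrow> complex fps) set" where
  "T N = {v \<in> VB. \<forall>b. \<forall>i<N. fps_nth (v b) i = 0}"

lemma T_0: "T 0 = VB" by (simp add: T_def)

lemma VB_smul: "v \<in> VB \<Longrightarrow> smul f v \<in> VB" by (simp add: VB_def smul_def)
lemma VB_add: "u \<in> VB \<Longrightarrow> v \<in> VB \<Longrightarrow> u + v \<in> VB" by (simp add: VB_def)
lemma VB_D: "D v \<in> VB" by (simp add: VB_def D_out)
lemma VB_pi: "pi j v \<in> VB" by (simp add: VB_def pi_out)

lemma T_smul: "v \<in> T N \<Longrightarrow> smul f v \<in> T N"
  by (auto simp: T_def VB_smul) (auto simp: smul_def fps_mult_nth)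

lemma T_smul_low: "v \<in> VB \<Longrightarrow> (\<And>i. i < N \<Longrightarrow> fps_nth f i = 0) \<Longrightarrow> smul f v \<in> T N"
  by (auto simp: T_def VB_smul) (auto simp: smul_def fps_mult_nth)

lemma T_subspace: "subspace (T N)"
  by (rule subspaceI) (auto simp: T_def VB_def smul_def)

lemma T_add: "u \<in> T N \<Longrightarrow> v \<in> T N \<Longrightarrow> u + v \<in> T N" by (rule subspace_add[OF T_subspace])
lemma T_diff: "u \<in> T N \<Longrightarrow> v \<in> T N \<Longrightarrow> u - v \<in> T N" by (rule subspace_diff[OF T_subspace])

lemma VB_subspace: "subspace VB" using T_subspace[of 0] by (simp add: T_0)

lemma T_mono: "N \<le> N' \<Longrightarrow> T N' \<subseteq> T N" by (auto simp: T_def)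

lemma T_VB: "v \<in> T N \<Longrightarrow> v \<in> VB" by (simp add: T_def)

lemma T_factor: "v \<in> T N \<Longrightarrow> \<exists>u\<in>VB. v = smul (fps_X ^ N) u"
proof -
  assume v: "v \<in> T N"
  have "v = smul (fps_X ^ N) (\<lambda>b. fps_shift N (v b))"
  proof
    fix b show "v b = smul (fps_X ^ N) (\<lambda>b. fps_shift N (v b)) b"
      using v by (intro fps_ext) (simp add: smul_def fps_X_power_mult_nth T_def)
  qed
  moreover have "(\<lambda>b. fps_shift N (v b)) \<in> VB" using v by (simp add: T_def VB_def)
  ultimately show ?thesis by blast
qed

lemma T_power: "u \<in> VB \<Longrightarrow> smul (fps_X ^ N) u \<in> T N"
  by (rule T_smul_low) (simp_all add: fps_X_power_nth)

lemma T_Int: assumes "\<And>N. v \<in> T N" shows "v = 0"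
proof
  fix b show "v b = 0 b"
  proof (rule fps_ext)
    fix i show "fps_nth (v b) i = fps_nth (0 b) i" using assms[of "Suc i"] by (simp add: T_def)
  qed
qed

lemma euler_nth: "fps_nth (of_nat n * fps_X * fps_deriv f) i = of_nat (n * i) * fps_nth (f :: complex fps) i"
  by (cases i) (simp_all add: mult.assoc algebra_simps flip: fps_of_nat)

lemma euler_X_power: "of_nat n * fps_X * fps_deriv (fps_X ^ N) = fps_const (of_nat (n * N)) * (fps_X ^ N :: complex fps)"
  by (rule fps_ext) (simp add: euler_nth fps_X_power_nth)

text \<open>t^N is an eigenvector of n t d/dt for nN; this is the source of the shift of eigenvalues
  from layer to layer.\<close>

lemma D_power: assumes "u \<in> VB"
  shows "D (smul (fps_X ^ N) u) = smul (fps_X ^ N) (D u + smul (fps_const (of_nat (n * N))) u)"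
proof -
  have "D (smul (fps_X ^ N) u) = smul (fps_X ^ N) (D u) + smul (fps_const (of_nat (n * N)) * fps_X ^ N) u"
    using D_smul[of u "fps_X ^ N"] assms unfolding euler_X_power by (simp add: VB_def)
  thus ?thesis by (simp only: smul_simps mult.commute)
qed

lemma T_zero: "0 \<in> T N" by (rule subspace_0[OF T_subspace])

lemma T_stable: "stable (T N)"
  unfolding stable_def
proof (intro conjI ballI T_subspace)
  fix v assume "v \<in> T N"
  then obtain u where u: "u \<in> VB" "v = smul (fps_X ^ N) u" using T_factor by blast
  show "D v \<in> T N" unfolding u(2) D_power[OF u(1)] by (intro T_power VB_add VB_D VB_smul u(1))
qed

lemma VB_stable: "stable VB" using T_stable[of 0] by (simp add: T_0)

lemma VB_op: "v \<in> VB \<Longrightarrow> op \<mu> v \<in> VB" by (rule T_op[OF VB_stable])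
lemma VB_diff: "u \<in> VB \<Longrightarrow> v \<in> VB \<Longrightarrow> u - v \<in> VB" by (rule subspace_diff[OF VB_subspace])
lemma VB_sum: "(\<And>z. z \<in> A \<Longrightarrow> f z \<in> VB) \<Longrightarrow> (\<Sum>z\<in>A. f z) \<in> VB" by (rule subspace_sum[OF VB_subspace])

lemma op_power: assumes "u \<in> VB"
  shows "op (\<mu> + of_nat (n * N)) (smul (fps_X ^ N) u) = smul (fps_X ^ N) (op \<mu> u)"
proof -
  have "smul (fps_const (\<mu> + of_nat (n * N))) (smul (fps_X ^ N) u)
     = smul (fps_X ^ N) (smul (fps_const \<mu>) u) + smul (fps_X ^ N) (smul (fps_const (of_nat (n * N))) u)"
    by (rule ext) (simp add: smul_def algebra_simps flip: fps_const_add)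
  thus ?thesis unfolding op_def D_power[OF assms] by (simp only: smul_simps) simp
qed

lemma prodop_power: "u \<in> VB \<Longrightarrow>
  prodop (map (\<lambda>\<mu>. \<mu> + of_nat (n * N)) \<mu>s) (smul (fps_X ^ N) u) = smul (fps_X ^ N) (prodop \<mu>s u)"
  by (induction \<mu>s arbitrary: u) (simp_all add: op_power VB_op del: of_nat_mult)

lemma pow_power: "u \<in> VB \<Longrightarrow> (op (\<mu> + of_nat (n * N)) ^^ K) (smul (fps_X ^ N) u) = smul (fps_X ^ N) ((op \<mu> ^^ K) u)"
  using prodop_power[of u N "replicate K \<mu>"] by (simp add: prod_replicate)

definition ev0 :: "('i \<Rightarrow> complex fps) \<Rightarrow> 'i \<Rightarrow> complex" where "ev0 v = (\<lambda>b. fps_nth (v b) 0)"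

lemma ev0_simps: "ev0 (u + v) = ev0 u + ev0 v" "ev0 (smul (fps_const c) v) = (\<lambda>b. c * ev0 v b)"
  "ev0 (u - v) = ev0 u - ev0 v"
  by (simp_all add: ev0_def smul_def fun_eq_iff)

lemma ev0_sum: "ev0 (\<Sum>z\<in>A. f z) = (\<Sum>z\<in>A. ev0 (f z))"
  by (induction A rule: infinite_finite_induct) (simp_all add: ev0_simps, simp_all add: ev0_def fun_eq_iff)

lemma T_1_iff: "v \<in> VB \<Longrightarrow> v \<in> T 1 \<longleftrightarrow> ev0 v = 0"
  by (simp add: T_def ev0_def fun_eq_iff)

lemma ev0_supported: "v \<in> VB \<Longrightarrow> ev0 v \<in> supported B"
  by (simp add: VB_def ev0_def supported_def)

definition evec :: "'i \<Rightarrow> 'i \<Rightarrow> complex fps" where "evec b = (\<lambda>b'. if b' = b then 1 else 0)"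

text \<open>M / tM has dimension \<open>card B\<close>, so the first card B + 1 iterates of D on a
  basis vector are dependent modulo t and a nonzero polynomial in D kills it there. The linear
  factors of these polynomials, for all basis vectors, are put into one list.\<close>

lemma annihilator: "\<exists>\<mu>s. \<forall>v\<in>VB. prodop \<mu>s v \<in> T 1"
proof -
  have evB: "evec b \<in> VB" if "b \<in> B" for b using that by (auto simp: evec_def VB_def)
  have one: "\<exists>\<mu>s. prodop \<mu>s (evec b) \<in> T 1" if b: "b \<in> B" for b
  proof -
    have DV: "(D ^^ i) (evec b) \<in> VB" for i by (cases i) (simp_all add: evB b VB_D)
    obtain a where a: "\<exists>i\<in>{..card B}. a i \<noteq> (0::complex)"
      "\<forall>b'\<in>B. (\<Sum>i\<in>{..card B}. a i * ev0 ((D ^^ i) (evec b)) b') = 0"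
      using dependent_idom[OF finB, of "{..card B}" "\<lambda>i. ev0 ((D ^^ i) (evec b))"] by auto
    define p where "p = (\<Sum>i\<le>card B. monom (a i) i)"
    have cp: "coeff p i = (if i \<le> card B then a i else 0)" for i
      by (simp add: p_def coeff_sum)
    have p0: "p \<noteq> 0" using a(1) cp by (metis atMost_iff coeff_0)
    have "degree p \<le> card B" by (rule degree_le) (simp add: cp)
    hence pap: "pap p (evec b) = (\<Sum>i\<le>card B. smul (fps_const (a i)) ((D ^^ i) (evec b)))"
      by (subst pap_bound) (auto simp: cp intro!: sum.cong)
    have "pap p (evec b) \<in> VB" unfolding pap by (intro VB_sum VB_smul DV)
    moreover have "ev0 (pap p (evec b)) = 0"
    proof
      fix b'
      have "ev0 (pap p (evec b)) b' = (\<Sum>i\<le>card B. a i * ev0 ((D ^^ i) (evec b)) b')"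
        unfolding pap ev0_sum by (simp add: ev0_simps sum_fun_apply)
      also have "\<dots> = 0"
      proof (cases "b' \<in> B")
        case False thus ?thesis using ev0_supported[OF DV] by (simp add: supported_def)
      qed (use a(2) in simp)
      finally show "ev0 (pap p (evec b)) b' = 0 b'" by simp
    qed
    ultimately have "pap p (evec b) \<in> T 1" using T_1_iff by blast
    from pap_prodop[OF T_subspace p0 this] show ?thesis .
  qed
  have "\<exists>\<mu>s. \<forall>b\<in>B'. prodop \<mu>s (evec b) \<in> T 1" if "finite B'" "B' \<subseteq> B" for B'
    using that
  proof (induction B' rule: finite_induct)
    case (insert b B')
    then obtain \<mu>s where "\<forall>b\<in>B'. prodop \<mu>s (evec b) \<in> T 1" by auto
    moreover obtain \<nu>s where "prodop \<nu>s (evec b) \<in> T 1" using one[of b] insert.prems by blast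
    ultimately have "\<forall>b\<in>insert b B'. prodop (\<mu>s @ \<nu>s) (evec b) \<in> T 1"
      using T_prod[OF T_stable[of 1]] by (auto simp: prod_append) (metis prod_swap)
    thus ?case ..
  qed simp
  from this[OF finB subset_refl] obtain \<mu>s where "\<forall>b\<in>B. prodop \<mu>s (evec b) \<in> T 1" ..
  hence \<mu>s: "\<And>b. b \<in> B \<Longrightarrow> prodop \<mu>s (evec b) \<in> T 1" by (rule bspec)
  have "prodop \<mu>s v \<in> T 1" if v: "v \<in> VB" for v
  proof -
    let ?s = "\<Sum>b\<in>B. smul (fps_const (ev0 v b)) (evec b)"
    have sV: "?s \<in> VB" by (intro VB_sum VB_smul evB)
    have "ev0 ?s = ev0 v"
    proof
      fix b
      have "ev0 ?s b = (\<Sum>b'\<in>B. ev0 v b' * ev0 (evec b') b)"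
        by (simp add: ev0_sum ev0_simps sum_fun_apply)
      also have "\<dots> = (\<Sum>b'\<in>B. if b = b' then ev0 v b else 0)"
        by (intro sum.cong refl) (auto simp: ev0_def evec_def)
      finally have "ev0 ?s b = (\<Sum>b'\<in>B. if b = b' then ev0 v b else 0)" .
      thus "ev0 ?s b = ev0 v b" using finB ev0_supported[OF v] by (simp add: supported_def)
    qed
    hence "v - ?s \<in> T 1" using T_1_iff[OF VB_diff[OF v sV]] by (simp add: ev0_simps)
    hence "prodop \<mu>s (v - ?s) \<in> T 1" by (rule T_prod[OF T_stable])
    moreover have "prodop \<mu>s ?s \<in> T 1"
    proof -
      have "prodop \<mu>s (\<Sum>b\<in>A. smul (fps_const (ev0 v b)) (evec b)) \<in> T 1" if "finite A" "A \<subseteq> B" for A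
        using that
      proof (induction A rule: finite_induct)
        case empty
        show ?case unfolding sum.empty by (rule T_prod[OF T_stable T_zero])
      next
        case (insert b A)
        hence "prodop \<mu>s (\<Sum>b\<in>A. smul (fps_const (ev0 v b)) (evec b)) \<in> T 1" "b \<in> B" by simp_all
        thus ?case unfolding sum.insert[OF insert(1,2)] prod_add prod_scale by (intro T_add T_smul \<mu>s)
      qed
      thus ?thesis using finB by blast
    qed
    ultimately have "prodop \<mu>s ((v - ?s) + ?s) \<in> T 1" unfolding prod_add by (rule T_add)
    thus ?thesis by simp
  qed
  thus ?thesis by blast
qed

text \<open>Divide by t^N, apply the annihilator of M / tM and multiply back; moving D past t^N
  shifts each \<mu> by nN.\<close>

lemma T_prodop_shift:
  assumes "\<forall>v\<in>VB. prodop \<mu>s v \<in> T 1" "v \<in> T N"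
  shows "prodop (map (\<lambda>\<mu>. \<mu> + of_nat (n * N)) \<mu>s) v \<in> T (Suc N)"
proof -
  obtain u where u: "u \<in> VB" "v = smul (fps_X ^ N) u" using T_factor[OF assms(2)] by blast
  obtain w where w: "w \<in> VB" "prodop \<mu>s u = smul (fps_X ^ 1) w" using T_factor assms(1) u(1) by blast
  have "prodop (map (\<lambda>\<mu>. \<mu> + of_nat (n * N)) \<mu>s) v = smul (fps_X ^ Suc N) w"
    unfolding u(2) prodop_power[OF u(1)] w(2) by (simp add: smul_simps mult.commute)
  thus ?thesis using T_power[OF w(1), of "Suc N"] by simp
qed

lemma T_span: "T N \<subseteq> span (\<Union>\<nu>. gen (T N) (T (Suc N)) \<nu>)"
proof
  fix v assume v: "v \<in> T N"
  obtain \<mu>s where "\<forall>v\<in>VB. prodop \<mu>s v \<in> T 1" using annihilator by blast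
  from T_prodop_shift[OF this v] show "v \<in> span (\<Union>\<nu>. gen (T N) (T (Suc N)) \<nu>)"
    by (rule gen_decompose[OF T_stable T_stable v])
qed

text \<open>Non-resonance: only finitely many layers have \<open>\<nu>\<close> as an eigenvalue, so on all deep layers
  \<open>D - \<nu>\<close> is surjective, by successive approximation.\<close>

lemma op_surj: "\<exists>N0. \<forall>N\<ge>N0. \<forall>u\<in>T N. \<exists>w\<in>T N. op \<nu> w = u"
proof -
  obtain \<mu>s where \<mu>s: "\<forall>v\<in>VB. prodop \<mu>s v \<in> T 1" using annihilator by blast
  \<comment> \<open>For each \<mu> in the list, \<nu> = \<mu> + nN has at most one solution
    N.\<close>
  have "finite {N. \<exists>\<mu>\<in>set \<mu>s. \<nu> = \<mu> + of_nat (n * N)}"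
  proof -
    have "finite {N. \<nu> = \<mu> + of_nat (n * N)}" for \<mu>
    proof (rule finite_subset)
      show "{N. \<nu> = \<mu> + of_nat (n * N)} \<subseteq> {SOME N. \<nu> = \<mu> + of_nat (n * N)}"
      proof
        fix N assume "N \<in> {N. \<nu> = \<mu> + of_nat (n * N)}"
        hence N: "\<nu> = \<mu> + of_nat (n * N)" by simp
        hence "\<nu> = \<mu> + of_nat (n * (SOME N. \<nu> = \<mu> + of_nat (n * N)))" by (rule someI)
        hence "of_nat (n * N) = (of_nat (n * (SOME N. \<nu> = \<mu> + of_nat (n * N))) :: complex)" using N by (metis add_left_imp_eq)
        hence "n * N = n * (SOME N. \<nu> = \<mu> + of_nat (n * N))" by (simp only: of_nat_eq_iff)
        thus "N \<in> {SOME N. \<nu> = \<mu> + of_nat (n * N)}" using n1 by simp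
      qed
    qed simp
    moreover have "{N. \<exists>\<mu>\<in>set \<mu>s. \<nu> = \<mu> + of_nat (n * N)} = (\<Union>\<mu>\<in>set \<mu>s. {N. \<nu> = \<mu> + of_nat (n * N)})" by auto
    ultimately show ?thesis by simp
  qed
  then obtain N0 where "\<forall>N\<in>{N. \<exists>\<mu>\<in>set \<mu>s. \<nu> = \<mu> + of_nat (n * N)}. N < N0"
    unfolding finite_nat_set_iff_bounded ..
  hence N0: "\<And>N. N \<in> {N. \<exists>\<mu>\<in>set \<mu>s. \<nu> = \<mu> + of_nat (n * N)} \<Longrightarrow> N < N0" by (rule bspec)
  \<comment> \<open>In a layer whose eigenvalues avoid \<nu>, a product of factors D - \<mu> takes u
    into the next layer and is a nonzero scalar modulo D - \<nu>. Dividing by the scalar solves (D -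
    \<nu>) w = u up to the next layer.\<close>
  have step: "\<exists>w\<in>T N. u - op \<nu> w \<in> T (Suc N)" if N: "N \<ge> N0" and u: "u \<in> T N" for N u
  proof -
    let ?\<mu>s = "map (\<lambda>\<mu>. \<mu> + of_nat (n * N)) \<mu>s"
    have "\<nu> \<notin> set ?\<mu>s" using N0[of N] N by auto
    from prod_expand[OF T_stable T_stable u this, of "Suc N"] obtain w c where
      w: "w \<in> T N" "c \<noteq> 0" "prodop ?\<mu>s u = smul (fps_const c) u + op \<nu> w" by blast
    have "smul (fps_const (1 / c)) (prodop ?\<mu>s u) \<in> T (Suc N)"
      by (intro T_smul T_prodop_shift \<mu>s u)
    moreover have "smul (fps_const (1 / c)) (prodop ?\<mu>s u) = u - op \<nu> (smul (fps_const (- (1 / c))) w)"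
    proof -
      have "smul (fps_const (1 / c)) (smul (fps_const c) u) = u"
        using w(2) by (simp add: smul_simps fps_const_mult)
      moreover have "smul (fps_const (- (1 / c))) x = - smul (fps_const (1 / c)) x" for x :: "'i \<Rightarrow> complex fps"
        by (simp add: smul_def fun_eq_iff flip: fps_const_neg)
      ultimately have "op \<nu> (smul (fps_const (- (1 / c))) w) = - smul (fps_const (1 / c)) (op \<nu> w)"
        using op_scale[of \<nu> "- (1 / c)" w] by metis
      moreover have "smul (fps_const (1 / c)) (prodop ?\<mu>s u) = u + smul (fps_const (1 / c)) (op \<nu> w)"
        unfolding w(3) smul_simps(1) by (simp only: \<open>smul (fps_const (1 / c)) (smul (fps_const c) u) = u\<close>)
      ultimately show ?thesis by (simp only: diff_minus_eq_add)
    qed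
    ultimately show ?thesis using T_smul[OF w(1)] by metis
  qed
  have "\<exists>w\<in>T N. op \<nu> w = u" if N: "N \<ge> N0" and u: "u \<in> T N" for N u
  proof -
    \<comment> \<open>\<open>fst (f i)\<close> is the error before step i and
      \<open>snd (f i)\<close> the correction made in it.\<close>
    have "\<exists>f. \<forall>i. (fst (f i) \<in> T (N + i) \<and> snd (f i) \<in> T (N + i) \<and> (i = 0 \<longrightarrow> fst (f i) = u) \<and> fst (f i) - op \<nu> (snd (f i)) \<in> T (Suc (N + i)))
       \<and> fst (f (Suc i)) = fst (f i) - op \<nu> (snd (f i))"
    proof (rule dependent_nat_choice)
      obtain w where "w \<in> T N" "u - op \<nu> w \<in> T (Suc N)" using step[OF N u] by blast
      thus "\<exists>x. fst x \<in> T (N + 0) \<and> snd x \<in> T (N + 0) \<and> (0 = (0::nat) \<longrightarrow> fst x = u) \<and> fst x - op \<nu> (snd x) \<in> T (Suc (N + 0))"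
        using u by (intro exI[of _ "(u, w)"]) simp
    next
      fix x i assume x: "fst x \<in> T (N + i) \<and> snd x \<in> T (N + i) \<and> (i = 0 \<longrightarrow> fst x = u) \<and> fst x - op \<nu> (snd x) \<in> T (Suc (N + i))"
      obtain w where "w \<in> T (Suc (N + i))" "(fst x - op \<nu> (snd x)) - op \<nu> w \<in> T (Suc (Suc (N + i)))"
        using step[of "Suc (N + i)" "fst x - op \<nu> (snd x)"] N x by auto
      thus "\<exists>y. (fst y \<in> T (N + Suc i) \<and> snd y \<in> T (N + Suc i) \<and> (Suc i = 0 \<longrightarrow> fst y = u) \<and> fst y - op \<nu> (snd y) \<in> T (Suc (N + Suc i))) \<and> fst y = fst x - op \<nu> (snd x)"
        using x by (intro exI[of _ "(fst x - op \<nu> (snd x), w)"]) simp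
    qed
    then obtain f where f: "\<And>i. fst (f i) \<in> T (N + i)" "\<And>i. snd (f i) \<in> T (N + i)" "fst (f 0) = u"
      "\<And>i. fst (f (Suc i)) = fst (f i) - op \<nu> (snd (f i))" by blast
    \<comment> \<open>The sum of all corrections. The i-th one is divisible by t^(N + i), so only
      those with i \<le> e reach the coefficient of t^e.\<close>
    define w where "w = (\<lambda>b. Abs_fps (\<lambda>e. \<Sum>i\<le>e. fps_nth (snd (f i) b) e))"
    have part: "u - op \<nu> (\<Sum>i<M. snd (f i)) \<in> T (N + M)" for M
    proof -
      have "u - op \<nu> (\<Sum>i<M. snd (f i)) = fst (f M)"
      proof (induction M)
        case 0 show ?case by (simp only: lessThan_0 sum.empty op_zero diff_zero f(3))
      next
        case (Suc M) thus ?case by (simp only: sum.lessThan_Suc op_add f(4) diff_diff_add[symmetric])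
      qed
      thus ?thesis using f(1) by simp
    qed
    have f0: "fps_nth (snd (f i) b) e = 0" if "e < N + i" for i b e
      using f(2)[of i] that by (simp add: T_def)
    have tail: "w - (\<Sum>i<M. snd (f i)) \<in> T (N + M)" for M
    proof -
      have "fps_nth ((w - (\<Sum>i<M. snd (f i))) b) e = 0" if e: "e < N + M" for b e
      proof -
        have f2: "fps_nth (snd (f i) b) e = 0" if "\<not> i \<le> e" for i by (rule f0) (use that in simp)
        have f1: "fps_nth (snd (f i) b) e = 0" if "\<not> i < M" for i by (rule f0) (use e that in simp)
        have "(\<Sum>i\<le>e. fps_nth (snd (f i) b) e) = (\<Sum>i\<in>{..e} \<inter> {..<M}. fps_nth (snd (f i) b) e)"
          by (rule sum.mono_neutral_right) (use f1 in auto)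
        also have "\<dots> = (\<Sum>i<M. fps_nth (snd (f i) b) e)"
          by (rule sum.mono_neutral_left) (use f2 in auto)
        finally show ?thesis by (simp add: w_def sum_fun_apply fps_sum_nth)
      qed
      moreover have "w b = 0" if "b \<notin> B" for b
      proof -
        have "snd (f i) b = 0" for i using T_VB[OF f(2)[of i]] that by (simp add: VB_def)
        thus ?thesis by (simp add: w_def fps_eq_iff)
      qed
      moreover have "(\<Sum>i<M. snd (f i)) \<in> VB" by (intro VB_sum T_VB[OF f(2)])
      ultimately show ?thesis by (simp add: T_def VB_def)
    qed
    have "w \<in> T N" using tail[of 0] by simp
    moreover have "u - op \<nu> w \<in> T M" for M
    proof -
      have "u - op \<nu> w = (u - op \<nu> (\<Sum>i<M. snd (f i))) - op \<nu> (w - (\<Sum>i<M. snd (f i)))"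
        by (simp add: op_diff)
      moreover have "(u - op \<nu> (\<Sum>i<M. snd (f i))) - op \<nu> (w - (\<Sum>i<M. snd (f i))) \<in> T (N + M)"
        by (intro T_diff part T_op[OF T_stable] tail)
      ultimately have "u - op \<nu> w \<in> T (N + M)" by (simp only:)
      thus ?thesis using T_mono[of M "N + M"] by auto
    qed
    hence "u - op \<nu> w = 0" by (rule T_Int)
    ultimately show ?thesis by auto
  qed
  thus ?thesis by blast
qed

text \<open>A generalized eigenvector modulo t is corrected layer by layer, but only finitely often:
  from layer N0 on D - \<nu> is onto, so what is left of (D - \<nu>)^K v' is removed exactly by one
  more correction w.\<close>

lemma gen_lift:
  assumes v: "v \<in> VB" "(op \<nu> ^^ K) v \<in> T 1"
  shows "\<exists>v'\<in>VB. v - v' \<in> T 1 \<and> (\<exists>K. (op \<nu> ^^ K) v' = 0)"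
proof -
  obtain N0 where N0: "\<And>N u. N \<ge> N0 \<Longrightarrow> u \<in> T N \<Longrightarrow> \<exists>w\<in>T N. op \<nu> w = u" using op_surj by blast
  have "\<exists>v' K. v - v' \<in> T 1 \<and> (op \<nu> ^^ K) v' \<in> T (Suc N)" for N
  proof (induction N)
    case 0
    have "v - v \<in> T 1" unfolding diff_self by (rule T_zero)
    moreover have "(op \<nu> ^^ K) v \<in> T (Suc 0)" using v(2) by (simp only: One_nat_def)
    ultimately show ?case by (intro exI conjI)
  next
    case (Suc N)
    then obtain v' K where v': "v - v' \<in> T 1" "(op \<nu> ^^ K) v' \<in> T (Suc N)" by blast
    obtain v'' K' where v'': "v' - v'' \<in> T (Suc N)" "(op \<nu> ^^ K') v'' \<in> T (Suc (Suc N))"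
      using lift_step[OF T_stable T_stable T_span v'(2)] by blast
    have "(v - v') + (v' - v'') \<in> T 1" using v'(1) v''(1) T_mono[of 1 "Suc N"] by (intro T_add) auto
    moreover have "(v - v') + (v' - v'') = v - v''" by (rule ext) simp
    ultimately have "v - v'' \<in> T 1" by (simp only:)
    thus ?case using v''(2) by blast
  qed
  then obtain v' K where v': "v - v' \<in> T 1" "(op \<nu> ^^ K) v' \<in> T (Suc N0)" by blast
  have "\<exists>w\<in>T (Suc N0). (op \<nu> ^^ K) w = u" if "u \<in> T (Suc N0)" for u K
    using that
  proof (induction K arbitrary: u)
    case (Suc K)
    obtain u' where u': "u' \<in> T (Suc N0)" "op \<nu> u' = u" using N0[OF _ Suc.prems] by auto
    obtain w where "w \<in> T (Suc N0)" "(op \<nu> ^^ K) w = u'" using Suc.IH[OF u'(1)] by blast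
    thus ?case using u'(2) by auto
  qed auto
  then obtain w where w: "w \<in> T (Suc N0)" "(op \<nu> ^^ K) w = (op \<nu> ^^ K) v'" using v'(2) by blast
  have w1: "w \<in> T 1" using w(1) T_mono[of 1 "Suc N0"] by auto
  have "v - (v' - w) = (v - v') + w" by (rule ext) simp
  hence a: "v - (v' - w) \<in> T 1" using T_add[OF v'(1) w1] by (simp only:)
  have "v' - w = v - (v - (v' - w))" by simp
  hence "v' - w \<in> VB" using VB_diff[OF v(1) T_VB[OF a]] by simp
  moreover have "(op \<nu> ^^ K) (v' - w) = 0" by (simp add: pow_diff w(2))
  ultimately show ?thesis using a by blast
qed

lemma pi_diff: "pi j (u - v) = pi j u - pi j v"
  using pi_add[of j "u - v" v] by (simp add: algebra_simps)

lemma pi_op_pow: "j \<in> J \<Longrightarrow> pi j ((op \<nu> ^^ K) v) = (op \<nu> ^^ K) (pi j v)"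
  by (induction K) (simp_all add: op_def pi_diff pi_D pi_smul)

lemma pi_zero: "pi j 0 = 0" using pi_add[of j 0 0] by simp

section \<open>Homogeneous generalized eigenvectors and Nakayama's lemma\<close>

definition homog :: "('i \<Rightarrow> complex fps) \<Rightarrow> int \<Rightarrow> complex \<Rightarrow> bool" where
  "homog e j \<nu> \<longleftrightarrow> e \<in> VB \<and> j \<in> J \<and> pi j e = e \<and> (\<exists>K. (op \<nu> ^^ K) e = 0)"

text \<open>Generalized eigenvectors span M / tM, and each lifts to a generalized eigenvector in M.
  The projections to the graded pieces commute with D, so the homogeneous parts of a lift are again
  generalized eigenvectors.\<close>

lemma homog_span:
  assumes v: "v \<in> VB" shows "\<exists>h\<in>span {e. \<exists>j \<nu>. homog e j \<nu>}. v - h \<in> T 1"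
proof -
  let ?H = "{e. \<exists>j \<nu>. homog e j \<nu>}"
  have "v \<in> span (\<Union>\<nu>. gen VB (T 1) \<nu>)" using T_span[of 0] v by (auto simp: T_0)
  thus ?thesis
  proof (induction v rule: span_induct_alt)
    case base
    have "0 - 0 \<in> T 1" unfolding diff_self by (rule T_zero)
    thus ?case using span_zero by (rule bexI)
  next
    case (step c x y)
    then obtain h where h: "h \<in> span ?H" "y - h \<in> T 1" by blast
    obtain \<nu> K where x: "x \<in> VB" "(op \<nu> ^^ K) x \<in> T 1" using step by (auto simp: gen_def)
    obtain x' K' where x': "x' \<in> VB" "x - x' \<in> T 1" "(op \<nu> ^^ K') x' = 0" using gen_lift[OF x] by blast
    have "homog (pi j x') j \<nu>" if "j \<in> J" for j
      unfolding homog_def using that x'(3) pi_op_pow[OF that, where \<nu> = \<nu> and K = K' and v = x'] by (auto simp: VB_pi pi_pi pi_zero)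
    hence "(\<Sum>j\<in>J. pi j x') \<in> span ?H" by (intro span_sum span_base) blast
    hence xs: "x' \<in> span ?H" using pi_sum[of x'] x'(1) by (simp add: VB_def)
    have "smul (fps_const c) x' + h \<in> span ?H" by (intro span_add span_scale xs h)
    moreover have "smul (fps_const c) x + y - (smul (fps_const c) x' + h) = smul (fps_const c) (x - x') + (y - h)"
      by (simp add: smul_simps)
    moreover have "smul (fps_const c) (x - x') + (y - h) \<in> T 1" by (intro T_add T_smul x' h)
    ultimately show ?case by metis
  qed
qed

text \<open>The reductions modulo t of homogeneous generalized eigenvectors span M / tM; a maximal
  independent set of them is lifted back.\<close>

lemma homog_basis_mod_t:
  "\<exists>E. finite E \<and> (\<forall>e\<in>E. \<exists>j \<nu>. homog e j \<nu>) \<and>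
     (\<forall>v\<in>VB. \<exists>a. v - (\<Sum>e\<in>E. smul (fps_const (a e)) e) \<in> T 1) \<and>
     (\<forall>a. (\<Sum>e\<in>E. smul (fps_const (a e)) e) \<in> T 1 \<longrightarrow> (\<forall>e\<in>E. a e = 0))"
proof -
  let ?H = "{e. \<exists>j \<nu>. homog e j \<nu>}"
  have HV: "e \<in> VB" if "e \<in> ?H" for e using that by (auto simp: homog_def)
  obtain S where S: "S \<subseteq> ev0 ` ?H" "CV.independent S" "ev0 ` ?H \<subseteq> cspan S"
    using CV.maximal_independent_subset[of "ev0 ` ?H"] by blast
  have "S \<subseteq> supported B" using S(1) HV ev0_supported by blast
  from supported_bound[OF finB this S(2)] have Sfin: "finite S" by simp
  define g where "g s = (SOME e. e \<in> ?H \<and> ev0 e = s)" for s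
  have g: "g s \<in> ?H" "ev0 (g s) = s" if "s \<in> S" for s
  proof -
    have "\<exists>e. e \<in> ?H \<and> ev0 e = s" using S(1) that by blast
    from someI_ex[OF this] show "g s \<in> ?H" "ev0 (g s) = s" unfolding g_def by blast+
  qed
  have inj: "inj_on g S" by (rule inj_on_inverseI[of _ ev0]) (rule g(2))
  have sumE: "(\<Sum>e\<in>g ` S. smul (fps_const (a e)) e) = (\<Sum>s\<in>S. smul (fps_const (a (g s))) (g s))" for a
    by (rule sum.reindex[OF inj, unfolded comp_def])
  have sV: "(\<Sum>s\<in>S. smul (fps_const (a s)) (g s)) \<in> VB" for a
    using g(1) HV by (intro VB_sum VB_smul) blast
  have ev: "ev0 (\<Sum>s\<in>S. smul (fps_const (a s)) (g s)) = (\<Sum>s\<in>S. (\<lambda>b. a s * s b))" for a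
    unfolding ev0_sum ev0_simps by (intro sum.cong refl) (simp add: g(2))
  have hs: "ev0 h \<in> cspan S" if "h \<in> span ?H" for h
    using that
  proof (induction h rule: span_induct_alt)
    case base
    have "ev0 0 = 0" by (simp add: ev0_def fun_eq_iff)
    thus ?case using CV.span_zero by metis
  next
    case (step c x y)
    hence "ev0 x \<in> cspan S" using S(3) by blast
    thus ?case unfolding ev0_simps by (intro CV.span_add CV.span_scale step)
  qed
  have sp: "\<exists>a. v - (\<Sum>e\<in>g ` S. smul (fps_const (a e)) e) \<in> T 1" if v: "v \<in> VB" for v
  proof -
    obtain h where h: "h \<in> span ?H" "v - h \<in> T 1" using homog_span[OF v] by blast
    have "ev0 (v - h) = 0" using h(2) T_1_iff[OF T_VB[OF h(2)]] by simp
    hence "ev0 v = ev0 h" by (simp add: ev0_simps)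
    hence "ev0 v \<in> cspan S" using hs[OF h(1)] by simp
    then obtain a where a: "ev0 v = (\<Sum>s\<in>S. (\<lambda>b. a s * s b))" unfolding CV.span_finite[OF Sfin] by auto
    have e: "(\<Sum>e\<in>g ` S. smul (fps_const ((a \<circ> ev0) e)) e) = (\<Sum>s\<in>S. smul (fps_const (a s)) (g s))"
      unfolding sumE by (intro sum.cong refl) (simp add: g(2))
    have "v - (\<Sum>e\<in>g ` S. smul (fps_const ((a \<circ> ev0) e)) e) \<in> T 1"
      unfolding e using T_1_iff[OF VB_diff[OF v sV]] by (simp add: ev0_simps ev a)
    thus ?thesis by blast
  qed
  have ind: "\<forall>e\<in>g ` S. a e = 0" if "(\<Sum>e\<in>g ` S. smul (fps_const (a e)) e) \<in> T 1" for a
  proof -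
    have "ev0 (\<Sum>s\<in>S. smul (fps_const (a (g s))) (g s)) = 0"
      using that T_1_iff[OF sV[of "a \<circ> g"]] unfolding sumE by simp
    hence "(\<Sum>s\<in>S. (\<lambda>b. a (g s) * s b)) = 0" using ev[of "a \<circ> g"] by simp
    from CV.independentD[OF S(2) Sfin subset_refl this] show ?thesis by blast
  qed
  show ?thesis
    by (intro exI[of _ "g ` S"] conjI) (use Sfin g(1) sp ind in auto)
qed

text \<open>Nakayama's lemma with explicit coefficients: v is a combination of E plus t times a
  remainder, and the constants found for the i-th remainder are the coefficients of t^i.\<close>

lemma nakayama_ex:
  assumes E: "finite E" "E \<subseteq> VB"
    and sp: "\<And>v. v \<in> VB \<Longrightarrow> \<exists>a. v - (\<Sum>e\<in>E. smul (fps_const (a e)) e) \<in> T 1"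
    and v: "v \<in> VB"
  shows "\<exists>c. v = (\<Sum>e\<in>E. smul (c e) e)"
proof -
  have "\<forall>v\<in>VB. \<exists>z. snd z \<in> VB \<and> v = (\<Sum>e\<in>E. smul (fps_const (fst z e)) e) + smul fps_X (snd z)"
  proof
    fix v assume "v \<in> VB"
    then obtain a where "v - (\<Sum>e\<in>E. smul (fps_const (a e)) e) \<in> T 1" using sp by blast
    then obtain u where "u \<in> VB" "v - (\<Sum>e\<in>E. smul (fps_const (a e)) e) = smul (fps_X ^ 1) u" using T_factor by blast
    thus "\<exists>z. snd z \<in> VB \<and> v = (\<Sum>e\<in>E. smul (fps_const (fst z e)) e) + smul fps_X (snd z)"
      by (intro exI[of _ "(a, u)"]) (simp add: algebra_simps)
  qed
  from bchoice[OF this] obtain z where z: "\<And>v. v \<in> VB \<Longrightarrow> snd (z v) \<in> VB"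
    "\<And>v. v \<in> VB \<Longrightarrow> v = (\<Sum>e\<in>E. smul (fps_const (fst (z v) e)) e) + smul fps_X (snd (z v))" by blast
  define s where "s i = ((\<lambda>v. snd (z v)) ^^ i) v" for i
  have sV: "s i \<in> VB" for i by (induction i) (simp_all add: s_def v z(1))
  define c where "c e = Abs_fps (\<lambda>i. fst (z (s i)) e)" for e
  have cut: "fps_cutoff (Suc M) (c e) = fps_cutoff M (c e) + fps_const (fst (z (s M)) e) * fps_X ^ M" for M e
    by (rule fps_ext) (auto simp: c_def fps_X_power_nth less_Suc_eq)
  have part: "v = (\<Sum>e\<in>E. smul (fps_cutoff M (c e)) e) + smul (fps_X ^ M) (s M)" for M
  proof (induction M)
    case 0 show ?case by (simp add: smul_simps s_def)
  next
    case (Suc M)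
    have sM: "s (Suc M) = snd (z (s M))" by (simp add: s_def)
    have "smul (fps_X ^ M) (s M) = smul (fps_X ^ M) ((\<Sum>e\<in>E. smul (fps_const (fst (z (s M)) e)) e) + smul fps_X (s (Suc M)))"
      unfolding sM using arg_cong[OF z(2)[OF sV[of M]], of "smul (fps_X ^ M)"] .
    also have "\<dots> = (\<Sum>e\<in>E. smul (fps_const (fst (z (s M)) e) * fps_X ^ M) e) + smul (fps_X ^ Suc M) (s (Suc M))"
      by (simp add: smul_simps smul_sum mult.commute)
    finally have "v = (\<Sum>e\<in>E. smul (fps_cutoff M (c e)) e) + ((\<Sum>e\<in>E. smul (fps_const (fst (z (s M)) e) * fps_X ^ M) e) + smul (fps_X ^ Suc M) (s (Suc M)))"
      using Suc.IH by metis
    thus ?case by (simp only: cut smul_simps sum.distrib add.assoc)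
  qed
  have "v - (\<Sum>e\<in>E. smul (c e) e) \<in> T M" for M
  proof -
    have "v - (\<Sum>e\<in>E. smul (c e) e) = smul (fps_X ^ M) (s M) - (\<Sum>e\<in>E. smul (c e - fps_cutoff M (c e)) e)"
      using part[of M] by (simp add: smul_simps sum_subtractf algebra_simps)
    moreover have "(\<Sum>e\<in>E. smul (c e - fps_cutoff M (c e)) e) \<in> T M"
      using E(2) by (intro subspace_sum[OF T_subspace] T_smul_low) auto
    ultimately show ?thesis using T_diff[OF T_power[OF sV]] by simp
  qed
  hence "v - (\<Sum>e\<in>E. smul (c e) e) = 0" by (rule T_Int)
  thus ?thesis by (intro exI[of _ c]) simp
qed

lemma lowest_term:
  assumes E: "finite E" "E \<subseteq> VB" and low: "\<And>e i. e \<in> E \<Longrightarrow> i < M \<Longrightarrow> fps_nth (c e) i = 0"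
  shows "(\<Sum>e\<in>E. smul (c e) e) - smul (fps_X ^ M) (\<Sum>e\<in>E. smul (fps_const (fps_nth (c e) M)) e) \<in> T (Suc M)"
proof -
  have "(\<Sum>e\<in>E. smul (c e) e) - smul (fps_X ^ M) (\<Sum>e\<in>E. smul (fps_const (fps_nth (c e) M)) e)
    = (\<Sum>e\<in>E. smul (c e - fps_X ^ M * fps_const (fps_nth (c e) M)) e)"
    by (simp add: smul_sum smul_simps sum_subtractf)
  also have "\<dots> \<in> T (Suc M)"
  proof (intro subspace_sum[OF T_subspace] T_smul_low)
    fix e i assume "e \<in> E" "i < Suc M"
    thus "fps_nth (c e - fps_X ^ M * fps_const (fps_nth (c e) M)) i = 0"
      using low[of e i] by (auto simp: fps_X_power_mult_nth less_Suc_eq)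
  qed (use E(2) in auto)
  finally show ?thesis .
qed

lemma T_cancel: "v \<in> VB \<Longrightarrow> smul (fps_X ^ M) v \<in> T (Suc M) \<Longrightarrow> v \<in> T 1"
proof -
  assume v: "v \<in> VB" "smul (fps_X ^ M) v \<in> T (Suc M)"
  have "fps_nth (v b) 0 = 0" for b
    using v(2) by (auto simp: T_def smul_def fps_X_power_mult_nth dest!: spec[of _ b] spec[of _ M])
  thus ?thesis using v(1) by (simp add: T_def)
qed

text \<open>If all coefficients vanish below order M, those at order M give a relation modulo t and
  hence vanish as well.\<close>

lemma nakayama_unique:
  assumes E: "finite E" "E \<subseteq> VB"
    and ind: "\<And>a. (\<Sum>e\<in>E. smul (fps_const (a e)) e) \<in> T 1 \<Longrightarrow> \<forall>e\<in>E. a e = 0"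
    and z: "(\<Sum>e\<in>E. smul (c e) e) = 0"
  shows "\<forall>e\<in>E. c e = 0"
proof -
  have "\<forall>e\<in>E. fps_nth (c e) M = 0" for M
  proof (induction M rule: less_induct)
    case (less M)
    have V: "(\<Sum>e\<in>E. smul (fps_const (fps_nth (c e) M)) e) \<in> VB" using E(2) by (intro VB_sum VB_smul) auto
    have "0 - smul (fps_X ^ M) (\<Sum>e\<in>E. smul (fps_const (fps_nth (c e) M)) e) \<in> T (Suc M)"
      using lowest_term[OF E, of M c] less z by simp
    hence "smul (fps_X ^ M) (\<Sum>e\<in>E. smul (fps_const (fps_nth (c e) M)) e) \<in> T (Suc M)"
      using subspace_neg[OF T_subspace] by force
    from ind[OF T_cancel[OF V this]] show ?case .
  qed
  thus ?thesis by (simp add: fps_eq_iff)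
qed

text \<open>t^w e is a generalized eigenvector for \<open>lam e\<close> + nw. The terms with this
  value equal to \<nu> are killed by a power of D - \<nu>, so the sum of the other terms is killed
  too. The lowest layer of that sum is killed by a product of D - \<mu> with \<mu> \<noteq> \<nu>
  and, modulo the next layer, by a power of D - \<nu>; hence it is zero.\<close>

lemma weight_of_coefficient:
  assumes E: "finite E" "E \<subseteq> VB"
    and ind: "\<And>a. (\<Sum>e\<in>E. smul (fps_const (a e)) e) \<in> T 1 \<Longrightarrow> \<forall>e\<in>E. a e = 0"
    and hom: "\<And>e. e \<in> E \<Longrightarrow> \<exists>K. (op (lam e) ^^ K) e = 0"
    and v: "(op \<nu> ^^ K) (\<Sum>e\<in>E. smul (c e) e) = 0" and e: "e \<in> E" "fps_nth (c e) w \<noteq> 0"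
  shows "lam e + of_nat (n * w) = \<nu>"
proof -
  \<comment> \<open>The claim for coefficients without terms of weight \<nu>, by induction on the
    order in t.\<close>
  have main: "\<forall>e\<in>E. fps_nth (c e) M = 0"
    if v: "(op \<nu> ^^ K) (\<Sum>e\<in>E. smul (c e) e) = 0"
    and off: "\<And>e w. e \<in> E \<Longrightarrow> lam e + of_nat (n * w) = \<nu> \<Longrightarrow> fps_nth (c e) w = 0" for c K M
  proof (induction M rule: less_induct)
    case (less M)
    let ?a = "\<lambda>e. fps_nth (c e) M"
    let ?y = "\<Sum>e\<in>E. smul (fps_const (?a e)) e"
    have V: "?y \<in> VB" using E(2) by (intro VB_sum VB_smul) auto
    have low: "(\<Sum>e\<in>E. smul (c e) e) - smul (fps_X ^ M) ?y \<in> T (Suc M)"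
      by (rule lowest_term[OF E]) (use less in blast)
    have "(op \<nu> ^^ K) (smul (fps_X ^ M) ?y) = - (op \<nu> ^^ K) ((\<Sum>e\<in>E. smul (c e) e) - smul (fps_X ^ M) ?y)"
      using v by (simp add: pow_diff)
    hence yT: "(op \<nu> ^^ K) (smul (fps_X ^ M) ?y) \<in> T (Suc M)"
      using subspace_neg[OF T_subspace] T_pow[OF T_stable low] by simp
    \<comment> \<open>Each t^M e that occurs has an eigenvalue other than \<nu> and is killed by a
      power of the corresponding operator; the factors for all e are concatenated.\<close>
    have "\<exists>\<mu>s. \<nu> \<notin> set \<mu>s \<and> prodop \<mu>s (\<Sum>e\<in>E'. smul (fps_X ^ M) (smul (fps_const (?a e)) e)) = 0" if "finite E'" "E' \<subseteq> E" for E'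
      using that
    proof (induction E' rule: finite_induct)
      case empty show ?case by (intro exI[of _ "[]"]) simp
    next
      case (insert e E')
      then obtain \<mu>s where \<mu>s: "\<nu> \<notin> set \<mu>s" "prodop \<mu>s (\<Sum>e\<in>E'. smul (fps_X ^ M) (smul (fps_const (?a e)) e)) = 0" by blast
      obtain K' where K': "(op (lam e) ^^ K') e = 0" using hom insert by blast
      show ?case
      proof (cases "?a e = 0")
        case True
        hence "smul (fps_X ^ M) (smul (fps_const (?a e)) e) = 0" by (simp add: smul_simps)
        thus ?thesis using \<mu>s insert(1,2) by (intro exI[of _ \<mu>s]) simp
      next
        case False
        let ?\<mu> = "lam e + of_nat (n * M)"
        have ne: "?\<mu> \<noteq> \<nu>" using off[of e M] False insert by auto
        have eV: "e \<in> VB" using insert E(2) by auto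
        have "prodop (replicate K' ?\<mu>) (smul (fps_X ^ M) (smul (fps_const (?a e)) e)) = 0"
          unfolding prod_replicate pow_power[OF VB_smul[OF eV]] pow_scale K' by (simp add: smul_simps)
        moreover have p0: "prodop \<rho>s 0 = 0" for \<rho>s using prod_scale[of \<rho>s 0 0] by (simp add: smul_simps)
        ultimately have "prodop (\<mu>s @ replicate K' ?\<mu>) (\<Sum>e\<in>insert e E'. smul (fps_X ^ M) (smul (fps_const (?a e)) e)) = 0"
          using insert(1,2) \<mu>s(2) prod_swap[of "replicate K' ?\<mu>" \<mu>s] by (simp add: prod_append prod_add p0)
        thus ?thesis using \<mu>s(1) ne by (intro exI[of _ "\<mu>s @ replicate K' ?\<mu>"]) (auto simp: set_replicate_conv_if)
      qed
    qed
    from this[OF E(1) subset_refl] obtain \<mu>s where \<mu>s: "\<nu> \<notin> set \<mu>s" "prodop \<mu>s (smul (fps_X ^ M) ?y) = 0"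
      unfolding smul_sum[symmetric] by blast
    have "smul (fps_X ^ M) ?y \<in> T (Suc M)"
      by (rule prod_coprime_pow[OF T_stable \<mu>s(1) _ yT]) (simp add: \<mu>s(2) subspace_0[OF T_subspace])
    from ind[OF T_cancel[OF V this]] show ?case .
  qed
  \<comment> \<open>The splitting by weight. For fixed e at most one power of t has weight \<nu>, so
    \<open>c2 e\<close> is zero or a monomial.\<close>
  define c1 where "c1 e = Abs_fps (\<lambda>w. if lam e + of_nat (n * w) = \<nu> then 0 else fps_nth (c e) w)" for e
  define c2 where "c2 e = Abs_fps (\<lambda>w. if lam e + of_nat (n * w) = \<nu> then fps_nth (c e) w else 0)" for e
  have c: "c e = c1 e + c2 e" for e by (rule fps_ext) (simp add: c1_def c2_def)
  have "\<exists>K. (op \<nu> ^^ K) (smul (c2 e) e) = 0" if e: "e \<in> E" for e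
  proof (cases "\<exists>w. lam e + of_nat (n * w) = \<nu>")
    case False
    hence "c2 e = 0" by (simp add: c2_def fps_eq_iff)
    thus ?thesis by (intro exI[of _ 0]) (simp add: smul_simps)
  next
    case True
    then obtain w0 where w0: "lam e + of_nat (n * w0) = \<nu>" by blast
    have weq: "lam e + of_nat (n * w) = \<nu> \<longleftrightarrow> w = w0" for w
    proof -
      have "lam e + of_nat (n * w) = \<nu> \<longleftrightarrow> (of_nat (n * w) :: complex) = of_nat (n * w0)" unfolding w0[symmetric] by simp
      also have "\<dots> \<longleftrightarrow> n * w = n * w0" by (rule of_nat_eq_iff)
      finally show ?thesis using n1 by simp
    qed
    have "c2 e = fps_X ^ w0 * fps_const (fps_nth (c e) w0)"
      by (intro fps_ext) (auto simp: c2_def weq fps_X_power_mult_nth simp del: of_nat_mult)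
    hence c2: "smul (c2 e) e = smul (fps_X ^ w0) (smul (fps_const (fps_nth (c e) w0)) e)" by (simp add: smul_simps)
    obtain K where K: "(op (lam e) ^^ K) e = 0" using hom[OF e] by blast
    have "(op (lam e + of_nat (n * w0)) ^^ K) (smul (c2 e) e) = 0"
      unfolding c2 using E(2) e by (subst pow_power) (auto simp: VB_smul pow_scale K smul_simps)
    thus ?thesis using w0 by metis
  qed
  then obtain Kf where Kf: "\<And>e. e \<in> E \<Longrightarrow> (op \<nu> ^^ Kf e) (smul (c2 e) e) = 0" by metis
  have zstab: "stable {0}" using subspace_single_0 D_scale[of 0 0] by (simp add: stable_def smul_simps)
  let ?K = "K + (\<Sum>e\<in>E. Kf e)"
  have Kz: "(op \<nu> ^^ ?K) (smul (c2 e) e) = 0" if "e \<in> E" for e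
    using pow_mono[OF zstab, of "Kf e" \<nu> "smul (c2 e) e" ?K] Kf[OF that] member_le_sum[of e E Kf] that E(1) by simp
  have psum: "(op \<nu> ^^ L) (\<Sum>e\<in>A. f e) = (\<Sum>e\<in>A. (op \<nu> ^^ L) (f e))" for L A f
  proof (induction A rule: infinite_finite_induct)
    case (insert x F) show ?case unfolding sum.insert[OF insert(1,2)] pow_add insert(3) ..
  qed (simp_all only: sum.infinite sum.empty pow_zero not_False_eq_True)
  have 2: "(op \<nu> ^^ ?K) (\<Sum>e\<in>E. smul (c2 e) e) = 0"
    unfolding psum by (rule sum.neutral) (use Kz in blast)
  have 1: "(op \<nu> ^^ ?K) (\<Sum>e\<in>E. smul (c e) e) = 0"
    using pow_mono[OF zstab, of K \<nu> _ ?K] v by simp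
  have "(\<Sum>e\<in>E. smul (c1 e) e) = (\<Sum>e\<in>E. smul (c e) e) - (\<Sum>e\<in>E. smul (c2 e) e)"
    unfolding c by (simp add: smul_simps sum.distrib)
  hence "(op \<nu> ^^ ?K) (\<Sum>e\<in>E. smul (c1 e) e) = 0" using 1 2 by (simp add: pow_diff)
  from main[OF this, of w] have "\<forall>e\<in>E. fps_nth (c1 e) w = 0" by (simp add: c1_def)
  thus ?thesis using e by (auto simp: c1_def split: if_splits)
qed

end

section \<open>The connection on a rigid module\<close>

definition dC :: "nat \<Rightarrow> nat \<Rightarrow> complex fps fps set \<Rightarrow> complex fps fps set" where
  "dC n k C = clhat n k (dser n k (SOME f. f \<in> C))"

text \<open>The ideal is stable under the derivation, so any representative gives the same
  class.\<close>

lemma dC_clhat: "dC n k (clhat n k f) = clhat n k (dser n k f)"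
proof -
  let ?g = "SOME g. g \<in> clhat n k f"
  have "clhat n k ?g = clhat n k f" by (rule some_clhat) simp
  hence "Fhat n k dvd ?g - f" by (simp add: clhat_eq_iff)
  hence "Fhat n k dvd dser n k ?g - dser n k f" using dser_dvd by (simp add: dser_minus flip: dser_minus)
  thus ?thesis by (simp add: dC_def clhat_eq_iff)
qed

lemma dC_in: "dC n k C \<in> carrier (Rhat n k)" by (simp add: dC_def)

lemma dC_add: assumes "C \<in> carrier (Rhat n k)" "C' \<in> carrier (Rhat n k)"
  shows "dC n k (C \<oplus>\<^bsub>Rhat n k\<^esub> C') = dC n k C \<oplus>\<^bsub>Rhat n k\<^esub> dC n k C'"
proof -
  obtain f g where "C = clhat n k f" "C' = clhat n k g" using assms Rhat_cases by metis
  thus ?thesis by (simp add: clhat_add[symmetric] dC_clhat dser_add)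
qed

lemma dC_mult: assumes "C \<in> carrier (Rhat n k)" "C' \<in> carrier (Rhat n k)"
  shows "dC n k (C \<otimes>\<^bsub>Rhat n k\<^esub> C') = dC n k C \<otimes>\<^bsub>Rhat n k\<^esub> C' \<oplus>\<^bsub>Rhat n k\<^esub> C \<otimes>\<^bsub>Rhat n k\<^esub> dC n k C'"
proof -
  obtain f g where "C = clhat n k f" "C' = clhat n k g" using assms Rhat_cases by metis
  thus ?thesis by (simp add: clhat_mult[symmetric] clhat_add[symmetric] dC_clhat dser_mult)
qed

lemma dC_one: "dC n k \<one>\<^bsub>Rhat n k\<^esub> = \<zero>\<^bsub>Rhat n k\<^esub>"
  using dser_mon[of n k 1 0 0] by (simp add: dC_clhat mon_ser_one mon_ser_0 flip: clhat_one clhat_zero)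

lemma dC_grade: "C \<in> Rhat_grade n k j \<Longrightarrow> dC n k C \<in> Rhat_grade n k j"
proof -
  assume C: "C \<in> Rhat_grade n k j"
  then obtain f where "C = clhat n k f" by (auto simp: Rhat_grade_def)
  thus ?thesis using C dser_grade by (simp add: dC_clhat)
qed

text \<open>An extension of M by itself: C acts by the triangular matrix with C on the diagonal and
  its derivative in the corner. Multiplicativity of this action is the product rule for
  \<open>dC\<close>.\<close>

definition dext :: "nat \<Rightarrow> nat \<Rightarrow> 'b G_module \<Rightarrow> ('b \<times> 'b) G_module" where
  "dext n k M = \<lparr>carrier = carrier M \<times> carrier M, monoid.mult = undefined, monoid.one = undefined,
     ring.zero = (\<zero>\<^bsub>M\<^esub>, \<zero>\<^bsub>M\<^esub>), ring.add = (\<lambda>u v. (fst u \<oplus>\<^bsub>M\<^esub> fst v, snd u \<oplus>\<^bsub>M\<^esub> snd v)),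
     module.smult = (\<lambda>C u. (C \<odot>\<^bsub>M\<^esub> fst u \<oplus>\<^bsub>M\<^esub> dC n k C \<odot>\<^bsub>M\<^esub> snd u, C \<odot>\<^bsub>M\<^esub> snd u)),
     grade = (\<lambda>i. grade M i \<times> grade M i)\<rparr>"

lemma dext_simps [simp]:
  "carrier (dext n k M) = carrier M \<times> carrier M"
  "\<zero>\<^bsub>dext n k M\<^esub> = (\<zero>\<^bsub>M\<^esub>, \<zero>\<^bsub>M\<^esub>)"
  "u \<oplus>\<^bsub>dext n k M\<^esub> v = (fst u \<oplus>\<^bsub>M\<^esub> fst v, snd u \<oplus>\<^bsub>M\<^esub> snd v)"
  "C \<odot>\<^bsub>dext n k M\<^esub> u = (C \<odot>\<^bsub>M\<^esub> fst u \<oplus>\<^bsub>M\<^esub> dC n k C \<odot>\<^bsub>M\<^esub> snd u, C \<odot>\<^bsub>M\<^esub> snd u)"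
  "grade (dext n k M) i = grade M i \<times> grade M i"
  by (simp_all add: dext_def)

locale cm_mod =
  fixes n k :: nat and M :: "'b G_module" (structure)
  assumes k1: "1 \<le> k" and kn: "k < n" and cm: "CM_G n k M"
begin

abbreviation "RR \<equiv> Rhat n k"
abbreviation "GG \<equiv> G_dual n"

sublocale graded_mod GG RR "Rhat_grade n k" M
  using cm by unfold_locales (simp add: CM_G_def)

lemma GG_carrier: "carrier GG = {0..<int n}" using kn by (simp add: carrier_integer_mod_group)

lemma GG_comm: "comm_group GG"
  by (rule abelian_integer_mod_group)

lemma dext_abelian: "abelian_group (dext n k M)"
proof (rule abelian_groupI)
  fix x assume "x \<in> carrier (dext n k M)"
  thus "\<exists>y\<in>carrier (dext n k M). y \<oplus>\<^bsub>dext n k M\<^esub> x = \<zero>\<^bsub>dext n k M\<^esub>"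
    by (intro bexI[of _ "(\<ominus> fst x, \<ominus> snd x)"]) (auto simp: l_neg)
qed (auto simp: a_ac)

lemma dext_module: "module RR (dext n k M)"
proof (rule moduleI[OF Rhat_cring dext_abelian])
  fix C C' x assume C: "C \<in> carrier RR" "C' \<in> carrier RR" and x: "x \<in> carrier (dext n k M)"
  obtain a b where ab: "x = (a, b)" "a \<in> carrier M" "b \<in> carrier M" using x by auto
  note cl = smult_closed[OF C(1)] smult_closed[OF C(2)] smult_closed[OF dC_in]
  show "(C \<oplus>\<^bsub>RR\<^esub> C') \<odot>\<^bsub>dext n k M\<^esub> x = C \<odot>\<^bsub>dext n k M\<^esub> x \<oplus>\<^bsub>dext n k M\<^esub> C' \<odot>\<^bsub>dext n k M\<^esub> x"
    using ab C cl by (simp add: dC_add smult_l_distr dC_in a_ac)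
  show "C \<otimes>\<^bsub>RR\<^esub> C' \<odot>\<^bsub>dext n k M\<^esub> x = C \<odot>\<^bsub>dext n k M\<^esub> (C' \<odot>\<^bsub>dext n k M\<^esub> x)"
  proof -
    have "dC n k (C \<otimes>\<^bsub>RR\<^esub> C') \<odot> b = dC n k C \<odot> (C' \<odot> b) \<oplus> C \<odot> (dC n k C' \<odot> b)"
      using ab C dC_in by (simp add: dC_mult smult_l_distr smult_assoc1)
    thus ?thesis using ab C cl by (simp add: smult_assoc1 smult_r_distr a_ac)
  qed
next
  fix C x y assume C: "C \<in> carrier RR" and x: "x \<in> carrier (dext n k M)" and y: "y \<in> carrier (dext n k M)"
  note cl = smult_closed[OF C] smult_closed[OF dC_in]
  show "C \<odot>\<^bsub>dext n k M\<^esub> (x \<oplus>\<^bsub>dext n k M\<^esub> y) = C \<odot>\<^bsub>dext n k M\<^esub> x \<oplus>\<^bsub>dext n k M\<^esub> C \<odot>\<^bsub>dext n k M\<^esub> y"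
    using C x y cl dC_in by (auto simp: smult_r_distr a_ac)
next
  fix C x assume C: "C \<in> carrier RR" and x: "x \<in> carrier (dext n k M)"
  show "C \<odot>\<^bsub>dext n k M\<^esub> x \<in> carrier (dext n k M)"
    using C x smult_closed[OF C] smult_closed[OF dC_in] by auto
next
  fix x assume "x \<in> carrier (dext n k M)"
  thus "\<one>\<^bsub>RR\<^esub> \<odot>\<^bsub>dext n k M\<^esub> x = x" by (auto simp: dC_one)
qed

lemma dext_finsum: assumes "\<And>i. i \<in> A \<Longrightarrow> f i \<in> carrier (dext n k M)"
  shows "fst (finsum (dext n k M) f A) = (\<Oplus>i\<in>A. fst (f i))" "snd (finsum (dext n k M) f A) = (\<Oplus>i\<in>A. snd (f i))"
  by (rule additive_map_finsum_in[OF dext_abelian abelian_group_axioms]; use assms in fastforce)+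

lemma dext_graded: "graded_module GG RR (Rhat_grade n k) (dext n k M)"
  unfolding graded_module_def
proof (intro conjI ballI)
  show "module RR (dext n k M)" by (rule dext_module)
next
  interpret E: abelian_group "dext n k M" by (rule dext_abelian)
  fix i assume i: "i \<in> carrier GG"
  show "subgroup (grade (dext n k M) i) (add_monoid (dext n k M))"
  proof (rule E.add.subgroupI)
    show "grade (dext n k M) i \<subseteq> carrier (dext n k M)" using grade_carrier[OF i] by auto
    show "grade (dext n k M) i \<noteq> {}" using grade_zero[OF i] by auto
    fix a assume a: "a \<in> grade (dext n k M) i"
    have neg: "\<ominus>\<^bsub>dext n k M\<^esub> a = (\<ominus> fst a, \<ominus> snd a)"
      using a grade_carrier[OF i] by (intro E.minus_equality) (auto simp: l_neg)
    have "fst a \<in> grade M i" "snd a \<in> grade M i" using a by auto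
    hence "(\<ominus> fst a, \<ominus> snd a) \<in> grade (dext n k M) i" using grade_neg[OF i] by simp
    thus "\<ominus>\<^bsub>dext n k M\<^esub> a \<in> grade (dext n k M) i" unfolding neg .
  next
    fix a b assume "a \<in> grade (dext n k M) i" "b \<in> grade (dext n k M) i"
    thus "a \<oplus>\<^bsub>dext n k M\<^esub> b \<in> grade (dext n k M) i" using grade_add[OF i] by auto
  qed
next
  fix m assume m: "m \<in> carrier (dext n k M)"
  obtain a b where ab: "m = (a, b)" "a \<in> carrier M" "b \<in> carrier M" using m by auto
  define F where "F = (\<lambda>i\<in>carrier GG. (cmp a i, cmp b i))"
  let ?S = "\<lambda>f. {i \<in> carrier GG. f i \<noteq> \<zero>\<^bsub>dext n k M\<^esub>}"
  show "\<exists>!f. f \<in> (\<Pi>\<^sub>E i\<in>carrier GG. grade (dext n k M) i) \<and> finite (?S f) \<and> m = finsum (dext n k M) f (?S f)"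
  proof (rule ex1I[of _ F], intro conjI)
    show FE: "F \<in> (\<Pi>\<^sub>E i\<in>carrier GG. grade (dext n k M) i)" using comp_props(1) ab by (auto simp: F_def)
    show fin: "finite (?S F)" by (rule finite_subset[of _ "{0..<int n}"]) (auto simp: GG_carrier)
    have Fc: "F i \<in> carrier (dext n k M)" if "i \<in> ?S F" for i using that comp_closed ab by (auto simp: F_def)
    have "a = (\<Oplus>i\<in>?S F. cmp a i)" "b = (\<Oplus>i\<in>?S F. cmp b i)"
      by (rule comp_expand[OF _ fin]; use ab in \<open>auto simp: F_def gcomp_def\<close>)+
    moreover have "(\<Oplus>i\<in>?S F. fst (F i)) = (\<Oplus>i\<in>?S F. cmp a i)" "(\<Oplus>i\<in>?S F. snd (F i)) = (\<Oplus>i\<in>?S F. cmp b i)"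
      by (rule finsum_cong'; use comp_closed ab in \<open>auto simp: F_def\<close>)+
    ultimately have "fst m = fst (finsum (dext n k M) F (?S F))" "snd m = snd (finsum (dext n k M) F (?S F))"
      using dext_finsum[of "?S F" F, OF Fc] ab(1) by simp_all
    thus "m = finsum (dext n k M) F (?S F)" by (rule prod_eqI)
  next
    fix f assume f: "f \<in> (\<Pi>\<^sub>E i\<in>carrier GG. grade (dext n k M) i) \<and> finite (?S f) \<and> m = finsum (dext n k M) f (?S f)"
    have fg: "fst (f i) \<in> grade M i" "snd (f i) \<in> grade M i" if "i \<in> carrier GG" for i
      using f that by (auto simp: PiE_iff dest!: bspec[of _ _ i])
    have fc: "f i \<in> carrier (dext n k M)" if "i \<in> ?S f" for i
      using fg[of i] grade_carrier[of i] that by (cases "f i") auto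
    have s: "a = (\<Oplus>i\<in>?S f. fst (f i))" "b = (\<Oplus>i\<in>?S f. snd (f i))"
      using dext_finsum[of "?S f" f, OF fc] f ab(1) by (metis fst_conv, metis snd_conv)
    have "cmp a i = (if i \<in> ?S f then fst (f i) else \<zero>)" "cmp b i = (if i \<in> ?S f then snd (f i) else \<zero>)" for i
      unfolding s by (rule comp_finsum_homog; use f fg in auto)+
    hence "f i = (cmp a i, cmp b i)" if "i \<in> carrier GG" for i using that by (auto simp: prod_eq_iff)
    thus "f = F" using f by (auto simp: F_def PiE_iff extensional_def fun_eq_iff)
  qed
next
  fix i j C m assume ij: "i \<in> carrier GG" "j \<in> carrier GG" and C: "C \<in> Rhat_grade n k i" and m: "m \<in> grade (dext n k M) j"
  have ijL: "i \<otimes>\<^bsub>GG\<^esub> j \<in> carrier GG" using ij GG_carrier kn by auto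
  show "C \<odot>\<^bsub>dext n k M\<^esub> m \<in> grade (dext n k M) (i \<otimes>\<^bsub>GG\<^esub> j)"
    using grade_smult[OF ij] C dC_grade[OF C] m grade_add[OF ijL] by auto
qed

text \<open>A splitting of \<open>dext\<close> has the form u \<mapsto> (\<delta> u, u). That it is
  linear over the ring is the Leibniz rule for \<delta>, and that it is graded makes \<delta>
  preserve degrees.\<close>

lemma connection_exists:
  assumes "rigid n k M"
  shows "\<exists>\<delta>. (\<forall>u\<in>carrier M. \<delta> u \<in> carrier M) \<and> (\<forall>u\<in>carrier M. \<forall>v\<in>carrier M. \<delta> (u \<oplus> v) = \<delta> u \<oplus> \<delta> v) \<and>
    (\<forall>C\<in>carrier RR. \<forall>u\<in>carrier M. \<delta> (C \<odot> u) = C \<odot> \<delta> u \<oplus> dC n k C \<odot> u) \<and>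
    (\<forall>i\<in>carrier GG. \<forall>u\<in>grade M i. \<delta> u \<in> grade M i)"
proof -
  let ?f = "\<lambda>u. (u, \<zero>)"
  have "?f \<in> ghom GG RR M (dext n k M)"
    using grade_zero dC_in by (auto simp: ghom_def)
  moreover have "snd \<in> ghom GG RR (dext n k M) M" by (auto simp: ghom_def)
  moreover have "inj_on ?f (carrier M)" by (auto intro: inj_onI)
  moreover have "snd ` carrier (dext n k M) = carrier M" using zero_closed by force
  moreover have "?f ` carrier M = {e \<in> carrier (dext n k M). snd e = \<zero>}" by auto
  ultimately have "\<exists>s\<in>ghom GG RR M (dext n k M). \<forall>u\<in>carrier M. snd (s u) = u"
    using assms dext_graded unfolding rigid_def Ext1_zero_def by blast
  then obtain s where s: "s \<in> ghom GG RR M (dext n k M)" "\<And>u. u \<in> carrier M \<Longrightarrow> snd (s u) = u" by blast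
  have s1: "s u \<in> carrier (dext n k M)" if "u \<in> carrier M" for u using s(1) that by (auto simp: ghom_def)
  have s2: "s (u \<oplus> v) = s u \<oplus>\<^bsub>dext n k M\<^esub> s v" if "u \<in> carrier M" "v \<in> carrier M" for u v
    using s(1) that unfolding ghom_def by blast
  have s3: "s (C \<odot> u) = C \<odot>\<^bsub>dext n k M\<^esub> s u" if "C \<in> carrier RR" "u \<in> carrier M" for C u
    using s(1) that unfolding ghom_def by blast
  have s4: "s u \<in> grade (dext n k M) i" if "i \<in> carrier GG" "u \<in> grade M i" for u i
    using s(1) that unfolding ghom_def by blast
  show ?thesis
  proof (intro exI[of _ "\<lambda>u. fst (s u)"] conjI ballI)
    show "fst (s u) \<in> carrier M" if "u \<in> carrier M" for u using s1[OF that] by auto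
    show "fst (s (u \<oplus> v)) = fst (s u) \<oplus> fst (s v)" if "u \<in> carrier M" "v \<in> carrier M" for u v using s2[OF that] by simp
    show "fst (s (C \<odot> u)) = C \<odot> fst (s u) \<oplus> dC n k C \<odot> u" if "C \<in> carrier RR" "u \<in> carrier M" for C u
      using s3[OF that] s(2)[OF that(2)] by simp
    show "fst (s u) \<in> grade M i" if "i \<in> carrier GG" "u \<in> grade M i" for i u using s4[OF that] by auto
  qed
qed

section \<open>Coordinates over C[[t]] and finiteness of the rank\<close>

abbreviation "Tm \<equiv> restrict_scalars (t_hat n k) M"

definition B :: "'b set" where "B = (SOME B. is_basis TA Tm B)"

lemma T_module: "module TA Tm"
  using cm by (simp add: CM_G_def free_module_def)

lemma T_basis: "is_basis TA Tm B"
  unfolding B_def by (rule someI_ex) (use cm in \<open>simp add: CM_G_def free_module_def\<close>)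

sublocale T: module_with_basis Tm B
  by (intro module_with_basis.intro T_module module_with_basis_axioms.intro T_basis)

abbreviation "\<kappa> \<equiv> bcoord Tm B"

lemma \<kappa>_add: "u \<in> carrier M \<Longrightarrow> v \<in> carrier M \<Longrightarrow> \<kappa> (u \<oplus> v) = \<kappa> u + \<kappa> v"
  using T.coord_add[of u v] by simp

lemma \<kappa>_t: "u \<in> carrier M \<Longrightarrow> \<kappa> (t_hat n k f \<odot> u) = smul f (\<kappa> u)"
  using T.coord_smult[of u f] by (simp add: smul_def)

lemma \<kappa>_inj: "u \<in> carrier M \<Longrightarrow> v \<in> carrier M \<Longrightarrow> \<kappa> u = \<kappa> v \<Longrightarrow> u = v"
  using T.coord_inj[of u v] by simp

definition mon :: "nat \<Rightarrow> nat \<Rightarrow> 'b \<Rightarrow> 'b" where "mon p q u = clhat n k (mon_ser 1 p q) \<odot> u"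

lemma mon_closed: "u \<in> carrier M \<Longrightarrow> mon p q u \<in> carrier M" by (simp add: mon_def)

lemma mon_c: "u \<in> carrier M \<Longrightarrow> clhat n k (mon_ser c p q) \<odot> u = t_hat n k (fps_const c) \<odot> mon p q u"
  using smult_assoc1[of "t_hat n k (fps_const c)" "clhat n k (mon_ser 1 p q)" u] tser_monom[of c 0]
  by (simp add: mon_def mon_ser_mult t_hat_tser flip: clhat_mult)

lemma mon_t: "u \<in> carrier M \<Longrightarrow> mon p q (t_hat n k f \<odot> u) = t_hat n k f \<odot> mon p q u"
  using smult_assoc1[of "t_hat n k f" "clhat n k (mon_ser 1 p q)" u] smult_assoc1[of "clhat n k (mon_ser 1 p q)" "t_hat n k f" u]
  by (simp add: mon_def t_hat_tser mult.commute flip: clhat_mult)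

lemma clhat_sum_smult: assumes "u \<in> carrier M" "finite A"
  shows "clhat n k (\<Sum>z\<in>A. f z) \<odot> u = (\<Oplus>z\<in>A. clhat n k (f z) \<odot> u)"
  using assms(2)
proof (induction A rule: finite_induct)
  case empty show ?case using assms by (simp add: clhat_zero)
next
  case (insert z A)
  have "(\<Oplus>z\<in>insert z A. clhat n k (f z) \<odot> u) = clhat n k (f z) \<odot> u \<oplus> (\<Oplus>z\<in>A. clhat n k (f z) \<odot> u)"
    by (rule finsum_insert) (use insert assms in auto)
  moreover have "clhat n k (\<Sum>z\<in>insert z A. f z) \<odot> u = clhat n k (f z) \<odot> u \<oplus> clhat n k (\<Sum>z\<in>A. f z) \<odot> u"
    using insert(1,2) assms(1) by (simp add: clhat_add smult_l_distr)
  ultimately show ?case using insert(3) by simp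
qed

lemma smult_trunc: assumes u: "u \<in> carrier M"
  shows "\<exists>g. clhat n k f \<odot> u = (\<Oplus>z\<in>{..<n*N} \<times> {..<n*N}. t_hat n k (fps_const (fps_nth (fps_nth f (snd z)) (fst z))) \<odot> mon (fst z) (snd z) u)
     \<oplus> t_hat n k (fps_X ^ N) \<odot> (clhat n k g \<odot> u)"
proof -
  obtain g where g: "clhat n k f = clhat n k ((\<Sum>p<n*N. \<Sum>q<n*N. mon_ser (fps_nth (fps_nth f q) p) p q) + tser (fps_X ^ N) * g)"
    using clhat_trunc[OF k1 kn, of f N] by blast
  have "(\<Sum>p<n*N. \<Sum>q<n*N. mon_ser (fps_nth (fps_nth f q) p) p q) = (\<Sum>z\<in>{..<n*N} \<times> {..<n*N}. mon_ser (fps_nth (fps_nth f (snd z)) (fst z)) (fst z) (snd z))"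
    by (simp add: sum.cartesian_product split_def)
  hence "clhat n k f \<odot> u = clhat n k (\<Sum>z\<in>{..<n*N} \<times> {..<n*N}. mon_ser (fps_nth (fps_nth f (snd z)) (fst z)) (fst z) (snd z)) \<odot> u \<oplus> t_hat n k (fps_X ^ N) \<odot> (clhat n k g \<odot> u)"
    using u by (simp add: g clhat_add clhat_mult smult_l_distr smult_assoc1 t_hat_tser)
  thus ?thesis using u by (simp add: clhat_sum_smult mon_c del: fps_const_mult) blast
qed

text \<open>Truncation at N = 1 shows that modulo t the ring acts through the monomials with p, q <
  n; finite generation then bounds the dimension of M / tM.\<close>

lemma finite_B: "finite B"
proof -
  define \<epsilon> :: "'b \<Rightarrow> 'b \<Rightarrow> complex" where "\<epsilon> u = (\<lambda>b. fps_nth (\<kappa> u b) 0)" for u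
  have e_add: "\<epsilon> (u \<oplus> v) = \<epsilon> u + \<epsilon> v" if "u \<in> carrier M" "v \<in> carrier M" for u v
    using that by (simp add: \<epsilon>_def \<kappa>_add fun_eq_iff)
  have e_t: "\<epsilon> (t_hat n k f \<odot> u) = (\<lambda>b. fps_nth f 0 * \<epsilon> u b)" if "u \<in> carrier M" for f u
    using that by (simp add: \<epsilon>_def \<kappa>_t smul_def)
  let ?Q = "{..<n*1} \<times> {..<n*1}"
  show ?thesis
  proof (rule fin_gen_basis_finite[where \<epsilon> = \<epsilon> and Q = ?Q and M = M and R = RR
      and g = "\<lambda>z. clhat n k (mon_ser 1 (fst z) (snd z))"])
    show "module RR M" by (rule module_axioms)
    show "fin_gen RR M" using cm by (simp add: CM_G_def)
    show "finite ?Q" by simp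
    fix C assume "C \<in> carrier RR"
    then obtain f where f: "C = clhat n k f" by (rule Rhat_cases)
    show "\<exists>c. \<forall>m\<in>carrier M. \<epsilon> (C \<odot> m) = (\<Sum>z\<in>?Q. (\<lambda>b. c z * \<epsilon> (clhat n k (mon_ser 1 (fst z) (snd z)) \<odot> m) b))"
    proof (intro exI[of _ "\<lambda>z. fps_nth (fps_nth f (snd z)) (fst z)"] ballI)
      fix m assume m: "m \<in> carrier M"
      obtain g where g: "clhat n k f \<odot> m = (\<Oplus>z\<in>?Q. t_hat n k (fps_const (fps_nth (fps_nth f (snd z)) (fst z))) \<odot> mon (fst z) (snd z) m)
         \<oplus> t_hat n k (fps_X ^ 1) \<odot> (clhat n k g \<odot> m)" using smult_trunc[OF m] by blast
      have c1: "t_hat n k h \<odot> mon p q m \<in> carrier M" for h p q using m mon_closed by simp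
      have "\<epsilon> (C \<odot> m) = \<epsilon> (\<Oplus>z\<in>?Q. t_hat n k (fps_const (fps_nth (fps_nth f (snd z)) (fst z))) \<odot> mon (fst z) (snd z) m) + \<epsilon> (t_hat n k (fps_X ^ 1) \<odot> (clhat n k g \<odot> m))"
        unfolding f g by (rule e_add) (use m c1 in \<open>auto intro!: finsum_closed\<close>)
      also have "\<epsilon> (t_hat n k (fps_X ^ 1) \<odot> (clhat n k g \<odot> m)) = 0" using m by (simp add: e_t fun_eq_iff)
      also have "\<epsilon> (\<Oplus>z\<in>?Q. t_hat n k (fps_const (fps_nth (fps_nth f (snd z)) (fst z))) \<odot> mon (fst z) (snd z) m)
         = (\<Sum>z\<in>?Q. \<epsilon> (t_hat n k (fps_const (fps_nth (fps_nth f (snd z)) (fst z))) \<odot> mon (fst z) (snd z) m))"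
        by (rule additive_map_finsum[OF abelian_group_axioms e_add]) (use c1 in auto)
      also have "\<dots> = (\<Sum>z\<in>?Q. (\<lambda>b. fps_nth (fps_nth f (snd z)) (fst z) * \<epsilon> (clhat n k (mon_ser 1 (fst z) (snd z)) \<odot> m) b))"
        by (intro sum.cong refl) (use m in \<open>simp add: e_t mon_closed, simp add: mon_def\<close>)
      finally show "\<epsilon> (C \<odot> m) = (\<Sum>z\<in>?Q. (\<lambda>b. fps_nth (fps_nth f (snd z)) (fst z) * \<epsilon> (clhat n k (mon_ser 1 (fst z) (snd z)) \<odot> m) b))" by simp
    qed
  next
    fix b assume b: "b \<in> B"
    show "\<exists>m\<in>carrier M. \<epsilon> m = (\<lambda>b'. if b' = b then 1 else 0)"
      using T.coord_basis[OF b] T.B_carrier[OF b] by (intro bexI[of _ b]) (auto simp: \<epsilon>_def fun_eq_iff)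
  qed (rule e_add)
qed

end

section \<open>Homogeneous bases of generalized eigenvectors\<close>

lemma dC_t: "k \<le> n \<Longrightarrow> dC n k (t_hat n k f) = t_hat n k (of_nat n * fps_X * fps_deriv f)"
  by (simp add: t_hat_tser dC_clhat dser_tser)

lemma dC_mon: "dC n k (clhat n k (mon_ser 1 p q)) = clhat n k (mon_ser (of_nat ((n - k) * p + k * q)) p q)"
  by (simp add: dC_clhat dser_mon del: of_nat_add of_nat_mult)

lemma (in cm_mod) cmp_t: assumes "u \<in> carrier M" "i \<in> carrier GG" shows "cmp (t_hat n k f \<odot> u) i = t_hat n k f \<odot> cmp u i"
proof -
  have "0 \<otimes>\<^bsub>GG\<^esub> i = i" using assms(2) by (auto simp: GG_carrier)
  moreover have "0 \<in> carrier GG" using kn by (auto simp: GG_carrier)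
  ultimately show ?thesis using comp_smult[OF GG_comm _ t_hat_grade t_hat_in assms, of f] by simp
qed

lemma (in cm_mod) mon_add: "u \<in> carrier M \<Longrightarrow> v \<in> carrier M \<Longrightarrow> mon p q (u \<oplus> v) = mon p q u \<oplus> mon p q v"
  by (simp add: mon_def smult_r_distr)

locale cm_conn = cm_mod n k M for n k and M :: "'b G_module" (structure) +
  fixes \<delta> :: "'b \<Rightarrow> 'b"
  assumes \<delta>_closed: "u \<in> carrier M \<Longrightarrow> \<delta> u \<in> carrier M"
    and \<delta>_add: "u \<in> carrier M \<Longrightarrow> v \<in> carrier M \<Longrightarrow> \<delta> (u \<oplus> v) = \<delta> u \<oplus> \<delta> v"
    and \<delta>_smult: "C \<in> carrier RR \<Longrightarrow> u \<in> carrier M \<Longrightarrow> \<delta> (C \<odot> u) = C \<odot> \<delta> u \<oplus> dC n k C \<odot> u"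
    and \<delta>_grade: "i \<in> carrier GG \<Longrightarrow> u \<in> grade M i \<Longrightarrow> \<delta> u \<in> grade M i"
begin

definition rest :: "('b \<Rightarrow> complex fps) \<Rightarrow> 'b \<Rightarrow> complex fps" where "rest v = (\<lambda>b. if b \<in> B then v b else 0)"

text \<open>The inverse of the coordinate map, made total by ignoring values outside B, so that
  \<delta> can be carried over to an operator on all functions.\<close>

definition \<kappa>i :: "('b \<Rightarrow> complex fps) \<Rightarrow> 'b" where "\<kappa>i v = (SOME m. m \<in> carrier M \<and> \<kappa> m = rest v)"

lemma \<kappa>i: "\<kappa>i v \<in> carrier M" "\<kappa> (\<kappa>i v) = rest v"
proof -
  have "finite {b. rest v b \<noteq> 0}" by (rule finite_subset[OF _ finite_B]) (auto simp: rest_def)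
  then obtain m where "m \<in> carrier Tm" "\<kappa> m = rest v"
    by (rule T.coord_surj[where c = "rest v"]) (auto simp: rest_def)
  hence "\<exists>m. m \<in> carrier M \<and> \<kappa> m = rest v" by auto
  from someI_ex[OF this] show "\<kappa>i v \<in> carrier M" "\<kappa> (\<kappa>i v) = rest v" unfolding \<kappa>i_def by blast+
qed

lemma rest_\<kappa>: "rest (\<kappa> m) = \<kappa> m" using T.coord_outside by (auto simp: rest_def)

lemma \<kappa>i_\<kappa>: "m \<in> carrier M \<Longrightarrow> \<kappa>i (\<kappa> m) = m"
  by (rule \<kappa>_inj) (simp_all add: \<kappa>i rest_\<kappa>)

lemma \<kappa>i_add: "\<kappa>i (u + v) = \<kappa>i u \<oplus> \<kappa>i v"
  by (rule \<kappa>_inj) (auto simp: \<kappa>i \<kappa>_add rest_def fun_eq_iff)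

lemma \<kappa>i_smul: "\<kappa>i (smul f v) = t_hat n k f \<odot> \<kappa>i v"
  by (rule \<kappa>_inj) (auto simp: \<kappa>i \<kappa>_t rest_def smul_def fun_eq_iff)

definition DD where "DD v = \<kappa> (\<delta> (\<kappa>i v))"
definition pp where "pp j v = \<kappa> (cmp (\<kappa>i v) j)"

lemma \<kappa>_zero: "\<kappa> \<zero> = 0" using T.coord_zero by simp

lemma t_const_der: "dC n k (t_hat n k (fps_const c)) \<odot> u = \<zero>" if "u \<in> carrier M"
proof -
  have "dC n k (t_hat n k (fps_const c)) = t_hat n k 0" using kn by (simp add: dC_t)
  moreover have "\<kappa> (t_hat n k 0 \<odot> u) = \<kappa> \<zero>" unfolding \<kappa>_t[OF that] \<kappa>_zero by (rule smul_simps)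
  ultimately show ?thesis using \<kappa>_inj[of "t_hat n k 0 \<odot> u" \<zero>] that by simp
qed

lemma cmp_\<delta>: assumes u: "u \<in> carrier M" and i: "i \<in> carrier GG" shows "cmp (\<delta> u) i = \<delta> (cmp u i)"
proof -
  have fin: "finite (carrier GG)" by (simp add: GG_carrier)
  have "u = (\<Oplus>i\<in>carrier GG. cmp u i)" by (rule comp_expand[OF u fin subset_refl]) (simp add: gcomp_def)
  hence "\<delta> u = \<delta> (\<Oplus>i\<in>carrier GG. cmp u i)" by (rule arg_cong)
  also have "\<dots> = (\<Oplus>i\<in>carrier GG. \<delta> (cmp u i))"
    by (rule additive_map_finsum_in[OF abelian_group_axioms abelian_group_axioms \<delta>_closed \<delta>_add]) (assumption | rule comp_closed[OF u])+
  finally have e: "\<delta> u = (\<Oplus>i\<in>carrier GG. \<delta> (cmp u i))" .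
  show ?thesis unfolding e
    by (subst comp_finsum_homog[OF fin subset_refl]) (use i in \<open>simp_all add: \<delta>_grade comp_props(1)[OF u]\<close>)
qed

lemma conn: "connection B n DD (carrier GG) pp"
proof
  show "finite B" by (rule finite_B)
  show "1 \<le> n" using kn by simp
  show "finite (carrier GG)" by (simp add: GG_carrier)
  fix u v c f b i j
  show "DD (u + v) = DD u + DD v" unfolding DD_def \<kappa>i_add using \<delta>_add \<delta>_closed \<kappa>_add \<kappa>i(1) by simp
  show "DD (smul (fps_const c) v) = smul (fps_const c) (DD v)"
    unfolding DD_def \<kappa>i_smul by (simp add: \<delta>_smult \<kappa>i(1) \<delta>_closed t_const_der \<kappa>_t)
  show "b \<notin> B \<Longrightarrow> DD v b = 0" unfolding DD_def by (rule T.coord_outside)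
  show "DD (smul f v) = smul f (DD v) + smul (of_nat n * fps_X * fps_deriv f) v" if "\<forall>b. b \<notin> B \<longrightarrow> v b = 0"
  proof -
    have "rest v = v" using that by (auto simp: rest_def)
    thus ?thesis unfolding DD_def \<kappa>i_smul using kn by (simp add: \<delta>_smult \<kappa>i \<delta>_closed \<kappa>_t \<kappa>_add dC_t)
  qed
  show "pp j (u + v) = pp j u + pp j v" unfolding pp_def \<kappa>i_add by (simp add: comp_add \<kappa>i(1) \<kappa>_add comp_closed)
  show "pp j (smul f v) = smul f (pp j v)"
  proof (cases "j \<in> carrier GG")
    case True thus ?thesis unfolding pp_def \<kappa>i_smul by (simp add: cmp_t \<kappa>i(1) \<kappa>_t comp_closed)
  next
    case False thus ?thesis unfolding pp_def by (simp only: gcomp_def if_False \<kappa>_zero smul_simps)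
  qed
  show "b \<notin> B \<Longrightarrow> pp j v b = 0" unfolding pp_def by (rule T.coord_outside)
  show "pp i (pp j v) = (if i = j then pp j v else 0)" if "i \<in> carrier GG" "j \<in> carrier GG"
  proof -
    have "cmp (cmp (\<kappa>i v) j) i = (if i = j then cmp (\<kappa>i v) j else \<zero>)"
      using comp_homog[OF that(2) comp_props(1)[OF \<kappa>i(1) that(2)]] .
    thus ?thesis unfolding pp_def \<kappa>i_\<kappa>[OF comp_closed[OF \<kappa>i(1)]] by (simp only: \<kappa>_zero split: if_split) simp
  qed
  show "(\<Sum>j\<in>carrier GG. pp j v) = v" if "\<forall>b. b \<notin> B \<longrightarrow> v b = 0"
  proof -
    have fin: "finite (carrier GG)" by (simp add: GG_carrier)
    have r: "rest v = v" using that by (auto simp: rest_def)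
    have "(\<Sum>j\<in>carrier GG. pp j v) = \<kappa> (\<Oplus>j\<in>carrier GG. cmp (\<kappa>i v) j)"
      unfolding pp_def by (rule additive_map_finsum[OF abelian_group_axioms \<kappa>_add, symmetric]) (assumption | rule comp_closed[OF \<kappa>i(1)])+
    also have "(\<Oplus>j\<in>carrier GG. cmp (\<kappa>i v) j) = \<kappa>i v"
      by (rule comp_expand[OF \<kappa>i(1) fin subset_refl, symmetric]) (simp add: gcomp_def)
    finally show ?thesis unfolding \<kappa>i(2) r .
  qed
  show "pp j (DD v) = DD (pp j v)" if "j \<in> carrier GG"
    unfolding pp_def DD_def by (simp add: \<kappa>i_\<kappa> \<delta>_closed \<kappa>i(1) comp_closed cmp_\<delta>[OF _ that])
qed

sublocale C: connection B n DD "carrier GG" pp by (rule conn)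

definition opM :: "complex \<Rightarrow> 'b \<Rightarrow> 'b" where "opM \<nu> m = \<delta> m \<oplus> t_hat n k (fps_const (- \<nu>)) \<odot> m"

lemma opM_closed: "m \<in> carrier M \<Longrightarrow> opM \<nu> m \<in> carrier M" by (simp add: opM_def \<delta>_closed)
lemma opM_pow_closed: "m \<in> carrier M \<Longrightarrow> (opM \<nu> ^^ K) m \<in> carrier M" by (induction K) (simp_all add: opM_closed)

lemma smul_neg: "smul (- f) v = - smul f v" by (simp add: smul_def fun_eq_iff)

lemma \<kappa>_opM: assumes "m \<in> carrier M" shows "\<kappa> (opM \<nu> m) = C.op \<nu> (\<kappa> m)"
proof -
  have c: "fps_const (- \<nu>) = - fps_const \<nu>" by simp
  have "\<kappa> (opM \<nu> m) = \<kappa> (\<delta> m) + smul (fps_const (- \<nu>)) (\<kappa> m)"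
    unfolding opM_def using assms \<delta>_closed[OF assms] by (subst \<kappa>_add) (simp_all only: \<kappa>_t smult_closed t_hat_in)
  thus ?thesis unfolding C.op_def DD_def \<kappa>i_\<kappa>[OF assms] c smul_neg by (simp only: add_uminus_conv_diff)
qed

lemma \<kappa>_opM_pow: assumes "m \<in> carrier M" shows "\<kappa> ((opM \<nu> ^^ K) m) = (C.op \<nu> ^^ K) (\<kappa> m)"
  by (induction K) (simp_all add: \<kappa>_opM opM_pow_closed assms)

text \<open>By the Leibniz rule multiplication by x^p y^q adds the weight of the monomial to an
  eigenvalue.\<close>

lemma mon_opM: assumes m: "m \<in> carrier M"
  shows "mon p q (opM \<nu> m) = opM (\<nu> + of_nat ((n - k) * p + k * q)) (mon p q m)"
proof -
  let ?c = "of_nat ((n - k) * p + k * q) :: complex"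
  have d: "\<delta> (mon p q m) = mon p q (\<delta> m) \<oplus> t_hat n k (fps_const ?c) \<odot> mon p q m"
    unfolding mon_c[OF m, symmetric] dC_mon[symmetric] using m by (simp add: mon_def \<delta>_smult)
  have c: "fps_const (- \<nu>) = fps_const ?c + fps_const (- (\<nu> + ?c))" by (simp only: fps_const_add) simp
  have t: "t_hat n k (fps_const (- \<nu>)) \<odot> mon p q m = t_hat n k (fps_const ?c) \<odot> mon p q m \<oplus> t_hat n k (fps_const (- (\<nu> + ?c))) \<odot> mon p q m"
    unfolding c using m mon_closed[OF m]
    by (simp only: t_hat_tser tser_add clhat_add smult_l_distr clhat_in)
  have "mon p q (opM \<nu> m) = mon p q (\<delta> m) \<oplus> t_hat n k (fps_const (- \<nu>)) \<odot> mon p q m"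
    unfolding opM_def using m \<delta>_closed[OF m] by (subst mon_add) (simp_all only: mon_t smult_closed t_hat_in)
  also have "\<dots> = opM (\<nu> + ?c) (mon p q m)"
    unfolding opM_def d t
    by (rule a_assoc[symmetric]) (use m mon_closed \<delta>_closed in \<open>auto simp del: of_nat_add of_nat_mult\<close>)
  finally show ?thesis .
qed

lemma mon_opM_pow: assumes m: "m \<in> carrier M"
  shows "mon p q ((opM \<nu> ^^ K) m) = (opM (\<nu> + of_nat ((n - k) * p + k * q)) ^^ K) (mon p q m)"
  by (induction K) (simp_all add: mon_opM opM_pow_closed m del: of_nat_add of_nat_mult)

text \<open>\<open>lam e\<close> is the eigenvalue of e. Since x^p y^q e1 is a generalized
  eigenvector for \<open>lam e1\<close> plus the weight of the monomial, it involves only those t^w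
  e whose eigenvalue \<open>lam e\<close> + nw agrees with this sum.\<close>

lemma homogeneous_basis:
  "\<exists>E jd lam. finite E \<and> is_basis TA Tm E \<and> (\<forall>e\<in>E. jd e \<in> carrier GG \<and> e \<in> grade M (jd e)) \<and>
     (\<forall>e1\<in>E. \<forall>e\<in>E. \<forall>p q w. fps_nth (bcoord Tm E (mon p q e1) e) w \<noteq> 0 \<longrightarrow>
        lam e + of_nat (n * w) = lam e1 + (of_nat ((n - k) * p + k * q) :: complex))"
proof -
  obtain E0 where E0: "finite E0" "\<forall>e\<in>E0. \<exists>j \<nu>. C.homog e j \<nu>"
    "\<forall>v\<in>C.VB. \<exists>a. v - (\<Sum>e\<in>E0. smul (fps_const (a e)) e) \<in> C.T 1"
    "\<forall>a. (\<Sum>e\<in>E0. smul (fps_const (a e)) e) \<in> C.T 1 \<longrightarrow> (\<forall>e\<in>E0. a e = 0)"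
    using C.homog_basis_mod_t by (elim exE conjE)
  have EV: "E0 \<subseteq> C.VB" using E0(2) by (auto simp: C.homog_def)
  have ind: "\<And>a. (\<Sum>e\<in>E0. smul (fps_const (a e)) e) \<in> C.T 1 \<Longrightarrow> \<forall>e\<in>E0. a e = 0" using E0(4) by blast
  obtain jd0 lam0 where jl: "\<And>e. e \<in> E0 \<Longrightarrow> C.homog e (jd0 e) (lam0 e)" using bchoice[OF E0(2)]
    by (metis E0(2))
  have rV: "rest v = v" if "v \<in> C.VB" for v using that by (auto simp: rest_def C.VB_def)
  have \<kappa>V: "\<kappa> m \<in> C.VB" for m using T.coord_outside by (auto simp: C.VB_def)
  have k\<kappa>: "\<kappa> (\<kappa>i e) = e" if "e \<in> E0" for e using rV EV that by (auto simp: \<kappa>i)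
  have inj: "inj_on \<kappa>i E0" by (rule inj_on_inverseI[of _ \<kappa>]) (rule k\<kappa>)
  define E where "E = \<kappa>i ` E0"
  have EM: "E \<subseteq> carrier M" using \<kappa>i(1) by (auto simp: E_def)
  have \<kappa>sum: "\<kappa> (\<Oplus>\<^bsub>Tm\<^esub>b\<in>E. c b \<odot>\<^bsub>Tm\<^esub> b) = (\<Sum>e\<in>E0. smul (c (\<kappa>i e)) e)" for c
  proof -
    have "\<kappa> (\<Oplus>\<^bsub>Tm\<^esub>b\<in>E. c b \<odot>\<^bsub>Tm\<^esub> b) = (\<Sum>b\<in>E. \<kappa> (c b \<odot>\<^bsub>Tm\<^esub> b))"
      by (rule T.coord_finsum) (use EM in auto)
    also have "\<dots> = (\<Sum>b\<in>E. smul (c b) (\<kappa> b))" by (intro sum.cong refl) (use EM \<kappa>_t in auto)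
    also have "\<dots> = (\<Sum>e\<in>E0. smul (c (\<kappa>i e)) (\<kappa> (\<kappa>i e)))" unfolding E_def by (simp add: sum.reindex[OF inj])
    also have "\<dots> = (\<Sum>e\<in>E0. smul (c (\<kappa>i e)) e)" by (intro sum.cong refl) (simp add: k\<kappa>)
    finally show ?thesis .
  qed
  have basis: "is_basis TA Tm E"
  proof (rule is_basis_finiteI[OF T_module])
    show "finite E" using E0(1) by (simp add: E_def)
    show "E \<subseteq> carrier Tm" using EM by simp
    fix v assume v: "v \<in> carrier Tm"
    obtain c where c: "\<kappa> v = (\<Sum>e\<in>E0. smul (c e) e)"
      using C.nakayama_ex[OF E0(1) EV _ \<kappa>V] E0(3) by blast
    have "v = (\<Oplus>\<^bsub>Tm\<^esub>b\<in>E. c (\<kappa> b) \<odot>\<^bsub>Tm\<^esub> b)"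
    proof (rule T.coord_inj[OF v])
      show "(\<Oplus>\<^bsub>Tm\<^esub>b\<in>E. c (\<kappa> b) \<odot>\<^bsub>Tm\<^esub> b) \<in> carrier Tm" by (rule T.finsum_closed) (use EM in auto)
      show "\<kappa> v = \<kappa> (\<Oplus>\<^bsub>Tm\<^esub>b\<in>E. c (\<kappa> b) \<odot>\<^bsub>Tm\<^esub> b)" unfolding c \<kappa>sum by (intro sum.cong refl) (simp add: k\<kappa>)
    qed
    thus "\<exists>c. v = (\<Oplus>\<^bsub>Tm\<^esub>b\<in>E. c b \<odot>\<^bsub>Tm\<^esub> b)" by (rule exI[of _ "\<lambda>b. c (\<kappa> b)"])
  next
    fix c assume "(\<Oplus>\<^bsub>Tm\<^esub>b\<in>E. c b \<odot>\<^bsub>Tm\<^esub> b) = \<zero>\<^bsub>Tm\<^esub>"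
    hence "(\<Sum>e\<in>E0. smul (c (\<kappa>i e)) e) = 0" using \<kappa>sum[of c] T.coord_zero by simp
    from C.nakayama_unique[OF E0(1) EV ind this] show "\<forall>b\<in>E. c b = 0" by (auto simp: E_def)
  qed
  have finE: "finite E" using E0(1) by (simp add: E_def)
  interpret E: module_with_basis Tm E
    by (intro module_with_basis.intro T_module module_with_basis_axioms.intro basis)
  have hE: "jd0 (\<kappa> e) \<in> carrier GG \<and> e \<in> grade M (jd0 (\<kappa> e))" if "e \<in> E" for e
  proof -
    obtain e0 where e0: "e0 \<in> E0" "e = \<kappa>i e0" using \<open>e \<in> E\<close> by (auto simp: E_def)
    have ke: "\<kappa> e = e0" using e0 k\<kappa> by simp
    have j: "jd0 e0 \<in> carrier GG" and "pp (jd0 e0) e0 = e0" using jl[OF e0(1)] by (auto simp: C.homog_def)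
    hence "\<kappa> (cmp e (jd0 e0)) = \<kappa> e" unfolding ke by (simp add: pp_def e0(2))
    hence "cmp e (jd0 e0) = e" using \<kappa>_inj[OF comp_closed] EM \<open>e \<in> E\<close> by blast
    moreover have "cmp e (jd0 e0) \<in> grade M (jd0 e0)" using EM \<open>e \<in> E\<close> by (intro comp_props(1) j) auto
    ultimately show ?thesis unfolding ke using j by simp
  qed
  have wt: "lam0 (\<kappa> e) + of_nat (n * w) = lam0 (\<kappa> e1) + (of_nat ((n - k) * p + k * q) :: complex)"
    if e1: "e1 \<in> E" and e: "e \<in> E" and nz: "fps_nth (bcoord Tm E (mon p q e1) e) w \<noteq> 0" for e1 e p q w
  proof -
    have e1M: "e1 \<in> carrier M" using e1 EM by auto
    have mM: "mon p q e1 \<in> carrier M" by (rule mon_closed[OF e1M])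
    have k1: "\<kappa> e1 \<in> E0" "\<kappa> e \<in> E0" "\<kappa>i (\<kappa> e) = e" using e1 e k\<kappa> by (auto simp: E_def)
    obtain K where K: "(C.op (lam0 (\<kappa> e1)) ^^ K) (\<kappa> e1) = 0" using jl[OF k1(1)] by (auto simp: C.homog_def)
    hence "\<kappa> ((opM (lam0 (\<kappa> e1)) ^^ K) e1) = \<kappa> \<zero>" unfolding \<kappa>_opM_pow[OF e1M] \<kappa>_zero .
    hence "(opM (lam0 (\<kappa> e1)) ^^ K) e1 = \<zero>" by (rule \<kappa>_inj[OF opM_pow_closed[OF e1M] zero_closed])
    hence "(opM (lam0 (\<kappa> e1) + of_nat ((n - k) * p + k * q)) ^^ K) (mon p q e1) = \<zero>"
      unfolding mon_opM_pow[OF e1M, symmetric] by (simp add: mon_def)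
    hence op: "(C.op (lam0 (\<kappa> e1) + of_nat ((n - k) * p + k * q)) ^^ K) (\<kappa> (mon p q e1)) = 0"
      unfolding \<kappa>_opM_pow[OF mM, symmetric] by (simp only: \<kappa>_zero)
    have "mon p q e1 = (\<Oplus>\<^bsub>Tm\<^esub>b\<in>E. bcoord Tm E (mon p q e1) b \<odot>\<^bsub>Tm\<^esub> b)"
      by (rule E.coord_expand') (use mM finE E.coord_outside in auto)
    hence "\<kappa> (mon p q e1) = \<kappa> (\<Oplus>\<^bsub>Tm\<^esub>b\<in>E. bcoord Tm E (mon p q e1) b \<odot>\<^bsub>Tm\<^esub> b)" by (rule arg_cong)
    hence ks: "\<kappa> (mon p q e1) = (\<Sum>e\<in>E0. smul (bcoord Tm E (mon p q e1) (\<kappa>i e)) e)" unfolding \<kappa>sum .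
    show ?thesis
      by (rule C.weight_of_coefficient[OF E0(1) EV ind _ op[unfolded ks] k1(2)])
        (use jl nz k1(3) in \<open>auto simp: C.homog_def\<close>)
  qed
  show ?thesis
    by (intro exI[of _ E] exI[of _ "\<lambda>e. jd0 (\<kappa> e)"] exI[of _ "\<lambda>e. lam0 (\<kappa> e)"] conjI ballI allI impI)
      (use finE basis hE wt in blast)+
qed

end

lemma (in cm_mod) rigid_homogeneous_basis:
  assumes "rigid n k M"
  shows "\<exists>E jd lam. finite E \<and> is_basis TA Tm E \<and> (\<forall>e\<in>E. jd e \<in> carrier GG \<and> e \<in> grade M (jd e)) \<and>
     (\<forall>e1\<in>E. \<forall>e\<in>E. \<forall>p q w. fps_nth (bcoord Tm E (mon p q e1) e) w \<noteq> 0 \<longrightarrow>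
        lam e + of_nat (n * w) = lam e1 + (of_nat ((n - k) * p + k * q) :: complex))"
proof -
  obtain \<delta> where \<delta>: "\<forall>u\<in>carrier M. \<delta> u \<in> carrier M" "\<forall>u\<in>carrier M. \<forall>v\<in>carrier M. \<delta> (u \<oplus> v) = \<delta> u \<oplus> \<delta> v"
    "\<forall>C\<in>carrier RR. \<forall>u\<in>carrier M. \<delta> (C \<odot> u) = C \<odot> \<delta> u \<oplus> dC n k C \<odot> u"
    "\<forall>i\<in>carrier GG. \<forall>u\<in>grade M i. \<delta> u \<in> grade M i"
    using connection_exists[OF assms] by (elim exE conjE)
  have "cm_conn n k M \<delta>"
    by (intro cm_conn.intro cm_mod_axioms cm_conn_axioms.intro) (use \<delta> in blast)+
  thus ?thesis by (rule cm_conn.homogeneous_basis)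
qed

section \<open>Coordinates in a homogeneous basis\<close>

locale tbasis = cm_mod n k M for n k and M :: "'b G_module" (structure) +
  fixes E :: "'b set" and jd :: "'b \<Rightarrow> int"
  assumes finE: "finite E" and basisE: "is_basis TA (restrict_scalars (t_hat n k) M) E"
    and jd_in: "e \<in> E \<Longrightarrow> jd e \<in> carrier (G_dual n)" and jd_grade: "e \<in> E \<Longrightarrow> e \<in> grade M (jd e)"
begin

sublocale E: module_with_basis Tm E
  by (intro module_with_basis.intro T_module module_with_basis_axioms.intro basisE)

abbreviation "cf \<equiv> bcoord Tm E"

lemma E_M: "e \<in> E \<Longrightarrow> e \<in> carrier M" using E.B_carrier by simp

lemma cf_add: "u \<in> carrier M \<Longrightarrow> v \<in> carrier M \<Longrightarrow> cf (u \<oplus> v) = cf u + cf v"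
  using E.coord_add[of u v] by simp

lemma cf_t: "u \<in> carrier M \<Longrightarrow> cf (t_hat n k f \<odot> u) = smul f (cf u)"
  using E.coord_smult[of u f] by (simp add: smul_def)

lemma cf_inj: "u \<in> carrier M \<Longrightarrow> v \<in> carrier M \<Longrightarrow> cf u = cf v \<Longrightarrow> u = v"
  using E.coord_inj[of u v] by simp

lemma cf_zero: "cf \<zero> = 0" using E.coord_zero by simp

lemma cf_neg: "u \<in> carrier M \<Longrightarrow> cf (\<ominus> u) = - cf u"
  by (rule additive_map_neg[OF abelian_group_axioms cf_add])

lemma cf_finsum: "(\<And>i. i \<in> A \<Longrightarrow> f i \<in> carrier M) \<Longrightarrow> cf (\<Oplus>i\<in>A. f i) = (\<Sum>i\<in>A. cf (f i))"
  by (rule additive_map_finsum[OF abelian_group_axioms cf_add])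

lemma cf_expand: assumes "m \<in> carrier M" shows "m = (\<Oplus>e\<in>E. t_hat n k (cf m e) \<odot> e)"
proof -
  have "m = (\<Oplus>\<^bsub>Tm\<^esub>e\<in>E. cf m e \<odot>\<^bsub>Tm\<^esub> e)"
    by (rule E.coord_expand') (use assms finE E.coord_outside in auto)
  thus ?thesis by (simp add: restrict_scalars_finsum)
qed

definition el :: "('b \<Rightarrow> complex fps) \<Rightarrow> 'b" where
  "el c = (SOME m. m \<in> carrier M \<and> cf m = (\<lambda>e. if e \<in> E then c e else 0))"

lemma el: "el c \<in> carrier M" "cf (el c) = (\<lambda>e. if e \<in> E then c e else 0)"
proof -
  have "finite {b. (if b \<in> E then c b else 0) \<noteq> 0}" by (rule finite_subset[OF _ finE]) auto
  then obtain m where "m \<in> carrier Tm" "cf m = (\<lambda>e. if e \<in> E then c e else 0)"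
    by (rule E.coord_surj[where c = "\<lambda>e. if e \<in> E then c e else 0"]) auto
  hence "\<exists>m. m \<in> carrier M \<and> cf m = (\<lambda>e. if e \<in> E then c e else 0)" by auto
  from someI_ex[OF this] show "el c \<in> carrier M" "cf (el c) = (\<lambda>e. if e \<in> E then c e else 0)" unfolding el_def by blast+
qed

lemma smul_apply: "smul f v b = f * v b" by (simp add: smul_def)

lemma cf_mon: assumes m: "m \<in> carrier M"
  shows "cf (mon p q m) e = (\<Sum>e1\<in>E. cf m e1 * cf (mon p q e1) e)"
proof -
  have "mon p q m = mon p q (\<Oplus>e\<in>E. t_hat n k (cf m e) \<odot> e)" by (rule arg_cong[OF cf_expand[OF m]])
  hence "cf (mon p q m) = cf (mon p q (\<Oplus>e\<in>E. t_hat n k (cf m e) \<odot> e))" by (rule arg_cong)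
  also have "\<dots> = (\<Sum>e1\<in>E. cf (mon p q (t_hat n k (cf m e1) \<odot> e1)))"
    by (rule additive_map_finsum[OF abelian_group_axioms])
      (simp_all only: mon_add cf_add mon_closed E_M smult_closed t_hat_in)
  also have "\<dots> = (\<Sum>e1\<in>E. smul (cf m e1) (cf (mon p q e1)))"
    by (intro sum.cong refl) (simp add: mon_t E_M cf_t mon_closed)
  finally have "cf (mon p q m) e = (\<Sum>e1\<in>E. smul (cf m e1) (cf (mon p q e1))) e" by (rule arg_cong)
  thus ?thesis by (simp add: sum_fun_apply smul_apply)
qed

text \<open>What lies outside the box acts through multiples of t^N, so coefficients below t^N do
  not see it.\<close>

lemma cf_smult_nth: assumes u: "u \<in> carrier M" and w: "w < N"
  shows "fps_nth (cf (clhat n k f \<odot> u) e) w =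
    (\<Sum>z\<in>{..<n*N} \<times> {..<n*N}. fps_nth (fps_nth f (snd z)) (fst z) * fps_nth (cf (mon (fst z) (snd z) u) e) w)"
proof -
  let ?Q = "{..<n*N} \<times> {..<n*N}" let ?h = "\<lambda>z. t_hat n k (fps_const (fps_nth (fps_nth f (snd z)) (fst z))) \<odot> mon (fst z) (snd z) u"
  obtain g where g: "clhat n k f \<odot> u = (\<Oplus>z\<in>?Q. ?h z) \<oplus> t_hat n k (fps_X ^ N) \<odot> (clhat n k g \<odot> u)"
    using smult_trunc[OF u] by blast
  have h: "?h z \<in> carrier M" for z using u by (simp add: mon_closed)
  have "cf (clhat n k f \<odot> u) = (\<Sum>z\<in>?Q. cf (?h z)) + smul (fps_X ^ N) (cf (clhat n k g \<odot> u))"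
    unfolding g using u h by (simp only: cf_add cf_t cf_finsum finsum_closed smult_closed clhat_in t_hat_in Pi_I)
  hence "cf (clhat n k f \<odot> u) e = (\<Sum>z\<in>?Q. cf (?h z) e) + fps_X ^ N * cf (clhat n k g \<odot> u) e"
    by (simp add: sum_fun_apply smul_apply)
  hence "fps_nth (cf (clhat n k f \<odot> u) e) w = (\<Sum>z\<in>?Q. fps_nth (cf (?h z) e) w)"
    using w by (simp add: fps_sum_nth fps_X_power_mult_nth)
  also have "\<dots> = (\<Sum>z\<in>?Q. fps_nth (fps_nth f (snd z)) (fst z) * fps_nth (cf (mon (fst z) (snd z) u) e) w)"
    by (intro sum.cong refl) (simp add: cf_t mon_closed u smul_apply)
  finally show ?thesis .
qed

lemma cf_cmp: assumes m: "m \<in> carrier M" and j: "j \<in> carrier GG"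
  shows "cf (cmp m j) e = (if jd e = j then cf m e else 0)"
proof (cases "e \<in> E")
  case True
  have c: "cmp (t_hat n k (cf m e1) \<odot> e1) j = (if jd e1 = j then t_hat n k (cf m e1) \<odot> e1 else \<zero>)" if "e1 \<in> E" for e1
    using comp_homog[OF jd_in jd_grade, OF that that, of j] by (simp add: cmp_t[OF E_M j] that smult_r_null)
  have "cmp m j = cmp (\<Oplus>e\<in>E. t_hat n k (cf m e) \<odot> e) j" by (rule arg_cong[OF cf_expand[OF m]])
  also have "\<dots> = (\<Oplus>e1\<in>E. cmp (t_hat n k (cf m e1) \<odot> e1) j)" by (rule comp_finsum) (simp add: E_M)
  finally have "cf (cmp m j) = (\<Sum>e1\<in>E. cf (cmp (t_hat n k (cf m e1) \<odot> e1) j))"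
    by (simp only:) (rule cf_finsum, rule comp_closed, simp add: E_M)
  also have "\<dots> = (\<Sum>e1\<in>E. if jd e1 = j then smul (cf m e1) (\<lambda>b. if b = e1 then 1 else 0) else 0)"
  proof (rule sum.cong[OF refl])
    fix e1 assume e1: "e1 \<in> E"
    show "cf (cmp (t_hat n k (cf m e1) \<odot> e1) j) = (if jd e1 = j then smul (cf m e1) (\<lambda>b. if b = e1 then 1 else 0) else 0)"
      unfolding c[OF e1] using cf_t[OF E_M[OF e1]] E.coord_basis[OF e1] cf_zero by (simp only: split: if_split) simp
  qed
  finally have "cf (cmp m j) e = (\<Sum>e1\<in>E. (if jd e1 = j then smul (cf m e1) (\<lambda>b. if b = e1 then 1 else 0) else 0) e)"
    by (simp only: sum_fun_apply)
  also have "\<dots> = (\<Sum>e1\<in>E. if e1 = e then (if jd e = j then cf m e else 0) else 0)"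
    by (intro sum.cong refl) (auto simp: smul_apply)
  finally show ?thesis using True finE by simp
qed (simp add: E.coord_outside)

lemma grade_iff: assumes m: "m \<in> carrier M" and j: "j \<in> carrier GG"
  shows "m \<in> grade M j \<longleftrightarrow> (\<forall>e. cf m e \<noteq> 0 \<longrightarrow> jd e = j)"
proof
  assume "m \<in> grade M j"
  hence "cmp m j = m" using comp_homog[OF j, of m j] by simp
  hence "cf m e = (if jd e = j then cf m e else 0)" for e using cf_cmp[OF m j, of e] by simp
  thus "\<forall>e. cf m e \<noteq> 0 \<longrightarrow> jd e = j" by metis
next
  assume a: "\<forall>e. cf m e \<noteq> 0 \<longrightarrow> jd e = j"
  have "cmp m j = m"
    by (rule cf_inj[OF comp_closed[OF m] m], rule ext) (use a in \<open>simp only: cf_cmp[OF m j] split: if_split\<close>, metis)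
  thus "m \<in> grade M j" using comp_props(1)[OF m j] by simp
qed

lemma jd_mon: assumes e1: "e1 \<in> E" and nz: "cf (mon p q e1) e \<noteq> 0"
  shows "jd e = (jd e1 + (int p - int q)) mod int n"
proof -
  have L: "(int p - int q) mod int n \<in> carrier GG" using kn by (auto simp: GG_carrier)
  have "mon p q e1 \<in> grade M ((int p - int q) mod int n \<otimes>\<^bsub>GG\<^esub> jd e1)"
    unfolding mon_def by (rule grade_smult[OF L jd_in[OF e1] mon_Rhat_grade jd_grade[OF e1]])
  hence "mon p q e1 \<in> grade M ((jd e1 + (int p - int q)) mod int n)" by (simp add: mod_simps add.commute)
  moreover have "(jd e1 + (int p - int q)) mod int n \<in> carrier GG" using kn by (auto simp: GG_carrier)
  ultimately show ?thesis using grade_iff[OF mon_closed[OF E_M[OF e1]]] nz by blast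
qed

definition part_sub :: "'b set \<Rightarrow> 'b set" where
  "part_sub S = {m \<in> carrier M. \<forall>e. e \<notin> S \<longrightarrow> cf m e = 0}"

lemma part_sub_graded:
  assumes S: "\<And>e1 e p q. e1 \<in> S \<Longrightarrow> e1 \<in> E \<Longrightarrow> cf (mon p q e1) e \<noteq> 0 \<Longrightarrow> e \<in> S"
  shows "graded_submodule GG RR M (part_sub S)"
  unfolding graded_submodule_def
proof (intro conjI subsetI)
  show "submodule (part_sub S) RR M"
  proof (rule submoduleI)
    fix C x assume C: "C \<in> carrier RR" and x: "x \<in> part_sub S"
    have xM: "x \<in> carrier M" and x0: "\<And>e. e \<notin> S \<Longrightarrow> cf x e = 0" using x by (auto simp: part_sub_def)
    obtain f where f: "C = clhat n k f" using C by (rule Rhat_cases)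
    have "cf (C \<odot> x) e = 0" if e: "e \<notin> S" for e
    proof (rule fps_ext)
      fix w
      have "cf (mon p q x) e = 0" for p q
        unfolding cf_mon[OF xM] by (rule sum.neutral) (use S[of _ p q e] x0 e in fastforce)
      thus "fps_nth (cf (C \<odot> x) e) w = fps_nth 0 w"
        unfolding f cf_smult_nth[OF xM lessI] by (simp only: fps_zero_nth mult_zero_right sum.neutral_const)
    qed
    thus "C \<odot> x \<in> part_sub S" using C xM by (simp add: part_sub_def)
  qed (auto simp: part_sub_def cf_zero cf_add cf_neg)
next
  fix m assume m: "m \<in> part_sub S"
  hence mM: "m \<in> carrier M" by (simp add: part_sub_def)
  have fin: "finite (carrier GG)" by (simp add: GG_carrier)
  have "cmp m i \<in> part_sub S \<inter> grade M i" if "i \<in> carrier GG" for i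
    using m comp_closed[OF mM] comp_props(1)[OF mM that] by (simp add: part_sub_def cf_cmp[OF mM that])
  moreover have "m = (\<Oplus>i\<in>carrier GG. cmp m i)" by (rule comp_expand[OF mM fin subset_refl]) (simp add: gcomp_def)
  ultimately show "m \<in> hom_sums M (carrier GG) (\<lambda>i. part_sub S \<inter> grade M i)"
    unfolding hom_sums_def using fin by blast
qed

text \<open>Monomials link no element of S with an element outside, so S and its complement span
  complementary graded submodules; indecomposability makes one of them zero.\<close>

lemma indecomposable_block:
  assumes ind: "gindecomposable GG RR M" and S: "S \<subseteq> E" "S \<noteq> {}"
    and cl: "\<And>e1 e p q. e1 \<in> E \<Longrightarrow> e \<in> E \<Longrightarrow> cf (mon p q e1) e \<noteq> 0 \<Longrightarrow> e1 \<in> S \<longleftrightarrow> e \<in> S"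
  shows "S = E"
proof -
  have out: "cf u e \<noteq> 0 \<Longrightarrow> e \<in> E" for u e using E.coord_outside by blast
  have g: "graded_submodule GG RR M (part_sub S)" "graded_submodule GG RR M (part_sub (E - S))"
    by (rule part_sub_graded; use cl out in blast)+
  have "part_sub S \<inter> part_sub (E - S) = {\<zero>}"
  proof (intro equalityI subsetI)
    fix u assume u: "u \<in> part_sub S \<inter> part_sub (E - S)"
    hence "cf u e = 0" for e by (cases "e \<in> S") (auto simp: part_sub_def)
    hence "cf u = cf \<zero>" by (simp add: cf_zero fun_eq_iff)
    thus "u \<in> {\<zero>}" using u cf_inj[of u \<zero>] by (auto simp: part_sub_def)
  qed (auto simp: part_sub_def cf_zero)
  moreover have "part_sub S <+> part_sub (E - S) = carrier M"
  proof (intro equalityI subsetI)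
    fix m assume m: "m \<in> carrier M"
    let ?a = "el (\<lambda>e. if e \<in> S then cf m e else 0)" and ?b = "el (\<lambda>e. if e \<in> S then 0 else cf m e)"
    have "m = ?a \<oplus> ?b" by (rule cf_inj) (auto simp: el m cf_add E.coord_outside fun_eq_iff)
    moreover have "?a \<in> part_sub S" "?b \<in> part_sub (E - S)" by (auto simp: part_sub_def el)
    ultimately show "m \<in> part_sub S <+> part_sub (E - S)" unfolding set_add_def' by blast
  qed (auto simp: part_sub_def set_add_def')
  ultimately have "part_sub S = {\<zero>} \<or> part_sub (E - S) = {\<zero>}" using ind g unfolding gindecomposable_def by blast
  moreover have "e \<notin> S'" if "part_sub S' = {\<zero>}" "e \<in> E" for S' e
  proof
    assume "e \<in> S'"
    hence "e \<in> part_sub S'" using E.coord_basis[OF that(2)] E_M[OF that(2)] by (simp add: part_sub_def)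
    hence "cf e e = 0" using that(1) by (simp add: cf_zero)
    thus False using E.coord_basis[OF that(2)] by simp
  qed
  ultimately show ?thesis using S by blast
qed

lemma E_nonempty: assumes "gindecomposable GG RR M" shows "E \<noteq> {}"
proof
  assume e: "E = {}"
  have "u = \<zero>" if "u \<in> carrier M" for u
    by (rule cf_inj[OF that zero_closed]) (use E.coord_outside e in \<open>simp add: fun_eq_iff\<close>)
  thus False using assms unfolding gindecomposable_def by blast
qed

text \<open>The basis elements whose degree and weight differ from those of \<open>e0\<close> by an integral degree span
  a direct summand.\<close>

lemma integral_weights:
  assumes ind: "gindecomposable GG RR M"
    and wt: "\<And>e1 e p q w. e1 \<in> E \<Longrightarrow> e \<in> E \<Longrightarrow> fps_nth (cf (mon p q e1) e) w \<noteq> 0 \<Longrightarrow>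
      lam e + of_nat (n * w) = lam e1 + (of_nat ((n - k) * p + k * q) :: complex)"
  shows "\<exists>J m. (\<forall>e\<in>E. jd e = J e mod int n) \<and> (\<forall>e1\<in>E. \<forall>e\<in>E. \<forall>p q w. fps_nth (cf (mon p q e1) e) w \<noteq> 0 \<longrightarrow>
      pt n k (J e) (m e + int w) = pt n k (J e1 + int p - int q) (m e1 + int q))"
proof -
  obtain e0 where e0: "e0 \<in> E" using E_nonempty[OF ind] by blast
  let ?d = "int n - int k"
  have kk: "int (n - k) = ?d" using kn by simp
  \<comment> \<open>The degree J deg(x) + m (deg(x) + deg(y)) has weight (n-k) J + n m.
    \<open>P e J m\<close> says that e has the residue of this degree, and the eigenvalue expected
    from its weight when \<open>e0\<close> is placed in degree \<open>jd e0\<close> times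
    deg(x).\<close>
  define P where "P e J m \<longleftrightarrow> jd e = J mod int n \<and> lam e = lam e0 + of_int (?d * (J - jd e0) + int n * m)" for e J m
  have jmod: "jd e mod int n = jd e" if "e \<in> E" for e using jd_in[OF that] by (auto simp: GG_carrier)
  have wt': "lam e = lam e1 + of_int (?d * (int p - int q) + int n * (int q - int w))"
    if "e1 \<in> E" "e \<in> E" "fps_nth (cf (mon p q e1) e) w \<noteq> 0" for e1 e p q w
  proof -
    have "int ((n - k) * p + k * q) = ?d * int p + int k * int q" by (simp add: kk)
    hence "of_nat ((n - k) * p + k * q) = (of_int (?d * int p + int k * int q) :: complex)"
      by (metis of_int_of_nat_eq)
    moreover have "(of_nat (n * w) :: complex) = of_int (int n * int w)" by simp
    ultimately have "lam e = lam e1 + of_int (?d * int p + int k * int q) - of_int (int n * int w)" using wt[OF that] by (simp only: eq_diff_eq)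
    thus ?thesis by (simp add: algebra_simps)
  qed
  have S: "{e \<in> E. \<exists>J m. P e J m} = E"
  proof (rule indecomposable_block[OF ind])
    show "{e \<in> E. \<exists>J m. P e J m} \<subseteq> E" by blast
    have "P e0 (jd e0) 0" using e0 jmod by (simp add: P_def)
    thus "{e \<in> E. \<exists>J m. P e J m} \<noteq> {}" using e0 by blast
    fix e1 e p q assume e: "e1 \<in> E" "e \<in> E" "cf (mon p q e1) e \<noteq> 0"
    then obtain w where w: "fps_nth (cf (mon p q e1) e) w \<noteq> 0" by (auto simp: fps_eq_iff)
    note wt1 = wt'[OF e(1,2) w] note jd1 = jd_mon[OF e(1,3)]
    \<comment> \<open>A nonzero coefficient of x^p y^q e1 at t^w e shifts J by p - q and m by q - w,
      so an integral degree can be carried along it in both directions.\<close>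
    have "P e (J + (int p - int q)) (m + (int q - int w))" if "P e1 J m" for J m
    proof -
      have "?d * (J + (int p - int q) - jd e0) + int n * (m + (int q - int w))
        = (?d * (J - jd e0) + int n * m) + (?d * (int p - int q) + int n * (int q - int w))" by (simp add: algebra_simps)
      hence "lam e = lam e0 + of_int (?d * (J + (int p - int q) - jd e0) + int n * (m + (int q - int w)))"
        using wt1 that by (simp only: P_def of_int_add add.assoc)
      moreover have "jd e = (J + (int p - int q)) mod int n" unfolding jd1 using that by (simp add: P_def mod_simps)
      ultimately show ?thesis by (simp only: P_def)
    qed
    moreover have "P e1 (J - (int p - int q)) (m - (int q - int w))" if "P e J m" for J m
    proof -
      have "jd e1 = (jd e1 + (int p - int q) - (int p - int q)) mod int n" using jmod[OF e(1)] by simp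
      also have "\<dots> = (jd e - (int p - int q)) mod int n" unfolding jd1 by (simp add: mod_simps)
      also have "\<dots> = (J - (int p - int q)) mod int n" using that by (simp add: P_def mod_simps)
      finally have "jd e1 = (J - (int p - int q)) mod int n" .
      moreover have "lam e1 = lam e0 + of_int (?d * (J - (int p - int q) - jd e0) + int n * (m - (int q - int w)))"
      proof -
        have "?d * (J - (int p - int q) - jd e0) + int n * (m - (int q - int w))
          = (?d * (J - jd e0) + int n * m) - (?d * (int p - int q) + int n * (int q - int w))" by (simp add: algebra_simps)
        moreover have "lam e1 = lam e - of_int (?d * (int p - int q) + int n * (int q - int w))" unfolding wt1 by (simp only: add_diff_cancel_right')
        ultimately show ?thesis using that by (simp only: P_def of_int_diff add_diff_eq)
      qed
      ultimately show ?thesis by (simp only: P_def)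
    qed
    ultimately show "e1 \<in> {e \<in> E. \<exists>J m. P e J m} \<longleftrightarrow> e \<in> {e \<in> E. \<exists>J m. P e J m}" using e(1,2) by blast
  qed
  hence "\<forall>e\<in>E. \<exists>z. P e (fst z) (snd z)" by fastforce
  from bchoice[OF this] obtain z where z: "\<And>e. e \<in> E \<Longrightarrow> P e (fst (z e)) (snd (z e))" by blast
  have "pt n k (fst (z e)) (snd (z e) + int w) = pt n k (fst (z e1) + int p - int q) (snd (z e1) + int q)"
    if e: "e1 \<in> E" "e \<in> E" and w: "fps_nth (cf (mon p q e1) e) w \<noteq> 0" for e1 e p q w
  proof -
    let ?J = "fst (z e)" and ?m = "snd (z e)" and ?J1 = "fst (z e1)" and ?m1 = "snd (z e1)"
    have "cf (mon p q e1) e \<noteq> 0" using w by auto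
    hence "?J mod int n = (?J1 + (int p - int q)) mod int n" using jd_mon[OF e(1)] z[OF e(1)] z[OF e(2)] by (simp add: P_def mod_simps)
    then obtain s where s: "?J1 + (int p - int q) = ?J + int n * s"
      by (metis mod_eqE)
    have "(of_int (?d * (?J - jd e0) + int n * ?m) :: complex) = of_int (?d * (?J1 - jd e0) + int n * ?m1 + (?d * (int p - int q) + int n * (int q - int w)))"
      using wt'[OF e w] z[OF e(1)] z[OF e(2)] by (simp add: P_def add.assoc)
    hence "?d * (?J - jd e0) + int n * ?m = ?d * (?J1 - jd e0) + int n * ?m1 + (?d * (int p - int q) + int n * (int q - int w))"
      by (simp only: of_int_eq_iff)
    \<comment> \<open>Equal residues determine J up to n s; equality of weights, divided by n, then
      gives the matching change of m, so the two degrees agree as characters.\<close>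
    hence "int n * (?m + int w) = int n * (?m1 + int q) + ?d * (?J1 + (int p - int q) - ?J)" by (simp add: algebra_simps)
    also have "\<dots> = int n * (?m1 + int q + ?d * s)" unfolding s by (simp add: algebra_simps)
    finally have "?m + int w = ?m1 + int q + ?d * s" using kn by simp
    hence "?m1 + int q = ?m + int w - ?d * s" by simp
    thus ?thesis using s unfolding pt_eq_iff by (intro exI[of _ s]) simp
  qed
  moreover have "jd e = fst (z e) mod int n" if "e \<in> E" for e using z[OF that] by (simp add: P_def)
  ultimately show ?thesis by (intro exI[of _ "\<lambda>e. fst (z e)"] exI[of _ "\<lambda>e. snd (z e)"]) blast
qed

end

section \<open>The graded lift\<close>

lemma fps_of_poly_ex: assumes "finite {w. fps_nth f w \<noteq> (0::complex)}" shows "\<exists>p. fps_of_poly p = f"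
proof -
  have "\<forall>\<^sub>F w in cofinite. fps_nth f w = 0" using assms by (simp add: eventually_cofinite)
  hence "Polynomial.coeff (Abs_poly (fps_nth f)) = fps_nth f" by (simp add: Abs_poly_inverse)
  hence "fps_of_poly (Abs_poly (fps_nth f)) = f" by (simp add: fps_eq_iff)
  thus ?thesis ..
qed

lemma finsum_mem:
  assumes "abelian_group N" "P \<subseteq> carrier N" "\<zero>\<^bsub>N\<^esub> \<in> P" "\<And>u v. u \<in> P \<Longrightarrow> v \<in> P \<Longrightarrow> u \<oplus>\<^bsub>N\<^esub> v \<in> P"
    and f: "\<And>i. i \<in> A \<Longrightarrow> f i \<in> P"
  shows "finsum N f A \<in> P"
proof -
  interpret abelian_group N by fact
  show ?thesis using f
  proof (induction A rule: infinite_finite_induct)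
    case (insert x F)
    have "f x \<in> carrier N" "f \<in> F \<rightarrow> carrier N" using insert.prems assms(2) by auto
    hence "finsum N f (insert x F) = f x \<oplus>\<^bsub>N\<^esub> finsum N f F" using insert by (intro finsum_insert) auto
    thus ?case using insert assms(4) by simp
  qed (simp_all add: assms(3) finsum_infinite)
qed

text \<open>\<open>J e\<close> and \<open>h e\<close> are coordinates of a degree of e in the
  character group of \<Gamma>; the assumption says that multiplication by monomials respects the
  resulting degrees of all t^w e.\<close>

locale lifted = tbasis n k M E "\<lambda>e. J e mod int n"
  for n k and M :: "'b G_module" (structure) and E J +
  fixes h :: "'b \<Rightarrow> int"
  assumes deg: "e1 \<in> E \<Longrightarrow> e \<in> E \<Longrightarrow> fps_nth (bcoord (restrict_scalars (t_hat n k) M) E (mon p q e1) e) w \<noteq> 0 \<Longrightarrow>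
      pt n k (J e) (h e + int w) = pt n k (J e1 + int p - int q) (h e1 + int q)"
begin

abbreviation "GD \<equiv> Gamma_dual n k"

text \<open>The degree of t^w e.\<close>

definition dg :: "'b \<Rightarrow> nat \<Rightarrow> (int \<times> int) set" where "dg e w = pt n k (J e) (h e + int w)"

lemma dg_in: "dg e w \<in> carrier GD" by (simp add: dg_def)

lemma dg_inj: "dg e w = dg e w' \<Longrightarrow> w = w'"
proof -
  assume "dg e w = dg e w'"
  then obtain s where "J e = J e + int n * s" "h e + int w' = h e + int w - (int n - int k) * s"
    unfolding dg_def pt_eq_iff by blast
  thus "w = w'" using kn by simp
qed

text \<open>The assumption \<open>deg\<close>, multiplied by t^a.\<close>

lemma mon_deg: assumes "fps_nth (cf (mon p q e1) e) (w - a) \<noteq> 0" "e1 \<in> E" "a \<le> w"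
  shows "dg e w = char_class n k (int p) (int q) \<otimes>\<^bsub>GD\<^esub> dg e1 a"
proof -
  have "e \<in> E" using assms(1) E.coord_outside[of e] by force
  from deg[OF assms(2) this assms(1)] obtain s where
    s: "J e1 + int p - int q = J e + int n * s" "h e1 + int q = h e + int (w - a) - (int n - int k) * s"
    unfolding pt_eq_iff by blast
  have "J e1 + int p - int q = J e + int n * s \<and> h e1 + int a + int q = h e + int w - (int n - int k) * s"
    using s assms(3) by (simp add: of_nat_diff)
  thus ?thesis unfolding dg_def char_mult_pt pt_eq_iff by (intro exI[of _ s])
qed

lemma cf_mon_nth: assumes u: "u \<in> carrier M"
  shows "fps_nth (cf (mon p q u) e) w = (\<Sum>e1\<in>E. \<Sum>a\<le>w. fps_nth (cf u e1) a * fps_nth (cf (mon p q e1) e) (w - a))"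
  unfolding cf_mon[OF u] fps_sum_nth fps_mult_nth atLeast0AtMost ..

text \<open>By \<open>mon_deg\<close> a term of u contributes only if its degree is that of t^w e
  lowered by (p, q). For elements with infinitely many coefficients this locality stands in for a
  decomposition into homogeneous components.\<close>

lemma mon_cong: assumes u: "u \<in> carrier M" and v: "v \<in> carrier M"
  and eq: "\<And>e1 a. dg e w = char_class n k (int p) (int q) \<otimes>\<^bsub>GD\<^esub> dg e1 a \<Longrightarrow> fps_nth (cf u e1) a = fps_nth (cf v e1) a"
  shows "fps_nth (cf (mon p q u) e) w = fps_nth (cf (mon p q v) e) w"
  unfolding cf_mon_nth[OF u] cf_mon_nth[OF v]
proof (intro sum.cong refl)
  fix e1 a assume "e1 \<in> E" "a \<in> {..w}"
  thus "fps_nth (cf u e1) a * fps_nth (cf (mon p q e1) e) (w - a) = fps_nth (cf v e1) a * fps_nth (cf (mon p q e1) e) (w - a)"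
    using mon_deg[of p q e1 e w a] eq[of e1 a] by (cases "fps_nth (cf (mon p q e1) e) (w - a) = 0") simp_all
qed

lemma mon_zero: "mon p q \<zero> = \<zero>" by (simp add: mon_def)

lemma mon_nz: assumes u: "u \<in> carrier M" and nz: "fps_nth (cf (mon p q u) e) w \<noteq> 0"
  shows "\<exists>e1 a. fps_nth (cf u e1) a \<noteq> 0 \<and> dg e w = char_class n k (int p) (int q) \<otimes>\<^bsub>GD\<^esub> dg e1 a"
proof (rule ccontr)
  assume "\<not> ?thesis"
  hence "fps_nth (cf (mon p q u) e) w = fps_nth (cf (mon p q \<zero>) e) w"
    by (intro mon_cong[OF u zero_closed]) (auto simp: cf_zero)
  thus False using nz by (simp add: mon_zero cf_zero)
qed

lemma smult_nz: assumes u: "u \<in> carrier M" and nz: "fps_nth (cf (clhat n k f \<odot> u) e) w \<noteq> 0"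
  shows "\<exists>p q e1 a. fps_nth (fps_nth f q) p \<noteq> 0 \<and> fps_nth (cf u e1) a \<noteq> 0 \<and>
    dg e w = char_class n k (int p) (int q) \<otimes>\<^bsub>GD\<^esub> dg e1 a"
proof -
  obtain z where "fps_nth (fps_nth f (snd z)) (fst z) * fps_nth (cf (mon (fst z) (snd z) u) e) w \<noteq> 0"
    using nz unfolding cf_smult_nth[OF u lessI] by (rule sum.not_neutral_contains_not_neutral)
  hence "fps_nth (fps_nth f (snd z)) (fst z) \<noteq> 0" "fps_nth (cf (mon (fst z) (snd z) u) e) w \<noteq> 0" by auto
  thus ?thesis using mon_nz[OF u] by blast
qed

definition fsupp :: "'b \<Rightarrow> ('b \<times> nat) set" where "fsupp u = {z. fps_nth (cf u (fst z)) (snd z) \<noteq> 0}"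

text \<open>For fixed e the degree determines w, and E is finite, so finitely many degrees carry
  finitely many coefficients.\<close>

lemma fsupp_finiteI: assumes D: "finite D" and sub: "\<And>e w. fps_nth (cf u e) w \<noteq> 0 \<Longrightarrow> dg e w \<in> D"
  shows "finite (fsupp u)"
proof (rule finite_subset)
  show "fsupp u \<subseteq> (\<Union>e\<in>E. Pair e ` (dg e -` D))"
  proof
    fix z assume z: "z \<in> fsupp u"
    obtain e w where ew: "z = (e, w)" by (cases z)
    have nz: "fps_nth (cf u e) w \<noteq> 0" using z by (simp add: fsupp_def ew)
    hence "e \<in> E" using E.coord_outside[of e] by force
    thus "z \<in> (\<Union>e\<in>E. Pair e ` (dg e -` D))" using sub[OF nz] ew by blast
  qed
  show "finite (\<Union>e\<in>E. Pair e ` (dg e -` D))"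
    by (intro finite_UN_I finE finite_imageI finite_vimageI D injI) (rule dg_inj)
qed

text \<open>The component of u in degree i. It is available for every u in M, also when infinitely
  many components are nonzero.\<close>

definition pr :: "'b \<Rightarrow> (int \<times> int) set \<Rightarrow> 'b" where
  "pr u i = el (\<lambda>e. Abs_fps (\<lambda>w. if dg e w = i then fps_nth (cf u e) w else 0))"

lemma pr_closed: "pr u i \<in> carrier M" by (simp add: pr_def el)

lemma cf_pr: "fps_nth (cf (pr u i) e) w = (if dg e w = i then fps_nth (cf u e) w else 0)"
  by (simp add: pr_def el E.coord_outside)

lemma eqI: "u \<in> carrier M \<Longrightarrow> v \<in> carrier M \<Longrightarrow> (\<And>e w. fps_nth (cf u e) w = fps_nth (cf v e) w) \<Longrightarrow> u = v"
  by (rule cf_inj) (auto intro!: ext fps_ext)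

text \<open>The ring map from \<open>Rbar n k\<close> to \<open>Rhat n k\<close> induced by the
  inclusion of polynomials into power series.\<close>

definition \<phi> :: "complex poly poly set \<Rightarrow> complex fps fps set" where
  "\<phi> C = clhat n k (p2s (SOME f. f \<in> C))"

lemma \<phi>_clbar: "\<phi> (clbar n k f) = clhat n k (p2s f)"
proof -
  let ?g = "SOME g. g \<in> clbar n k f"
  have "clbar n k ?g = clbar n k f" by (rule some_clbar) simp
  hence "Fbar n k dvd ?g - f" by (simp add: clbar_eq_iff)
  hence "Fhat n k dvd p2s (?g - f)" by (rule p2s_dvd)
  thus ?thesis by (simp add: \<phi>_def clhat_eq_iff p2s_diff)
qed

lemma \<phi>_in: "\<phi> C \<in> carrier RR" by (simp add: \<phi>_def)

text \<open>The elements with polynomial coefficients in the basis E. They have the type of the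
  elements of M, as \<open>graded_lift\<close> asks.\<close>

definition Lf :: "'b Gamma_module" where
  "Lf = \<lparr>carrier = {u \<in> carrier M. finite (fsupp u)}, monoid.mult = undefined, monoid.one = undefined,
     ring.zero = \<zero>, ring.add = (\<oplus>), module.smult = (\<lambda>C u. \<phi> C \<odot> u),
     grade = (\<lambda>i. {u \<in> carrier M. \<forall>e w. fps_nth (cf u e) w \<noteq> 0 \<longrightarrow> dg e w = i})\<rparr>"

lemma Lf_simps [simp]: "\<zero>\<^bsub>Lf\<^esub> = \<zero>" "u \<oplus>\<^bsub>Lf\<^esub> v = u \<oplus> v" "C \<odot>\<^bsub>Lf\<^esub> u = \<phi> C \<odot> u"
  by (simp_all add: Lf_def)

lemma Lf_carrier: "carrier Lf = {u \<in> carrier M. finite (fsupp u)}" by (simp add: Lf_def)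

lemma Lf_grade: "grade Lf i = {u \<in> carrier M. \<forall>e w. fps_nth (cf u e) w \<noteq> 0 \<longrightarrow> dg e w = i}" by (simp add: Lf_def)

lemma Lf_M: "u \<in> carrier Lf \<Longrightarrow> u \<in> carrier M" by (simp add: Lf_carrier)

lemma Lf_grade_carrier: assumes "u \<in> grade Lf i" shows "u \<in> carrier Lf"
proof -
  have "finite (fsupp u)" by (rule fsupp_finiteI[of "{i}"]) (use assms in \<open>auto simp: Lf_grade\<close>)
  thus ?thesis using assms by (simp add: Lf_carrier Lf_grade)
qed

lemma Lf_zero: "\<zero> \<in> carrier Lf" by (simp add: Lf_carrier fsupp_def cf_zero)

lemma Lf_add: assumes "u \<in> carrier Lf" "v \<in> carrier Lf" shows "u \<oplus> v \<in> carrier Lf"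
proof -
  have "fsupp (u \<oplus> v) \<subseteq> fsupp u \<union> fsupp v" using assms by (auto simp: fsupp_def Lf_carrier cf_add)
  thus ?thesis using assms by (auto simp: Lf_carrier intro: finite_subset)
qed

lemma Lf_neg: assumes "u \<in> carrier Lf" shows "\<ominus> u \<in> carrier Lf"
proof -
  have "fsupp (\<ominus> u) = fsupp u" using assms by (auto simp: fsupp_def Lf_carrier cf_neg)
  thus ?thesis using assms by (auto simp: Lf_carrier)
qed

text \<open>A polynomial has finitely many monomials, and each of them moves finitely many degrees
  to finitely many degrees.\<close>

lemma Lf_smult: assumes C: "C \<in> carrier (Rbar n k)" and u: "u \<in> carrier Lf" shows "\<phi> C \<odot> u \<in> carrier Lf"
proof -
  obtain f where f: "C = clbar n k f" using C by (rule Rbar_cases)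
  let ?P = "{(p, q). Polynomial.coeff (Polynomial.coeff f q) p \<noteq> 0}"
  let ?D = "(\<lambda>(z, y). char_class n k (int (fst z)) (int (snd z)) \<otimes>\<^bsub>GD\<^esub> dg (fst y) (snd y)) ` (?P \<times> fsupp u)"
  have "finite (fsupp (\<phi> C \<odot> u))"
  proof (rule fsupp_finiteI[of ?D])
    show "finite ?D" using finite_coeff_pol[of f] u by (intro finite_imageI finite_cartesian_product) (auto simp: Lf_carrier)
    fix e w assume "fps_nth (cf (\<phi> C \<odot> u) e) w \<noteq> 0"
    then obtain p q e1 a where "Polynomial.coeff (Polynomial.coeff f q) p \<noteq> 0" "fps_nth (cf u e1) a \<noteq> 0"
      "dg e w = char_class n k (int p) (int q) \<otimes>\<^bsub>GD\<^esub> dg e1 a"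
      unfolding f \<phi>_clbar using smult_nz[OF Lf_M[OF u]] p2s_nth by metis
    thus "dg e w \<in> ?D" by (intro image_eqI[of _ _ "((p, q), (e1, a))"]) (auto simp: fsupp_def)
  qed
  thus ?thesis using u \<phi>_in by (simp add: Lf_carrier)
qed

lemma Lf_abelian: "abelian_group Lf"
proof (rule abelian_groupI)
  fix x assume x: "x \<in> carrier Lf"
  thus "\<exists>y\<in>carrier Lf. y \<oplus>\<^bsub>Lf\<^esub> x = \<zero>\<^bsub>Lf\<^esub>" using Lf_neg[OF x] Lf_M[OF x] by (intro bexI[of _ "\<ominus> x"]) (simp_all add: l_neg)
qed (auto simp: Lf_zero Lf_add a_assoc Lf_M intro: a_comm)

lemma Lf_module: "module (Rbar n k) Lf"
proof (rule moduleI[OF Rbar_cring Lf_abelian])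
  fix C C' x assume C: "C \<in> carrier (Rbar n k)" "C' \<in> carrier (Rbar n k)" and x: "x \<in> carrier Lf"
  obtain f g where fg: "C = clbar n k f" "C' = clbar n k g" using C Rbar_cases by metis
  show "(C \<oplus>\<^bsub>Rbar n k\<^esub> C') \<odot>\<^bsub>Lf\<^esub> x = C \<odot>\<^bsub>Lf\<^esub> x \<oplus>\<^bsub>Lf\<^esub> C' \<odot>\<^bsub>Lf\<^esub> x"
    using Lf_M[OF x] by (simp add: fg clbar_add[symmetric] \<phi>_clbar p2s_add clhat_add smult_l_distr)
  show "C \<otimes>\<^bsub>Rbar n k\<^esub> C' \<odot>\<^bsub>Lf\<^esub> x = C \<odot>\<^bsub>Lf\<^esub> (C' \<odot>\<^bsub>Lf\<^esub> x)"
    using Lf_M[OF x] by (simp add: fg clbar_mult[symmetric] \<phi>_clbar p2s_mult clhat_mult smult_assoc1)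
next
  fix C x y assume "C \<in> carrier (Rbar n k)" "x \<in> carrier Lf" "y \<in> carrier Lf"
  thus "C \<odot>\<^bsub>Lf\<^esub> (x \<oplus>\<^bsub>Lf\<^esub> y) = C \<odot>\<^bsub>Lf\<^esub> x \<oplus>\<^bsub>Lf\<^esub> C \<odot>\<^bsub>Lf\<^esub> y" by (simp add: smult_r_distr \<phi>_in Lf_M)
next
  fix C x assume "C \<in> carrier (Rbar n k)" "x \<in> carrier Lf"
  thus "C \<odot>\<^bsub>Lf\<^esub> x \<in> carrier Lf" by (simp add: Lf_smult)
next
  fix x assume "x \<in> carrier Lf"
  thus "\<one>\<^bsub>Rbar n k\<^esub> \<odot>\<^bsub>Lf\<^esub> x = x" using \<phi>_clbar[of 1] by (simp add: clbar_one p2s_one clhat_one Lf_M)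
qed

lemma Lf_finsum: assumes "\<And>i. i \<in> A \<Longrightarrow> f i \<in> carrier Lf" shows "finsum Lf f A = (\<Oplus>i\<in>A. f i)"
proof -
  have "id (finsum Lf f A) = (\<Oplus>i\<in>A. id (f i))"
    by (rule additive_map_finsum_in[OF Lf_abelian abelian_group_axioms]) (use assms Lf_M in auto)
  thus ?thesis by simp
qed

lemma cf_Lf_finsum: assumes "\<And>i. i \<in> A \<Longrightarrow> f i \<in> carrier Lf"
  shows "fps_nth (cf (finsum Lf f A) e) w = (\<Sum>i\<in>A. fps_nth (cf (f i) e) w)"
proof -
  have "finsum Lf f A = (\<Oplus>i\<in>A. f i)" using assms by (rule Lf_finsum)
  moreover have "cf (\<Oplus>i\<in>A. f i) = (\<Sum>i\<in>A. cf (f i))" by (rule cf_finsum) (use assms Lf_M in blast)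
  ultimately show ?thesis by (simp add: sum_fun_apply fps_sum_nth)
qed

text \<open>The decomposition of u consists of the \<open>pr u i\<close>, of which finitely many are
  nonzero because u has finite support. Existence and uniqueness are both checked coefficient by
  coefficient.\<close>

lemma Lf_graded: "graded_module GD (Rbar n k) (Rbar_grade n k) Lf"
  unfolding graded_module_def
proof (intro conjI ballI)
  show "module (Rbar n k) Lf" by (rule Lf_module)
next
  interpret L: abelian_group Lf by (rule Lf_abelian)
  fix i assume i: "i \<in> carrier GD"
  show "subgroup (grade Lf i) (add_monoid Lf)"
  proof (rule L.add.subgroupI)
    show "grade Lf i \<subseteq> carrier Lf" using Lf_grade_carrier by blast
    have "\<zero> \<in> grade Lf i" by (simp add: Lf_grade cf_zero)
    thus "grade Lf i \<noteq> {}" by blast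
    fix a assume a: "a \<in> grade Lf i"
    hence aM: "a \<in> carrier M" by (simp add: Lf_grade)
    have neg: "\<ominus>\<^bsub>Lf\<^esub> a = \<ominus> a"
      by (rule L.minus_equality) (use aM Lf_grade_carrier[OF a] Lf_neg in \<open>simp_all add: l_neg\<close>)
    show "\<ominus>\<^bsub>Lf\<^esub> a \<in> grade Lf i" unfolding neg using a by (simp add: Lf_grade cf_neg)
  next
    fix a b assume ab: "a \<in> grade Lf i" "b \<in> grade Lf i"
    have "dg e w = i" if "fps_nth (cf (a \<oplus> b) e) w \<noteq> 0" for e w
    proof -
      have "fps_nth (cf a e) w \<noteq> 0 \<or> fps_nth (cf b e) w \<noteq> 0" using that ab by (auto simp: Lf_grade cf_add)
      thus ?thesis using ab by (auto simp: Lf_grade)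
    qed
    thus "a \<oplus>\<^bsub>Lf\<^esub> b \<in> grade Lf i" using ab by (simp add: Lf_grade)
  qed
next
  fix u assume u: "u \<in> carrier Lf"
  let ?S = "\<lambda>f. {i \<in> carrier GD. f i \<noteq> \<zero>\<^bsub>Lf\<^esub>}"
  let ?F = "\<lambda>i\<in>carrier GD. pr u i"
  have prg: "pr u i \<in> grade Lf i" for i by (simp add: Lf_grade pr_closed cf_pr)
  have pr0: "\<exists>e w. fps_nth (cf u e) w \<noteq> 0 \<and> dg e w = i" if "pr u i \<noteq> \<zero>" for i
  proof (rule ccontr)
    assume "\<not> ?thesis"
    hence "pr u i = \<zero>" by (intro eqI pr_closed) (auto simp: cf_pr cf_zero)
    thus False using that by simp
  qed
  show "\<exists>!f. f \<in> (\<Pi>\<^sub>E i\<in>carrier GD. grade Lf i) \<and> finite (?S f) \<and> u = finsum Lf f (?S f)"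
  proof (rule ex1I[of _ ?F], intro conjI)
    show "?F \<in> (\<Pi>\<^sub>E i\<in>carrier GD. grade Lf i)" using prg by simp
    have "?S ?F \<subseteq> (\<lambda>z. dg (fst z) (snd z)) ` fsupp u"
    proof
      fix i assume "i \<in> ?S ?F"
      hence "pr u i \<noteq> \<zero>" by auto
      then obtain e w where "fps_nth (cf u e) w \<noteq> 0" "dg e w = i" using pr0 by blast
      thus "i \<in> (\<lambda>z. dg (fst z) (snd z)) ` fsupp u" by (intro image_eqI[of _ _ "(e, w)"]) (auto simp: fsupp_def)
    qed
    moreover have "finite ((\<lambda>z. dg (fst z) (snd z)) ` fsupp u)" using u by (simp add: Lf_carrier)
    ultimately show fin: "finite (?S ?F)" by (rule finite_subset)
    have cl: "?F i \<in> carrier Lf" if "i \<in> ?S ?F" for i using that Lf_grade_carrier[OF prg] by simp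
    have sc: "finsum Lf ?F (?S ?F) \<in> carrier M"
      by (rule Lf_M[OF abelian_monoid.finsum_closed[OF abelian_group.axioms(1)[OF Lf_abelian]]]) (use cl in blast)
    show "u = finsum Lf ?F (?S ?F)"
    proof (rule eqI[OF Lf_M[OF u] sc])
      fix e w
      have "fps_nth (cf (finsum Lf ?F (?S ?F)) e) w = (\<Sum>i\<in>?S ?F. fps_nth (cf (?F i) e) w)" by (rule cf_Lf_finsum[OF cl])
      also have "\<dots> = (\<Sum>i\<in>?S ?F. if i = dg e w then fps_nth (cf u e) w else 0)"
        by (intro sum.cong refl) (auto simp: cf_pr)
      also have "\<dots> = (if dg e w \<in> ?S ?F then fps_nth (cf u e) w else 0)" using fin by (simp add: sum.delta)
      also have "\<dots> = fps_nth (cf u e) w"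
      proof (cases "pr u (dg e w) = \<zero>")
        case True
        hence "fps_nth (cf (pr u (dg e w)) e) w = 0" by (simp add: cf_zero)
        thus ?thesis by (simp add: cf_pr)
      qed (simp add: dg_in)
      finally show "fps_nth (cf u e) w = fps_nth (cf (finsum Lf ?F (?S ?F)) e) w" ..
    qed
  next
    fix f assume f: "f \<in> (\<Pi>\<^sub>E i\<in>carrier GD. grade Lf i) \<and> finite (?S f) \<and> u = finsum Lf f (?S f)"
    have fg: "f i \<in> grade Lf i" if "i \<in> carrier GD" for i using f that by (auto simp: PiE_iff)
    have "fps_nth (cf u e) w = fps_nth (cf (f (dg e w)) e) w" for e w
    proof -
      have "fps_nth (cf u e) w = fps_nth (cf (finsum Lf f (?S f)) e) w" using f by simp
      also have "\<dots> = (\<Sum>i\<in>?S f. fps_nth (cf (f i) e) w)"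
        by (rule cf_Lf_finsum) (use fg Lf_grade_carrier in blast)
      also have "\<dots> = (\<Sum>i\<in>?S f. if i = dg e w then fps_nth (cf (f i) e) w else 0)"
      proof (rule sum.cong[OF refl])
        fix i assume "i \<in> ?S f"
        thus "fps_nth (cf (f i) e) w = (if i = dg e w then fps_nth (cf (f i) e) w else 0)" using fg[of i] by (auto simp: Lf_grade)
      qed
      also have "\<dots> = (if dg e w \<in> ?S f then fps_nth (cf (f (dg e w)) e) w else 0)" using f by (simp add: sum.delta)
      also have "\<dots> = fps_nth (cf (f (dg e w)) e) w" using dg_in[of e w] by (auto simp: cf_zero)
      finally show ?thesis .
    qed
    hence "f i = pr u i" if "i \<in> carrier GD" for i
      using fg[OF that] by (intro eqI pr_closed) (auto simp: Lf_grade cf_pr)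
    thus "f = ?F" using f by (auto simp: PiE_iff extensional_def fun_eq_iff)
  qed
next
  fix i j C u assume ij: "i \<in> carrier GD" "j \<in> carrier GD" and C: "C \<in> Rbar_grade n k i" and u: "u \<in> grade Lf j"
  obtain f where f: "C = clbar n k f" "\<And>p q. Polynomial.coeff (Polynomial.coeff f q) p \<noteq> 0 \<Longrightarrow> char_class n k (int p) (int q) = i"
    using C by (auto simp: Rbar_grade_def)
  have uM: "u \<in> carrier M" using u by (simp add: Lf_grade)
  have "dg e w = i \<otimes>\<^bsub>GD\<^esub> j" if nz: "fps_nth (cf (\<phi> C \<odot> u) e) w \<noteq> 0" for e w
  proof -
    obtain p q e1 a where "Polynomial.coeff (Polynomial.coeff f q) p \<noteq> 0" "fps_nth (cf u e1) a \<noteq> 0"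
      "dg e w = char_class n k (int p) (int q) \<otimes>\<^bsub>GD\<^esub> dg e1 a"
      using smult_nz[OF uM nz[unfolded f(1) \<phi>_clbar]] unfolding p2s_nth by blast
    thus ?thesis using f(2) u by (simp add: Lf_grade)
  qed
  thus "C \<odot>\<^bsub>Lf\<^esub> u \<in> grade Lf (i \<otimes>\<^bsub>GD\<^esub> j)" using uM \<phi>_in by (simp add: Lf_grade)
qed

lemma \<phi>_t: "\<phi> (t_bar n k f) = t_hat n k (fps_of_poly f)"
  by (simp add: t_bar_tpol \<phi>_clbar p2s_tpol t_hat_tser)

lemma E_Lf: assumes "e \<in> E" shows "e \<in> carrier Lf"
proof -
  have "fsupp e \<subseteq> {(e, 0)}"
  proof
    fix z assume "z \<in> fsupp e"
    hence "fps_nth (if fst z = e then 1 else 0 :: complex fps) (snd z) \<noteq> 0" using E.coord_basis[OF assms] by (simp add: fsupp_def)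
    thus "z \<in> {(e, 0)}" by (cases z) (auto split: if_splits)
  qed
  thus ?thesis using E_M[OF assms] by (auto simp: Lf_carrier intro: finite_subset)
qed

lemma Lf_expand: assumes u: "u \<in> carrier Lf" shows "\<exists>c. u = (\<Oplus>\<^bsub>Lf\<^esub>e\<in>E. t_bar n k (c e) \<odot>\<^bsub>Lf\<^esub> e)"
proof -
  have "\<forall>e. \<exists>p. fps_of_poly p = cf u e"
  proof
    fix e
    have "{w. fps_nth (cf u e) w \<noteq> 0} = Pair e -` fsupp u" by (auto simp: fsupp_def)
    moreover have "finite (Pair e -` fsupp u)" by (rule finite_vimageI) (use u in \<open>auto simp: Lf_carrier inj_def\<close>)
    ultimately show "\<exists>p. fps_of_poly p = cf u e" by (intro fps_of_poly_ex) simp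
  qed
  from choice[OF this] obtain c where c: "\<And>e. fps_of_poly (c e) = cf u e" by blast
  have "(\<Oplus>\<^bsub>Lf\<^esub>e\<in>E. t_bar n k (c e) \<odot>\<^bsub>Lf\<^esub> e) = (\<Oplus>e\<in>E. t_bar n k (c e) \<odot>\<^bsub>Lf\<^esub> e)"
    by (rule Lf_finsum) (simp add: Lf_smult E_Lf)
  also have "\<dots> = (\<Oplus>e\<in>E. t_hat n k (cf u e) \<odot> e)" by (simp add: \<phi>_t c)
  also have "\<dots> = u" by (rule cf_expand[OF Lf_M[OF u], symmetric])
  finally show ?thesis by (intro exI[of _ c]) simp
qed

text \<open>E is a basis over C[t] because it is one over C[[t]] and finitely supported coefficients
  are polynomials; being finite, it also generates.\<close>

lemma Lf_CM: "CM_Gamma n k Lf"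
  unfolding CM_Gamma_def
proof (intro conjI)
  show "graded_module GD (Rbar n k) (Rbar_grade n k) Lf" by (rule Lf_graded)
  show "fin_gen (Rbar n k) Lf"
    unfolding fin_gen_def
  proof (intro exI[of _ E] conjI allI impI)
    show "finite E" by (rule finE)
    show "E \<subseteq> carrier Lf" using E_Lf by blast
    fix P assume P: "submodule P (Rbar n k) Lf \<and> E \<subseteq> P"
    hence sg: "subgroup P (add_monoid Lf)" and sm: "\<And>C x. C \<in> carrier (Rbar n k) \<Longrightarrow> x \<in> P \<Longrightarrow> C \<odot>\<^bsub>Lf\<^esub> x \<in> P"
      by (auto simp: submodule_def submodule_axioms_def)
    have PL: "P \<subseteq> carrier Lf" using subgroup.subset[OF sg] by simp
    have "u \<in> P" if "u \<in> carrier Lf" for u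
    proof -
      obtain c where c: "u = (\<Oplus>\<^bsub>Lf\<^esub>e\<in>E. t_bar n k (c e) \<odot>\<^bsub>Lf\<^esub> e)" using Lf_expand[OF \<open>u \<in> carrier Lf\<close>] ..
      show ?thesis unfolding c
      proof (rule finsum_mem[OF Lf_abelian PL])
        show "\<zero>\<^bsub>Lf\<^esub> \<in> P" using subgroup.one_closed[OF sg] by simp
        show "u \<oplus>\<^bsub>Lf\<^esub> v \<in> P" if "u \<in> P" "v \<in> P" for u v using subgroup.m_closed[OF sg that] by simp
        show "t_bar n k (c e) \<odot>\<^bsub>Lf\<^esub> e \<in> P" if "e \<in> E" for e by (rule sm) (use P that in auto)
      qed
    qed
    thus "P = carrier Lf" using PL by blast
  qed
  show "free_module TA (restrict_scalars (t_bar n k) Lf)"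
    unfolding free_module_def
  proof (intro conjI exI[of _ E])
    interpret L: module "Rbar n k" Lf by (rule Lf_module)
    have neg: "\<ominus>\<^bsub>Lf\<^esub> u \<in> carrier Lf" if "u \<in> carrier Lf" for u using that by (rule L.a_inv_closed)
    have "module TA (restrict_scalars (t_bar n k) (Lf\<lparr>carrier := carrier Lf\<rparr>))"
      by (rule restrict_scalars_module[OF Lf_module])
        (use neg Lf_zero Lf_add Lf_smult in \<open>simp_all add: t_bar_tpol tpol_add tpol_mult tpol_one clbar_add clbar_mult clbar_one\<close>)
    thus m: "module TA (restrict_scalars (t_bar n k) Lf)" by simp
    show "is_basis TA (restrict_scalars (t_bar n k) Lf) E"
    proof (rule is_basis_finiteI[OF m finE])
      show "E \<subseteq> carrier (restrict_scalars (t_bar n k) Lf)" using E_Lf by auto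
      show "\<exists>c. v = (\<Oplus>\<^bsub>restrict_scalars (t_bar n k) Lf\<^esub>b\<in>E. c b \<odot>\<^bsub>restrict_scalars (t_bar n k) Lf\<^esub> b)"
        if "v \<in> carrier (restrict_scalars (t_bar n k) Lf)" for v
        using Lf_expand[of v] that unfolding restrict_scalars_finsum by simp
      fix c assume z: "(\<Oplus>\<^bsub>restrict_scalars (t_bar n k) Lf\<^esub>b\<in>E. c b \<odot>\<^bsub>restrict_scalars (t_bar n k) Lf\<^esub> b) = \<zero>\<^bsub>restrict_scalars (t_bar n k) Lf\<^esub>"
      hence "finsum Lf (\<lambda>b. t_hat n k (fps_of_poly (c b)) \<odot> b) E = \<zero>" unfolding restrict_scalars_finsum by (simp add: \<phi>_t)
      moreover have cl: "t_hat n k (fps_of_poly (c b)) \<odot> b \<in> carrier Lf" if "b \<in> E" for b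
        using Lf_smult[OF t_bar_in E_Lf[OF that], of "c b"] by (simp add: \<phi>_t)
      ultimately have sum0: "(\<Sum>b\<in>E. fps_nth (cf (t_hat n k (fps_of_poly (c b)) \<odot> b) e) w) = 0" for e w
        using cf_Lf_finsum[of E "\<lambda>b. t_hat n k (fps_of_poly (c b)) \<odot> b" e w, OF cl] by (simp add: cf_zero)
      show "\<forall>b\<in>E. c b = 0"
      proof
        fix e assume e: "e \<in> E"
        have "Polynomial.coeff (c e) w = 0" for w
        proof -
          have "(\<Sum>b\<in>E. fps_nth (cf (t_hat n k (fps_of_poly (c b)) \<odot> b) e) w) = (\<Sum>b\<in>E. if b = e then Polynomial.coeff (c e) w else 0)"
            by (intro sum.cong refl) (auto simp: cf_t E_M smul_apply E.coord_basis)
          thus ?thesis using sum0[of e w] e finE by simp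
        qed
        thus "c e = 0" by (simp add: poly_eq_iff)
      qed
    qed
  qed
qed

end

section \<open>Completing the lift\<close>

context lifted
begin

text \<open>\<open>cf_smult_nth\<close> for the single monomial x^p y^q, which has no coefficient
  inside the box.\<close>

lemma mon_far: assumes u: "u \<in> carrier M" and z: "(p, q) \<notin> {..<n * Suc w} \<times> {..<n * Suc w}"
  shows "fps_nth (cf (mon p q u) e) w = 0"
proof -
  have c: "fps_nth (fps_nth (mon_ser 1 p q) (snd z)) (fst z) = 0" if "z \<in> {..<n * Suc w} \<times> {..<n * Suc w}" for z
    using that z by (cases z) (auto simp: mon_ser_def)
  have "fps_nth (cf (mon p q u) e) w = (\<Sum>z\<in>{..<n * Suc w} \<times> {..<n * Suc w}.
    fps_nth (fps_nth (mon_ser 1 p q) (snd z)) (fst z) * fps_nth (cf (mon (fst z) (snd z) u) e) w)"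
    by (subst mon_def) (rule cf_smult_nth[OF u lessI])
  also have "\<dots> = 0" by (rule sum.neutral) (use c in force)
  finally show ?thesis .
qed

lemma lifted_gamma_mod: "gamma_mod n k Lf"
  using k1 kn Lf_CM by unfold_locales

sublocale L: gamma_mod n k Lf by (rule lifted_gamma_mod)

abbreviation "CL \<equiv> completion n k Lf"

text \<open>The coefficient of t^w e is read from the only component of v in which it can
  occur.\<close>

definition \<Phi> :: "((int \<times> int) set \<Rightarrow> 'b) \<Rightarrow> 'b" where
  "\<Phi> v = el (\<lambda>e. Abs_fps (\<lambda>w. fps_nth (cf (v (dg e w)) e) w))"

lemma \<Phi>_closed: "\<Phi> v \<in> carrier M" by (simp add: \<Phi>_def el)

lemma cf_\<Phi>: "fps_nth (cf (\<Phi> v) e) w = fps_nth (cf (v (dg e w)) e) w"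
  by (simp add: \<Phi>_def el E.coord_outside)

lemma CL_grade: "v \<in> carrier CL \<Longrightarrow> i \<in> carrier GD \<Longrightarrow> v i \<in> grade Lf i"
  by (simp add: L.CC_carrier PiE_iff)

lemma CL_M: "v \<in> carrier CL \<Longrightarrow> i \<in> carrier GD \<Longrightarrow> v i \<in> carrier M"
  using CL_grade by (simp add: Lf_grade)

lemma GD_lower: assumes "dg e w = char_class n k (int p) (int q) \<otimes>\<^bsub>GD\<^esub> dg e1 a"
  shows "dg e w \<otimes>\<^bsub>GD\<^esub> inv\<^bsub>GD\<^esub> char_class n k (int p) (int q) = dg e1 a"
proof -
  interpret G: comm_group GD by (rule Gamma_comm_group)
  let ?c = "char_class n k (int p) (int q)"
  have "?c \<otimes>\<^bsub>GD\<^esub> dg e1 a = dg e1 a \<otimes>\<^bsub>GD\<^esub> ?c" by (rule G.m_comm) (simp_all add: dg_in)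
  thus ?thesis unfolding assms using dg_in by (simp add: G.m_assoc)
qed

text \<open>At the coefficient of t^w e the completion sums over the nonzero lowered components
  \<open>lo z\<close>, and M over the box p, q < n (w + 1). Terms outside the box vanish by
  \<open>mon_far\<close>, zero components contribute nothing, and by \<open>mon_cong\<close> each
  \<open>lo z\<close> may be replaced by \<open>\<Phi> v\<close> in its term.\<close>

lemma \<Phi>_smult: assumes C: "C \<in> carrier RR" and v: "v \<in> carrier CL"
  shows "\<Phi> (C \<odot>\<^bsub>CL\<^esub> v) = C \<odot> \<Phi> v"
proof (rule eqI[OF \<Phi>_closed])
  show "C \<odot> \<Phi> v \<in> carrier M" using C \<Phi>_closed by simp
  fix e w
  define f where "f = (SOME f. f \<in> C)"
  have Cf: "C = clhat n k f" using some_clhat[OF C] by (simp add: f_def)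
  define lo where "lo z = v (dg e w \<otimes>\<^bsub>GD\<^esub> inv\<^bsub>GD\<^esub> char_class n k (int (fst z)) (int (snd z)))" for z
  let ?Z = "{z. lo z \<noteq> \<zero>}" and ?Q = "{..<n * Suc w} \<times> {..<n * Suc w}"
  let ?c = "\<lambda>z. fps_nth (fps_nth f (snd z)) (fst z)"
  interpret G: comm_group GD by (rule Gamma_comm_group)
  have loL: "lo z \<in> carrier Lf" for z
  proof -
    have "dg e w \<otimes>\<^bsub>GD\<^esub> inv\<^bsub>GD\<^esub> char_class n k (int (fst z)) (int (snd z)) \<in> carrier GD"
      by (intro G.m_closed G.inv_closed dg_in char_class_in)
    thus ?thesis unfolding lo_def using Lf_grade_carrier CL_grade[OF v] by blast
  qed
  have fin: "finite ?Z"
    using L.low_finite[OF v, of "J e" "h e + int w"] by (simp add: lo_def dg_def pt_lower L.low_def)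
  have act: "clbar n k (mon_pol c p q) \<odot>\<^bsub>Lf\<^esub> u = t_hat n k (fps_const c) \<odot> mon p q u" if "u \<in> carrier M" for c p q u
    using that by (simp add: \<phi>_clbar p2s_mon mon_c)
  have "(C \<odot>\<^bsub>CL\<^esub> v) (dg e w) = (\<Oplus>\<^bsub>Lf\<^esub>z\<in>?Z. clbar n k (mon_pol (?c z) (fst z) (snd z)) \<odot>\<^bsub>Lf\<^esub> lo z)"
    unfolding L.CC_smult using dg_in by (simp add: lo_def f_def)
  hence "fps_nth (cf (\<Phi> (C \<odot>\<^bsub>CL\<^esub> v)) e) w = (\<Sum>z\<in>?Z. fps_nth (cf (clbar n k (mon_pol (?c z) (fst z) (snd z)) \<odot>\<^bsub>Lf\<^esub> lo z) e) w)"
    unfolding cf_\<Phi> by (simp only:) (rule cf_Lf_finsum, rule L.smult_closed[OF clbar_in loL])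
  also have "\<dots> = (\<Sum>z\<in>?Z. ?c z * fps_nth (cf (mon (fst z) (snd z) (lo z)) e) w)"
    by (intro sum.cong refl) (simp only: act[OF Lf_M[OF loL]] cf_t[OF mon_closed[OF Lf_M[OF loL]]] smul_apply fps_mult_left_const_nth)
  also have "\<dots> = (\<Sum>z\<in>?Z \<inter> ?Q. ?c z * fps_nth (cf (mon (fst z) (snd z) (lo z)) e) w)"
  proof (rule sum.mono_neutral_right[OF fin])
    show "\<forall>z\<in>?Z - ?Z \<inter> ?Q. ?c z * fps_nth (cf (mon (fst z) (snd z) (lo z)) e) w = 0"
      using mon_far[OF Lf_M[OF loL]] by force
  qed blast
  also have "\<dots> = (\<Sum>z\<in>?Q. ?c z * fps_nth (cf (mon (fst z) (snd z) (lo z)) e) w)"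
    by (rule sum.mono_neutral_left) (auto simp: mon_zero cf_zero)
  also have "\<dots> = (\<Sum>z\<in>?Q. ?c z * fps_nth (cf (mon (fst z) (snd z) (\<Phi> v)) e) w)"
  proof (rule sum.cong[OF refl])
    fix z assume "z \<in> ?Q"
    have "fps_nth (cf (mon (fst z) (snd z) (lo z)) e) w = fps_nth (cf (mon (fst z) (snd z) (\<Phi> v)) e) w"
    proof (rule mon_cong[OF Lf_M[OF loL] \<Phi>_closed])
      fix e1 a assume "dg e w = char_class n k (int (fst z)) (int (snd z)) \<otimes>\<^bsub>GD\<^esub> dg e1 a"
      from GD_lower[OF this] show "fps_nth (cf (lo z) e1) a = fps_nth (cf (\<Phi> v) e1) a" unfolding cf_\<Phi> lo_def by (rule arg_cong)
    qed
    thus "?c z * fps_nth (cf (mon (fst z) (snd z) (lo z)) e) w = ?c z * fps_nth (cf (mon (fst z) (snd z) (\<Phi> v)) e) w" by simp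
  qed
  also have "\<dots> = fps_nth (cf (C \<odot> \<Phi> v) e) w" unfolding Cf cf_smult_nth[OF \<Phi>_closed lessI] ..
  finally show "fps_nth (cf (\<Phi> (C \<odot>\<^bsub>CL\<^esub> v)) e) w = fps_nth (cf (C \<odot> \<Phi> v) e) w" .
qed

lemma \<Phi>_hom: "\<Phi> \<in> ghom GG RR CL M"
  unfolding ghom_def
proof (intro CollectI conjI ballI)
  show "\<Phi> \<in> carrier CL \<rightarrow> carrier M" using \<Phi>_closed by blast
  show "\<Phi> (C \<odot>\<^bsub>CL\<^esub> v) = C \<odot> \<Phi> v" if "C \<in> carrier RR" "v \<in> carrier CL" for C v using that by (rule \<Phi>_smult)
  show "\<Phi> (u \<oplus>\<^bsub>CL\<^esub> v) = \<Phi> u \<oplus> \<Phi> v" if "u \<in> carrier CL" "v \<in> carrier CL" for u v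
  proof (rule eqI)
    fix e w
    have "(u \<oplus>\<^bsub>CL\<^esub> v) (dg e w) = u (dg e w) \<oplus> v (dg e w)" by (simp add: L.CC_add dg_in)
    thus "fps_nth (cf (\<Phi> (u \<oplus>\<^bsub>CL\<^esub> v)) e) w = fps_nth (cf (\<Phi> u \<oplus> \<Phi> v) e) w"
      using CL_M[OF that(1) dg_in] CL_M[OF that(2) dg_in] by (simp add: cf_\<Phi> cf_add \<Phi>_closed)
  qed (simp_all add: \<Phi>_closed)
  show "\<Phi> ` grade CL j \<subseteq> grade M j" if j: "j \<in> carrier GG" for j
  proof
    fix x assume "x \<in> \<Phi> ` grade CL j"
    then obtain v where v: "x = \<Phi> v" "\<And>i. i \<in> carrier GD \<Longrightarrow> res_deg n i \<noteq> j \<Longrightarrow> v i = \<zero>"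
      by (auto simp: L.CC_grade)
    have "J e mod int n = j" if "cf (\<Phi> v) e \<noteq> 0" for e
    proof (rule ccontr)
      assume ne: "J e mod int n \<noteq> j"
      have "v (dg e w) = \<zero>" for w by (rule v(2)[OF dg_in]) (use ne in \<open>simp add: dg_def res_deg_pt\<close>)
      hence "cf (\<Phi> v) e = 0" by (intro fps_ext) (simp add: cf_\<Phi> cf_zero)
      thus False using that by simp
    qed
    thus "x \<in> grade M j" unfolding v(1) using grade_iff[OF \<Phi>_closed j] by blast
  qed
qed

text \<open>The inverse sends m to the family of its components \<open>pr m i\<close>.\<close>

lemma \<Phi>_bij: "bij_betw \<Phi> (carrier CL) (carrier M)"
  unfolding bij_betw_def
proof
  show "inj_on \<Phi> (carrier CL)"
  proof (rule inj_onI)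
    fix u v assume u: "u \<in> carrier CL" and v: "v \<in> carrier CL" and eq: "\<Phi> u = \<Phi> v"
    show "u = v"
    proof (rule PiE_ext[OF u[unfolded L.CC_carrier] v[unfolded L.CC_carrier]])
      fix i assume i: "i \<in> carrier GD"
      show "u i = v i"
      proof (rule eqI[OF CL_M[OF u i] CL_M[OF v i]])
        fix e w show "fps_nth (cf (u i) e) w = fps_nth (cf (v i) e) w"
        proof (cases "dg e w = i")
          case True
          have "fps_nth (cf (\<Phi> u) e) w = fps_nth (cf (\<Phi> v) e) w" by (simp only: eq)
          thus ?thesis unfolding cf_\<Phi> True .
        next
          case False
          hence "fps_nth (cf (u i) e) w = 0" "fps_nth (cf (v i) e) w = 0"
            using CL_grade[OF u i] CL_grade[OF v i] unfolding Lf_grade by blast+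
          thus ?thesis by simp
        qed
      qed
    qed
  qed
  have "m \<in> \<Phi> ` carrier CL" if m: "m \<in> carrier M" for m
  proof (rule image_eqI)
    show "m = \<Phi> (\<lambda>i\<in>carrier GD. pr m i)" by (rule eqI[OF m \<Phi>_closed]) (simp add: cf_\<Phi> cf_pr dg_in)
    show "(\<lambda>i\<in>carrier GD. pr m i) \<in> carrier CL" by (simp add: L.CC_carrier Lf_grade pr_closed cf_pr)
  qed
  thus "\<Phi> ` carrier CL = carrier M" using \<Phi>_closed by blast
qed

lemma lift: "CM_Gamma n k Lf \<and> iso_G n k (completion n k Lf) M"
  unfolding iso_G_def giso_def using Lf_CM \<Phi>_hom \<Phi>_bij by blast

end

text \<open>Rigidity provides the homogeneous eigenbasis, and indecomposability places its elements
  in integral degrees.\<close>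

lemma graded_lift_exists:
  fixes M :: "'b G_module"
  assumes "1 \<le> k" "k < n" "CM_G n k M" "rigid n k M" "gindecomposable (G_dual n) (Rhat n k) M"
  shows "\<exists>N :: 'b Gamma_module. CM_Gamma n k N \<and> iso_G n k (completion n k N) M"
proof -
  interpret cm_mod n k M using assms(1-3) by unfold_locales
  obtain E jd lam where E: "finite E" "is_basis TA Tm E" "\<forall>e\<in>E. jd e \<in> carrier GG \<and> e \<in> grade M (jd e)"
    and wt: "\<forall>e1\<in>E. \<forall>e\<in>E. \<forall>p q w. fps_nth (bcoord Tm E (mon p q e1) e) w \<noteq> 0 \<longrightarrow>
        lam e + of_nat (n * w) = lam e1 + (of_nat ((n - k) * p + k * q) :: complex)"
    using rigid_homogeneous_basis[OF assms(4)] by (elim exE conjE)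
  interpret tbasis n k M E jd by unfold_locales (use E in blast)+
  have "\<exists>J h. (\<forall>e\<in>E. jd e = J e mod int n) \<and> (\<forall>e1\<in>E. \<forall>e\<in>E. \<forall>p q w. fps_nth (cf (mon p q e1) e) w \<noteq> 0 \<longrightarrow>
      pt n k (J e) (h e + int w) = pt n k (J e1 + int p - int q) (h e1 + int q))"
    by (rule integral_weights[OF assms(5), of lam]) (use wt in blast)
  then obtain J h where J: "\<forall>e\<in>E. jd e = J e mod int n" and
    deg: "\<forall>e1\<in>E. \<forall>e\<in>E. \<forall>p q w. fps_nth (cf (mon p q e1) e) w \<noteq> 0 \<longrightarrow>
      pt n k (J e) (h e + int w) = pt n k (J e1 + int p - int q) (h e1 + int q)"
    by (elim exE conjE)
  have "tbasis n k M E (\<lambda>e. J e mod int n)"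
    by (intro tbasis.intro cm_mod_axioms tbasis_axioms.intro) (use E J in \<open>force simp: jd_in jd_grade\<close>)+
  hence "lifted n k M E J h"
    by (intro lifted.intro lifted_axioms.intro) (assumption | rule deg[rule_format])+
  thus ?thesis using lifted.lift by blast
qed

theorem corollary6p7:
  fixes n k :: nat and M :: "'b G_module"
  assumes "n \<ge> 2" and "1 \<le> k" and "k \<le> n - 1"
    and "CM_G n k M"
    and "gindecomposable (G_dual n) (Rhat n k) M"
    and "rigid n k M"
  shows "\<exists>F Is. mset Is = mset (profile n k M) \<and>
           gfiltration (G_dual n) (Rhat n k) M (length Is) F \<and>
           (\<forall>d < length Is. rank_one_of_type n k (gfactor M F d) (Is ! d))"
proof -
  have kn: "k < n" using assms(1,3) by linarith
  have gm: "graded_module (G_dual n) (Rhat n k) (Rhat_grade n k) M" using assms(4) by (simp add: CM_G_def)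
  \<comment> \<open>Since a lift exists, the one that \<open>SOME\<close> selects is a lift, and the
    profile of M is by definition the profile of that one.\<close>
  have "CM_Gamma n k (graded_lift n k M) \<and> iso_G n k (completion n k (graded_lift n k M)) M"
    unfolding graded_lift_def by (rule someI_ex[OF graded_lift_exists[OF assms(2) kn assms(4,6,5)]])
  thus ?thesis unfolding profile_def using lifted_filtration[OF assms(2) kn gm] by blast
qed

end
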